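(* Let $\nu>0$, $T>0$, let $\Lambda:(0,T]\to(0,\infty)$ be a frequency function and $\mathbb{P}_{<\Lambda(t)}$ the associated truncation operators as described in the context, and consider the $\Lambda$-Navier–Stokes equations on $[0,T]\times\mathbb{T}^3$: $$\partial_t u-\nu\Delta u+\mathbb{P}_{<\Lambda(t)}\big(\mathbb{P}_{<\Lambda(t)}u\cdot\nabla\,\mathbb{P}_{<\Lambda(t)}u\big)+\nabla p=0,\qquad \mathrm{div}\,u=0,\qquad u(0)=v_0.\qquad(\ast)$$ Let $v_0$ be an $\mathcal{F}_0$-measurable random variable which $\mathbb{P}$-a.s. is a divergence-free and mean-free element of $L^2(\mathbb{T}^3;\mathbb{R}^3)$ with $\|v_0\|_{L^2}\le M$, for some deterministic constant $M\ge1$. Then the following hold. (i) $\mathbb{P}$-a.s. there exists a global solution $\widetilde u$ to $(\ast)$ on $[0,T]$ which is $\{\mathcal{F}_t\}$-adapted, smooth for positive times, satisfies $\widetilde u(t)\to v_0$ strongly in $L^2$ as $t\to0^+$, and satisfies the energy balance $$\tfrac12\|\widetilde u(t)\|_{L^2}^2+\nu\int_0^t\|\nabla\widetilde u(s)\|_{L^2}^2\,ds=\tfrac12\|v_0\|_{L^2}^2,\qquad t\in[0,T].$$ Moreover, for any $1\le\rho<\infty$, $$\|\widetilde u-v_0\|_{L^\rho(\Omega;C([0,T_*];L^2))}\to0\quad\text{as } T_*\to0^+.$$ (ii) Any probabilistically strong and analytically weak solution $v$ to $(\ast)$ satisfying the energy inequality $$\tfrac12\|v(t)\|_{L^2}^2+\nu\int_0^t\|\nabla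 v(s)\|_{L^2}^2\,ds\le\tfrac12\|v_0\|_{L^2}^2,\qquad t\in[0,T],\ \mathbb{P}\text{-a.s.},$$ coincides with $\widetilde u$. In particular, $\widetilde u$ is unique in the Leray–Hopf class. (iii) For any $1\le\rho<\infty$, $$\big\|\mathbb{P}_{\ge\Lambda}\big(\mathbb{P}_{<\Lambda}\widetilde u\,\mathring\otimes\,\mathbb{P}_{<\Lambda}\widetilde u\big)\big\|_{L^\rho(\Omega;C([0,T_*];L^1))}\to0\quad\text{as } T_*\to0^+.$$
   Context: $\mathbb{T}^3=[0,1]^3$ with periodic boundary conditions. $(\Omega,\mathcal{F},\{\mathcal{F}_t\}_{t\ge0},\mathbb{P})$ is a stochastic basis with normal filtration. The symbol $\mathbb{P}$ without subscript denotes the probability measure; with subscripts such as $<\Lambda$ it denotes Fourier truncations. Frequency function: $\Lambda:(0,T]\to(0,\infty)$ is smooth, strictly decreasing, $\Lambda(t)\to+\infty$ as $t\to0^+$, $\Lambda(t)\ge c$ for some constant $c>0$, and $\Lambda(t)\le t^{-1/8}$ for $t\in(0,T]$. Truncation: $\varphi:\mathbb{R}^3\to[0,1]$ is a fixed smooth radial function, nonincreasing in $|x|$, with $\varphi(x)=1$ for $|x|<1$ and $\varphi(x)=0$ for $|x|\ge2$. For $t\in(0,T]$, $\mathbb{P}_{<\Lambda(t)}$ is the Fourier multiplier $\widehat{\mathbb{P}_{<\Lambda(t)}u}(\xi)=\hat u(\xi)\,\varphi(\xi/\Lambda(t))$, $\xi\in\mathbb{Z}^3$, and $\mathbb{P}_{\ge\Lambda(t)}=\mathrm{Id}-\mathbb{P}_{<\Lambda(t)}$.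 Since $\Lambda(t)\to\infty$ as $t\to0^+$, at $t=0$ one interprets $\mathbb{P}_{<\Lambda(0)}=\mathrm{Id}$ and $\mathbb{P}_{\ge\Lambda(0)}=0$. In expressions such as $\mathbb{P}_{<\Lambda}\widetilde u$ the operator at time $t$ is $\mathbb{P}_{<\Lambda(t)}$. $a\,\mathring\otimes\,b=a\otimes b-\tfrac13(a\cdot b)\mathrm{Id}$ is the trace-free part of the tensor product. For a Banach space $X$, $\|f\|_{L^\rho(\Omega;C([0,T_*];X))}=\big(\mathbf{E}\sup_{t\in[0,T_*]}\|f(t)\|_X^\rho\big)^{1/\rho}$. Solutions of $(\ast)$ are understood in the sense of distributions. A probabilistically strong and analytically weak solution of $(\ast)$ is an $\{\mathcal{F}_t\}$-adapted process $v$ with $\mathbb{P}$-a.s. continuous paths in $L^2(\mathbb{T}^3)$ on $[0,T]$, divergence-free and with zero spatial mean at each time, such that $\mathbb{P}$-a.s., for every divergence-free $\phi\in C^\infty(\mathbb{T}^3;\mathbb{R}^3)$ and all $t\in[0,T]$, $$\int_{\mathbb{T}^3} v(t)\cdot\phi\,dx=\int_{\mathbb{T}^3} v_0\cdot\phi\,dx+\int_0^t\int_{\mathbb{T}^3}\Big(\nu\, v\cdot\Delta\phi+\mathbb{P}_{<\Lambda(s)}v\cdot\big(\mathbb{P}_{<\Lambda(s)}v\cdot\nabla\big)\mathbb{P}_{<\Lambda(s)}\phi\Big)\,dx\,ds.$$ The Leray–Hopf class means the class of such solutions satisfying the energy inequality in (ii). *)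

theory Defs
  imports "HOL-Analysis.Analysis" "HOL-Probability.Probability"
begin

text \<open>
  Functions on the torus are 1-periodic functions on \<open>real^3\<close>; elements of the Lebesgue spaces on
  the torus are represented by Borel functions, and their equality is equality almost everywhere.
\<close>

definition torus :: "(real^3) measure" where
  "torus = restrict_space lborel (cbox 0 1)"

definition periodic :: "(real^3 \<Rightarrow> 'b) \<Rightarrow> bool" where
  "periodic f \<longleftrightarrow> (\<forall>x i. f (x + axis i 1) = f x)"

definition ennpow :: "ennreal \<Rightarrow> real \<Rightarrow> ennreal" where
  "ennpow x p = (if x = \<infinity> then \<infinity> else ennreal (enn2real x powr p))"

definition Lnorm :: "real \<Rightarrow> (real^3 \<Rightarrow> 'b::euclidean_space) \<Rightarrow> ennreal" where
  "Lnorm p f = ennpow (\<integral>\<^sup>+ x. ennreal (norm (f x) powr p) \<partial>torus) (1 / p)"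

definition in_L :: "real \<Rightarrow> (real^3 \<Rightarrow> 'b::euclidean_space) \<Rightarrow> bool" where
  "in_L p f \<longleftrightarrow> periodic f \<and> f \<in> borel_measurable borel \<and> Lnorm p f < \<infinity>"

text \<open>
  The Borel sigma-algebra of the square-integrable vector fields, generated by the open sets of the
  pseudometric. It is taken on all functions, with the non-square-integrable ones forming a single
  atom, so that a random field only has to be square-integrable almost surely.
\<close>

definition L2_open :: "(real^3 \<Rightarrow> real^3) set \<Rightarrow> bool" where
  "L2_open U \<longleftrightarrow> U \<subseteq> Collect (in_L 2) \<and>
     (\<forall>f\<in>U. \<exists>r>0. \<forall>g. in_L 2 g \<and> Lnorm 2 (\<lambda>x. g x - f x) < ennreal r \<longrightarrow> g \<in> U)"

definition L2_borel :: "(real^3 \<Rightarrow> real^3) measure" where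
  "L2_borel = sigma UNIV (Collect L2_open)"

definition C_path :: "real \<Rightarrow> real \<Rightarrow> (real \<Rightarrow> real^3 \<Rightarrow> 'b::euclidean_space) \<Rightarrow> bool" where
  "C_path p T f \<longleftrightarrow> (\<forall>t\<in>{0..T}. in_L p (f t) \<and>
     ((\<lambda>s. Lnorm p (\<lambda>x. f s x - f t x)) \<longlongrightarrow> 0) (at t within {0..T}))"

definition LC_norm ::
  "'w measure \<Rightarrow> real \<Rightarrow> real \<Rightarrow> real \<Rightarrow> (real \<Rightarrow> 'w \<Rightarrow> real^3 \<Rightarrow> 'b::euclidean_space) \<Rightarrow> ennreal"
where
  "LC_norm P \<rho> p T f =
     ennpow (\<integral>\<^sup>+ \<omega>. (SUP t\<in>{0..T}. ennpow (Lnorm p (f t \<omega>)) \<rho>) \<partial>P) (1 / \<rho>)"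

text \<open>
  Continuity of all iterated directional derivatives. Derivatives are taken within \<open>S\<close>, so they are
  one-sided at the boundary points that \<open>S\<close> contains.
\<close>

primrec Ck_on :: "nat \<Rightarrow> 'a::euclidean_space set \<Rightarrow> ('a \<Rightarrow> 'b::real_normed_vector) \<Rightarrow> bool" where
  "Ck_on 0 S f = continuous_on S f"
| "Ck_on (Suc k) S f = (\<exists>f'. (\<forall>x\<in>S. (f has_derivative f' x) (at x within S)) \<and>
     (\<forall>v. Ck_on k S (\<lambda>x. f' x v)))"

definition smooth_on :: "'a::euclidean_space set \<Rightarrow> ('a \<Rightarrow> 'b::real_normed_vector) \<Rightarrow> bool" where
  "smooth_on S f \<longleftrightarrow> (\<forall>k. Ck_on k S f)"

definition pd :: "3 \<Rightarrow> (real^3 \<Rightarrow> 'b::real_normed_vector) \<Rightarrow> real^3 \<Rightarrow> 'b" where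
  "pd j f x = frechet_derivative f (at x) (axis j 1)"

definition laplacian :: "(real^3 \<Rightarrow> 'b::real_normed_vector) \<Rightarrow> real^3 \<Rightarrow> 'b" where
  "laplacian f x = (\<Sum>j\<in>UNIV. pd j (pd j f) x)"

definition advect :: "(real^3 \<Rightarrow> real^3) \<Rightarrow> (real^3 \<Rightarrow> real^3) \<Rightarrow> real^3 \<Rightarrow> real^3" where
  "advect a b x = (\<Sum>j\<in>UNIV. (a x $ j) *\<^sub>R pd j b x)"

definition test_scalar :: "(real^3 \<Rightarrow> real) \<Rightarrow> bool" where
  "test_scalar \<psi> \<longleftrightarrow> periodic \<psi> \<and> smooth_on UNIV \<psi>"

definition solenoidal_test :: "(real^3 \<Rightarrow> real^3) \<Rightarrow> bool" where
  "solenoidal_test \<phi> \<longleftrightarrow> periodic \<phi> \<and> smooth_on UNIV \<phi> \<and> (\<forall>x. (\<Sum>j\<in>UNIV. pd j \<phi> x $ j) = 0)"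

definition div_free :: "(real^3 \<Rightarrow> real^3) \<Rightarrow> bool" where
  "div_free f \<longleftrightarrow>
     (\<forall>\<psi>. test_scalar \<psi> \<longrightarrow> (\<integral>x. (\<Sum>j\<in>UNIV. f x $ j * pd j \<psi> x) \<partial>torus) = 0)"

definition mean_free :: "(real^3 \<Rightarrow> real^3) \<Rightarrow> bool" where
  "mean_free f \<longleftrightarrow> (\<integral>x. f x \<partial>torus) = 0"

definition weak_gradient :: "(real^3 \<Rightarrow> real^3) \<Rightarrow> (real^3 \<Rightarrow> real^3^3) \<Rightarrow> bool" where
  "weak_gradient f G \<longleftrightarrow> in_L 2 G \<and> (\<forall>\<psi> i j. test_scalar \<psi> \<longrightarrow>
     (\<integral>x. f x $ i * pd j \<psi> x \<partial>torus) = - (\<integral>x. G x $ i $ j * \<psi> x \<partial>torus))"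

text \<open>
  The squared L2 norm of the weak gradient, which is unique almost everywhere; the value is
  infinite when there is no square-integrable weak gradient.
\<close>

definition grad_sq :: "(real^3 \<Rightarrow> real^3) \<Rightarrow> ennreal" where
  "grad_sq f = (INF G\<in>Collect (weak_gradient f). Lnorm 2 G ^ 2)"

definition lattice_vec :: "int^3 \<Rightarrow> real^3" where
  "lattice_vec \<xi> = (\<chi> i. of_int (\<xi> $ i))"

definition fcoeff :: "(real^3 \<Rightarrow> real) \<Rightarrow> int^3 \<Rightarrow> complex" where
  "fcoeff f \<xi> = (\<integral>x. of_real (f x) * cis (- 2 * pi * (lattice_vec \<xi> \<bullet> x)) \<partial>torus)"

text \<open>
  The multiplier with symbol \<open>m\<close>, acting on each component. For even \<open>m\<close>, as here, the Fourier
  series is real, so that taking the real part only changes the type.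
\<close>

definition fmult :: "(real^3 \<Rightarrow> real) \<Rightarrow> (real^3 \<Rightarrow> 'b::euclidean_space) \<Rightarrow> real^3 \<Rightarrow> 'b" where
  "fmult m f x = (\<Sum>b\<in>Basis. Re (\<Sum>\<^sub>\<infinity>\<xi>\<in>UNIV. of_real (m (lattice_vec \<xi>)) *
     fcoeff (\<lambda>y. f y \<bullet> b) \<xi> * cis (2 * pi * (lattice_vec \<xi> \<bullet> x))) *\<^sub>R b)"

definition cutoff :: "(real^3 \<Rightarrow> real) \<Rightarrow> bool" where
  "cutoff \<phi> \<longleftrightarrow> smooth_on UNIV \<phi> \<and> (\<forall>x. 0 \<le> \<phi> x \<and> \<phi> x \<le> 1) \<and>
     (\<forall>x y. norm x = norm y \<longrightarrow> \<phi> x = \<phi> y) \<and> (\<forall>x y. norm x \<le> norm y \<longrightarrow> \<phi> y \<le> \<phi> x) \<and>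
     (\<forall>x. norm x < 1 \<longrightarrow> \<phi> x = 1) \<and> (\<forall>x. norm x \<ge> 2 \<longrightarrow> \<phi> x = 0)"

definition frequency_function :: "real \<Rightarrow> (real \<Rightarrow> real) \<Rightarrow> bool" where
  "frequency_function T \<Lambda> \<longleftrightarrow> (\<forall>t\<in>{0<..T}. \<Lambda> t > 0) \<and> smooth_on {0<..T} \<Lambda> \<and>
     strict_antimono_on {0<..T} \<Lambda> \<and> filterlim \<Lambda> at_top (at_right 0) \<and>
     (\<exists>c>0. \<forall>t\<in>{0<..T}. c \<le> \<Lambda> t) \<and> (\<forall>t\<in>{0<..T}. \<Lambda> t \<le> t powr (- 1 / 8))"

definition P_low ::
  "(real^3 \<Rightarrow> real) \<Rightarrow> (real \<Rightarrow> real) \<Rightarrow> real \<Rightarrow> (real^3 \<Rightarrow> 'b::euclidean_space) \<Rightarrow> real^3 \<Rightarrow> 'b"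
where
  "P_low \<phi> \<Lambda> t f = (if t = 0 then f else fmult (\<lambda>\<xi>. \<phi> (\<xi> /\<^sub>R \<Lambda> t)) f)"

definition P_high ::
  "(real^3 \<Rightarrow> real) \<Rightarrow> (real \<Rightarrow> real) \<Rightarrow> real \<Rightarrow> (real^3 \<Rightarrow> 'b::euclidean_space) \<Rightarrow> real^3 \<Rightarrow> 'b"
where
  "P_high \<phi> \<Lambda> t f x = f x - P_low \<phi> \<Lambda> t f x"

definition tf_tensor :: "real^3 \<Rightarrow> real^3 \<Rightarrow> real^3^3" where
  "tf_tensor a b = (\<chi> i j. a $ i * b $ j) - ((a \<bullet> b) / 3) *\<^sub>R mat 1"

text \<open>Only the indices \<open>t \<ge> 0\<close> of the filtration are used.\<close>

definition normal_filtration :: "'w measure \<Rightarrow> (real \<Rightarrow> 'w measure) \<Rightarrow> bool" where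
  "normal_filtration P F \<longleftrightarrow> (\<forall>t\<ge>0. subalgebra P (F t)) \<and>
     (\<forall>s t. 0 \<le> s \<and> s \<le> t \<longrightarrow> sets (F s) \<subseteq> sets (F t)) \<and>
     (\<forall>t\<ge>0. sets (F t) = (\<Inter>s\<in>{t<..}. sets (F s))) \<and>
     null_sets P \<subseteq> sets (F 0)"

text \<open>
  The pressure does not appear in the weak formulation because the test fields are divergence-free.
\<close>

definition weak_solution ::
  "'w measure \<Rightarrow> (real \<Rightarrow> 'w measure) \<Rightarrow> (real^3 \<Rightarrow> real) \<Rightarrow> (real \<Rightarrow> real) \<Rightarrow> real \<Rightarrow> real \<Rightarrow>
   ('w \<Rightarrow> real^3 \<Rightarrow> real^3) \<Rightarrow> (real \<Rightarrow> 'w \<Rightarrow> real^3 \<Rightarrow> real^3) \<Rightarrow> bool"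
where
  "weak_solution P F \<phi> \<Lambda> \<nu> T v0 v \<longleftrightarrow>
     (\<forall>t\<in>{0..T}. v t \<in> measurable (F t) L2_borel) \<and>
     (AE \<omega> in P. C_path 2 T (\<lambda>t. v t \<omega>)) \<and>
     (AE \<omega> in P. \<forall>t\<in>{0..T}. div_free (v t \<omega>) \<and> mean_free (v t \<omega>)) \<and>
     (AE \<omega> in P. \<forall>\<eta>. solenoidal_test \<eta> \<longrightarrow> (\<forall>t\<in>{0..T}.
        (\<integral>x. v t \<omega> x \<bullet> \<eta> x \<partial>torus) = (\<integral>x. v0 \<omega> x \<bullet> \<eta> x \<partial>torus) +
        (LINT s:{0..t}|lborel. (\<integral>x. \<nu> * (v s \<omega> x \<bullet> laplacian \<eta> x) +
           P_low \<phi> \<Lambda> s (v s \<omega>) x \<bullet> advect (P_low \<phi> \<Lambda> s (v s \<omega>)) (P_low \<phi> \<Lambda> s \<eta>) x \<partial>torus))))"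

definition energy :: "real \<Rightarrow> (real \<Rightarrow> real^3 \<Rightarrow> real^3) \<Rightarrow> real \<Rightarrow> ennreal" where
  "energy \<nu> v t = Lnorm 2 (v t) ^ 2 / 2 + ennreal \<nu> * (\<integral>\<^sup>+ s\<in>{0..t}. grad_sq (v s) \<partial>lborel)"

definition leray_hopf ::
  "'w measure \<Rightarrow> (real \<Rightarrow> 'w measure) \<Rightarrow> (real^3 \<Rightarrow> real) \<Rightarrow> (real \<Rightarrow> real) \<Rightarrow> real \<Rightarrow> real \<Rightarrow>
   ('w \<Rightarrow> real^3 \<Rightarrow> real^3) \<Rightarrow> (real \<Rightarrow> 'w \<Rightarrow> real^3 \<Rightarrow> real^3) \<Rightarrow> bool"
where
  "leray_hopf P F \<phi> \<Lambda> \<nu> T v0 v \<longleftrightarrow> weak_solution P F \<phi> \<Lambda> \<nu> T v0 v \<and>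
     (AE \<omega> in P. \<forall>t\<in>{0..T}. energy \<nu> (\<lambda>s. v s \<omega>) t \<le> Lnorm 2 (v0 \<omega>) ^ 2 / 2)"

end

theory Submission
  imports Defs
begin

text \<open>
  On the Fourier side the equation is \<open>u\<^sub>k' = - \<sigma>\<^sub>k u\<^sub>k + F\<^sub>k(s, u)\<close>, and at time \<open>s\<close> only the modes
  \<open>|k| < 2 \<Lambda>(s) \<le> 2 s powr (-1/8)\<close> take part in the nonlinearity. These are so few that, on bounded
  sets, \<open>F(s, \<cdot>)\<close> is Lipschitz for the supremum norm over the modes with the integrable constant
  \<open>C / sqrt s\<close>. After a radial truncation of the amplitudes, a contraction argument therefore gives
  existence, uniqueness and stability of mild solutions on \<open>[0, T]\<close> for square-summable data.
  On \<open>[\<epsilon>, T]\<close> finitely many modes interact and the others follow the heat flow; this yields smoothness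
  and the energy balance on \<open>[\<epsilon>, T]\<close>, and \<open>\<epsilon> \<rightarrow> 0\<close> gives the balance from time \<open>0\<close>, which shows that the
  truncation was never active. A weak solution in the Leray-Hopf class has the same a priori bound, so
  its Fourier coefficients solve the same mild equation.

  The high-pass filter is bounded on \<open>L\<^sup>1\<close> uniformly in \<open>\<Lambda>\<close>, because on the relevant frequencies its
  symbol is an absolutely convergent Fourier series and the filter is a combination of translations.
  It annihilates the square of the low modes of the datum, and what remains of the quadratic term tends
  to \<open>0\<close> in \<open>L\<^sup>1\<close> since the solution attains its datum strongly in \<open>L\<^sup>2\<close>.
\<close>

subsection \<open>Fourier modes\<close>

text \<open>The growth bound on \<open>\<Lambda>\<close> enters through one count. At time
  \<open>s\<close> about \<open>s powr (-3/8)\<close> modes are active, and the derivative in the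
  nonlinearity costs \<open>s powr (-1/8)\<close> more; together \<open>1 / sqrt s\<close>. The
  supremum norm over the modes suits this count, since a coefficient of the nonlinearity is a finite
  sum of products of coefficients, and square-integrable data have bounded coefficients. It does not
  see the \<open>L2\<close> structure, which is recovered afterwards: on active modes four powers of
  \<open>knorm k\<close> are worth \<open>s powr (-1/2)\<close>, so the forcing is also bounded by
  \<open>s powr (-7/8) / knorm k ^ 3\<close>, still integrable in time and square summable in
  \<open>k\<close>. Test fields see the equation only modulo gradients, hence the projection
  \<open>leray\<close> on every mode; being real, they see \<open>k\<close> and \<open>- k\<close>
  together. The construction is pathwise, and randomness enters through the datum alone. At positive
  times the solution operator is Lipschitz on \<open>L2\<close>, hence Borel, so the solution at any
  time is measurable already for \<open>F 0\<close>. The retraction radius is the bound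
  \<open>M\<close> of the data, because no mode exceeds the \<open>L2\<close> norm.\<close>

definition fexp :: "int^3 \<Rightarrow> real^3 \<Rightarrow> complex" where
  "fexp k x = cis (2 * pi * (lattice_vec k \<bullet> x))"

lemma lattice_vec_simps [simp]:
  "lattice_vec 0 = 0" "lattice_vec (k + l) = lattice_vec k + lattice_vec l"
  "lattice_vec (- k) = - lattice_vec k" "lattice_vec (k - l) = lattice_vec k - lattice_vec l"
  "lattice_vec k $ i = of_int (k $ i)"
  by (simp_all add: lattice_vec_def vec_eq_iff)

lemma lattice_vec_eq_0_iff [simp]: "lattice_vec k = 0 \<longleftrightarrow> k = 0"
  by (simp add: lattice_vec_def vec_eq_iff)

lemma fexp_0 [simp]: "fexp 0 x = 1"
  by (simp add: fexp_def)

lemma fexp_add: "fexp (k + l) x = fexp k x * fexp l x"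
  by (simp add: fexp_def inner_add_left cis_mult algebra_simps)

lemma fexp_uminus: "fexp (- k) x = cnj (fexp k x)"
  by (simp add: fexp_def cis_cnj)

lemma fexp_diff: "fexp (k - l) x = fexp k x * cnj (fexp l x)"
  using fexp_add[of k "- l"] by (simp add: fexp_uminus)

lemma fexp_add_arg: "fexp k (x + y) = fexp k x * fexp k y"
  by (simp add: fexp_def inner_add_right cis_mult algebra_simps)

lemma norm_fexp [simp]: "norm (fexp k x) = 1"
  by (simp add: fexp_def)

lemma fexp_axis: "fexp k (axis i h) = cis (2 * pi * (of_int (k $ i) * h))"
  by (simp add: fexp_def inner_axis)

lemma periodic_fexp: "fexp k (x + axis i 1) = fexp k x"
proof -
  have "cis (2 * pi * of_int (k $ i)) = 1" by (rule cis_multiple_2pi) auto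
  then show ?thesis by (simp add: fexp_add_arg fexp_axis)
qed

lemma continuous_on_fexp [continuous_intros]:
  "continuous_on S f \<Longrightarrow> continuous_on S (\<lambda>x. fexp k (f x))"
  unfolding fexp_def by (intro continuous_intros)

lemma measurable_fexp [measurable]: "fexp k \<in> borel_measurable borel"
  by (intro borel_measurable_continuous_onI continuous_intros)

lemma fcoeff_fexp: "fcoeff f k = (\<integral>x. of_real (f x) * fexp (- k) x \<partial>torus)"
  by (simp add: fcoeff_def fexp_def)

subsection \<open>The torus as a probability space\<close>

lemma cube_iff: "x \<in> cbox 0 (1::real^3) \<longleftrightarrow> (\<forall>i. 0 \<le> x $ i \<and> x $ i \<le> 1)"
  by (auto simp: mem_box_cart)

lemma space_torus [simp]: "space torus = cbox 0 1"
  by (simp add: torus_def space_restrict_space)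

lemma prob_space_torus: "prob_space torus"
proof
  have "emeasure torus (cbox 0 1) = emeasure lborel (cbox 0 (1::real^3))"
    by (simp add: torus_def emeasure_restrict_space)
  also have "\<dots> = 1"
  proof -
    have "(\<Prod>b\<in>Basis. (1 - 0 :: real^3) \<bullet> b) = 1"
      by (rule prod.neutral) (auto simp: Basis_vec_def inner_axis)
    then show ?thesis by (subst emeasure_lborel_cbox) (auto simp: Basis_vec_def inner_axis)
  qed
  finally show "emeasure torus (space torus) = 1" by simp
qed

interpretation torus: prob_space torus by (rule prob_space_torus)

lemma borel_measurable_torus [measurable (raw)]: "f \<in> borel_measurable borel \<Longrightarrow> f \<in> borel_measurable torus"
  unfolding torus_def by (intro measurable_restrict_space1) simp

lemma integral_torus:
  "(\<integral>x. f x \<partial>torus) = (\<integral>x. indicator (cbox 0 1) x *\<^sub>R (f x :: 'b :: {banach, second_countable_topology}) \<partial>lborel)"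
  unfolding torus_def by (subst integral_restrict_space) auto

lemma integrable_torus_bounded:
  fixes f :: "real^3 \<Rightarrow> 'b :: {banach, second_countable_topology}"
  assumes "f \<in> borel_measurable borel" "\<And>x. x \<in> cbox 0 1 \<Longrightarrow> norm (f x) \<le> C"
  shows "integrable torus f"
  by (rule torus.integrable_const_bound[of _ C]) (use assms in auto)

lemma integrable_torus_continuous:
  fixes f :: "real^3 \<Rightarrow> 'b :: {banach, second_countable_topology}"
  assumes "continuous_on UNIV f"
  shows "integrable torus f"
proof -
  have "compact (f ` cbox 0 1)"
    by (intro compact_continuous_image continuous_on_subset[OF assms]) auto
  then obtain C where "\<forall>y\<in>f ` cbox 0 1. norm y \<le> C"
    using compact_imp_bounded bounded_iff by metis
  then show ?thesis
    by (intro integrable_torus_bounded[of _ C] borel_measurable_continuous_onI assms) auto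
qed

text \<open>On a Euclidean space \<open>lborel\<close> is the image of the product measure over
  \<open>Basis\<close> (\<open>lborel_eq\<close>), so functions of separate coordinates integrate
  independently.\<close>

lemma lborel_integral_prod:
  fixes f :: "'a::euclidean_space \<Rightarrow> real \<Rightarrow> 'b::{real_normed_field,banach,second_countable_topology}"
  assumes "\<And>b. b \<in> Basis \<Longrightarrow> integrable lborel (f b)"
  shows "(\<integral>x. (\<Prod>b\<in>Basis. f b (x \<bullet> b)) \<partial>lborel) = (\<Prod>b\<in>Basis. (\<integral>x. f b x \<partial>lborel))"
proof -
  interpret product_sigma_finite "\<lambda>_::'a. lborel :: real measure" ..
  have [measurable]: "f b \<in> borel_measurable borel" if "b \<in> Basis" for b
    using borel_measurable_integrable[OF assms[OF that]] by simp
  have "(\<integral>x. (\<Prod>b\<in>Basis. f b (x \<bullet> b)) \<partial>lborel) =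
    (\<integral>y. (\<Prod>b\<in>Basis. f b ((\<Sum>c\<in>Basis. y c *\<^sub>R c) \<bullet> b)) \<partial>(\<Pi>\<^sub>M b\<in>Basis. lborel))"
    unfolding lborel_eq[where 'a='a] by (subst integral_distr) auto
  also have "\<dots> = (\<integral>y. (\<Prod>b\<in>Basis. f b (y b)) \<partial>(\<Pi>\<^sub>M b\<in>Basis. lborel))"
    by (intro Bochner_Integration.integral_cong refl prod.cong) simp
  also have "\<dots> = (\<Prod>b\<in>Basis. (\<integral>x. f b x \<partial>lborel))"
    by (rule product_integral_prod) (use assms in auto)
  finally show ?thesis .
qed

lemma integral_cis_period:
  fixes n :: int
  shows "(\<integral>x. indicator {0..1} x *\<^sub>R cis (2 * pi * (of_int n * x)) \<partial>lborel) = (if n = 0 then 1 else 0)"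
proof (cases "n = 0")
  case False
  let ?F = "\<lambda>x. cis (2 * pi * (of_int n * x)) / (\<i> * of_real (2 * pi * of_int n))"
  have "(\<integral>x. indicator {0..1} x *\<^sub>R cis (2 * pi * (of_int n * x)) \<partial>lborel) = ?F 1 - ?F 0"
  proof (rule integral_FTC_Icc)
    fix x :: real
    show "(?F has_vector_derivative cis (2 * pi * (of_int n * x))) (at x within {0..1})"
      using False
      by (auto intro!: derivative_eq_intros simp: has_vector_derivative_def fun_eq_iff scaleR_conv_of_real field_simps)
  qed (auto intro!: continuous_intros)
  also have "cis (2 * pi * of_int n) = 1" by (rule cis_multiple_2pi) auto
  then have "?F 1 - ?F 0 = 0" by simp
  finally show ?thesis using False by simp
qed simp

text \<open>Orthonormality of the characters. The exponential splits into one factor per coordinate,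
  and a single coordinate with nonzero frequency annihilates the product.\<close>

lemma integral_fexp: "(\<integral>x. fexp k x \<partial>torus) = (if k = 0 then 1 else 0)"
proof -
  let ?h = "\<lambda>(b::real^3) y. indicator {0..1} y *\<^sub>R cis (2 * pi * ((lattice_vec k \<bullet> b) * y))"
  have cis_sum: "cis (\<Sum>b\<in>A. g b) = (\<Prod>b\<in>A. cis (g b))" if "finite A" for A and g :: "real^3 \<Rightarrow> real"
    using that by induction (auto simp: cis_mult[symmetric])
  have ind: "indicator (cbox 0 1) x = (\<Prod>b\<in>Basis. indicator {0..1} (x \<bullet> b) :: real)" for x :: "real^3"
  proof -
    have "(1::real^3) \<bullet> b = 1" if "b \<in> Basis" for b using that by (auto simp: Basis_vec_def inner_axis)
    then show ?thesis by (auto simp: indicator_def mem_box)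
  qed
  have e: "fexp k x = (\<Prod>b\<in>Basis. cis (2 * pi * ((lattice_vec k \<bullet> b) * (x \<bullet> b))))" for x
    unfolding fexp_def by (subst euclidean_inner) (simp add: sum_distrib_left cis_sum)
  have "(\<integral>x. fexp k x \<partial>torus) = (\<integral>x. (\<Prod>b\<in>Basis. ?h b (x \<bullet> b)) \<partial>lborel)"
    by (simp add: integral_torus e ind scaleR_conv_of_real prod.distrib)
  also have "\<dots> = (\<Prod>b\<in>Basis. (\<integral>x. ?h b x \<partial>lborel))"
    by (intro lborel_integral_prod borel_integrable_compact) (auto intro!: continuous_intros)
  also have "\<dots> = (\<Prod>b\<in>(\<lambda>i. axis i 1) ` UNIV. (\<integral>x. ?h b x \<partial>lborel))"
    by (intro prod.cong) (auto simp: Basis_vec_def)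
  also have "\<dots> = (\<Prod>i\<in>UNIV. (if k $ i = 0 then 1 else 0))"
    by (subst prod.reindex) (auto simp: inj_on_def axis_eq_axis inner_axis integral_cis_period)
  also have "\<dots> = (if k = 0 then 1 else 0)" by (auto simp: vec_eq_iff)
  finally show ?thesis .
qed

subsection \<open>Countable unconditional sums\<close>

text \<open>A sum over a countable index becomes a series over \<open>nat\<close>, padded with 0
  outside the range of \<open>to_nat\<close>. In this way theorems on series, such as
  \<open>integrable_suminf\<close>, \<open>has_derivative_series\<close> and Tannery's theorem,
  apply to sums over the lattice.\<close>

definition natseq :: "('k::countable \<Rightarrow> 'b::zero) \<Rightarrow> nat \<Rightarrow> 'b" where
  "natseq c n = (if n \<in> range (to_nat :: 'k \<Rightarrow> nat) then c (from_nat n) else 0)"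

lemma natseq_has_sum:
  fixes c :: "'k::countable \<Rightarrow> 'b::{topological_comm_monoid_add, t2_space}"
  shows "(natseq c has_sum s) UNIV \<longleftrightarrow> (c has_sum s) UNIV"
proof -
  have inj: "inj (to_nat :: 'k \<Rightarrow> nat)" by simp
  have "(natseq c has_sum s) UNIV \<longleftrightarrow> (natseq c has_sum s) (range (to_nat :: 'k \<Rightarrow> nat))"
    by (rule has_sum_cong_neutral) (auto simp: natseq_def)
  also have "\<dots> \<longleftrightarrow> ((natseq c \<circ> (to_nat :: 'k \<Rightarrow> nat)) has_sum s) UNIV"
    by (rule has_sum_reindex[OF inj])
  also have "natseq c \<circ> (to_nat :: 'k \<Rightarrow> nat) = c" by (auto simp: natseq_def)
  finally show ?thesis .
qed

lemma natseq_sums: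
  fixes c :: "'k::countable \<Rightarrow> 'b::{topological_comm_monoid_add, t2_space}"
  shows "(c has_sum s) UNIV \<Longrightarrow> natseq c sums s"
  by (rule has_sum_imp_sums) (simp add: natseq_has_sum)

lemma natseq_summable: "(c :: _ \<Rightarrow> real) summable_on UNIV \<Longrightarrow> summable (natseq c)"
  by (rule sums_summable[OF natseq_sums[OF has_sum_infsum]])

text \<open>The majorant separates into a summable factor in \<open>k\<close> and an integrable
  factor in \<open>x\<close>, so the integrals of the norms are summable. The weight is what later
  admits the time singularity \<open>1 + 1 / sqrt s\<close>; \<open>integral_has_sum\<close> is the
  case \<open>w = 1\<close>.\<close>

lemma integral_has_sum_weighted:
  fixes f :: "'k::countable \<Rightarrow> 'a \<Rightarrow> 'b::{banach,second_countable_topology}"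
  assumes w: "integrable M w" and meas [measurable]: "\<And>k. f k \<in> borel_measurable M"
    and bd: "\<And>k x. x \<in> space M \<Longrightarrow> norm (f k x) \<le> b k * w x" and b: "b summable_on UNIV"
  shows "integrable M (\<lambda>x. \<Sum>\<^sub>\<infinity>k. f k x)"
    and "((\<lambda>k. \<integral>x. f k x \<partial>M) has_sum (\<integral>x. (\<Sum>\<^sub>\<infinity>k. f k x) \<partial>M)) UNIV"
proof -
  let ?g = "\<lambda>n x. natseq (\<lambda>k. f k x) n"
  have g_alt: "?g n = (if n \<in> range (to_nat :: 'k \<Rightarrow> nat) then f (from_nat n) else (\<lambda>_. 0))" for n
    by (auto simp: natseq_def)
  have [measurable]: "?g n \<in> borel_measurable M" for n unfolding g_alt by auto
  have gb: "norm (?g n x) \<le> natseq b n * w x" if "x \<in> space M" for n x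
    using bd[OF that] by (auto simp: natseq_def)
  have sb: "summable (natseq b)" by (rule natseq_summable[OF b])
  have int_g: "integrable M (?g n)" for n
    by (rule Bochner_Integration.integrable_bound[OF integrable_mult_right[OF w, of "natseq b n"]])
       (use gb in \<open>auto intro!: AE_I2 order_trans[OF _ abs_ge_self]\<close>)
  have sn: "summable (\<lambda>n. norm (?g n x))" if "x \<in> space M" for x
    by (rule summable_comparison_test'[OF summable_mult2[OF sb, of "w x"], of 0]) (use gb[OF that] in auto)
  have sums: "?g n x = ?g n x" "(\<Sum>\<^sub>\<infinity>k. f k x) = (\<Sum>n. ?g n x)" if "x \<in> space M" for n x
  proof -
    have "((\<lambda>n. ?g n x) has_sum (\<Sum>n. ?g n x)) UNIV"
      by (rule norm_summable_imp_has_sum[OF sn[OF that] summable_sums[OF summable_norm_cancel[OF sn[OF that]]]])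
    then show "(\<Sum>\<^sub>\<infinity>k. f k x) = (\<Sum>n. ?g n x)"
      by (intro infsumI) (simp only: natseq_has_sum)
  qed simp
  have int_norm: "(\<integral>x. norm (?g n x) \<partial>M) \<le> natseq b n * (\<integral>x. w x \<partial>M)" for n
  proof -
    have "(\<integral>x. norm (?g n x) \<partial>M) \<le> (\<integral>x. natseq b n * w x \<partial>M)"
      by (intro integral_mono integrable_norm int_g gb integrable_mult_right w)
    then show ?thesis by simp
  qed
  have S: "summable (\<lambda>n. \<integral>x. norm (?g n x) \<partial>M)"
    by (rule summable_comparison_test'[OF summable_mult2[OF sb, of "\<integral>x. w x \<partial>M"], of 0])
       (use int_norm in auto)
  have "integrable M (\<lambda>x. \<Sum>n. ?g n x)"
    by (rule integrable_suminf) (use int_g sn S in auto)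
  then show "integrable M (\<lambda>x. \<Sum>\<^sub>\<infinity>k. f k x)"
    by (rule Bochner_Integration.integrable_cong[THEN iffD1, rotated 2]) (use sums in auto)
  have "(\<lambda>n. \<integral>x. ?g n x \<partial>M) sums (\<integral>x. (\<Sum>n. ?g n x) \<partial>M)"
    by (rule sums_integral) (use int_g sn S in auto)
  also have "(\<integral>x. (\<Sum>n. ?g n x) \<partial>M) = (\<integral>x. (\<Sum>\<^sub>\<infinity>k. f k x) \<partial>M)"
    by (rule Bochner_Integration.integral_cong) (use sums in auto)
  finally have *: "(\<lambda>n. \<integral>x. ?g n x \<partial>M) sums (\<integral>x. (\<Sum>\<^sub>\<infinity>k. f k x) \<partial>M)" .
  have "((\<lambda>n. \<integral>x. ?g n x \<partial>M) has_sum (\<integral>x. (\<Sum>\<^sub>\<infinity>k. f k x) \<partial>M)) UNIV"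
    by (intro norm_summable_imp_has_sum[OF _ *] summable_comparison_test'[OF S, of 0])
       (auto intro: integral_norm_bound)
  moreover have "(\<lambda>n. \<integral>x. ?g n x \<partial>M) = natseq (\<lambda>k. \<integral>x. f k x \<partial>M)"
    by (auto simp: natseq_def fun_eq_iff)
  ultimately show "((\<lambda>k. \<integral>x. f k x \<partial>M) has_sum (\<integral>x. (\<Sum>\<^sub>\<infinity>k. f k x) \<partial>M)) UNIV"
    by (simp only: natseq_has_sum)
qed

lemma integral_has_sum:
  fixes f :: "'k::countable \<Rightarrow> 'a \<Rightarrow> 'b::{banach,second_countable_topology}"
  assumes "finite_measure M" "\<And>k. f k \<in> borel_measurable M"
    and "\<And>k x. x \<in> space M \<Longrightarrow> norm (f k x) \<le> b k" and "b summable_on UNIV"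
  shows "integrable M (\<lambda>x. \<Sum>\<^sub>\<infinity>k. f k x)"
    and "((\<lambda>k. \<integral>x. f k x \<partial>M) has_sum (\<integral>x. (\<Sum>\<^sub>\<infinity>k. f k x) \<partial>M)) UNIV"
  using integral_has_sum_weighted[of M "\<lambda>_. 1" f b] assms by (auto simp: finite_measure.integrable_const)

subsection \<open>Trigonometric polynomials and their density\<close>

text \<open>Generated by monomials and sums, so that closure under products, continuity and
  translation invariance of the mean go by induction; \<open>trig_poly_repr\<close> recovers the
  coefficients.\<close>

inductive trig_poly :: "(real^3 \<Rightarrow> complex) \<Rightarrow> bool" where
  trig_poly_monom: "trig_poly (\<lambda>x. c * fexp k x)"
| trig_poly_add: "trig_poly p \<Longrightarrow> trig_poly q \<Longrightarrow> trig_poly (\<lambda>x. p x + q x)"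

lemma trig_poly_const: "trig_poly (\<lambda>x. c)"
  using trig_poly_monom[of c 0] by simp

lemma trig_poly_mult_monom: "trig_poly p \<Longrightarrow> trig_poly (\<lambda>x. c * fexp k x * p x)"
proof (induction rule: trig_poly.induct)
  case (trig_poly_monom d l)
  then show ?case
    using trig_poly.trig_poly_monom[of "c * d" "k + l"] by (simp add: fexp_add mult_ac)
qed (simp add: distrib_left trig_poly_add)

lemma trig_poly_mult: "trig_poly p \<Longrightarrow> trig_poly q \<Longrightarrow> trig_poly (\<lambda>x. p x * q x)"
  by (induction rule: trig_poly.induct) (simp_all add: distrib_right trig_poly_add trig_poly_mult_monom)

lemma trig_poly_sum: "finite A \<Longrightarrow> (\<And>a. a \<in> A \<Longrightarrow> trig_poly (p a)) \<Longrightarrow> trig_poly (\<lambda>x. \<Sum>a\<in>A. p a x)"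
  by (induction rule: finite_induct) (auto intro: trig_poly_const trig_poly_add)

lemma trig_poly_repr: "trig_poly p \<Longrightarrow> \<exists>A c. finite A \<and> p = (\<lambda>x. \<Sum>k\<in>A. c k * fexp k x)"
proof (induction rule: trig_poly.induct)
  case (trig_poly_monom c k)
  show ?case by (rule exI[of _ "{k}"], rule exI[of _ "\<lambda>_. c"]) simp
next
  case (trig_poly_add p q)
  then obtain A c B d where *: "finite A" "p = (\<lambda>x. \<Sum>k\<in>A. c k * fexp k x)"
    "finite B" "q = (\<lambda>x. \<Sum>k\<in>B. d k * fexp k x)" by blast
  let ?e = "\<lambda>k. (if k \<in> A then c k else 0) + (if k \<in> B then d k else 0)"
  have "p x + q x = (\<Sum>k\<in>A \<union> B. ?e k * fexp k x)" for x
  proof -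
    have "(\<Sum>k\<in>A. c k * fexp k x) = (\<Sum>k\<in>A \<union> B. (if k \<in> A then c k else 0) * fexp k x)"
      using * by (intro sum.mono_neutral_cong_left) auto
    moreover have "(\<Sum>k\<in>B. d k * fexp k x) = (\<Sum>k\<in>A \<union> B. (if k \<in> B then d k else 0) * fexp k x)"
      using * by (intro sum.mono_neutral_cong_left) auto
    ultimately show ?thesis using * by (simp add: sum.distrib distrib_right)
  qed
  then show ?case using * by (intro exI[of _ "A \<union> B"] exI[of _ ?e]) auto
qed

lemma trig_poly_continuous: "trig_poly p \<Longrightarrow> continuous_on UNIV p"
  by (induction rule: trig_poly.induct) (auto intro!: continuous_intros)

lemma trig_poly_measurable [measurable_dest]: "trig_poly p \<Longrightarrow> p \<in> borel_measurable borel"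
  by (intro borel_measurable_continuous_onI trig_poly_continuous)

text \<open>Realises the torus as a product of three circles, a compact set on which the
  Stone-Weierstrass theorem applies. \<open>torus_arg\<close> is the inverse on the half-open
  cube.\<close>

definition torus_embed :: "real^3 \<Rightarrow> complex^3" where
  "torus_embed x = (\<chi> i. cis (2 * pi * x $ i))"

definition torus_arg :: "complex^3 \<Rightarrow> real^3" where
  "torus_arg z = (\<chi> i. Arg2pi (z $ i) / (2 * pi))"

lemma continuous_torus_embed: "continuous_on S torus_embed"
  unfolding torus_embed_def by (intro continuous_intros)

lemma measurable_torus_embed [measurable]: "torus_embed \<in> borel_measurable borel"
  by (intro borel_measurable_continuous_onI continuous_torus_embed)

lemma compact_torus_embed: "compact (torus_embed ` cbox 0 1)"
  by (intro compact_continuous_image continuous_torus_embed compact_cbox)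

text \<open>\<open>Arg2pi\<close> jumps only across the nonnegative real axis, where it takes the
  value 0, so it is continuous off a closed set and constant on it.\<close>

lemma measurable_Arg2pi: "Arg2pi \<in> borel_measurable borel"
proof -
  have "Arg2pi = (\<lambda>z. if z \<in> \<real>\<^sub>\<ge>\<^sub>0 then 0 else Arg2pi z)"
    by (auto simp: fun_eq_iff Arg2pi_eq_0 complex_nonneg_Reals_iff complex_is_Real_iff)
  also have "\<dots> \<in> borel_measurable borel"
    by (rule borel_measurable_continuous_on_if)
       (auto intro!: continuous_at_imp_continuous_on continuous_at_Arg2pi)
  finally show ?thesis .
qed

lemma measurable_vec_lambda:
  fixes f :: "'a \<Rightarrow> 'n::finite \<Rightarrow> 'b::euclidean_space"
  assumes [measurable]: "\<And>i. (\<lambda>x. f x i) \<in> borel_measurable M"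
  shows "(\<lambda>x. \<chi> i. f x i) \<in> borel_measurable M"
  by (subst borel_measurable_euclidean_space) (auto simp: Basis_vec_def inner_axis)

lemma measurable_torus_arg [measurable]: "torus_arg \<in> borel_measurable borel"
proof -
  have [measurable]: "(\<lambda>z::complex^3. z $ i) \<in> borel_measurable borel" for i
    by (intro borel_measurable_continuous_onI continuous_intros)
  note [measurable] = measurable_Arg2pi
  show ?thesis unfolding torus_arg_def by (intro measurable_vec_lambda) simp
qed

lemma torus_arg_embed:
  assumes "\<And>i. 0 \<le> x $ i" "\<And>i. x $ i < 1"
  shows "torus_arg (torus_embed x) = x"
proof -
  have "Arg2pi (cis (2 * pi * x $ i)) = 2 * pi * x $ i" for i
    by (rule Arg2pi_unique[of 1]) (use assms[of i] in \<open>auto simp: cis_conv_exp\<close>)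
  then show ?thesis by (simp add: torus_arg_def torus_embed_def vec_eq_iff)
qed

text \<open>The measure \<open>torus\<close> lives on the closed cube, whose opposite faces have the
  same image under \<open>torus_embed\<close>. Discarding the upper faces, a null set, makes the
  embedding invertible.\<close>

lemma AE_torus_half_open: "AE x in torus. \<forall>i. 0 \<le> x $ i \<and> x $ i < 1"
proof -
  have null: "{x::real^3. x $ i = 1} \<in> null_sets lborel" for i
  proof -
    have meas: "{x::real^3. x $ i = 1} \<in> sets lborel"
      by (auto intro!: borel_closed closed_Collect_eq continuous_intros)
    have "negligible {x::real^3. x $ i = 1}"
      using negligible_hyperplane[of "axis i (1::real)" 1]
      by (simp add: inner_axis' axis_eq_0_iff)
    then have "{x::real^3. x $ i = 1} \<in> null_sets lebesgue" by (simp only: negligible_iff_null_sets)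
    then show ?thesis using null_sets_completion_iff[OF meas] by simp
  qed
  have "AE x in lborel. \<forall>i. (x::real^3) $ i \<noteq> 1"
    unfolding AE_all_countable using AE_not_in[OF null] by auto
  then show ?thesis
    unfolding torus_def by (subst AE_restrict_space_iff) (auto simp: cube_iff order_less_le elim!: eventually_mono)
qed

text \<open>Real polynomials on \<open>complex^3\<close> are generated by constants and by the real
  and imaginary parts of the coordinates. On the embedded torus these parts are cosines and sines,
  combinations of a character and its conjugate.\<close>

lemma trig_poly_real_polynomial:
  assumes "real_polynomial_function g"
  shows "trig_poly (\<lambda>x. of_real (g (torus_embed x)))"
  using assms
proof (induction rule: real_polynomial_function.induct)
  case (linear f)
  interpret bounded_linear f by fact
  have f_alt: "f z = (\<Sum>b\<in>Basis. (z \<bullet> b) * f b)" for z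
  proof -
    have "f (\<Sum>b\<in>Basis. (z \<bullet> b) *\<^sub>R b) = (\<Sum>b\<in>Basis. (z \<bullet> b) * f b)"
      by (simp add: sum scaleR)
    then show ?thesis by (simp add: euclidean_representation)
  qed
  have "trig_poly (\<lambda>x. of_real (torus_embed x \<bullet> b))" if "b \<in> Basis" for b
  proof -
    obtain i u where b: "b = axis i u" "u = 1 \<or> u = \<i>"
      using \<open>b \<in> Basis\<close> by (auto simp: Basis_vec_def Basis_complex_def)
    have e: "torus_embed x $ i = fexp (axis i 1) x" for x
    proof -
      have "lattice_vec (axis i 1) = axis i 1" by (auto simp: vec_eq_iff axis_def)
      then show ?thesis by (simp add: torus_embed_def fexp_def inner_axis')
    qed
    have "trig_poly (\<lambda>x. 1/2 * fexp (axis i 1) x + 1/2 * fexp (- axis i 1) x)"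
      "trig_poly (\<lambda>x. (1/(2*\<i>)) * fexp (axis i 1) x + (- 1/(2*\<i>)) * fexp (- axis i 1) x)"
      by (intro trig_poly_add trig_poly_monom)+
    moreover have "of_real (torus_embed x \<bullet> axis i 1) = 1/2 * fexp (axis i 1) x + 1/2 * fexp (- axis i 1) x"
      "of_real (torus_embed x \<bullet> axis i \<i>) = (1/(2*\<i>)) * fexp (axis i 1) x + (- 1/(2*\<i>)) * fexp (- axis i 1) x" for x
      by (simp_all add: inner_axis e fexp_uminus inner_complex_def complex_eq_iff)
    ultimately show ?thesis using b by auto
  qed
  then have "trig_poly (\<lambda>x. \<Sum>b\<in>Basis. of_real (torus_embed x \<bullet> b) * of_real (f b))"
    by (intro trig_poly_sum trig_poly_mult trig_poly_const) auto
  then show ?case by (simp add: f_alt[of "torus_embed _"])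
qed (simp_all add: trig_poly_const trig_poly_add trig_poly_mult)

lemma trig_poly_dense_continuous:
  fixes h :: "complex^3 \<Rightarrow> real"
  assumes "continuous_on (torus_embed ` cbox 0 1) h" "e > 0"
  obtains p where "trig_poly p" "\<And>x. x \<in> cbox 0 1 \<Longrightarrow> norm (of_real (h (torus_embed x)) - p x) < e"
proof -
  obtain g where g: "real_polynomial_function g" "\<And>x. x \<in> torus_embed ` cbox 0 1 \<Longrightarrow> \<bar>h x - g x\<bar> < e"
    by (rule Stone_Weierstrass_real_polynomial_function[OF compact_torus_embed assms]) blast
  have "norm (of_real (h (torus_embed x)) - of_real (g (torus_embed x)) :: complex) < e" if "x \<in> cbox 0 1" for x
    using g(2)[OF imageI, OF that] by (metis norm_of_real of_real_diff)
  then show ?thesis using that[OF trig_poly_real_polynomial[OF g(1)]] by blast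
qed

text \<open>Closure of the trigonometric polynomials in square mean; the nonnegative integral makes
  the notion meaningful before any integrability is known.\<close>

definition L2_approx :: "(real^3 \<Rightarrow> complex) \<Rightarrow> bool" where
  "L2_approx g \<longleftrightarrow> g \<in> borel_measurable borel \<and>
     (\<forall>e>0. \<exists>p. trig_poly p \<and> (\<integral>\<^sup>+x. ennreal ((norm (g x - p x))\<^sup>2) \<partial>torus) < ennreal e)"

text \<open>From \<open>(a + b)^2 \<le> 2 a^2 + 2 b^2\<close>: two errors below \<open>e / 4\<close>
  add up to less than \<open>e\<close>.\<close>

lemma L2_dist_triangle:
  fixes f g h :: "real^3 \<Rightarrow> complex"
  assumes [measurable]: "f \<in> borel_measurable borel" "g \<in> borel_measurable borel" "h \<in> borel_measurable borel"
    and "(\<integral>\<^sup>+x. ennreal ((norm (f x - g x))\<^sup>2) \<partial>torus) < ennreal (e / 4)"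
    and "(\<integral>\<^sup>+x. ennreal ((norm (g x - h x))\<^sup>2) \<partial>torus) < ennreal (e / 4)"
    and "e > 0"
  shows "(\<integral>\<^sup>+x. ennreal ((norm (f x - h x))\<^sup>2) \<partial>torus) < ennreal e"
proof -
  have le: "(norm (f x - h x))\<^sup>2 \<le> 2 * (norm (f x - g x))\<^sup>2 + 2 * (norm (g x - h x))\<^sup>2" for x
  proof -
    have "norm (f x - h x) \<le> norm (f x - g x) + norm (g x - h x)"
      using norm_triangle_ineq[of "f x - g x" "g x - h x"] by simp
    then have "(norm (f x - h x))\<^sup>2 \<le> (norm (f x - g x) + norm (g x - h x))\<^sup>2"
      by (intro power_mono) auto
    also have "\<dots> \<le> 2 * (norm (f x - g x))\<^sup>2 + 2 * (norm (g x - h x))\<^sup>2"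
      using sum_squares_bound[of "norm (f x - g x)" "norm (g x - h x)"] by (simp add: power2_sum)
    finally show ?thesis .
  qed
  have "(\<integral>\<^sup>+x. ennreal ((norm (f x - h x))\<^sup>2) \<partial>torus) \<le>
      (\<integral>\<^sup>+x. 2 * ennreal ((norm (f x - g x))\<^sup>2) + 2 * ennreal ((norm (g x - h x))\<^sup>2) \<partial>torus)"
  proof (rule nn_integral_mono)
    fix x
    have "2 * ennreal ((norm (f x - g x))\<^sup>2) + 2 * ennreal ((norm (g x - h x))\<^sup>2) =
       ennreal (2 * (norm (f x - g x))\<^sup>2 + 2 * (norm (g x - h x))\<^sup>2)"
      by (simp add: ennreal_plus ennreal_mult)
    then show "ennreal ((norm (f x - h x))\<^sup>2) \<le> 2 * ennreal ((norm (f x - g x))\<^sup>2) + 2 * ennreal ((norm (g x - h x))\<^sup>2)"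
      using ennreal_leI[OF le[of x]] by (simp only:)
  qed
  also have "\<dots> = 2 * (\<integral>\<^sup>+x. ennreal ((norm (f x - g x))\<^sup>2) \<partial>torus) + 2 * (\<integral>\<^sup>+x. ennreal ((norm (g x - h x))\<^sup>2) \<partial>torus)"
    by (subst nn_integral_add) (auto simp: nn_integral_cmult)
  also have "\<dots> < 2 * ennreal (e / 4) + 2 * ennreal (e / 4)"
    by (intro add_strict_mono ennreal_mult_strict_left_mono assms) auto
  also have "\<dots> = ennreal e"
    using \<open>e > 0\<close> by (simp add: ennreal_mult[symmetric] ennreal_plus[symmetric] flip: ennreal_numeral)
  finally show ?thesis .
qed

lemma L2_approx_lim:
  assumes "g \<in> borel_measurable borel"
    "\<And>e. e > 0 \<Longrightarrow> \<exists>g'. L2_approx g' \<and> (\<integral>\<^sup>+x. ennreal ((norm (g x - g' x))\<^sup>2) \<partial>torus) < ennreal e"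
  shows "L2_approx g"
  unfolding L2_approx_def
proof (intro conjI allI impI assms)
  fix e :: real assume e: "e > 0"
  then obtain g' where g': "L2_approx g'" "(\<integral>\<^sup>+x. ennreal ((norm (g x - g' x))\<^sup>2) \<partial>torus) < ennreal (e/4)"
    using assms(2)[of "e/4"] by auto
  obtain p where p: "trig_poly p" "(\<integral>\<^sup>+x. ennreal ((norm (g' x - p x))\<^sup>2) \<partial>torus) < ennreal (e/4)"
    using g'(1) e unfolding L2_approx_def by (meson divide_pos_pos zero_less_numeral)
  show "\<exists>p. trig_poly p \<and> (\<integral>\<^sup>+x. ennreal ((norm (g x - p x))\<^sup>2) \<partial>torus) < ennreal e"
    using L2_dist_triangle[OF assms(1) _ trig_poly_measurable[OF p(1)] g'(2) p(2) e] g'(1) p(1)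
    by (auto simp: L2_approx_def)
qed

lemma L2_approx_seq:
  assumes L: "\<And>n. L2_approx (s n)" and g [measurable]: "g \<in> borel_measurable borel"
    and lim: "\<And>x. x \<in> cbox 0 1 \<Longrightarrow> (\<lambda>n. s n x) \<longlonglongrightarrow> g x"
    and w: "\<And>n x. x \<in> cbox 0 1 \<Longrightarrow> norm (s n x - g x) \<le> w x"
    and w_meas [measurable]: "w \<in> borel_measurable borel"
    and "(\<integral>\<^sup>+x. ennreal ((w x)\<^sup>2) \<partial>torus) < \<infinity>"
  shows "L2_approx g"
proof (rule L2_approx_lim[OF g])
  fix e :: real assume e: "e > 0"
  have [measurable]: "s n \<in> borel_measurable borel" for n using L by (auto simp: L2_approx_def)
  have "(\<lambda>n. \<integral>\<^sup>+x. ennreal ((norm (g x - s n x))\<^sup>2) \<partial>torus) \<longlonglongrightarrow> (\<integral>\<^sup>+x. 0 \<partial>torus)"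
  proof (rule nn_integral_dominated_convergence[where w="\<lambda>x. ennreal ((w x)\<^sup>2)"])
    show "AE x in torus. ennreal ((norm (g x - s n x))\<^sup>2) \<le> ennreal ((w x)\<^sup>2)" for n
      using w by (intro AE_I2 ennreal_leI power_mono) (auto simp: norm_minus_commute)
    have "(\<lambda>n. ennreal ((norm (g x - s n x))\<^sup>2)) \<longlonglongrightarrow> ennreal ((norm (g x - g x))\<^sup>2)" if "x \<in> cbox 0 1" for x
      by (intro tendsto_intros lim that)
    then show "AE x in torus. (\<lambda>n. ennreal ((norm (g x - s n x))\<^sup>2)) \<longlonglongrightarrow> 0"
      by (intro AE_I2) simp
  qed (use assms in auto)
  then have "\<forall>\<^sub>F n in sequentially. (\<integral>\<^sup>+x. ennreal ((norm (g x - s n x))\<^sup>2) \<partial>torus) < ennreal e"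
    using e by (intro order_tendstoD) auto
  then obtain n where "(\<integral>\<^sup>+x. ennreal ((norm (g x - s n x))\<^sup>2) \<partial>torus) < ennreal e"
    by (auto dest: eventually_happens)
  with L show "\<exists>g'. L2_approx g' \<and> (\<integral>\<^sup>+x. ennreal ((norm (g x - g' x))\<^sup>2) \<partial>torus) < ennreal e" by blast
qed

lemma L2_approx_uniform:
  assumes g: "g \<in> borel_measurable borel"
    and "\<And>e. e > 0 \<Longrightarrow> \<exists>g'. L2_approx g' \<and> (\<forall>x\<in>cbox 0 1. norm (g x - g' x) \<le> e)"
  shows "L2_approx g"
proof (rule L2_approx_lim[OF g])
  fix e :: real assume e: "e > 0"
  obtain g' where g': "L2_approx g'" "\<And>x. x \<in> cbox 0 1 \<Longrightarrow> norm (g x - g' x) \<le> sqrt (e/2)"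
    using assms(2)[of "sqrt (e/2)"] e by auto
  have "(\<integral>\<^sup>+x. ennreal ((norm (g x - g' x))\<^sup>2) \<partial>torus) \<le> (\<integral>\<^sup>+x. ennreal ((sqrt (e/2))\<^sup>2) \<partial>torus)"
    by (intro nn_integral_mono ennreal_leI power_mono g') auto
  also have "\<dots> = ennreal (e/2)" using e torus.emeasure_space_1 by simp
  also have "\<dots> < ennreal e" using e by (intro ennreal_lessI) auto
  finally show "\<exists>g'. L2_approx g' \<and> (\<integral>\<^sup>+x. ennreal ((norm (g x - g' x))\<^sup>2) \<partial>torus) < ennreal e"
    using g'(1) by blast
qed

lemma L2_approx_trig_poly: "trig_poly p \<Longrightarrow> L2_approx p"
  unfolding L2_approx_def by (auto intro!: exI[of _ p] simp: trig_poly_measurable)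

lemma L2_approx_add:
  assumes "L2_approx f" "L2_approx g"
  shows "L2_approx (\<lambda>x. f x + g x)"
proof -
  note [measurable] = assms[unfolded L2_approx_def, THEN conjunct1]
  have half: "L2_approx (\<lambda>x. f x + p x)" if p: "trig_poly p" for p
    unfolding L2_approx_def
  proof (intro conjI allI impI)
    fix e :: real assume "e > 0"
    then obtain q where "trig_poly q" "(\<integral>\<^sup>+x. ennreal ((norm (f x - q x))\<^sup>2) \<partial>torus) < ennreal e"
      using assms(1) by (auto simp: L2_approx_def)
    then show "\<exists>q. trig_poly q \<and> (\<integral>\<^sup>+x. ennreal ((norm (f x + p x - q x))\<^sup>2) \<partial>torus) < ennreal e"
      by (intro exI[of _ "\<lambda>x. q x + p x"]) (auto intro: trig_poly_add p)
  qed (use trig_poly_measurable[OF p] in measurable)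
  show ?thesis
  proof (rule L2_approx_lim)
    fix e :: real assume "e > 0"
    then obtain q where q: "trig_poly q" "(\<integral>\<^sup>+x. ennreal ((norm (g x - q x))\<^sup>2) \<partial>torus) < ennreal e"
      using assms(2) by (auto simp: L2_approx_def)
    then show "\<exists>g'. L2_approx g' \<and> (\<integral>\<^sup>+x. ennreal ((norm (f x + g x - g' x))\<^sup>2) \<partial>torus) < ennreal e"
      by (intro exI[of _ "\<lambda>x. f x + q x"]) (auto intro: half)
  qed simp
qed

lemma L2_approx_cmult:
  assumes "L2_approx f"
  shows "L2_approx (\<lambda>x. c * f x)"
proof -
  note [measurable] = assms[unfolded L2_approx_def, THEN conjunct1]
  show ?thesis
  unfolding L2_approx_def
  proof (intro conjI allI impI)
    fix e :: real assume e: "e > 0"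
    have pos: "e / (1 + (norm c)\<^sup>2) > 0" using e by (intro divide_pos_pos add_pos_nonneg) auto
    then obtain q where q: "trig_poly q" "(\<integral>\<^sup>+x. ennreal ((norm (f x - q x))\<^sup>2) \<partial>torus) < ennreal (e / (1 + (norm c)\<^sup>2))"
      using assms(1) by (auto simp: L2_approx_def)
    have [measurable]: "q \<in> borel_measurable borel" using q(1) by (rule trig_poly_measurable)
    have "(\<integral>\<^sup>+x. ennreal ((norm (c * f x - c * q x))\<^sup>2) \<partial>torus) = (\<integral>\<^sup>+x. ennreal ((norm c)\<^sup>2) * ennreal ((norm (f x - q x))\<^sup>2) \<partial>torus)"
      by (simp add: right_diff_distrib[symmetric] norm_mult power_mult_distrib ennreal_mult)
    also have "\<dots> = ennreal ((norm c)\<^sup>2) * (\<integral>\<^sup>+x. ennreal ((norm (f x - q x))\<^sup>2) \<partial>torus)"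
      by (rule nn_integral_cmult) simp
    also have "\<dots> \<le> ennreal ((norm c)\<^sup>2) * ennreal (e / (1 + (norm c)\<^sup>2))"
      using q(2) by (intro mult_left_mono) auto
    also have "\<dots> = ennreal ((norm c)\<^sup>2 * (e / (1 + (norm c)\<^sup>2)))" by (rule ennreal_mult[symmetric]) (use pos in auto)
    also have "\<dots> < ennreal e"
    proof (intro ennreal_lessI e)
      have "0 < 1 + (norm c)\<^sup>2" by (simp add: add_pos_nonneg)
      then show "(norm c)\<^sup>2 * (e / (1 + (norm c)\<^sup>2)) < e" using e by (simp add: field_simps)
    qed
    finally show "\<exists>q. trig_poly q \<and> (\<integral>\<^sup>+x. ennreal ((norm (c * f x - q x))\<^sup>2) \<partial>torus) < ennreal e"
      using trig_poly_mult[OF trig_poly_const q(1)] by (intro exI[of _ "\<lambda>x. c * q x"]) auto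
  qed simp
qed

lemma L2_approx_sum:
  "finite A \<Longrightarrow> (\<And>a. a \<in> A \<Longrightarrow> L2_approx (f a)) \<Longrightarrow> L2_approx (\<lambda>x. \<Sum>a\<in>A. f a x)"
  by (induction rule: finite_induct) (auto intro: L2_approx_add L2_approx_trig_poly trig_poly_const)

text \<open>Tent functions of the distance to \<open>C\<close> converge to its indicator. They are
  continuous on the embedded torus, hence uniform limits of trigonometric polynomials, and dominated
  convergence does the rest.\<close>

lemma L2_approx_closed:
  assumes "closed C"
  shows "L2_approx (\<lambda>x. indicator C (torus_embed x))"
\<comment> \<open>\<open>infdist\<close> to the empty set is 0, which would make every tent
  constantly 1.\<close>
proof (cases "C = {}")
  case True
  then show ?thesis by (simp add: L2_approx_trig_poly trig_poly_const)
next
  case False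
  note [measurable] = borel_closed[OF assms]
  let ?h = "\<lambda>n z. max 0 (1 - real n * infdist z C)"
  show ?thesis
  proof (rule L2_approx_seq[where s="\<lambda>n x. of_real (?h n (torus_embed x))" and w="\<lambda>_. 1"])
    fix n
    have meas: "(\<lambda>x. complex_of_real (?h n (torus_embed x))) \<in> borel_measurable borel"
      by (intro borel_measurable_continuous_onI continuous_intros continuous_torus_embed)
    show "L2_approx (\<lambda>x. complex_of_real (?h n (torus_embed x)))"
    proof (rule L2_approx_uniform[OF meas])
      fix e :: real assume "e > 0"
      obtain p where "trig_poly p" "\<And>x. x \<in> cbox 0 1 \<Longrightarrow> norm (of_real (?h n (torus_embed x)) - p x) < e"
        by (rule trig_poly_dense_continuous[OF _ \<open>e > 0\<close>, of "?h n"]) (auto intro!: continuous_intros)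
      then show "\<exists>g'. L2_approx g' \<and> (\<forall>x\<in>cbox 0 1. norm (of_real (?h n (torus_embed x)) - g' x) \<le> e)"
        by (intro exI[of _ p]) (auto intro: L2_approx_trig_poly less_imp_le)
    qed
  next
    fix x :: "real^3"
    have "(\<lambda>n. ?h n z) \<longlonglongrightarrow> indicator C z" for z
    proof (cases "z \<in> C")
      case True
      then show ?thesis by simp
    next
      case False
      then have pos: "infdist z C > 0"
        using assms \<open>C \<noteq> {}\<close> by (simp add: infdist_pos_not_in_closed)
      obtain N where N: "real N * infdist z C > 1" using reals_Archimedean3[OF pos] by blast
      have "\<forall>n\<ge>N. ?h n z = 0"
      proof safe
        fix n assume "n \<ge> N"
        then have "real n * infdist z C \<ge> real N * infdist z C" using pos by (intro mult_right_mono) auto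
        then show "?h n z = 0" using N by simp
      qed
      then have "(\<lambda>n. ?h n z) \<longlonglongrightarrow> 0"
        by (intro tendsto_eventually) (auto simp: eventually_at_top_linorder)
      then show ?thesis using False by simp
    qed
    from this[of "torus_embed x"]
    have "(\<lambda>n. complex_of_real (?h n (torus_embed x))) \<longlonglongrightarrow> complex_of_real (indicator C (torus_embed x))"
      by (rule tendsto_of_real)
    moreover have "complex_of_real (indicator C (torus_embed x)) = indicator C (torus_embed x)"
      by (simp add: indicator_def)
    ultimately show "(\<lambda>n. complex_of_real (?h n (torus_embed x))) \<longlonglongrightarrow> indicator C (torus_embed x)"
      by (simp only:)
  next
    fix n x
    have "infdist (torus_embed x) C \<ge> 0" by (rule infdist_nonneg)
    then have "\<bar>?h n (torus_embed x) - indicator C (torus_embed x)\<bar> \<le> 1"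
      by (auto simp: indicator_def max_def)
    moreover have "complex_of_real (?h n (torus_embed x)) - indicator C (torus_embed x) =
       of_real (?h n (torus_embed x) - indicator C (torus_embed x))"
      by (auto simp: indicator_def)
    ultimately show "norm (complex_of_real (?h n (torus_embed x)) - indicator C (torus_embed x)) \<le> 1"
      by (simp only: norm_of_real)
  qed (use torus.emeasure_space_1 in auto)
qed

text \<open>Dynkin's argument: the closed sets are stable under intersection and generate;
  complements are affine combinations, and countable disjoint unions are dominated limits of finite
  sums.\<close>

lemma L2_approx_borel:
  assumes "B \<in> sets borel"
  shows "L2_approx (\<lambda>x. indicator B (torus_embed x))"
proof -
  have sets: "sigma_sets UNIV (Collect closed) = sets (borel :: (complex^3) measure)"
    by (simp add: borel_eq_closed)
  have "Int_stable (Collect closed :: (complex^3) set set)" "(Collect closed :: (complex^3) set set) \<subseteq> Pow UNIV"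
    "B \<in> sigma_sets UNIV (Collect closed)"
    using assms by (auto simp: Int_stable_def sets)
  then show ?thesis
  proof (induction rule: sigma_sets_induct_disjoint)
    case (compl A)
    have "L2_approx (\<lambda>x. 1 + (-1) * indicator A (torus_embed x))"
      by (intro L2_approx_add L2_approx_cmult compl L2_approx_trig_poly trig_poly_const)
    moreover have "(\<lambda>x. 1 + (-1) * indicator A (torus_embed x) :: complex) = (\<lambda>x. indicator (UNIV - A) (torus_embed x))"
      by (auto simp: indicator_def fun_eq_iff)
    ultimately show ?case by simp
  next
    case (union A)
    have A: "A i \<in> sets borel" for i using union(2) sets by auto
    have [measurable]: "\<Union>(range A) \<in> sets borel" using A by (intro sets.countable_UN) auto
    have eq: "(\<Sum>i<n. indicator (A i) z) = (indicator (\<Union>i<n. A i) z :: complex)" for n z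
      using union(1) by (intro indicator_UN_disjoint[symmetric]) (auto simp: disjoint_family_on_def)
    show ?case
    proof (rule L2_approx_seq[where s="\<lambda>n x. \<Sum>i<n. indicator (A i) (torus_embed x)" and w="\<lambda>_. 1"])
      show "(\<lambda>n. \<Sum>i<n. indicator (A i) (torus_embed x) :: complex) \<longlonglongrightarrow> indicator (\<Union>(range A)) (torus_embed x)" for x
        unfolding eq by (rule LIMSEQ_indicator_UN)
      show "norm ((\<Sum>i<n. indicator (A i) (torus_embed x)) - indicator (\<Union>(range A)) (torus_embed x) :: complex) \<le> 1" for n x
        unfolding eq by (auto simp: indicator_def)
    qed (use torus.emeasure_space_1 in \<open>auto intro!: L2_approx_sum union\<close>)
  qed (auto simp: Int_stable_def L2_approx_closed intro!: L2_approx_trig_poly trig_poly_const)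
qed

text \<open>Almost everywhere \<open>f\<close> is a Borel function of the embedded point, through
  \<open>torus_arg\<close>. The simple functions approximating it are combinations of indicators of
  Borel sets and are dominated by twice its norm.\<close>

lemma L2_approx_square_integrable:
  fixes f :: "real^3 \<Rightarrow> complex"
  assumes f [measurable]: "f \<in> borel_measurable borel"
    and fin: "(\<integral>\<^sup>+x. ennreal ((norm (f x))\<^sup>2) \<partial>torus) < \<infinity>"
  shows "L2_approx f"
proof -
  let ?F = "\<lambda>z. f (torus_arg z)"
  obtain s where s: "\<And>i. simple_function borel (s i)" "\<And>z. (\<lambda>i. s i z) \<longlonglongrightarrow> ?F z"
    "\<And>i z. norm (s i z) \<le> 2 * norm (?F z)"
    using borel_measurable_implies_sequence_metric[of ?F borel 0] by auto
  have simple: "L2_approx (\<lambda>x. s i (torus_embed x))" for i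
  proof -
    have fin: "finite (range (s i))" using s(1)[of i] by (auto simp: simple_function_def)
    have rep: "s i z = (\<Sum>y\<in>range (s i). y * indicator (s i -` {y}) z)" for z
    proof -
      have "(\<Sum>y\<in>range (s i). y * indicator (s i -` {y}) z) = (\<Sum>y\<in>{s i z}. y * indicator (s i -` {y}) z)"
        using fin by (intro sum.mono_neutral_right) (auto simp: indicator_def)
      then show ?thesis by simp
    qed
    have "s i -` {y} \<in> sets borel" for y
      using simple_functionD(2)[OF s(1), of i "{y}"] by simp
    then have "L2_approx (\<lambda>x. \<Sum>y\<in>range (s i). y * indicator (s i -` {y}) (torus_embed x))"
      using fin by (intro L2_approx_sum L2_approx_cmult L2_approx_borel) auto
    then show ?thesis by (simp only: rep[symmetric])
  qed
  have 1: "AE x in torus. ?F (torus_embed x) = f x"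
    using AE_torus_half_open by eventually_elim (simp add: torus_arg_embed)
  have 2: "L2_approx (\<lambda>x. ?F (torus_embed x))"
  proof (rule L2_approx_seq[where s="\<lambda>n x. s n (torus_embed x)" and w="\<lambda>x. 3 * norm (?F (torus_embed x))"])
    show "norm (s n (torus_embed x) - ?F (torus_embed x)) \<le> 3 * norm (?F (torus_embed x))" for n x
      using norm_triangle_ineq4[of "s n (torus_embed x)" "?F (torus_embed x)"] s(3)[of n "torus_embed x"] by simp
    have "(\<integral>\<^sup>+x. ennreal ((3 * norm (?F (torus_embed x)))\<^sup>2) \<partial>torus) = (\<integral>\<^sup>+x. ennreal 9 * ennreal ((norm (f x))\<^sup>2) \<partial>torus)"
      by (intro nn_integral_cong_AE) (use 1 in \<open>eventually_elim, simp add: power_mult_distrib ennreal_mult\<close>)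
    also have "\<dots> = ennreal 9 * (\<integral>\<^sup>+x. ennreal ((norm (f x))\<^sup>2) \<partial>torus)"
      by (rule nn_integral_cmult) simp
    also have "\<dots> < \<infinity>" using fin by (simp add: ennreal_mult_less_top)
    finally show "(\<integral>\<^sup>+x. ennreal ((3 * norm (?F (torus_embed x)))\<^sup>2) \<partial>torus) < \<infinity>" .
  qed (use simple s(2) in auto)
  have "(\<integral>\<^sup>+x. ennreal ((norm (f x - p x))\<^sup>2) \<partial>torus) = (\<integral>\<^sup>+x. ennreal ((norm (?F (torus_embed x) - p x))\<^sup>2) \<partial>torus)" for p
    by (intro nn_integral_cong_AE) (use 1 in \<open>eventually_elim, simp\<close>)
  with 2 show ?thesis unfolding L2_approx_def by simp
qed

subsection \<open>Parseval's identity\<close>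

lemma has_sum_finite_sum:
  fixes f :: "'i \<Rightarrow> 'k \<Rightarrow> 'b::topological_comm_monoid_add"
  assumes "finite I" "\<And>i. i \<in> I \<Longrightarrow> (f i has_sum s i) A"
  shows "((\<lambda>k. \<Sum>i\<in>I. f i k) has_sum (\<Sum>i\<in>I. s i)) A"
  using assms by (induction rule: finite_induct) (auto intro: has_sum_add has_sum_0)

lemma integral_trig_poly:
  assumes "finite A"
  shows "(\<integral>x. (\<Sum>k\<in>A. c k * fexp k x) * cnj (\<Sum>k\<in>A. d k * fexp k x) \<partial>torus) = (\<Sum>k\<in>A. c k * cnj (d k))"
proof -
  have int: "integrable torus (\<lambda>x. a * fexp k x)" for a k
    by (intro integrable_torus_continuous continuous_intros)
  have "(\<Sum>k\<in>A. c k * fexp k x) * cnj (\<Sum>k\<in>A. d k * fexp k x) =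
     (\<Sum>k\<in>A. \<Sum>l\<in>A. c k * cnj (d l) * fexp (k - l) x)" for x
    by (simp add: sum_product fexp_diff mult_ac)
  then have "(\<integral>x. (\<Sum>k\<in>A. c k * fexp k x) * cnj (\<Sum>k\<in>A. d k * fexp k x) \<partial>torus) =
     (\<Sum>k\<in>A. \<Sum>l\<in>A. c k * cnj (d l) * (\<integral>x. fexp (k - l) x \<partial>torus))"
    by (simp add: Bochner_Integration.integral_sum int)
  also have "\<dots> = (\<Sum>k\<in>A. \<Sum>l\<in>A. if l = k then c k * cnj (d k) else 0)"
    by (intro sum.cong) (auto simp: integral_fexp)
  also have "\<dots> = (\<Sum>k\<in>A. c k * cnj (d k))" using assms by simp
  finally show ?thesis .
qed

lemma integral_norm_trig_poly:
  assumes "finite A"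
  shows "(\<integral>x. (cmod (\<Sum>k\<in>A. c k * fexp k x))\<^sup>2 \<partial>torus) = (\<Sum>k\<in>A. (cmod (c k))\<^sup>2)"
proof -
  have "complex_of_real (\<integral>x. (cmod (\<Sum>k\<in>A. c k * fexp k x))\<^sup>2 \<partial>torus) =
     (\<integral>x. (\<Sum>k\<in>A. c k * fexp k x) * cnj (\<Sum>k\<in>A. c k * fexp k x) \<partial>torus)"
    by (subst integral_complex_of_real[symmetric]) (simp only: complex_norm_square)
  also have "\<dots> = of_real (\<Sum>k\<in>A. (cmod (c k))\<^sup>2)"
    by (simp only: integral_trig_poly[OF assms] of_real_sum complex_norm_square)
  finally show ?thesis using of_real_eq_iff by blast
qed

lemma integrable_mult_fexp:
  fixes f :: "real^3 \<Rightarrow> complex"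
  assumes "integrable torus f"
  shows "integrable torus (\<lambda>x. f x * fexp k x)"
proof (rule Bochner_Integration.integrable_bound[OF assms])
  have [measurable]: "f \<in> borel_measurable torus" using assms by auto
  show "(\<lambda>x. f x * fexp k x) \<in> borel_measurable torus" by measurable
qed (simp add: norm_mult)

lemma fcoeff_add:
  assumes "integrable torus f" "integrable torus g"
  shows "fcoeff (\<lambda>x. f x + g x) k = fcoeff f k + fcoeff g k"
  unfolding fcoeff_fexp using assms
  by (simp add: distrib_right Bochner_Integration.integral_add integrable_mult_fexp integrable_of_real)

lemma fcoeff_cmult: "fcoeff (\<lambda>x. c * f x) k = of_real c * fcoeff f k"
  unfolding fcoeff_fexp by (simp add: mult.assoc)

lemma fcoeff_uminus_fun: "fcoeff (\<lambda>x. - f x) k = - fcoeff f k"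
  using fcoeff_cmult[of "-1" f k] by simp

lemma fcoeff_diff:
  assumes "integrable torus f" "integrable torus g"
  shows "fcoeff (\<lambda>x. f x - g x) k = fcoeff f k - fcoeff g k"
  using fcoeff_add[OF assms(1), of "\<lambda>x. - g x" k] assms by (simp add: fcoeff_uminus_fun)

lemma fcoeff_uminus: "fcoeff f (- k) = cnj (fcoeff f k)"
  unfolding fcoeff_fexp
  using integral_bounded_linear'[OF bounded_linear_cnj bounded_linear_cnj,
      of torus "\<lambda>x. of_real (f x) * fexp (- k) x"] by (simp add: fexp_uminus)

lemma integrable_square_sum:
  fixes f g :: "real^3 \<Rightarrow> real"
  assumes [measurable]: "f \<in> borel_measurable borel" "g \<in> borel_measurable borel"
    and "integrable torus (\<lambda>x. (f x)\<^sup>2)" "integrable torus (\<lambda>x. (g x)\<^sup>2)"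
  shows "integrable torus (\<lambda>x. f x * g x)" "integrable torus (\<lambda>x. (f x + g x)\<^sup>2)" "integrable torus (\<lambda>x. (f x - g x)\<^sup>2)"
proof -
  have le: "\<bar>f x * g x\<bar> \<le> (f x)\<^sup>2 + (g x)\<^sup>2" for x
  proof -
    have "2 * \<bar>f x\<bar> * \<bar>g x\<bar> \<le> (f x)\<^sup>2 + (g x)\<^sup>2"
      using sum_squares_bound[of "\<bar>f x\<bar>" "\<bar>g x\<bar>"] by simp
    moreover have "0 \<le> \<bar>f x\<bar> * \<bar>g x\<bar>" by simp
    ultimately show ?thesis unfolding abs_mult by linarith
  qed
  show 1: "integrable torus (\<lambda>x. f x * g x)"
    by (rule Bochner_Integration.integrable_bound[OF Bochner_Integration.integrable_add[OF assms(3,4)]])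
       (use le in \<open>auto simp: order_trans[OF _ abs_ge_self]\<close>)
  show "integrable torus (\<lambda>x. (f x + g x)\<^sup>2)" "integrable torus (\<lambda>x. (f x - g x)\<^sup>2)"
    unfolding power2_sum power2_diff using assms 1 by (auto simp: mult.assoc)
qed

lemma square_integrable_integrable:
  fixes f :: "real^3 \<Rightarrow> real"
  assumes [measurable]: "f \<in> borel_measurable borel" and "integrable torus (\<lambda>x. (f x)\<^sup>2)"
  shows "integrable torus f"
  by (rule torus.square_integrable_imp_integrable) (use assms in auto)

text \<open>Pythagoras for the orthonormal characters. With \<open>c = fcoeff f\<close> it yields
  Bessel's inequality; for general \<open>c\<close> it shows that the Fourier coefficients give the
  best approximation with spectrum \<open>A\<close>.\<close>

lemma L2_dist_trig_poly:
  fixes f :: "real^3 \<Rightarrow> real"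
  assumes f [measurable]: "f \<in> borel_measurable borel" and f2: "integrable torus (\<lambda>x. (f x)\<^sup>2)"
    and A: "finite A"
  shows "integrable torus (\<lambda>x. (cmod (of_real (f x) - (\<Sum>k\<in>A. c k * fexp k x)))\<^sup>2)" (is ?I)
    and "(\<integral>x. (cmod (of_real (f x) - (\<Sum>k\<in>A. c k * fexp k x)))\<^sup>2 \<partial>torus) =
      (\<integral>x. (f x)\<^sup>2 \<partial>torus) - (\<Sum>k\<in>A. (cmod (fcoeff f k))\<^sup>2) + (\<Sum>k\<in>A. (cmod (fcoeff f k - c k))\<^sup>2)" (is ?E)
proof -
  let ?p = "\<lambda>x. \<Sum>k\<in>A. c k * fexp k x"
  have f1: "integrable torus f" by (rule square_integrable_integrable[OF f f2])
  have e: "(cmod (of_real a - z))\<^sup>2 = a\<^sup>2 - 2 * Re (of_real a * cnj z) + (cmod z)\<^sup>2" for a z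
    unfolding cmod_power2 by (simp add: power2_eq_square algebra_simps)
  have alt: "of_real (f x) * cnj (?p x) = (\<Sum>k\<in>A. cnj (c k) * (of_real (f x) * fexp (- k) x))" for x
    by (simp add: sum_distrib_left fexp_uminus mult_ac)
  have i0: "integrable torus (\<lambda>x. complex_of_real (f x) * fexp (- k) x)" for k
    using f1 by (intro integrable_mult_fexp integrable_of_real)
  have i1: "integrable torus (\<lambda>x. of_real (f x) * cnj (?p x))"
    unfolding alt by (intro Bochner_Integration.integrable_sum integrable_mult_right i0)
  have i2: "integrable torus (\<lambda>x. (cmod (?p x))\<^sup>2)"
    by (intro integrable_torus_continuous continuous_intros)
  show ?I unfolding e
    by (intro Bochner_Integration.integrable_add Bochner_Integration.integrable_diff
          integrable_mult_right integrable_Re f2 i1 i2)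
  have "(\<integral>x. of_real (f x) * cnj (?p x) \<partial>torus) = (\<Sum>k\<in>A. cnj (c k) * fcoeff f k)"
    unfolding alt fcoeff_fexp by (subst Bochner_Integration.integral_sum) (use i0 in auto)
  moreover have "(\<integral>x. (cmod (of_real (f x) - ?p x))\<^sup>2 \<partial>torus) =
     (\<integral>x. (f x)\<^sup>2 \<partial>torus) - 2 * Re (\<integral>x. of_real (f x) * cnj (?p x) \<partial>torus) + (\<integral>x. (cmod (?p x))\<^sup>2 \<partial>torus)"
  proof -
    have "(\<integral>x. F x - 2 * Re (G x) + H x \<partial>torus) = (\<integral>x. F x \<partial>torus) - 2 * Re (\<integral>x. G x \<partial>torus) + (\<integral>x. H x \<partial>torus)"
      if "integrable torus F" "integrable torus G" "integrable torus H" for F H :: "real^3 \<Rightarrow> real" and G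
      using that by simp
    then show ?thesis unfolding e using f2 i1 i2 .
  qed
  moreover have "(\<Sum>k\<in>A. (cmod (fcoeff f k - c k))\<^sup>2) = (\<Sum>k\<in>A. (cmod (fcoeff f k))\<^sup>2)
     - 2 * Re (\<Sum>k\<in>A. cnj (c k) * fcoeff f k) + (\<Sum>k\<in>A. (cmod (c k))\<^sup>2)"
  proof -
    have "(cmod (a - b))\<^sup>2 = (cmod a)\<^sup>2 - 2 * Re (cnj b * a) + (cmod b)\<^sup>2" for a b
      unfolding cmod_power2 by (simp add: power2_eq_square algebra_simps)
    then show ?thesis by (simp add: sum.distrib sum_subtractf sum_distrib_left)
  qed
  ultimately show ?E by (simp add: integral_norm_trig_poly[OF A])
qed

text \<open>Let \<open>A\<close> be the spectrum of a trigonometric polynomial close to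
  \<open>f\<close>. Best approximation puts the partial sum over \<open>A\<close> within
  \<open>e\<close> of the integral, and Bessel's inequality keeps the sums over larger finite sets
  in between.\<close>

lemma parseval:
  fixes f :: "real^3 \<Rightarrow> real"
  assumes f [measurable]: "f \<in> borel_measurable borel" and f2: "integrable torus (\<lambda>x. (f x)\<^sup>2)"
  shows "((\<lambda>k. (cmod (fcoeff f k))\<^sup>2) has_sum (\<integral>x. (f x)\<^sup>2 \<partial>torus)) UNIV"
  unfolding has_sum_def tendsto_iff eventually_finite_subsets_at_top
proof (intro allI impI)
  fix e :: real assume e: "e > 0"
  let ?S = "\<lambda>A. \<Sum>k\<in>A. (cmod (fcoeff f k))\<^sup>2"
  have "(\<integral>\<^sup>+x. ennreal ((norm (complex_of_real (f x)))\<^sup>2) \<partial>torus) < \<infinity>"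
    using f2 by (simp add: integrable_iff_bounded)
  then have "L2_approx (\<lambda>x. complex_of_real (f x))"
    by (intro L2_approx_square_integrable) auto
  then obtain p where p: "trig_poly p" "(\<integral>\<^sup>+x. ennreal ((norm (of_real (f x) - p x))\<^sup>2) \<partial>torus) < ennreal e"
    using e unfolding L2_approx_def by blast
  obtain A c where A: "finite A" "p = (\<lambda>x. \<Sum>k\<in>A. c k * fexp k x)"
    using trig_poly_repr[OF p(1)] by blast
  note D = L2_dist_trig_poly[OF f f2 A(1), of c, folded A(2)[THEN fun_cong]]
  have "ennreal (\<integral>x. (cmod (of_real (f x) - p x))\<^sup>2 \<partial>torus) < ennreal e"
    using p(2) D(1) by (subst nn_integral_eq_integral[symmetric]) auto
  then have "(\<integral>x. (cmod (of_real (f x) - p x))\<^sup>2 \<partial>torus) < e"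
    by (simp add: ennreal_less_iff)
  moreover have "(\<Sum>k\<in>A. (cmod (fcoeff f k - c k))\<^sup>2) \<ge> 0" by (intro sum_nonneg) auto
  ultimately have lt: "(\<integral>x. (f x)\<^sup>2 \<partial>torus) - ?S A < e" using D(2) by linarith
  have "dist (?S B) (\<integral>x. (f x)\<^sup>2 \<partial>torus) < e" if B: "finite B" "A \<subseteq> B" for B
  proof -
    have "?S A \<le> ?S B" using B by (intro sum_mono2) auto
    moreover have "0 \<le> (\<integral>x. (cmod (of_real (f x) - (\<Sum>k\<in>B. fcoeff f k * fexp k x)))\<^sup>2 \<partial>torus)" by simp
    then have "?S B \<le> (\<integral>x. (f x)\<^sup>2 \<partial>torus)"
      using L2_dist_trig_poly(2)[OF f f2 B(1), of "fcoeff f"] by simp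
    ultimately show ?thesis using lt by (simp add: dist_real_def)
  qed
  then show "\<exists>X. finite X \<and> X \<subseteq> UNIV \<and> (\<forall>Y. finite Y \<and> X \<subseteq> Y \<and> Y \<subseteq> UNIV \<longrightarrow>
      dist (?S Y) (\<integral>x. (f x)\<^sup>2 \<partial>torus) < e)"
    using A(1) by (intro exI[of _ A]) auto
qed

text \<open>Polarization of \<open>parseval\<close>. The real inner product of the coefficients
  suffices, because for real functions the contributions of \<open>k\<close> and \<open>- k\<close>
  are conjugate.\<close>

lemma parseval_inner:
  fixes f g :: "real^3 \<Rightarrow> real"
  assumes f: "f \<in> borel_measurable borel" "integrable torus (\<lambda>x. (f x)\<^sup>2)"
    and g: "g \<in> borel_measurable borel" "integrable torus (\<lambda>x. (g x)\<^sup>2)"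
  shows "((\<lambda>k. fcoeff f k \<bullet> fcoeff g k) has_sum (\<integral>x. f x * g x \<partial>torus)) UNIV"
proof -
  note [measurable] = f(1) g(1)
  note i = integrable_square_sum[OF f(1) g(1) f(2) g(2)]
  note fi = square_integrable_integrable[OF f] square_integrable_integrable[OF g]
  have "((\<lambda>k. 1/4 * ((cmod (fcoeff (\<lambda>x. f x + g x) k))\<^sup>2 - (cmod (fcoeff (\<lambda>x. f x - g x) k))\<^sup>2)) has_sum
      (1/4 * ((\<integral>x. (f x + g x)\<^sup>2 \<partial>torus) - (\<integral>x. (f x - g x)\<^sup>2 \<partial>torus)))) UNIV"
    using has_sum_cmult_right[OF has_sum_add[OF parseval[OF _ i(2)] has_sum_uminusI[OF parseval[OF _ i(3)]]], of "1/4"]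
    by simp
  moreover have "(\<integral>x. (f x + g x)\<^sup>2 \<partial>torus) - (\<integral>x. (f x - g x)\<^sup>2 \<partial>torus) = 4 * (\<integral>x. f x * g x \<partial>torus)"
  proof -
    have "(\<integral>x. (f x + g x)\<^sup>2 \<partial>torus) - (\<integral>x. (f x - g x)\<^sup>2 \<partial>torus) = (\<integral>x. (f x + g x)\<^sup>2 - (f x - g x)\<^sup>2 \<partial>torus)"
      using i by simp
    also have "\<dots> = (\<integral>x. 4 * (f x * g x) \<partial>torus)"
      by (intro Bochner_Integration.integral_cong) (auto simp: power2_eq_square algebra_simps)
    finally show ?thesis by simp
  qed
  moreover have "1/4 * ((cmod (fcoeff (\<lambda>x. f x + g x) k))\<^sup>2 - (cmod (fcoeff (\<lambda>x. f x - g x) k))\<^sup>2) = fcoeff f k \<bullet> fcoeff g k" for k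
    unfolding cmod_power2
    by (simp add: fcoeff_add fcoeff_diff fi inner_complex_def power2_eq_square algebra_simps)
  ultimately show ?thesis by simp
qed

subsection \<open>Square-integrable vector fields\<close>

definition vcoef :: "(real^3 \<Rightarrow> real^3) \<Rightarrow> int^3 \<Rightarrow> complex^3" where
  "vcoef f k = (\<chi> i. fcoeff (\<lambda>x. f x $ i) k)"

lemma ennpow_half: "0 \<le> a \<Longrightarrow> ennpow (ennreal a) (1/2) = ennreal (sqrt a)"
  by (simp add: ennpow_def powr_half_sqrt)

lemma norm_powr_2: "norm x powr 2 = (norm x)\<^sup>2"
  by (cases "x = 0") (simp_all flip: powr_numeral)

lemma in_L2_iff:
  "in_L 2 f \<longleftrightarrow> periodic f \<and> f \<in> borel_measurable borel \<and> integrable torus (\<lambda>x. (norm (f x))\<^sup>2)"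
proof -
  have "Lnorm 2 f < \<infinity> \<longleftrightarrow> (\<integral>\<^sup>+ x. ennreal ((norm (f x))\<^sup>2) \<partial>torus) < \<infinity>"
    by (auto simp: Lnorm_def ennpow_def norm_powr_2 less_top)
  moreover have "(\<integral>\<^sup>+ x. ennreal ((norm (f x))\<^sup>2) \<partial>torus) < \<infinity> \<longleftrightarrow> integrable torus (\<lambda>x. (norm (f x))\<^sup>2)"
    if "f \<in> borel_measurable borel"
  proof -
    note [measurable] = that
    have "(\<lambda>x. (norm (f x))\<^sup>2) \<in> borel_measurable torus" by measurable
    then show ?thesis by (simp add: integrable_iff_bounded)
  qed
  ultimately show ?thesis by (auto simp: in_L_def)
qed

lemma Lnorm2_eq:
  assumes "integrable torus (\<lambda>x. (norm (f x))\<^sup>2)"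
  shows "Lnorm 2 f = ennreal (sqrt (\<integral>x. (norm (f x))\<^sup>2 \<partial>torus))"
  unfolding Lnorm_def norm_powr_2 nn_integral_eq_integral[OF assms AE_I2[OF zero_le_power2]]
  by (rule ennpow_half) simp

lemma norm_vec_sq: "(norm (x :: 'a::real_normed_vector^'n))\<^sup>2 = (\<Sum>i\<in>UNIV. (norm (x $ i))\<^sup>2)"
  by (simp add: norm_vec_def L2_set_def sum_nonneg)

lemma in_L2_component:
  fixes f :: "real^3 \<Rightarrow> 'b::euclidean_space"
  assumes "in_L 2 f"
  shows "(\<lambda>x. f x \<bullet> b) \<in> borel_measurable borel" "integrable torus (\<lambda>x. (f x \<bullet> b)\<^sup>2)"
    "integrable torus (\<lambda>x. f x \<bullet> b)"
proof -
  have [measurable]: "f \<in> borel_measurable borel" and i: "integrable torus (\<lambda>x. (norm (f x))\<^sup>2)"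
    using assms by (auto simp: in_L2_iff)
  show 1: "(\<lambda>x. f x \<bullet> b) \<in> borel_measurable borel" by measurable
  have "(f x \<bullet> b)\<^sup>2 \<le> (norm b)\<^sup>2 * (norm (f x))\<^sup>2" for x
    using power_mono[OF Cauchy_Schwarz_ineq2[of "f x" b] abs_ge_zero, of 2]
    by (simp add: power_mult_distrib mult.commute)
  then show 2: "integrable torus (\<lambda>x. (f x \<bullet> b)\<^sup>2)"
    by (intro Bochner_Integration.integrable_bound[OF integrable_mult_right[OF i, of "(norm b)\<^sup>2"]]) auto
  show "integrable torus (\<lambda>x. f x \<bullet> b)"
    by (rule square_integrable_integrable[OF 1 2])
qed

lemma in_L2_component_vec:
  fixes f :: "real^3 \<Rightarrow> real^3"
  assumes "in_L 2 f"
  shows "(\<lambda>x. f x $ i) \<in> borel_measurable borel" "integrable torus (\<lambda>x. (f x $ i)\<^sup>2)"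
    "integrable torus (\<lambda>x. f x $ i)"
  using in_L2_component[OF assms, of "axis i 1"] by (simp_all add: inner_axis)

lemma parseval_vec_inner:
  assumes f: "in_L 2 f" and g: "in_L 2 g"
  shows "((\<lambda>k. vcoef f k \<bullet> vcoef g k) has_sum (\<integral>x. f x \<bullet> g x \<partial>torus)) UNIV"
proof -
  note fm = in_L2_component_vec[OF f] and gm = in_L2_component_vec[OF g]
  have "((\<lambda>k. \<Sum>i\<in>UNIV. fcoeff (\<lambda>x. f x $ i) k \<bullet> fcoeff (\<lambda>x. g x $ i) k) has_sum
     (\<Sum>i\<in>UNIV. \<integral>x. f x $ i * g x $ i \<partial>torus)) UNIV"
    by (intro has_sum_finite_sum parseval_inner fm gm) auto
  moreover have "(\<Sum>i\<in>UNIV. \<integral>x. f x $ i * g x $ i \<partial>torus) = (\<integral>x. f x \<bullet> g x \<partial>torus)"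
    by (subst Bochner_Integration.integral_sum[symmetric])
       (auto intro!: integrable_square_sum fm gm simp: inner_vec_def)
  ultimately show ?thesis by (simp add: inner_vec_def vcoef_def)
qed

lemma parseval_vec:
  assumes f: "in_L 2 f"
  shows "((\<lambda>k. (norm (vcoef f k))\<^sup>2) has_sum (\<integral>x. (norm (f x))\<^sup>2 \<partial>torus)) UNIV"
  using parseval_vec_inner[OF f f] by (simp add: dot_square_norm)

lemma in_L2_add:
  assumes "in_L 2 f" "in_L 2 g"
  shows "in_L 2 (\<lambda>x. f x + g x)"
proof -
  note [measurable] = assms[unfolded in_L2_iff, THEN conjunct2, THEN conjunct1]
  have i: "integrable torus (\<lambda>x. 2 * (norm (f x))\<^sup>2 + 2 * (norm (g x))\<^sup>2)"
    using assms by (auto simp: in_L2_iff)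
  have "(norm (f x + g x))\<^sup>2 \<le> 2 * (norm (f x))\<^sup>2 + 2 * (norm (g x))\<^sup>2" for x
  proof -
    have "(norm (f x + g x))\<^sup>2 \<le> (norm (f x) + norm (g x))\<^sup>2"
      by (intro power_mono norm_triangle_ineq) auto
    then show ?thesis using sum_squares_bound[of "norm (f x)" "norm (g x)"] by (simp add: power2_sum)
  qed
  then have "integrable torus (\<lambda>x. (norm (f x + g x))\<^sup>2)"
    by (intro Bochner_Integration.integrable_bound[OF i]) auto
  then show ?thesis using assms by (auto simp: in_L2_iff periodic_def)
qed

lemma in_L2_cmult: "in_L 2 f \<Longrightarrow> in_L 2 (\<lambda>x. c *\<^sub>R f x)"
  by (auto simp: in_L2_iff periodic_def power_mult_distrib)

lemma in_L2_diff: "in_L 2 f \<Longrightarrow> in_L 2 g \<Longrightarrow> in_L 2 (\<lambda>x. f x - g x)"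
  using in_L2_add[of f "\<lambda>x. (-1) *\<^sub>R g x"] in_L2_cmult[of g "-1"] by simp

lemma vcoef_diff:
  assumes "in_L 2 f" "in_L 2 g"
  shows "vcoef (\<lambda>x. f x - g x) k = vcoef f k - vcoef g k"
  using in_L2_component_vec(3)[OF assms(1)] in_L2_component_vec(3)[OF assms(2)]
  by (simp add: vcoef_def vec_eq_iff fcoeff_diff)

lemma vcoef_uminus: "vcoef f (- k) $ i = cnj (vcoef f k $ i)"
  by (simp add: vcoef_def fcoeff_uminus)

lemma Lnorm2_dist:
  assumes "in_L 2 f" "in_L 2 g"
  shows "Lnorm 2 (\<lambda>x. f x - g x) = ennreal (sqrt (\<Sum>\<^sub>\<infinity>k. (norm (vcoef f k - vcoef g k))\<^sup>2))"
  using parseval_vec[OF in_L2_diff[OF assms], THEN infsumI] in_L2_diff[OF assms]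
  by (simp add: Lnorm2_eq in_L2_iff vcoef_diff[OF assms])

lemma Lnorm2_vcoef:
  assumes "in_L 2 f"
  shows "Lnorm 2 f = ennreal (sqrt (\<Sum>\<^sub>\<infinity>k. (norm (vcoef f k))\<^sup>2))"
  using parseval_vec[OF assms, THEN infsumI] assms by (simp add: Lnorm2_eq in_L2_iff)

lemma Lnorm2_sq_vcoef:
  assumes "in_L 2 f"
  shows "Lnorm 2 f ^ 2 = ennreal (\<Sum>\<^sub>\<infinity>k. (norm (vcoef f k))\<^sup>2)"
  unfolding Lnorm2_vcoef[OF assms]
  by (subst ennreal_power) (auto simp: infsum_nonneg)

lemma norm_vcoef_le:
  assumes "in_L 2 f"
  shows "norm (vcoef f k) \<le> sqrt (\<Sum>\<^sub>\<infinity>k. (norm (vcoef f k))\<^sup>2)"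
proof (rule real_le_rsqrt)
  have "(\<lambda>k. (norm (vcoef f k))\<^sup>2) summable_on UNIV"
    using parseval_vec[OF assms] by (auto simp: summable_on_def)
  then have "sum (\<lambda>k. (norm (vcoef f k))\<^sup>2) {k} \<le> (\<Sum>\<^sub>\<infinity>k. (norm (vcoef f k))\<^sup>2)"
    by (intro finite_sum_le_infsum) auto
  then show "(norm (vcoef f k))\<^sup>2 \<le> (\<Sum>\<^sub>\<infinity>k. (norm (vcoef f k))\<^sup>2)" by simp
qed

lemma vcoef_inj:
  assumes f: "in_L 2 f" and g: "in_L 2 g" and eq: "\<And>k. vcoef f k = vcoef g k"
  shows "AE x in torus. f x = g x"
proof -
  have "(\<integral>x. (norm (f x - g x))\<^sup>2 \<partial>torus) = 0"
    using parseval_vec[OF in_L2_diff[OF f g], THEN infsumI] by (simp add: vcoef_diff[OF f g] eq)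
  then have "AE x in torus. (norm (f x - g x))\<^sup>2 = 0"
    using in_L2_diff[OF f g] by (subst (asm) integral_nonneg_eq_0_iff_AE) (auto simp: in_L2_iff)
  then show ?thesis by eventually_elim simp
qed

subsection \<open>Periodic continuous functions and integration by parts\<close>

lemma periodic_lattice:
  assumes "periodic g"
  shows "g (x + lattice_vec k) = g x"
proof -
  have 1: "g (x + axis i (real n)) = g x" for x i n
  proof (induction n)
    case 0
    have "axis i (0::real) = 0" by (simp add: axis_eq_0_iff)
    then show ?case by (simp only: of_nat_0 add_0_right)
  next
    case (Suc n)
    have "axis i (real (Suc n)) = axis i (real n) + axis i (1::real)"
      by (auto simp: vec_eq_iff axis_def)
    then show ?case using assms Suc by (simp add: periodic_def add.assoc[symmetric])
  qed
  have 2: "g (x + axis i (of_int n)) = g x" for x i n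
  proof (cases "n \<ge> 0")
    case True
    then show ?thesis using 1[of x i "nat n"] by simp
  next
    case False
    have "axis i (of_int n) + axis i (real (nat (- n))) = (0 :: real^3)"
      using False by (auto simp: vec_eq_iff axis_def)
    then show ?thesis using 1[of "x + axis i (of_int n)" i "nat (- n)"] by (simp add: add.assoc)
  qed
  have 3: "g (x + (\<Sum>i\<in>A. axis i (of_int (k $ i)))) = g x" if "finite A" for A x
    using that by (induction arbitrary: x) (auto simp: 2 add.assoc[symmetric])
  have "lattice_vec k = (\<Sum>i\<in>UNIV. axis i (of_int (k $ i)))"
    by (auto simp: vec_eq_iff axis_def if_distrib[of "\<lambda>f. f $ _"] sum.delta cong: if_cong)
  then show ?thesis using 3[of UNIV x] by simp
qed

lemma torus_embed_eq:
  assumes "torus_embed x = torus_embed y"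
  obtains k where "x = y + lattice_vec k"
proof -
  have "\<exists>n::int. x $ i = y $ i + of_int n" for i
  proof -
    have "cis (2 * pi * x $ i) = cis (2 * pi * y $ i)"
      using assms by (simp add: torus_embed_def vec_eq_iff)
    then have "sin (2 * pi * x $ i) = sin (2 * pi * y $ i) \<and> cos (2 * pi * x $ i) = cos (2 * pi * y $ i)"
      by (simp add: complex_eq_iff)
    then obtain n :: int where "2 * pi * x $ i = 2 * pi * y $ i + 2 * pi * of_int n"
      unfolding sin_cos_eq_iff by (auto simp: mult_ac)
    then have "2 * pi * x $ i = 2 * pi * (y $ i + of_int n)" by (simp add: distrib_left)
    then show ?thesis by auto
  qed
  then obtain n where "\<And>i. x $ i = y $ i + of_int (n i)" by metis
  then have "x = y + lattice_vec (\<chi> i. n i)" by (simp add: vec_eq_iff)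
  then show thesis by (rule that)
qed

lemma unit_cube_representative:
  obtains k where "x - lattice_vec k \<in> cbox 0 1"
proof
  show "x - lattice_vec (\<chi> i. \<lfloor>x $ i\<rfloor>) \<in> cbox 0 1"
    by (simp add: cube_iff) linarith
qed

text \<open>A continuous map from a compact set to a Hausdorff space is closed, hence a quotient map
  onto its image.\<close>

lemma continuous_on_compact_image_factor:
  fixes \<Phi> :: "'a::t2_space \<Rightarrow> 'b::t2_space"
  assumes "compact K" "continuous_on K \<Phi>" "continuous_on K (\<lambda>x. h (\<Phi> x))"
  shows "continuous_on (\<Phi> ` K) h"
  unfolding continuous_on_closed_invariant
proof (intro allI impI)
  fix B :: "'c set" assume "closed B"
  then obtain A where A: "closed A" "A \<inter> K = (\<lambda>x. h (\<Phi> x)) -` B \<inter> K"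
    using assms(3) unfolding continuous_on_closed_invariant by blast
  have "compact (A \<inter> K)" using A(1) assms(1) by (simp add: closed_Int_compact)
  then have "compact (\<Phi> ` (A \<inter> K))"
    by (intro compact_continuous_image continuous_on_subset[OF assms(2)]) auto
  then have "closed (\<Phi> ` (A \<inter> K))" by (rule compact_imp_closed)
  moreover have "\<Phi> ` (A \<inter> K) \<inter> \<Phi> ` K = h -` B \<inter> \<Phi> ` K" using A(2) by auto
  ultimately show "\<exists>A. closed A \<and> A \<inter> \<Phi> ` K = h -` B \<inter> \<Phi> ` K" by blast
qed

lemma trig_poly_periodic: "trig_poly p \<Longrightarrow> periodic p"
  by (induction rule: trig_poly.induct) (auto simp: periodic_def periodic_fexp)

text \<open>A periodic function depends only on the embedded point, so it does not matter which
  preimage in the cube \<open>?h\<close> picks, and \<open>?h\<close> inherits continuity from the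
  quotient property. Periodicity extends the approximation from the cube to the whole space.\<close>

lemma trig_poly_dense_periodic:
  fixes g :: "real^3 \<Rightarrow> real"
  assumes cont: "continuous_on UNIV g" and per: "periodic g" and "e > 0"
  obtains p where "trig_poly p" "\<And>x. norm (of_real (g x) - p x) < e"
proof -
  let ?K = "cbox 0 1 :: (real^3) set"
  let ?h = "\<lambda>z. g (inv_into ?K torus_embed z)"
  have h: "?h (torus_embed x) = g x" if "x \<in> ?K" for x
  proof -
    have "torus_embed (inv_into ?K torus_embed (torus_embed x)) = torus_embed x"
      using that by (intro f_inv_into_f) auto
    then obtain k where "inv_into ?K torus_embed (torus_embed x) = x + lattice_vec k"
      by (rule torus_embed_eq)
    then show ?thesis using periodic_lattice[OF per] by simp
  qed
  have "continuous_on (torus_embed ` ?K) ?h"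
  proof (rule continuous_on_compact_image_factor)
    have "continuous_on ?K g" using cont continuous_on_subset by blast
    then show "continuous_on ?K (\<lambda>x. ?h (torus_embed x))"
      by (rule continuous_on_eq) (use h in auto)
  qed (auto intro: continuous_torus_embed)
  then obtain p where p: "trig_poly p" "\<And>x. x \<in> ?K \<Longrightarrow> norm (of_real (?h (torus_embed x)) - p x) < e"
    using trig_poly_dense_continuous[OF _ \<open>e > 0\<close>] by blast
  have "norm (of_real (g x) - p x) < e" for x
  proof -
    obtain k where k: "x - lattice_vec k \<in> ?K" by (rule unit_cube_representative)
    have "g x = g (x - lattice_vec k)" "p x = p (x - lattice_vec k)"
      using periodic_lattice[OF per, of "x - lattice_vec k" k]
        periodic_lattice[OF trig_poly_periodic[OF p(1)], of "x - lattice_vec k" k] by simp_all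
    then show ?thesis using p(2)[OF k] h[OF k] by simp
  qed
  then show thesis using that p(1) by blast
qed

lemma integral_torus_translate_trig_poly:
  "trig_poly p \<Longrightarrow> (\<integral>x. p (x + h) \<partial>torus) = (\<integral>x. p x \<partial>torus)"
proof (induction rule: trig_poly.induct)
  case (trig_poly_monom c k)
  have "(\<integral>x. c * fexp k (x + h) \<partial>torus) = c * fexp k h * (\<integral>x. fexp k x \<partial>torus)"
    by (simp add: fexp_add_arg mult_ac)
  then show ?case by (auto simp: integral_fexp)
next
  case (trig_poly_add p q)
  have "integrable torus r" "integrable torus (\<lambda>x. r (x + h))" if "trig_poly r" for r
    by (intro integrable_torus_continuous trig_poly_continuous[OF that]
          continuous_on_compose2[OF trig_poly_continuous[OF that]] continuous_intros; simp)+
  then show ?case using trig_poly_add by simp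
qed

text \<open>For a character both integrals vanish unless the frequency is 0, so translation
  invariance holds for trigonometric polynomials and passes to uniform limits. No cutting and
  rearranging of the cube is involved.\<close>

lemma integral_torus_translate:
  fixes g :: "real^3 \<Rightarrow> real"
  assumes cont: "continuous_on UNIV g" and per: "periodic g"
  shows "(\<integral>x. g (x + h) \<partial>torus) = (\<integral>x. g x \<partial>torus)"
proof (rule ccontr)
  assume "\<not> ?thesis"
  \<comment> \<open>A quarter of the supposed gap: replacing \<open>g\<close> by \<open>p\<close>
    costs it once on each side, which cannot fill the gap.\<close>
  then have e: "\<bar>(\<integral>x. g (x + h) \<partial>torus) - (\<integral>x. g x \<partial>torus)\<bar> / 4 > 0" (is "?e > 0") by simp
  obtain p where p: "trig_poly p" "\<And>x. norm (of_real (g x) - p x) < ?e"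
    using trig_poly_dense_periodic[OF cont per e] by blast
  have [simp]: "integrable torus (\<lambda>x. g (x + a))" "integrable torus (\<lambda>x. p (x + a))" for a
    by (intro integrable_torus_continuous
          continuous_on_compose2[OF cont] continuous_on_compose2[OF trig_poly_continuous[OF p(1)]] continuous_intros; simp)+
  have lt: "norm (of_real (\<integral>x. g (x + a) \<partial>torus) - (\<integral>x. p (x + a) \<partial>torus)) \<le> ?e" for a
  proof -
    have "(of_real (\<integral>x. g (x + a) \<partial>torus) - (\<integral>x. p (x + a) \<partial>torus)) = (\<integral>x. of_real (g (x + a)) - p (x + a) \<partial>torus)"
      by (subst Bochner_Integration.integral_diff) (auto intro: integrable_of_real)
    also have "norm \<dots> \<le> (\<integral>x. norm (of_real (g (x + a)) - p (x + a)) \<partial>torus)"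
      by (rule integral_norm_bound)
    also have "\<dots> \<le> (\<integral>x. ?e \<partial>torus)"
      using p(2) by (intro integral_mono integrable_norm Bochner_Integration.integrable_diff integrable_of_real) (auto intro: less_imp_le)
    finally show ?thesis using torus.prob_space by simp
  qed
  have "\<bar>(\<integral>x. g (x + h) \<partial>torus) - (\<integral>x. g x \<partial>torus)\<bar> = norm (complex_of_real (\<integral>x. g (x + h) \<partial>torus) - of_real (\<integral>x. g x \<partial>torus))"
    by (simp only: of_real_diff[symmetric] norm_of_real)
  also have "\<dots> \<le> norm (of_real (\<integral>x. g (x + h) \<partial>torus) - (\<integral>x. p (x + h) \<partial>torus)) +
      norm (of_real (\<integral>x. g (x + 0) \<partial>torus) - (\<integral>x. p (x + 0) \<partial>torus))"
    using norm_triangle_ineq4[of "of_real (\<integral>x. g (x + h) \<partial>torus) - (\<integral>x. p (x + h) \<partial>torus)"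
        "of_real (\<integral>x. g x \<partial>torus) - (\<integral>x. p x \<partial>torus)"] integral_torus_translate_trig_poly[OF p(1), of h] by simp
  also have "\<dots> \<le> ?e + ?e" by (intro add_mono lt)
  finally show False using e by simp
qed

lemma integral_torus_translate_complex:
  fixes g :: "real^3 \<Rightarrow> complex"
  assumes cont: "continuous_on UNIV g" and per: "periodic g"
  shows "(\<integral>x. g (x + h) \<partial>torus) = (\<integral>x. g x \<partial>torus)"
proof -
  have [simp]: "integrable torus g" "integrable torus (\<lambda>x. g (x + h))"
    by (intro integrable_torus_continuous cont continuous_on_compose2[OF cont] continuous_intros; simp)+
  have "(\<integral>x. Re (g (x + h)) \<partial>torus) = (\<integral>x. Re (g x) \<partial>torus)" "(\<integral>x. Im (g (x + h)) \<partial>torus) = (\<integral>x. Im (g x) \<partial>torus)"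
    using per by (intro integral_torus_translate continuous_intros cont; simp add: periodic_def)+
  then show ?thesis by (auto intro!: complex_eqI)
qed

lemma periodic_continuous_bounded:
  fixes g :: "real^3 \<Rightarrow> 'b::real_normed_vector"
  assumes cont: "continuous_on UNIV g" and per: "periodic g"
  obtains C where "\<And>x. norm (g x) \<le> C"
proof -
  have "compact (g ` cbox 0 1)"
    by (intro compact_continuous_image continuous_on_subset[OF cont]) auto
  then obtain C where C: "\<forall>y\<in>g ` cbox 0 1. norm y \<le> C"
    using compact_imp_bounded bounded_iff by metis
  have "norm (g x) \<le> C" for x
  proof -
    obtain k where k: "x - lattice_vec k \<in> cbox 0 1" by (rule unit_cube_representative)
    then show ?thesis using C periodic_lattice[OF per, of "x - lattice_vec k" k] by auto
  qed
  then show thesis by (rule that)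
qed

lemma periodic_pd:
  fixes g :: "real^3 \<Rightarrow> 'b::real_normed_vector"
  assumes per: "periodic g" and diff: "\<And>x. g differentiable (at x)"
  shows "periodic (pd j g)"
proof -
  have "frechet_derivative g (at (x + axis i 1)) = frechet_derivative g (at x)" for x i
  proof -
    have "((\<lambda>y. y + axis i 1) has_derivative (\<lambda>y. y)) (at x)" by (auto intro!: derivative_eq_intros)
    from has_derivative_compose[OF this frechet_derivative_works[THEN iffD1, OF diff]]
    have "((\<lambda>y. g (y + axis i 1)) has_derivative frechet_derivative g (at (x + axis i 1))) (at x)" .
    moreover have "(\<lambda>y. g (y + axis i 1)) = g" using per by (auto simp: periodic_def)
    ultimately show ?thesis by (simp add: frechet_derivative_at)
  qed
  then show ?thesis by (simp add: periodic_def pd_def)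
qed

text \<open>Translation by \<open>t\<close> along an axis multiplies the coefficient by a character
  of \<open>t\<close>, so the coefficients of the difference quotients are explicit. The mean value
  theorem bounds the quotients by the supremum of the derivative, and dominated convergence passes
  to the limit.\<close>

lemma fcoeff_pd:
  fixes g :: "real^3 \<Rightarrow> real"
  assumes per: "periodic g" and diff: "\<And>x. g differentiable (at x)" and cont: "continuous_on UNIV (pd j g)"
  shows "fcoeff (pd j g) k = 2 * pi * \<i> * of_int (k $ j) * fcoeff g k"
proof -
  let ?h = "\<lambda>n. inverse (real (Suc n))"
  let ?q = "\<lambda>n x. (g (x + axis j (?h n)) - g x) / ?h n"
  have gc: "continuous_on UNIV g"
    using diff by (meson continuous_at_imp_continuous_on differentiable_imp_continuous_within)
  have pper: "periodic (pd j g)" by (rule periodic_pd[OF per diff])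
  obtain C where C: "\<And>x. norm (pd j g x) \<le> C"
    using periodic_continuous_bounded[OF cont pper] by blast
  have axis_scale: "axis j t = t *\<^sub>R axis j (1::real)" for t by (auto simp: vec_eq_iff axis_def)
  have deriv: "((\<lambda>t. g (x + axis j t)) has_real_derivative pd j g (x + axis j t)) (at t)" for x t
  proof -
    let ?D = "frechet_derivative g (at (x + t *\<^sub>R axis j 1))"
    have lin: "((\<lambda>t. x + t *\<^sub>R axis j 1) has_derivative (\<lambda>s. s *\<^sub>R axis j 1)) (at t)"
      by (auto intro!: derivative_eq_intros)
    from has_derivative_compose[OF lin frechet_derivative_works[THEN iffD1, OF diff]]
    have "((\<lambda>t. g (x + t *\<^sub>R axis j 1)) has_derivative (\<lambda>s. ?D (s *\<^sub>R axis j 1))) (at t)" .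
    moreover have "?D (s *\<^sub>R axis j 1) = s * ?D (axis j 1)" for s
      using linear_cmul[OF linear_frechet_derivative[OF diff]] by simp
    ultimately have "((\<lambda>t. g (x + t *\<^sub>R axis j 1)) has_real_derivative ?D (axis j 1)) (at t)"
      by (simp add: has_field_derivative_def mult_commute_abs)
    then show ?thesis
      unfolding pd_def axis_scale[symmetric] .
  qed
  have q_lim: "(\<lambda>n. ?q n x) \<longlonglongrightarrow> pd j g x" for x
  proof -
    have "((\<lambda>t. (g (x + axis j t) - g (x + axis j 0)) / t) \<longlongrightarrow> pd j g (x + axis j 0)) (at 0)"
      using deriv[of x 0] by (simp add: has_field_derivative_iff)
    moreover have "filterlim ?h (at 0) sequentially"
      by (intro filterlim_atI LIMSEQ_inverse_real_of_nat) auto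
    moreover have "axis j (0::real) = 0" by (simp add: axis_eq_0_iff)
    ultimately show ?thesis by (auto dest: filterlim_compose)
  qed
  have q_bd: "\<bar>?q n x\<bar> \<le> C" for n x
  proof -
    have pos: "0 < ?h n" by simp
    obtain z where "g (x + axis j (?h n)) - g (x + axis j 0) = (?h n - 0) * pd j g (x + axis j z)"
      using MVT2[OF pos, of "\<lambda>t. g (x + axis j t)" "\<lambda>t. pd j g (x + axis j t)"] deriv by blast
    moreover have "axis j (0::real) = 0" by (simp add: axis_eq_0_iff)
    ultimately have "?q n x = pd j g (x + axis j z)" by (simp add: field_simps)
    then show ?thesis using C by simp
  qed
  have trans: "fcoeff (\<lambda>x. g (x + axis j t)) k = cis (2 * pi * (of_int (k $ j) * t)) * fcoeff g k" for t
  proof -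
    have "(\<integral>x. (\<lambda>y. of_real (g y) * fexp (- k) y) (x + axis j t) \<partial>torus) = (\<integral>x. of_real (g x) * fexp (- k) x \<partial>torus)"
      by (intro integral_torus_translate_complex continuous_intros gc)
         (use per periodic_fexp in \<open>simp add: periodic_def\<close>)
    then have "cis (- (2 * pi * (of_int (k $ j) * t))) * fcoeff (\<lambda>x. g (x + axis j t)) k = fcoeff g k"
      by (simp add: fcoeff_fexp fexp_add_arg fexp_axis mult_ac integral_mult_right_zero[symmetric] del: integral_mult_right_zero)
    then have "cis (2 * pi * (of_int (k $ j) * t)) * (cis (- (2 * pi * (of_int (k $ j) * t))) * fcoeff (\<lambda>x. g (x + axis j t)) k)
       = cis (2 * pi * (of_int (k $ j) * t)) * fcoeff g k" by simp
    then show ?thesis by (simp add: mult.assoc[symmetric] cis_mult)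
  qed
  have gt: "integrable torus (\<lambda>x. g (x + axis j t))" for t
    by (intro integrable_torus_continuous continuous_on_compose2[OF gc] continuous_intros) auto
  have fq: "fcoeff (?q n) k = (cis (2 * pi * (of_int (k $ j) * ?h n)) - 1) / of_real (?h n) * fcoeff g k" for n
  proof -
    have "fcoeff (\<lambda>x. (1 / ?h n) * (g (x + axis j (?h n)) - g x)) k =
        of_real (1 / ?h n) * (fcoeff (\<lambda>x. g (x + axis j (?h n))) k - fcoeff g k)"
      by (subst fcoeff_cmult, subst fcoeff_diff) (use gt gt[of 0] integrable_torus_continuous[OF gc] in auto)
    then show ?thesis unfolding trans by (simp add: field_simps)
  qed
  have "(\<lambda>n. fcoeff (?q n) k) \<longlonglongrightarrow> fcoeff (pd j g) k"
    unfolding fcoeff_fexp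
  proof (rule integral_dominated_convergence[where w="\<lambda>_. C"])
    have [measurable]: "g \<in> borel_measurable borel" "pd j g \<in> borel_measurable borel"
      using gc cont by (auto intro: borel_measurable_continuous_onI)
    show "(\<lambda>x. complex_of_real (pd j g x) * fexp (- k) x) \<in> borel_measurable torus"
      "(\<lambda>x. complex_of_real (?q n x) * fexp (- k) x) \<in> borel_measurable torus" for n
      by measurable
    show "AE x in torus. (\<lambda>n. complex_of_real (?q n x) * fexp (- k) x) \<longlonglongrightarrow> complex_of_real (pd j g x) * fexp (- k) x"
      by (intro AE_I2 tendsto_intros q_lim)
    show "AE x in torus. norm (complex_of_real (?q n x) * fexp (- k) x) \<le> C" for n
      using q_bd[where n=n] by (intro AE_I2) (simp only: norm_mult norm_fexp norm_of_real mult_1_right)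
  qed simp
  moreover have "(\<lambda>n. fcoeff (?q n) k) \<longlonglongrightarrow> 2 * pi * \<i> * of_int (k $ j) * fcoeff g k"
  proof -
    let ?w = "2 * pi * \<i> * of_int (k $ j)" and ?E = "\<lambda>z. exp (2 * pi * \<i> * of_int (k $ j) * z)"
    have "(?E has_field_derivative ?w) (at 0)"
      by (auto intro!: derivative_eq_intros)
    then have "((\<lambda>z. (?E z - ?E 0) / (z - 0)) \<longlongrightarrow> ?w) (at 0)"
      unfolding has_field_derivative_iff .
    moreover have "filterlim (\<lambda>n. complex_of_real (?h n)) (at 0) sequentially"
      using tendsto_of_real[OF LIMSEQ_inverse_real_of_nat, where 'a=complex]
      by (intro filterlim_atI) (auto simp del: of_real_inverse of_nat_Suc)
    ultimately have "(\<lambda>n. (?E (of_real (?h n)) - ?E 0) / (of_real (?h n) - 0)) \<longlonglongrightarrow> ?w"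
      by (rule filterlim_compose)
    then have lim: "(\<lambda>n. (?E (of_real (?h n)) - ?E 0) / (of_real (?h n) - 0) * fcoeff g k) \<longlonglongrightarrow> ?w * fcoeff g k"
      by (rule tendsto_mult_right)
    have E: "?E (of_real t) = cis (2 * pi * (of_int (k $ j) * t))" for t
      by (simp add: cis_conv_exp mult_ac)
    show ?thesis using lim unfolding fq by (simp only: E mult_zero_right exp_zero diff_zero)
  qed
  ultimately show ?thesis using LIMSEQ_unique by blast
qed

subsection \<open>Sums over the lattice\<close>

abbreviation knorm :: "int^3 \<Rightarrow> real" where
  "knorm k \<equiv> norm (lattice_vec k)"

definition lattice_box :: "int \<Rightarrow> (int^3) set" where
  "lattice_box N = {k. \<forall>i. k $ i \<in> {- N..N}}"

lemma lattice_box_image: "lattice_box N = vec_lambda ` (UNIV \<rightarrow>\<^sub>E {- N..N})"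
proof -
  have "k \<in> vec_lambda ` (UNIV \<rightarrow>\<^sub>E {- N..N})" if "k \<in> lattice_box N" for k
    using that by (intro image_eqI[of _ _ "vec_nth k"]) (auto simp: lattice_box_def)
  then show ?thesis by (auto simp: lattice_box_def PiE_iff)
qed

lemma inj_vec_lambda: "inj_on vec_lambda A"
  by (auto simp: inj_on_def vec_eq_iff)

lemma finite_lattice_box: "finite (lattice_box N)"
  unfolding lattice_box_image by (intro finite_imageI finite_PiE) auto

lemma abs_coord_le_knorm: "\<bar>real_of_int (k $ i)\<bar> \<le> knorm k"
  using component_le_norm_cart[of "lattice_vec k" i] by simp

lemma knorm_ball_subset: "{k. knorm k < r} \<subseteq> lattice_box \<lfloor>r\<rfloor>"
proof -
  have "\<bar>k $ i\<bar> \<le> \<lfloor>r\<rfloor>" if "knorm k < r" for k i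
  proof -
    have "real_of_int \<bar>k $ i\<bar> \<le> r" using abs_coord_le_knorm[of k i] that by simp
    then show ?thesis by (simp add: le_floor_iff)
  qed
  then show ?thesis by (auto simp: lattice_box_def abs_le_iff) (smt (verit))
qed

lemma finite_knorm_ball: "finite {k. knorm k < r}"
  using finite_subset[OF knorm_ball_subset finite_lattice_box] .

lemma card_knorm_ball: "0 \<le> r \<Longrightarrow> real (card {k. knorm k < r}) \<le> (2 * r + 1) ^ 3"
proof -
  assume r: "0 \<le> r"
  have "real (card {k. knorm k < r}) \<le> real (card (lattice_box \<lfloor>r\<rfloor>))"
    using card_mono[OF finite_lattice_box knorm_ball_subset] by simp
  also have "card (lattice_box \<lfloor>r\<rfloor>) = nat (2 * \<lfloor>r\<rfloor> + 1) ^ 3"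
    unfolding lattice_box_image by (subst card_image[OF inj_vec_lambda]) (simp add: card_funcsetE)
  also have "real (nat (2 * \<lfloor>r\<rfloor> + 1) ^ 3) = (2 * of_int \<lfloor>r\<rfloor> + 1) ^ 3"
    using r by (simp add: of_nat_power)
  also have "\<dots> \<le> (2 * r + 1) ^ 3" using r by (intro power_mono) auto
  finally show ?thesis .
qed

text \<open>The exponent 6 allows an inverse square for each of the three coordinates, and the
  square root of the weight is the third-order decay of the Duhamel increments in
  \<open>mild_increment\<close>.\<close>

definition lweight :: "int^3 \<Rightarrow> real" where
  "lweight k = 1 / (1 + knorm k) ^ 6"

lemma lweight_pos: "lweight k > 0"
  unfolding lweight_def by (intro divide_pos_pos zero_less_power) (auto intro: add_pos_nonneg)

text \<open>On a box the sum of products of one-dimensional weights is a product of sums, each at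
  most twice the sum of inverse squares; every finite set of frequencies lies in a box.\<close>

lemma summable_lweight: "lweight summable_on UNIV"
proof (rule nonneg_bdd_above_summable_on)
  define g where "g n = 1 / (1 + \<bar>real_of_int n\<bar>) ^ 2" for n :: int
  define C where "C = (\<Sum>n. 1 / (1 + real n) ^ 2)"
  have sC: "summable (\<lambda>n. 1 / (1 + real n) ^ 2)"
    using inverse_squares_sums by (auto simp: sums_iff add.commute)
  have g_sum: "(\<Sum>n\<in>{-int N..int N}. g n) \<le> 2 * C" for N
  proof -
    have "(\<Sum>n\<in>{-int N..int N}. g n) \<le> (\<Sum>n\<in>{0..int N} \<union> uminus ` {0..int N}. g n)"
    proof (intro sum_mono2)
      show "{- int N..int N} \<subseteq> {0..int N} \<union> uminus ` {0..int N}"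
      proof
        fix n assume "n \<in> {- int N..int N}"
        then show "n \<in> {0..int N} \<union> uminus ` {0..int N}"
          by (cases "n \<ge> 0") (auto intro!: image_eqI[of _ _ "- n"])
      qed
    qed (auto simp: g_def)
    also have "\<dots> \<le> (\<Sum>n\<in>{0..int N}. g n) + (\<Sum>n\<in>uminus ` {0..int N}. g n)"
      by (subst sum_Un) (auto simp: g_def intro!: sum_nonneg)
    also have "(\<Sum>n\<in>uminus ` {0..int N}. g n) = (\<Sum>n\<in>{0..int N}. g n)"
      by (subst sum.reindex) (auto simp: g_def)
    also have "(\<Sum>n\<in>{0..int N}. g n) = (\<Sum>n\<in>int ` {..N}. g n)"
      by (intro sum.cong) (auto simp: image_iff intro!: bexI[of _ "nat _"])
    also have "\<dots> = (\<Sum>n\<le>N. 1 / (1 + real n) ^ 2)"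
      by (subst sum.reindex) (auto simp: g_def)
    also have "\<dots> \<le> C" unfolding C_def by (intro sum_le_suminf sC) auto
    finally show ?thesis by simp
  qed
  have le: "lweight k \<le> (\<Prod>i\<in>UNIV. g (k $ i))" for k
  proof -
    have "(\<Prod>i\<in>(UNIV::3 set). (1 + \<bar>real_of_int (k $ i)\<bar>) ^ 2) \<le> (\<Prod>i\<in>(UNIV::3 set). (1 + knorm k) ^ 2)"
      by (intro prod_mono conjI power_mono add_left_mono abs_coord_le_knorm) auto
    also have "\<dots> = (1 + knorm k) ^ 6" by (simp add: power_mult[symmetric])
    finally have "inverse ((1 + knorm k) ^ 6) \<le> inverse (\<Prod>i\<in>(UNIV::3 set). (1 + \<bar>real_of_int (k $ i)\<bar>) ^ 2)"
      by (intro le_imp_inverse_le prod_pos) (auto intro: add_pos_nonneg)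
    then show ?thesis by (simp add: lweight_def g_def divide_inverse prod_inversef[symmetric])
  qed
  show "bdd_above (sum lweight ` {F. F \<subseteq> UNIV \<and> finite F})"
  proof (intro bdd_aboveI2)
    fix F :: "(int^3) set" assume "F \<in> {F. F \<subseteq> UNIV \<and> finite F}"
    then have F: "finite F" by simp
    obtain R where R: "R > 0" "\<forall>k\<in>F. knorm k < R"
      using finite_imp_bounded[OF finite_imageI[OF F, of lattice_vec]]
      by (metis bounded_pos_less image_eqI)
    define N where "N = nat \<lfloor>R\<rfloor>"
    have "F \<subseteq> lattice_box (int N)"
    proof -
      have "F \<subseteq> lattice_box \<lfloor>R\<rfloor>" using R knorm_ball_subset[of R] by auto
      also have "\<lfloor>R\<rfloor> = int N" using R by (simp add: N_def)
      finally show ?thesis .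
    qed
    then have "sum lweight F \<le> sum lweight (lattice_box (int N))"
      by (intro sum_mono2 finite_lattice_box) (auto intro: less_imp_le lweight_pos)
    also have "\<dots> \<le> (\<Sum>k\<in>lattice_box (int N). \<Prod>i\<in>UNIV. g (k $ i))" by (intro sum_mono le)
    also have "\<dots> = (\<Sum>f\<in>(UNIV::3 set) \<rightarrow>\<^sub>E {- int N..int N}. \<Prod>i\<in>UNIV. g (f i))"
      unfolding lattice_box_image by (subst sum.reindex[OF inj_vec_lambda]) (simp add: o_def)
    also have "\<dots> = (\<Prod>i\<in>(UNIV::3 set). \<Sum>n\<in>{- int N..int N}. g n)"
      by (rule prod_sum_PiE[symmetric]) auto
    also have "\<dots> \<le> (\<Prod>i\<in>(UNIV::3 set). 2 * C)"
      by (intro prod_mono conjI g_sum sum_nonneg) (auto simp: g_def)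
    finally show "sum lweight F \<le> (\<Prod>i\<in>(UNIV::3 set). 2 * C)" .
  qed
qed (auto intro: less_imp_le lweight_pos)

text \<open>A single term of the exponential series already dominates \<open>r ^ (2 * n)\<close>;
  splitting at \<open>r = 1\<close> compares this power with \<open>(1 + r) ^ n\<close>.\<close>

lemma power_exp_square_bounded:
  fixes c :: real
  assumes "c > 0"
  obtains C where "\<And>r. r \<ge> 0 \<Longrightarrow> (1 + r) ^ n * exp (- (c * r\<^sup>2)) \<le> C"
proof
  fix r :: real assume r: "r \<ge> 0"
  have e: "(c * r\<^sup>2) ^ n / fact n \<le> exp (c * r\<^sup>2)"
  proof -
    have "(\<Sum>m\<in>{n}. (c * r\<^sup>2) ^ m /\<^sub>R fact m) \<le> exp (c * r\<^sup>2)"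
      unfolding exp_def using assms by (intro sum_le_suminf summable_exp_generic) auto
    then show ?thesis by (simp add: field_simps)
  qed
  have "(1 + r) ^ n \<le> 2 ^ n * (1 + r ^ (2 * n))"
  proof (cases "r \<le> 1")
    case True
    have "(1 + r) ^ n \<le> 2 ^ n" using True r by (intro power_mono) auto
    also have "\<dots> \<le> 2 ^ n * (1 + r ^ (2 * n))" using r by simp
    finally show ?thesis .
  next
    case False
    then have "(1 + r) ^ n \<le> (2 * r) ^ n" using r by (intro power_mono) auto
    also have "\<dots> = 2 ^ n * r ^ n" by (simp add: power_mult_distrib)
    also have "\<dots> \<le> 2 ^ n * (1 + r ^ (2 * n))"
    proof (rule mult_left_mono)
      have "r ^ n \<le> r ^ (2 * n)" using False by (intro power_increasing) auto
      then show "r ^ n \<le> 1 + r ^ (2 * n)" by simp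
    qed simp
    finally show ?thesis .
  qed
  also have "r ^ (2 * n) \<le> fact n / c ^ n * exp (c * r\<^sup>2)"
  proof -
    have "(r\<^sup>2) ^ n = r ^ (2 * n)" by (simp add: power_mult)
    then show ?thesis using e assms by (simp add: power_mult_distrib field_simps)
  qed
  finally have "(1 + r) ^ n \<le> 2 ^ n * (1 + fact n / c ^ n * exp (c * r\<^sup>2))" by simp
  then have "(1 + r) ^ n * exp (- (c * r\<^sup>2)) \<le> 2 ^ n * (1 + fact n / c ^ n * exp (c * r\<^sup>2)) * exp (- (c * r\<^sup>2))"
    by (intro mult_right_mono) auto
  also have "\<dots> = 2 ^ n * (exp (- (c * r\<^sup>2)) + fact n / c ^ n)"
    by (simp add: exp_minus field_simps)
  also have "\<dots> \<le> 2 ^ n * (1 + fact n / c ^ n)"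
    using assms by (intro mult_left_mono add_right_mono) auto
  finally show "(1 + r) ^ n * exp (- (c * r\<^sup>2)) \<le> 2 ^ n * (1 + fact n / c ^ n)" .
qed

subsection \<open>Integrals with an inverse square root singularity\<close>

lemma has_integral_inverse_sqrt:
  assumes "0 \<le> t"
  shows "((\<lambda>s. K / sqrt s) has_integral (2 * K * sqrt t)) {0..t}"
proof -
  have "((\<lambda>s. K * s powr (-1/2)) has_integral (K * (t powr (-1/2+1) / (-1/2+1)))) {0..t}"
    using assms by (intro has_integral_mult_right has_integral_powr_from_0) auto
  moreover have "K * (t powr (-1/2+1) / (-1/2+1)) = 2 * K * sqrt t"
    using assms by (simp add: powr_half_sqrt)
  moreover have "K * s powr (-1/2) = K / sqrt s" if "s \<in> {0..t}" for s
    using that powr_minus_divide[of s "1/2"] by (simp add: powr_half_sqrt)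
  ultimately show ?thesis using has_integral_eq[of "{0..t}" "\<lambda>s. K * s powr (-1/2)"] by metis
qed

lemma set_integrable_inverse_sqrt: "set_integrable lborel {0..t} (\<lambda>s. K / sqrt s)"
proof -
  have pos: "set_integrable lborel {0..t} (\<lambda>s. 1 / sqrt s)"
  proof (cases "0 \<le> t")
    case True
    have i: "(\<lambda>s. 1 / sqrt s) integrable_on {0..t}"
      using has_integral_inverse_sqrt[OF True, of 1] by (auto simp: integrable_on_def)
    then have "(\<lambda>s. 1 / sqrt s) absolutely_integrable_on {0..t}"
      by (rule nonnegative_absolutely_integrable_1) auto
    then have "integrable lebesgue (\<lambda>s. indicator {0..t} s *\<^sub>R (1 / sqrt s))"
      by (simp add: set_integrable_def)
    then show ?thesis unfolding set_integrable_def by (subst (asm) integrable_completion) auto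
  qed (simp add: set_integrable_def)
  show ?thesis using set_integrable_mult_right[OF _ , of K lborel "{0..t}" "\<lambda>s. 1 / sqrt s"] pos by simp
qed

text \<open>The estimates live on \<open>{0<..t}\<close>, while the weak formulation integrates over
  \<open>{0..t}\<close>; a single instant has measure zero.\<close>

lemma
  fixes f :: "real \<Rightarrow> 'b::euclidean_space"
  assumes f: "set_integrable lborel {0<..t} f"
  shows set_integrable_insert_0: "set_integrable lborel {0..t} f"
    and set_integral_insert_0: "t \<ge> 0 \<Longrightarrow> (LINT s:{0..t}|lborel. f s) = (LINT s:{0<..t}|lborel. f s)"
proof -
  have "(\<lambda>x. indicat_real {0} x *\<^sub>R f x) = (\<lambda>x. indicator {0} x *\<^sub>R f 0)"
    by (auto simp: indicator_def)
  then have 0: "set_integrable lborel {0} f" "(LINT s:{0}|lborel. f s) = 0"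
    by (simp_all add: set_integrable_def set_lebesgue_integral_def)
  have "set_integrable lborel ({0} \<union> {0<..t}) f" using f 0 by (intro set_integrable_Un) auto
  then show "set_integrable lborel {0..t} f" by (rule set_integrable_subset) auto
  assume "t \<ge> 0"
  then have "{0..t} = {0} \<union> {0<..t}" by auto
  then show "(LINT s:{0..t}|lborel. f s) = (LINT s:{0<..t}|lborel. f s)"
    using set_integral_Un[OF _ 0(1) f] 0(2) by simp
qed

lemma set_integrable_singular:
  fixes f :: "real \<Rightarrow> 'b::euclidean_space"
  assumes cont: "continuous_on {0<..t} f" and bd: "\<And>s. s \<in> {0<..t} \<Longrightarrow> norm (f s) \<le> K / sqrt s"
  shows "set_integrable lborel {0..t} f"
proof -
  have bd': "norm (f s) \<le> \<bar>K\<bar> / sqrt s" if "s \<in> {0<..t}" for s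
    using that by (intro order_trans[OF bd[OF that] divide_right_mono[OF abs_ge_self]]) auto
  have "set_integrable lborel {0<..t} f"
  proof -
    have meas: "(\<lambda>s. indicator {0<..t} s *\<^sub>R f s) \<in> borel_measurable lborel"
      using borel_measurable_continuous_on_indicator[OF _ cont] by simp
    have "set_integrable lborel {0<..t} (\<lambda>s. K / sqrt s)"
      by (rule set_integrable_subset[OF set_integrable_inverse_sqrt]) auto
    then show ?thesis unfolding set_integrable_def
      by (rule Bochner_Integration.integrable_bound[OF _ meas]) (use bd' in \<open>auto simp: indicator_def\<close>)
  qed
  then show ?thesis by (rule set_integrable_insert_0)
qed

lemma singular_integrable_on:
  fixes f :: "real \<Rightarrow> 'b::euclidean_space"
  assumes "continuous_on {0<..t} f" and "\<And>s. s \<in> {0<..t} \<Longrightarrow> norm (f s) \<le> K / sqrt s"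
  shows "f integrable_on {0..t}"
  by (rule set_borel_integral_eq_integral(1)[OF set_integrable_singular[OF assms]])

lemma norm_integral_le:
  fixes f :: "real \<Rightarrow> 'b::euclidean_space"
  assumes f: "f integrable_on {0..t}" and g: "(g has_integral G) {0..t}" and "0 \<le> t"
    and le: "\<And>s. s \<in> {0<..t} \<Longrightarrow> norm (f s) \<le> g s"
  shows "norm (integral {0..t} f) \<le> G"
proof -
  \<comment> \<open>The bound may fail at 0, where \<open>K / sqrt 0\<close> is 0 by convention; the
    majorant is redefined there without changing its integral.\<close>
  define g' where "g' s = (if s = 0 then norm (f 0) else g s)" for s
  have "(g' has_integral G) {0..t}"
    by (rule has_integral_spike[OF negligible_sing[of 0] _ g]) (auto simp: g'_def)
  then have "norm (integral {0..t} f) \<le> integral {0..t} g'"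
    using f le by (intro integral_norm_bound_integral) (auto simp: g'_def integrable_on_def)
  then show ?thesis using \<open>(g' has_integral G) {0..t}\<close> by (simp add: integral_unique)
qed

lemma has_integral_exp_sqrt:
  assumes "0 \<le> t" "q > 0"
  shows "((\<lambda>s. exp (q * sqrt s) / sqrt s) has_integral (2 / q * (exp (q * sqrt t) - 1))) {0..t}"
proof -
  have "((\<lambda>s. exp (q * sqrt s) / sqrt s) has_integral (2 / q * exp (q * sqrt t) - 2 / q * exp (q * sqrt 0))) {0..t}"
  proof (rule fundamental_theorem_of_calculus_interior[OF assms(1)])
    fix x assume "x \<in> {0<..<t}"
    then have "((\<lambda>x. 2 / q * exp (q * sqrt x)) has_real_derivative exp (q * sqrt x) / sqrt x) (at x)"
      using assms by (auto intro!: derivative_eq_intros simp: field_simps)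
    then show "((\<lambda>x. 2 / q * exp (q * sqrt x)) has_vector_derivative exp (q * sqrt x) / sqrt x) (at x)"
      by (simp add: has_real_derivative_iff_has_vector_derivative)
  qed (use assms in \<open>auto intro!: continuous_intros\<close>)
  then show ?thesis by (simp add: right_diff_distrib)
qed

subsection \<open>Duhamel's formula for a singular Lipschitz nonlinearity\<close>

text \<open>With the discrete topology on the modes a whole family of paths is one continuous
  function on a product space, so that \<open>mild_exists\<close> can work in the Banach space of
  bounded continuous functions.\<close>

lemma continuous_on_prod_discrete:
  fixes f :: "real \<times> 'a discrete \<Rightarrow> 'b::topological_space"
  assumes "\<And>n. continuous_on UNIV (\<lambda>t. f (t, n))"
  shows "continuous_on UNIV f"
proof -
  have "continuous_on (\<Union>n\<in>UNIV. UNIV \<times> {n}) f"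
  proof (rule continuous_on_open_UN)
    fix n :: "'a discrete"
    show "open (UNIV \<times> {n} :: (real \<times> 'a discrete) set)" by (rule open_Times[OF open_UNIV open_discrete])
    have "continuous_on (UNIV \<times> {n}) (\<lambda>p. f (fst p, n))"
      by (intro continuous_on_compose2[OF assms] continuous_intros) auto
    then show "continuous_on (UNIV \<times> {n}) f"
      by (rule continuous_on_eq) auto
  qed
  moreover have "(\<Union>n\<in>UNIV. UNIV \<times> {n}) = (UNIV :: (real \<times> 'a discrete) set)" by auto
  ultimately show ?thesis by simp
qed

text \<open>Variation of constants for \<open>u' = - \<sigma> u + f\<close> with
  \<open>u 0 = a\<close>. The factor \<open>exp (- (\<sigma> * t))\<close> stands outside, so the
  integrand does not depend on \<open>t\<close> and the fundamental theorem applies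
  directly.\<close>

definition duhamel :: "real \<Rightarrow> 'b \<Rightarrow> (real \<Rightarrow> 'b) \<Rightarrow> real \<Rightarrow> 'b::euclidean_space" where
  "duhamel \<sigma> a f t = exp (- (\<sigma> * t)) *\<^sub>R (a + integral {0..t} (\<lambda>s. exp (\<sigma> * s) *\<^sub>R f s))"

lemma duhamel_weight_bound:
  fixes f :: "real \<Rightarrow> 'b::euclidean_space"
  assumes "\<sigma> \<ge> 0" "0 < s" "s \<le> t" "norm (f s) \<le> K / sqrt s"
  shows "norm (exp (\<sigma> * s) *\<^sub>R f s) \<le> exp (\<sigma> * t) * K / sqrt s"
proof -
  have "norm (exp (\<sigma> * s) *\<^sub>R f s) \<le> exp (\<sigma> * t) * (K / sqrt s)"
    unfolding norm_scaleR using assms by (intro mult_mono) (auto intro!: mult_left_mono)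
  then show ?thesis by simp
qed

lemma duhamel_integrable:
  fixes f :: "real \<Rightarrow> 'b::euclidean_space"
  assumes cont: "continuous_on {0<..t} f" and bd: "\<And>s. s \<in> {0<..t} \<Longrightarrow> norm (f s) \<le> K / sqrt s"
    and "\<sigma> \<ge> 0"
  shows "(\<lambda>s. exp (\<sigma> * s) *\<^sub>R f s) integrable_on {0..t}"
proof (rule singular_integrable_on[where K="exp (\<sigma> * t) * K"])
  show "continuous_on {0<..t} (\<lambda>s. exp (\<sigma> * s) *\<^sub>R f s)" by (intro continuous_intros cont)
  show "norm (exp (\<sigma> * s) *\<^sub>R f s) \<le> exp (\<sigma> * t) * K / sqrt s" if "s \<in> {0<..t}" for s
    using that bd by (intro duhamel_weight_bound \<open>\<sigma> \<ge> 0\<close>) auto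
qed

lemma duhamel_continuous:
  fixes f :: "real \<Rightarrow> 'b::euclidean_space"
  assumes cont: "continuous_on {0<..T} f" and bd: "\<And>s. s \<in> {0<..T} \<Longrightarrow> norm (f s) \<le> K / sqrt s"
    and "\<sigma> \<ge> 0"
  shows "continuous_on {0..T} (duhamel \<sigma> a f)"
  unfolding duhamel_def
  by (intro continuous_intros indefinite_integral_continuous_1 duhamel_integrable[OF cont bd \<open>\<sigma> \<ge> 0\<close>])

lemma duhamel_has_derivative:
  fixes f :: "real \<Rightarrow> 'b::euclidean_space"
  assumes cont: "continuous_on {0<..T} f" and bd: "\<And>s. s \<in> {0<..T} \<Longrightarrow> norm (f s) \<le> K / sqrt s"
    and "\<sigma> \<ge> 0" and t: "t \<in> {0<..T}"
  shows "(duhamel \<sigma> a f has_vector_derivative (- \<sigma> *\<^sub>R duhamel \<sigma> a f t + f t)) (at t within {0<..T})"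
proof -
  have eq: "{0..T} - {0} = {0<..T}" by auto
  have "((\<lambda>u. integral {0..u} (\<lambda>s. exp (\<sigma> * s) *\<^sub>R f s)) has_vector_derivative exp (\<sigma> * t) *\<^sub>R f t) (at t within {0..T} - {0})"
  proof (rule integral_has_vector_derivative_continuous_at)
    show "continuous (at t within {0..T} - {0}) (\<lambda>s. exp (\<sigma> * s) *\<^sub>R f s)"
      unfolding eq using cont t by (intro continuous_intros) (auto simp: continuous_on_eq_continuous_within)
  qed (use t duhamel_integrable[OF cont bd \<open>\<sigma> \<ge> 0\<close>] in auto)
  then have I: "((\<lambda>u. integral {0..u} (\<lambda>s. exp (\<sigma> * s) *\<^sub>R f s)) has_vector_derivative exp (\<sigma> * t) *\<^sub>R f t) (at t within {0<..T})"
    unfolding eq .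
  have E: "((\<lambda>u. exp (- (\<sigma> * u))) has_real_derivative - \<sigma> * exp (- (\<sigma> * t))) (at t within {0<..T})"
    by (auto intro!: derivative_eq_intros)
  have A: "((\<lambda>u. a + integral {0..u} (\<lambda>s. exp (\<sigma> * s) *\<^sub>R f s)) has_vector_derivative exp (\<sigma> * t) *\<^sub>R f t) (at t within {0<..T})"
    using has_vector_derivative_add[OF has_vector_derivative_const I] by simp
  have ee: "exp (- (\<sigma> * t)) * exp (\<sigma> * t) = 1" "exp (\<sigma> * t) * exp (- (\<sigma> * t)) = 1"
    by (simp_all add: exp_minus)
  from has_vector_derivative_scaleR[OF E A] show ?thesis
    unfolding duhamel_def by (simp add: ee algebra_simps)
qed

lemma duhamel_0 [simp]: "duhamel \<sigma> a f 0 = a"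
  by (simp add: duhamel_def)

text \<open>The kernel \<open>exp (- \<sigma> (t - s))\<close> is at most 1, so damping is simply
  discarded and the bound is uniform in \<open>\<sigma>\<close>, that is, in the mode.\<close>

lemma duhamel_diff_bound:
  fixes f g :: "real \<Rightarrow> 'b::euclidean_space"
  assumes f: "continuous_on {0<..t} f" "\<And>s. s \<in> {0<..t} \<Longrightarrow> norm (f s) \<le> K / sqrt s"
    and g: "continuous_on {0<..t} g" "\<And>s. s \<in> {0<..t} \<Longrightarrow> norm (g s) \<le> K / sqrt s"
    and "\<sigma> \<ge> 0" "t \<ge> 0" and h: "(h has_integral H) {0..t}"
    and le: "\<And>s. s \<in> {0<..t} \<Longrightarrow> norm (f s - g s) \<le> h s"
  shows "norm (duhamel \<sigma> a f t - duhamel \<sigma> b g t) \<le> norm (a - b) + H"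
proof -
  note fi = duhamel_integrable[OF f \<open>\<sigma> \<ge> 0\<close>] and gi = duhamel_integrable[OF g \<open>\<sigma> \<ge> 0\<close>]
  have i: "(\<lambda>s. exp (\<sigma> * s) *\<^sub>R (f s - g s)) integrable_on {0..t}"
    unfolding scaleR_diff_right by (intro integrable_diff fi gi)
  have eq: "duhamel \<sigma> a f t - duhamel \<sigma> b g t =
     exp (- (\<sigma> * t)) *\<^sub>R (a - b) + integral {0..t} (\<lambda>s. exp (- (\<sigma> * t)) *\<^sub>R (exp (\<sigma> * s) *\<^sub>R (f s - g s)))"
  proof -
    have "integral {0..t} (\<lambda>s. exp (\<sigma> * s) *\<^sub>R (f s - g s)) =
      integral {0..t} (\<lambda>s. exp (\<sigma> * s) *\<^sub>R f s) - integral {0..t} (\<lambda>s. exp (\<sigma> * s) *\<^sub>R g s)"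
      unfolding scaleR_diff_right by (rule integral_diff[OF fi gi])
    then show ?thesis
      unfolding integral_cmul duhamel_def by (simp add: scaleR_diff_right scaleR_add_right)
  qed
  have i': "(\<lambda>s. exp (- (\<sigma> * t)) *\<^sub>R (exp (\<sigma> * s) *\<^sub>R (f s - g s))) integrable_on {0..t}"
    using i by (rule integrable_cmul)
  have "norm (integral {0..t} (\<lambda>s. exp (- (\<sigma> * t)) *\<^sub>R (exp (\<sigma> * s) *\<^sub>R (f s - g s)))) \<le> H"
  proof (rule norm_integral_le[OF i' h \<open>t \<ge> 0\<close>])
    fix s assume s: "s \<in> {0<..t}"
    have "exp (- (\<sigma> * t)) * exp (\<sigma> * s) \<le> 1"
      using s \<open>\<sigma> \<ge> 0\<close> by (simp add: mult_exp_exp mult_left_mono)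
    then have "exp (- (\<sigma> * t)) * exp (\<sigma> * s) * norm (f s - g s) \<le> 1 * norm (f s - g s)"
      by (intro mult_right_mono) auto
    then show "norm (exp (- (\<sigma> * t)) *\<^sub>R (exp (\<sigma> * s) *\<^sub>R (f s - g s))) \<le> h s"
      using le[OF s] by simp
  qed
  moreover have "norm (exp (- (\<sigma> * t)) *\<^sub>R (a - b)) \<le> norm (a - b)"
    using \<open>\<sigma> \<ge> 0\<close> \<open>t \<ge> 0\<close> by (simp add: mult_left_le_one_le)
  ultimately show ?thesis unfolding eq by (intro norm_triangle_le add_mono)
qed

text \<open>The supremum norm over the modes enters only through common bounds \<open>B\<close> and
  \<open>D\<close>, so families of modes stay plain functions. Time 0 is excluded from the
  estimates, which blow up there.\<close>

locale singular_evolution =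
  fixes T L K :: real and \<sigma> :: "'k \<Rightarrow> real"
    and F :: "real \<Rightarrow> ('k \<Rightarrow> 'b::euclidean_space) \<Rightarrow> 'k \<Rightarrow> 'b"
  assumes T: "T > 0" and L: "L \<ge> 0" and \<sigma>: "\<And>k. \<sigma> k \<ge> 0"
    and lipschitz: "\<And>s u v D k. 0 < s \<Longrightarrow> s \<le> T \<Longrightarrow> (\<And>j. norm (u j - v j) \<le> D) \<Longrightarrow>
      (\<exists>B. \<forall>j. norm (u j) \<le> B) \<Longrightarrow> (\<exists>B. \<forall>j. norm (v j) \<le> B) \<Longrightarrow>
      norm (F s u k - F s v k) \<le> L / sqrt s * D"
    and bound: "\<And>s u k. 0 < s \<Longrightarrow> s \<le> T \<Longrightarrow> (\<exists>B. \<forall>j. norm (u j) \<le> B) \<Longrightarrow> norm (F s u k) \<le> K / sqrt s"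
    and cont: "\<And>u k. (\<And>j. continuous_on {0..T} (\<lambda>s. u s j)) \<Longrightarrow>
      (\<exists>B. \<forall>s\<in>{0..T}. \<forall>j. norm (u s j) \<le> B) \<Longrightarrow> continuous_on {0<..T} (\<lambda>s. F s (u s) k)"
begin

definition mild :: "('k \<Rightarrow> 'b) \<Rightarrow> (real \<Rightarrow> 'k \<Rightarrow> 'b) \<Rightarrow> bool" where
  "mild a u \<longleftrightarrow> (\<forall>k. continuous_on {0..T} (\<lambda>t. u t k)) \<and> (\<exists>B. \<forall>t\<in>{0..T}. \<forall>k. norm (u t k) \<le> B) \<and>
     (\<forall>t\<in>{0..T}. \<forall>k. u t k = duhamel (\<sigma> k) (a k) (\<lambda>s. F s (u s) k) t)"

text \<open>In the supremum norm weighted by \<open>exp (- lam * sqrt t)\<close> the Duhamel map contracts by \<open>1/2\<close>: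
  the weight turns the singular factor \<open>1 / sqrt s\<close> into an exact derivative.\<close>

definition lam :: real where "lam = 4 * L + 1"

lemma lam: "lam > 0" "2 * L / lam \<le> 1 / 2"
  using L by (auto simp: lam_def field_simps)

text \<open>Taking \<open>a = b\<close> gives the contraction, general data give stability:
  \<open>mild_exists\<close> and \<open>mild_stable\<close> share this estimate.\<close>

lemma weighted_bound:
  assumes t: "0 \<le> t" "t \<le> T" and D: "0 \<le> D"
    and u: "\<And>j. continuous_on {0..T} (\<lambda>s. u s j)" "\<And>s j. s \<in> {0..T} \<Longrightarrow> norm (u s j) \<le> B"
    and v: "\<And>j. continuous_on {0..T} (\<lambda>s. v s j)" "\<And>s j. s \<in> {0..T} \<Longrightarrow> norm (v s j) \<le> B'"
    and le: "\<And>s j. s \<in> {0..T} \<Longrightarrow> norm (u s j - v s j) \<le> D * exp (lam * sqrt s)"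
  shows "exp (- (lam * sqrt t)) * norm (duhamel (\<sigma> k) a (\<lambda>s. F s (u s) k) t - duhamel (\<sigma> k) b (\<lambda>s. F s (v s) k) t)
     \<le> norm (a - b) + D / 2"
proof -
  have sub: "{0<..t} \<subseteq> {0<..T}" using t by auto
  have bu: "\<exists>B. \<forall>j. norm (u s j) \<le> B" and bv: "\<exists>B. \<forall>j. norm (v s j) \<le> B" if "s \<in> {0..T}" for s
    using that u(2) v(2) by blast+
  have ub: "\<exists>B. \<forall>s\<in>{0..T}. \<forall>j. norm (u s j) \<le> B" and vb: "\<exists>B. \<forall>s\<in>{0..T}. \<forall>j. norm (v s j) \<le> B"
    using u(2) v(2) by blast+
  have "norm (duhamel (\<sigma> k) a (\<lambda>s. F s (u s) k) t - duhamel (\<sigma> k) b (\<lambda>s. F s (v s) k) t)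
      \<le> norm (a - b) + L * D * (2 / lam * (exp (lam * sqrt t) - 1))"
  proof (rule duhamel_diff_bound[where K=K])
    show "((\<lambda>s. L * D * (exp (lam * sqrt s) / sqrt s)) has_integral L * D * (2 / lam * (exp (lam * sqrt t) - 1))) {0..t}"
      by (intro has_integral_mult_right has_integral_exp_sqrt t lam)
    show "norm (F s (u s) k - F s (v s) k) \<le> L * D * (exp (lam * sqrt s) / sqrt s)" if "s \<in> {0<..t}" for s
      using lipschitz[of s "u s" "v s" "D * exp (lam * sqrt s)" k] le[of s] bu[of s] bv[of s] that t
      by (auto simp: field_simps)
  qed (use t \<sigma> bu bv bound sub in \<open>auto intro: continuous_on_subset[OF cont[OF u(1) ub] sub]
      continuous_on_subset[OF cont[OF v(1) vb] sub]\<close>)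
  also have "\<dots> \<le> norm (a - b) + D / 2 * exp (lam * sqrt t)"
  proof -
    have "L * D * (2 / lam * (exp (lam * sqrt t) - 1)) \<le> (2 * L / lam) * (D * exp (lam * sqrt t))"
      using L D lam(1) by (simp add: field_simps)
    also have "\<dots> \<le> 1 / 2 * (D * exp (lam * sqrt t))" using D by (intro mult_right_mono lam) auto
    finally show ?thesis by simp
  qed
  finally have "exp (- (lam * sqrt t)) * norm (duhamel (\<sigma> k) a (\<lambda>s. F s (u s) k) t - duhamel (\<sigma> k) b (\<lambda>s. F s (v s) k) t)
    \<le> exp (- (lam * sqrt t)) * (norm (a - b) + D / 2 * exp (lam * sqrt t))"
    by (intro mult_left_mono) auto
  also have "\<dots> = exp (- (lam * sqrt t)) * norm (a - b) + D / 2"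
    by (simp add: exp_minus field_simps)
  also have "\<dots> \<le> norm (a - b) + D / 2"
    using lam(1) t by (intro add_right_mono mult_left_le_one_le) auto
  finally show ?thesis .
qed

text \<open>The weighted supremum \<open>D\<close> of the difference is finite, since mild solutions
  are bounded, and satisfies \<open>D \<le> d + D / 2\<close>; finiteness permits absorbing the
  second term.\<close>

lemma mild_stable:
  assumes u: "mild a u" and v: "mild b v" and ab: "\<And>k. norm (a k - b k) \<le> d" and t: "t \<in> {0..T}"
  shows "norm (u t k - v t k) \<le> 2 * exp (lam * sqrt T) * d"
proof -
  let ?S = "(\<lambda>(s, j). exp (- (lam * sqrt s)) * norm (u s j - v s j)) ` ({0..T} \<times> UNIV)"
  obtain B B' where B: "\<And>s j. s \<in> {0..T} \<Longrightarrow> norm (u s j) \<le> B" "\<And>s j. s \<in> {0..T} \<Longrightarrow> norm (v s j) \<le> B'"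
    using u v unfolding mild_def by blast
  have bdd: "bdd_above ?S"
  proof (rule bdd_aboveI2, clarsimp)
    fix s j assume "0 \<le> s" "s \<le> T"
    then have "norm (u s j - v s j) \<le> B + B'"
      using norm_triangle_ineq4[of "u s j" "v s j"] B(1)[of s j] B(2)[of s j] by auto
    moreover have "exp (- (lam * sqrt s)) * norm (u s j - v s j) \<le> norm (u s j - v s j)"
      using lam(1) \<open>0 \<le> s\<close> by (intro mult_left_le_one_le) auto
    ultimately show "exp (- (lam * sqrt s)) * norm (u s j - v s j) \<le> B + B'" by simp
  qed
  define D where "D = Sup ?S"
  have D_ge: "exp (- (lam * sqrt s)) * norm (u s j - v s j) \<le> D" if "s \<in> {0..T}" for s j
    unfolding D_def by (rule cSup_upper[OF _ bdd]) (use that in \<open>auto intro!: image_eqI[of _ _ "(s, j)"]\<close>)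
  have "0 \<le> exp (- (lam * sqrt 0)) * norm (u 0 k - v 0 k)" by simp
  also have "\<dots> \<le> D" using D_ge[of 0 k] T by simp
  finally have D0: "0 \<le> D" .
  have le: "norm (u s j - v s j) \<le> D * exp (lam * sqrt s)" if "s \<in> {0..T}" for s j
    using D_ge[OF that, of j] by (simp add: exp_minus field_simps)
  have half: "exp (- (lam * sqrt s)) * norm (u s j - v s j) \<le> d + D / 2" if s: "s \<in> {0..T}" for s j
  proof -
    have "exp (- (lam * sqrt s)) * norm (u s j - v s j) \<le> norm (a j - b j) + D / 2"
      using weighted_bound[OF _ _ D0 _ B(1) _ B(2) le, where t=s and k=j and a="a j" and b="b j"] u v s
      unfolding mild_def by auto
    then show ?thesis using ab[of j] by simp
  qed
  have "D \<le> d + D / 2" unfolding D_def[symmetric]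
    by (subst D_def, rule cSup_least) (use half T in auto)
  then have "D \<le> 2 * d" by simp
  then have "norm (u t k - v t k) \<le> 2 * d * exp (lam * sqrt t)"
    using le[OF t, of k] by (meson exp_ge_zero mult_right_mono order_trans)
  also have "\<dots> \<le> 2 * d * exp (lam * sqrt T)"
  proof -
    have "0 \<le> d" using ab[of k] norm_ge_zero order_trans by blast
    then show ?thesis using t lam(1) by (intro mult_left_mono) auto
  qed
  finally show ?thesis by (simp add: mult_ac)
qed

lemma mild_unique:
  assumes "mild a u" "mild a v" "t \<in> {0..T}"
  shows "u t k = v t k"
  using mild_stable[OF assms(1,2) _ assms(3), of 0 k] by simp

text \<open>Banach's fixed point theorem for bounded continuous functions of time and mode. The
  exponential weight replaces the usual restriction to a short time interval.\<close>

lemma mild_exists: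
  assumes A: "\<And>k. norm (a k) \<le> A"
  shows "\<exists>u. mild a u"
proof -
  \<comment> \<open>Elements of the function space are defined at all times, so time is clamped to
    \<open>[0, T]\<close>.\<close>
  define cl where "cl t = max 0 (min T t)" for t :: real
  have cl: "cl t \<in> {0..T}" for t using T by (auto simp: cl_def)
  have cl_id: "cl t = t" if "t \<in> {0..T}" for t using that by (auto simp: cl_def)
  have cl_cont: "continuous_on UNIV cl" unfolding cl_def by (intro continuous_intros)
  \<comment> \<open>\<open>y\<close> stores the solution divided by its weight, so that the plain
    supremum norm of \<open>y\<close> is the weighted norm of the solution.\<close>
  define U where "U y t k = exp (lam * sqrt t) *\<^sub>R apply_bcontfun y (t, discrete k)"
    for y :: "(real \<times> 'k discrete) \<Rightarrow>\<^sub>C 'b" and t and k :: 'k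
  define \<Psi> where "\<Psi> y = (\<lambda>(t, n). exp (- (lam * sqrt (cl t))) *\<^sub>R
     duhamel (\<sigma> (of_discrete n)) (a (of_discrete n)) (\<lambda>s. F s (U y s) (of_discrete n)) (cl t))" for y
  have U_cont: "continuous_on {0..T} (\<lambda>t. U y t k)" for y k
    unfolding U_def
    by (intro continuous_intros continuous_on_compose2[OF continuous_on_apply_bcontfun[where T=UNIV]]) auto
  have U_bd: "norm (U y s j) \<le> exp (lam * sqrt T) * norm y" if "s \<in> {0..T}" for y s j
    unfolding U_def norm_scaleR using that lam(1)
    by (intro mult_mono norm_bounded) auto
  have UB: "\<exists>B. \<forall>s\<in>{0..T}. \<forall>j. norm (U y s j) \<le> B" for y using U_bd by blast
  have fcont: "continuous_on {0<..T} (\<lambda>s. F s (U y s) k)" for y k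
    by (rule cont[OF U_cont UB])
  have fbd: "norm (F s (U y s) k) \<le> K / sqrt s" if "s \<in> {0<..T}" for s y k
    using that U_bd[of s y] by (intro bound) auto
  have \<Psi>_bcont: "\<Psi> y \<in> bcontfun" for y
  proof -
    have "continuous_on UNIV (\<Psi> y)"
    proof (rule continuous_on_prod_discrete)
      fix n
      have "continuous_on UNIV (\<lambda>t. duhamel (\<sigma> (of_discrete n)) (a (of_discrete n)) (\<lambda>s. F s (U y s) (of_discrete n)) (cl t))"
        by (rule continuous_on_compose2[OF duhamel_continuous[OF fcont fbd \<sigma>] cl_cont]) (use cl in auto)
      then show "continuous_on UNIV (\<lambda>t. \<Psi> y (t, n))"
        unfolding \<Psi>_def by (auto intro!: continuous_intros cl_cont)
    qed
    moreover have "norm (\<Psi> y p) \<le> A + 2 * K * sqrt T" for p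
    proof -
      obtain t n where p: "p = (t, n)" by force
      let ?k = "of_discrete n :: 'k" and ?t = "cl t"
      have t: "0 \<le> ?t" "?t \<le> T" using cl[of t] by auto
      have sub: "{0<..?t} \<subseteq> {0<..T}" using t by auto
      have "0 \<le> K / sqrt T" using T by (intro order_trans[OF norm_ge_zero fbd[of T y ?k]]) auto
      then have K: "0 \<le> K" using T by (simp add: zero_le_divide_iff)
      have "norm (duhamel (\<sigma> ?k) (a ?k) (\<lambda>s. F s (U y s) ?k) ?t - duhamel (\<sigma> ?k) 0 (\<lambda>s. 0) ?t) \<le> norm (a ?k - 0) + 2 * K * sqrt ?t"
        by (rule duhamel_diff_bound[where K=K and h="\<lambda>s. K / sqrt s"])
           (use fbd t K \<sigma> in \<open>auto intro!: continuous_on_subset[OF fcont sub] has_integral_inverse_sqrt\<close>)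
      also have "\<dots> \<le> A + 2 * K * sqrt T" using A[of ?k] t K by (intro add_mono mult_left_mono) auto
      finally have "norm (duhamel (\<sigma> ?k) (a ?k) (\<lambda>s. F s (U y s) ?k) ?t) \<le> A + 2 * K * sqrt T"
        by (simp add: duhamel_def)
      moreover have "norm (\<Psi> y p) \<le> norm (duhamel (\<sigma> ?k) (a ?k) (\<lambda>s. F s (U y s) ?k) ?t)"
        using lam(1) t by (simp add: p \<Psi>_def mult_left_le_one_le)
      ultimately show ?thesis by simp
    qed
    ultimately show ?thesis by (intro bcontfun_normI)
  qed
  have "\<exists>!y. Bcontfun (\<Psi> y) = y"
  proof (rule banach_fix_type[where c="1/2" and f="\<lambda>y. Bcontfun (\<Psi> y)"], goal_cases)
    case 3
    show ?case
    proof safe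
    fix y z
    show "dist (Bcontfun (\<Psi> y)) (Bcontfun (\<Psi> z)) \<le> 1 / 2 * dist y z"
    proof (rule dist_bound)
      fix p :: "real \<times> 'k discrete"
      obtain t n where p: "p = (t, n)" by force
      let ?k = "of_discrete n :: 'k" and ?t = "cl t"
      have le: "norm (U y s j - U z s j) \<le> dist y z * exp (lam * sqrt s)" if "s \<in> {0..T}" for s j
      proof -
        have "U y s j - U z s j = exp (lam * sqrt s) *\<^sub>R (y (s, discrete j) - z (s, discrete j))"
          by (simp add: U_def scaleR_diff_right)
        then show ?thesis using dist_bounded[of y "(s, discrete j)" z] by (simp add: dist_norm mult.commute)
      qed
      have "norm (\<Psi> y p - \<Psi> z p) = exp (- (lam * sqrt ?t)) * norm (duhamel (\<sigma> ?k) (a ?k) (\<lambda>s. F s (U y s) ?k) ?t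
          - duhamel (\<sigma> ?k) (a ?k) (\<lambda>s. F s (U z s) ?k) ?t)"
        by (simp add: p \<Psi>_def flip: scaleR_diff_right)
      also have "\<dots> \<le> norm (a ?k - a ?k) + dist y z / 2"
        using cl[of t] by (intro weighted_bound[OF _ _ _ U_cont U_bd U_cont U_bd le]) auto
      finally show "dist (apply_bcontfun (Bcontfun (\<Psi> y)) p) (apply_bcontfun (Bcontfun (\<Psi> z)) p) \<le> 1 / 2 * dist y z"
        by (simp add: Bcontfun_inverse \<Psi>_bcont dist_norm)
    qed
    qed
  qed auto
  then obtain y where y: "Bcontfun (\<Psi> y) = y" by blast
  then have y': "apply_bcontfun y = \<Psi> y" by (metis Bcontfun_inverse \<Psi>_bcont)
  have "U y t k = duhamel (\<sigma> k) (a k) (\<lambda>s. F s (U y s) k) t" if "t \<in> {0..T}" for t k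
  proof -
    have "U y t k = exp (lam * sqrt t) *\<^sub>R \<Psi> y (t, discrete k)" by (simp add: U_def y')
    also have "\<dots> = duhamel (\<sigma> k) (a k) (\<lambda>s. F s (U y s) k) t"
      using that by (simp add: \<Psi>_def cl_id exp_minus discrete_inverse)
    finally show ?thesis .
  qed
  then have "mild a (U y)" unfolding mild_def using U_cont UB by blast
  then show ?thesis by blast
qed

lemma mild_forcing:
  assumes u: "mild a u"
  shows "continuous_on {0<..T} (\<lambda>s. F s (u s) k)" "\<And>s. s \<in> {0<..T} \<Longrightarrow> norm (F s (u s) k) \<le> K / sqrt s"
proof -
  show "continuous_on {0<..T} (\<lambda>s. F s (u s) k)"
  proof (rule cont)
    show "continuous_on {0..T} (\<lambda>s. u s j)" for j using u unfolding mild_def by blast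
    show "\<exists>B. \<forall>s\<in>{0..T}. \<forall>j. norm (u s j) \<le> B" using u unfolding mild_def by blast
  qed
  show "norm (F s (u s) k) \<le> K / sqrt s" if "s \<in> {0<..T}" for s
  proof (rule bound)
    obtain B where "\<forall>t\<in>{0..T}. \<forall>k. norm (u t k) \<le> B" using u unfolding mild_def by blast
    then show "\<exists>B. \<forall>j. norm (u s j) \<le> B" using that by (intro exI[of _ B]) auto
  qed (use that in auto)
qed

lemma mild_0: "mild a u \<Longrightarrow> u 0 k = a k"
  using T by (simp add: mild_def)

lemma mild_has_derivative:
  assumes u: "mild a u" and t: "t \<in> {0<..T}"
  shows "((\<lambda>t. u t k) has_vector_derivative (- \<sigma> k *\<^sub>R u t k + F t (u t) k)) (at t within {0<..T})"
proof -
  let ?d = "duhamel (\<sigma> k) (a k) (\<lambda>s. F s (u s) k)"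
  have eq: "?d s = u s k" if "s \<in> {0<..T}" for s using u that by (auto simp: mild_def)
  have "(?d has_vector_derivative (- \<sigma> k *\<^sub>R ?d t + F t (u t) k)) (at t within {0<..T})"
    by (rule duhamel_has_derivative[OF mild_forcing[OF u] \<sigma> t])
  then have "((\<lambda>t. u t k) has_vector_derivative (- \<sigma> k *\<^sub>R ?d t + F t (u t) k)) (at t within {0<..T})"
    by (rule has_vector_derivative_transform[OF t, rotated]) (use eq in auto)
  then show ?thesis using eq[OF t] by simp
qed

text \<open>The integrating factor \<open>exp (\<sigma> k * s)\<close> turns the equation into a
  pure derivative. The interior form of the fundamental theorem also supplies the integrability of
  the weighted forcing.\<close>

lemma mildI:
  assumes cont_u: "\<And>k. continuous_on {0..T} (\<lambda>t. u t k)" and bd: "\<And>t k. t \<in> {0..T} \<Longrightarrow> norm (u t k) \<le> B"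
    and deriv: "\<And>t k. t \<in> {0<..<T} \<Longrightarrow>
      ((\<lambda>t. u t k) has_vector_derivative (- \<sigma> k *\<^sub>R u t k + F t (u t) k)) (at t)"
    and init: "\<And>k. u 0 k = a k"
  shows "mild a u"
  unfolding mild_def
proof (intro conjI ballI allI cont_u)
  show "\<exists>B. \<forall>t\<in>{0..T}. \<forall>k. norm (u t k) \<le> B" using bd by blast
  fix t k assume t: "t \<in> {0..T}"
  have "((\<lambda>s. exp (\<sigma> k * s) *\<^sub>R F s (u s) k) has_integral (exp (\<sigma> k * t) *\<^sub>R u t k - exp (\<sigma> k * 0) *\<^sub>R u 0 k)) {0..t}"
  proof (rule fundamental_theorem_of_calculus_interior)
    show "continuous_on {0..t} (\<lambda>s. exp (\<sigma> k * s) *\<^sub>R u s k)"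
      by (intro continuous_intros continuous_on_subset[OF cont_u]) (use t in auto)
    fix x assume x: "x \<in> {0<..<t}"
    have E: "((\<lambda>s. exp (\<sigma> k * s)) has_real_derivative \<sigma> k * exp (\<sigma> k * x)) (at x)"
      by (auto intro!: derivative_eq_intros)
    have "x \<in> {0<..<T}" using x t by auto
    from has_vector_derivative_scaleR[OF E deriv[OF this, of k]]
    show "((\<lambda>s. exp (\<sigma> k * s) *\<^sub>R u s k) has_vector_derivative exp (\<sigma> k * x) *\<^sub>R F x (u x) k) (at x)"
      by (simp add: algebra_simps)
  qed (use t in auto)
  then have "integral {0..t} (\<lambda>s. exp (\<sigma> k * s) *\<^sub>R F s (u s) k) = exp (\<sigma> k * t) *\<^sub>R u t k - a k"
    by (simp add: integral_unique init)
  then show "u t k = duhamel (\<sigma> k) (a k) (\<lambda>s. F s (u s) k) t"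
    by (simp add: duhamel_def exp_minus)
qed

end

subsection \<open>Calculus of iterated differentiability\<close>

lemma Ck_on_cong:
  assumes "Ck_on n S f" "\<And>x. x \<in> S \<Longrightarrow> f x = g x"
  shows "Ck_on n S g"
proof (cases n)
  case 0
  then show ?thesis using assms continuous_on_cong[of S S f g] by simp
next
  case (Suc m)
  then obtain f' where "\<forall>x\<in>S. (f has_derivative f' x) (at x within S)" "\<forall>v. Ck_on m S (\<lambda>x. f' x v)"
    using assms(1) by auto
  then show ?thesis using Suc assms(2) has_derivative_transform[of _ S g f]
    by (auto intro!: exI[of _ f'])
qed

lemma Ck_on_imp_continuous: "Ck_on n S f \<Longrightarrow> continuous_on S f"
  by (cases n) (auto intro: has_derivative_continuous_on)

lemma Ck_on_SucD: "Ck_on (Suc n) S f \<Longrightarrow> Ck_on n S f"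
proof (induction n arbitrary: f)
  case 0
  then show ?case using Ck_on_imp_continuous by (metis Ck_on.simps(1))
next
  case (Suc n)
  obtain f' where f': "\<forall>x\<in>S. (f has_derivative f' x) (at x within S)" "\<forall>v. Ck_on (Suc n) S (\<lambda>x. f' x v)"
    using Suc.prems unfolding Ck_on.simps(2)[of "Suc n"] by blast
  show ?case unfolding Ck_on.simps(2)[of n]
    using f' Suc.IH by blast
qed

lemma Ck_on_subset:
  assumes "Ck_on n S f" "S' \<subseteq> S"
  shows "Ck_on n S' f"
  using assms(1)
proof (induction n arbitrary: f)
  case 0
  then show ?case using assms(2) continuous_on_subset by auto
next
  case (Suc n)
  then obtain f' where f': "\<forall>x\<in>S. (f has_derivative f' x) (at x within S)" "\<forall>v. Ck_on n S (\<lambda>x. f' x v)"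
    by auto
  then show ?case using Suc.IH assms(2) has_derivative_subset
    by (auto intro!: exI[of _ f']) blast
qed

lemma Ck_on_const: "Ck_on n S (\<lambda>x. c)"
  by (induction n arbitrary: c) (auto intro!: exI[of _ "\<lambda>_ _. 0"])

lemma Ck_on_add: "Ck_on n S f \<Longrightarrow> Ck_on n S g \<Longrightarrow> Ck_on n S (\<lambda>x. f x + g x)"
proof (induction n arbitrary: f g)
  case 0
  then show ?case by (auto intro: continuous_on_add)
next
  case (Suc n)
  then obtain f' g' where f': "\<forall>x\<in>S. (f has_derivative f' x) (at x within S)" "\<forall>v. Ck_on n S (\<lambda>x. f' x v)"
    and g': "\<forall>x\<in>S. (g has_derivative g' x) (at x within S)" "\<forall>v. Ck_on n S (\<lambda>x. g' x v)"
    by auto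
  then show ?case using Suc.IH
    by (auto intro!: exI[of _ "\<lambda>x h. f' x h + g' x h"] has_derivative_add)
qed

lemma Ck_on_sum: "(\<And>i. i \<in> I \<Longrightarrow> Ck_on n S (f i)) \<Longrightarrow> Ck_on n S (\<lambda>x. \<Sum>i\<in>I. f i x)"
  by (induction I rule: infinite_finite_induct) (auto intro: Ck_on_add Ck_on_const)

lemma Ck_on_bounded_linear: "bounded_linear h \<Longrightarrow> Ck_on n S f \<Longrightarrow> Ck_on n S (\<lambda>x. h (f x))"
proof (induction n arbitrary: f)
  case 0
  then show ?case by (auto intro: bounded_linear.continuous_on)
next
  case (Suc n)
  then obtain f' where f': "\<forall>x\<in>S. (f has_derivative f' x) (at x within S)" "\<forall>v. Ck_on n S (\<lambda>x. f' x v)"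
    by auto
  show ?case unfolding Ck_on.simps
    by (intro exI[of _ "\<lambda>x v. h (f' x v)"] conjI ballI allI Suc.IH[OF Suc.prems(1)]
          bounded_linear.has_derivative[OF Suc.prems(1)]) (use f' in auto)
qed

lemma Ck_on_bilinear:
  assumes "bounded_bilinear pr"
  shows "Ck_on n S f \<Longrightarrow> Ck_on n S g \<Longrightarrow> Ck_on n S (\<lambda>x. pr (f x) (g x))"
proof (induction n arbitrary: f g)
  case 0
  then show ?case by (auto intro: bounded_bilinear.continuous_on[OF assms])
next
  case (Suc n)
  then obtain f' g' where f': "\<forall>x\<in>S. (f has_derivative f' x) (at x within S)" "\<forall>v. Ck_on n S (\<lambda>x. f' x v)"
    and g': "\<forall>x\<in>S. (g has_derivative g' x) (at x within S)" "\<forall>v. Ck_on n S (\<lambda>x. g' x v)"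
    by auto
  have fg: "Ck_on n S f" "Ck_on n S g" using Suc.prems by (auto intro: Ck_on_SucD simp del: Ck_on.simps)
  show ?case unfolding Ck_on.simps
  proof (intro exI[of _ "\<lambda>x h. pr (f x) (g' x h) + pr (f' x h) (g x)"] conjI ballI allI)
    show "((\<lambda>x. pr (f x) (g x)) has_derivative (\<lambda>h. pr (f x) (g' x h) + pr (f' x h) (g x))) (at x within S)" if "x \<in> S" for x
      using f'(1) g'(1) that by (intro bounded_bilinear.FDERIV[OF assms]) auto
    show "Ck_on n S (\<lambda>x. pr (f x) (g' x v) + pr (f' x v) (g x))" for v
      using f'(2) g'(2) fg by (intro Ck_on_add Suc.IH) auto
  qed
qed

lemmas Ck_on_mult = Ck_on_bilinear[OF bounded_bilinear_mult]
lemmas Ck_on_scaleR = Ck_on_bilinear[OF bounded_bilinear_scaleR]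

lemma Ck_on_inverse:
  fixes f :: "'a::euclidean_space \<Rightarrow> real"
  assumes nz: "\<And>x. x \<in> S \<Longrightarrow> f x \<noteq> 0"
  shows "Ck_on n S f \<Longrightarrow> Ck_on n S (\<lambda>x. inverse (f x))"
proof (induction n)
  case 0
  then show ?case using nz by (auto intro: continuous_on_inverse)
next
  case (Suc n)
  then obtain f' where f': "\<forall>x\<in>S. (f has_derivative f' x) (at x within S)" "\<forall>v. Ck_on n S (\<lambda>x. f' x v)"
    by auto
  have IH: "Ck_on n S (\<lambda>x. inverse (f x))" by (rule Suc.IH[OF Ck_on_SucD[OF Suc.prems]])
  show ?case unfolding Ck_on.simps
  proof (intro exI[of _ "\<lambda>x h. - (inverse (f x) * f' x h * inverse (f x))"] conjI ballI allI)
    show "((\<lambda>x. inverse (f x)) has_derivative (\<lambda>h. - (inverse (f x) * f' x h * inverse (f x)))) (at x within S)" if "x \<in> S" for x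
      using f'(1) nz that by (intro Deriv.has_derivative_inverse) auto
    show "Ck_on n S (\<lambda>x. - (inverse (f x) * f' x v * inverse (f x)))" for v
      using f'(2) IH by (intro Ck_on_bounded_linear[OF bounded_linear_minus[OF bounded_linear_ident]] Ck_on_mult) auto
  qed
qed

text \<open>In the chain rule \<open>g'\<close> is applied to \<open>f' x h\<close>, a direction
  that varies with \<open>x\<close>, whereas \<open>Ck_on\<close> speaks about fixed directions;
  expanding in \<open>Basis\<close> separates the two dependences.\<close>

lemma Ck_on_compose:
  fixes g :: "'b::euclidean_space \<Rightarrow> 'c::real_normed_vector" and f :: "'a::euclidean_space \<Rightarrow> 'b"
  shows "Ck_on n S f \<Longrightarrow> Ck_on n UNIV g \<Longrightarrow> Ck_on n S (\<lambda>x. g (f x))"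
proof (induction n arbitrary: g)
  case 0
  then show ?case by (auto intro: continuous_on_compose2)
next
  case (Suc n)
  obtain f' where f': "\<forall>x\<in>S. (f has_derivative f' x) (at x within S)" "\<forall>v. Ck_on n S (\<lambda>x. f' x v)"
    using Suc.prems(1) by auto
  obtain g' where g': "\<forall>x. (g has_derivative g' x) (at x)" "\<forall>v. Ck_on n UNIV (\<lambda>x. g' x v)"
    using Suc.prems(2) by auto
  have f: "Ck_on n S f" by (rule Ck_on_SucD[OF Suc.prems(1)])
  show ?case unfolding Ck_on.simps
  proof (intro exI[of _ "\<lambda>x h. \<Sum>b\<in>Basis. (f' x h \<bullet> b) *\<^sub>R g' (f x) b"] conjI ballI allI)
    fix x assume x: "x \<in> S"
    interpret gl: bounded_linear "g' (f x)" using g'(1) has_derivative_bounded_linear by blast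
    have rep: "g' (f x) y = (\<Sum>b\<in>Basis. (y \<bullet> b) *\<^sub>R g' (f x) b)" for y
    proof -
      have "g' (f x) (\<Sum>b\<in>Basis. (y \<bullet> b) *\<^sub>R b) = (\<Sum>b\<in>Basis. (y \<bullet> b) *\<^sub>R g' (f x) b)"
        by (simp add: gl.sum gl.scaleR)
      then show ?thesis by (simp add: euclidean_representation)
    qed
    have eq: "(\<lambda>h. \<Sum>b\<in>Basis. (f' x h \<bullet> b) *\<^sub>R g' (f x) b) = (\<lambda>h. g' (f x) (f' x h))"
      by (rule ext) (rule rep[symmetric])
    have "((\<lambda>x. g (f x)) has_derivative (\<lambda>h. g' (f x) (f' x h))) (at x within S)"
      by (rule has_derivative_compose[OF f'(1)[rule_format, OF x] g'(1)[rule_format]])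
    then show "((\<lambda>x. g (f x)) has_derivative (\<lambda>h. \<Sum>b\<in>Basis. (f' x h \<bullet> b) *\<^sub>R g' (f x) b)) (at x within S)"
      unfolding eq .
  next
    fix v
    show "Ck_on n S (\<lambda>x. \<Sum>b\<in>Basis. (f' x v \<bullet> b) *\<^sub>R g' (f x) b)"
      using f'(2) g'(2)
      by (intro Ck_on_sum Ck_on_scaleR Ck_on_bounded_linear[OF bounded_linear_inner_left] Suc.IH f) auto
  qed
qed

lemma Ck_on_vecI:
  fixes f :: "'a::euclidean_space \<Rightarrow> 'b::euclidean_space^'n"
  assumes "\<And>i. Ck_on n S (\<lambda>x. f x $ i)"
  shows "Ck_on n S f"
proof -
  have ax: "bounded_linear (\<lambda>y::'b. axis i y :: 'b^'n)" for i
    by (rule linear_conv_bounded_linear[THEN iffD1]) (rule linearI; simp add: vec_eq_iff axis_def)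
  have eq: "(\<Sum>i\<in>UNIV. axis i (f x $ i)) = f x" for x
    by (simp add: vec_eq_iff axis_def if_distrib[of "\<lambda>f. f $ _"] sum.delta' cong: if_cong)
  have "Ck_on n S (\<lambda>x. \<Sum>i\<in>UNIV. axis i (f x $ i) :: 'b^'n)"
    by (intro Ck_on_sum Ck_on_bounded_linear[OF ax] assms)
  then show ?thesis by (simp only: eq)
qed

lemma Ck_on_vec_nth: "Ck_on n S f \<Longrightarrow> Ck_on n S (\<lambda>x. f x $ i)"
  by (rule Ck_on_bounded_linear[OF bounded_linear_vec_nth])

lemma Ck_on_Suc_realI:
  fixes f :: "real \<Rightarrow> 'b::real_normed_vector"
  assumes "\<And>t. t \<in> S \<Longrightarrow> (f has_vector_derivative f' t) (at t within S)" "Ck_on n S f'"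
  shows "Ck_on (Suc n) S f"
  unfolding Ck_on.simps
proof (intro exI[of _ "\<lambda>t h. h *\<^sub>R f' t"] conjI ballI allI)
  show "Ck_on n S (\<lambda>t. h *\<^sub>R f' t)" for h
    by (rule Ck_on_bounded_linear[OF bounded_linear_scaleR_right assms(2)])
qed (use assms(1) in \<open>auto simp: has_vector_derivative_def\<close>)

lemma at_within_Ioc_not_bot: "t \<in> {a<..b} \<Longrightarrow> at t within {a<..b} \<noteq> (bot :: real filter)"
  by (auto simp: trivial_limit_within islimpt_Ioc)

text \<open>On a half-open interval derivatives within the set are unique, so the derivative that
  \<open>Ck_on\<close> merely asserts to exist is \<open>vector_derivative\<close>, a canonical
  choice that can be iterated.\<close>

lemma Ck_on_Suc_realD:
  fixes f :: "real \<Rightarrow> 'b::real_normed_vector"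
  assumes "Ck_on (Suc n) {a<..b} f"
  shows "\<And>t. t \<in> {a<..b} \<Longrightarrow> (f has_vector_derivative vector_derivative f (at t within {a<..b})) (at t within {a<..b})"
    and "Ck_on n {a<..b} (\<lambda>t. vector_derivative f (at t within {a<..b}))"
proof -
  let ?S = "{a<..b}"
  obtain f' where f': "\<And>x. x \<in> ?S \<Longrightarrow> (f has_derivative f' x) (at x within ?S)" "\<And>v. Ck_on n ?S (\<lambda>x. f' x v)"
    using assms unfolding Ck_on.simps by blast
  have vd: "(f has_vector_derivative f' t 1) (at t within ?S)" if "t \<in> ?S" for t
  proof -
    interpret bounded_linear "f' t" using f'(1)[OF that] has_derivative_bounded_linear by blast
    have eq: "(\<lambda>h. h *\<^sub>R f' t 1) = f' t" 
    proof
      fix h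
      have "f' t (h *\<^sub>R 1) = h *\<^sub>R f' t 1" by (rule scaleR)
      then show "h *\<^sub>R f' t 1 = f' t h" by simp
    qed
    show ?thesis unfolding has_vector_derivative_def eq by (rule f'(1)[OF that])
  qed
  have eq: "vector_derivative f (at t within ?S) = f' t 1" if "t \<in> ?S" for t
    by (rule vector_derivative_within[OF at_within_Ioc_not_bot[OF that] vd[OF that]])
  show "(f has_vector_derivative vector_derivative f (at t within ?S)) (at t within ?S)" if "t \<in> ?S" for t
    using vd[OF that] eq[OF that] by simp
  show "Ck_on n ?S (\<lambda>t. vector_derivative f (at t within ?S))"
    by (rule Ck_on_cong[OF f'(2)[of 1]]) (use eq in auto)
qed

lemma at_within_Ioc_left:
  fixes t :: real
  assumes "a \<le> c" "c < t"
  shows "at t within {a<..b} = at t within {c<..b}"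
  by (rule at_within_nhd[of t "{c<..}"]) (use assms in auto)

text \<open>Reduces regularity on \<open>{0<..T}\<close> to the intervals \<open>{c<..T}\<close>, on
  which all active modes belong to one finite set \<open>low c\<close>.\<close>

lemma Ck_on_Ioc_local:
  fixes f :: "real \<Rightarrow> 'b::real_normed_vector"
  assumes "\<And>c. a < c \<Longrightarrow> c < b \<Longrightarrow> Ck_on n {c<..b} f"
  shows "Ck_on n {a<..b} f"
  using assms
proof (induction n arbitrary: f)
  case 0
  show ?case unfolding Ck_on.simps continuous_on_eq_continuous_within
  proof
    fix t assume t: "t \<in> {a<..b}"
    have "continuous_on {(a + t) / 2<..b} f" using 0[of "(a + t) / 2"] t by simp
    then have "continuous (at t within {(a + t) / 2<..b}) f"
      using t by (auto simp: continuous_on_eq_continuous_within)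
    then show "continuous (at t within {a<..b}) f"
      using at_within_Ioc_left[of a "(a + t) / 2" t b] t by (simp add: continuous_within)
  qed
next
  case (Suc n)
  have eq: "vector_derivative f (at t within {a<..b}) = vector_derivative f (at t within {c<..b})"
    if "a < c" "c < t" for c t
    using at_within_Ioc_left[of a c t b] that by simp
  show ?case
  proof (rule Ck_on_Suc_realI)
    show "(f has_vector_derivative vector_derivative f (at t within {a<..b})) (at t within {a<..b})" if t: "t \<in> {a<..b}" for t
    proof -
      let ?c = "(a + t) / 2"
      have c: "a < ?c" "?c < t" "?c < b" using t by auto
      show ?thesis
        using Ck_on_Suc_realD(1)[OF Suc.prems[OF c(1,3)], of t] t c at_within_Ioc_left[of a ?c t b] by simp
    qed
    show "Ck_on n {a<..b} (\<lambda>t. vector_derivative f (at t within {a<..b}))"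
    proof (rule Suc.IH)
      fix c assume c: "a < c" "c < b"
      show "Ck_on n {c<..b} (\<lambda>t. vector_derivative f (at t within {a<..b}))"
        by (rule Ck_on_cong[OF Ck_on_Suc_realD(2)[OF Suc.prems[OF c]]]) (use c eq in auto)
    qed
  qed
qed

lemma smooth_on_iterates:
  fixes f :: "real \<Rightarrow> 'b::real_normed_vector"
  assumes "smooth_on {a<..b} f"
  obtains D where "D 0 = f" "\<And>n. continuous_on {a<..b} (D n)"
    "\<And>n t. t \<in> {a<..b} \<Longrightarrow> (D n has_vector_derivative D (Suc n) t) (at t within {a<..b})"
proof -
  define D where "D = rec_nat f (\<lambda>_ g t. vector_derivative g (at t within {a<..b}))"
  have smooth: "smooth_on {a<..b} (D n)" for n
  proof (induction n)
    case (Suc n)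
    then show ?case
      using Ck_on_Suc_realD(2)[of _ a b "D n"] unfolding smooth_on_def by (simp add: D_def del: Ck_on.simps)
  qed (use assms in \<open>simp add: D_def\<close>)
  show thesis
  proof
    show "continuous_on {a<..b} (D n)" for n
      using smooth[of n] Ck_on.simps(1) unfolding smooth_on_def by blast
    show "(D n has_vector_derivative D (Suc n) t) (at t within {a<..b})" if "t \<in> {a<..b}" for n t
      using Ck_on_Suc_realD(1)[of 0 a b "D n" t] smooth[of n] that
      unfolding smooth_on_def by (simp add: D_def del: Ck_on.simps)
  qed (simp add: D_def)
qed

subsection \<open>Smoothness of Fourier series\<close>

text \<open>Decay faster than every power, uniform on \<open>[t0, T]\<close> but with no control as
  \<open>t0\<close> tends to 0, where the datum is only square integrable.\<close>

definition rapid :: "real \<Rightarrow> (real \<Rightarrow> int^3 \<Rightarrow> complex) \<Rightarrow> bool" where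
  "rapid T c \<longleftrightarrow> (\<forall>m t0. 0 < t0 \<longrightarrow> (\<exists>C. \<forall>t\<in>{t0..T}. \<forall>k. norm (c t k) * (1 + knorm k) ^ m \<le> C))"

text \<open>The time derivatives are part of the structure, so that each of them can be required to
  decay rapidly; spatial derivatives then cost only powers of the frequency.\<close>

definition smooth_coef :: "real \<Rightarrow> (real \<Rightarrow> int^3 \<Rightarrow> complex) \<Rightarrow> bool" where
  "smooth_coef T c \<longleftrightarrow> (\<exists>D. D 0 = c \<and> (\<forall>n. rapid T (D n)) \<and>
     (\<forall>n k. \<forall>t\<in>{0<..T}. ((\<lambda>t. D n t k) has_vector_derivative D (Suc n) t k) (at t within {0<..T})))"

lemma rapid_bound:
  assumes "rapid T c" "0 < t0"
  obtains C where "C \<ge> 0" "\<And>t k. t \<in> {t0..T} \<Longrightarrow> norm (c t k) \<le> C * lweight k"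
proof -
  obtain C where C: "\<And>t k. t \<in> {t0..T} \<Longrightarrow> norm (c t k) * (1 + knorm k) ^ 6 \<le> C"
    using assms unfolding rapid_def by meson
  have "norm (c t k) \<le> max 0 C * lweight k" if "t \<in> {t0..T}" for t k
  proof -
    have p: "(1 + knorm k) ^ 6 > 0" by (intro zero_less_power) (auto intro: add_pos_nonneg)
    have "norm (c t k) \<le> C / (1 + knorm k) ^ 6"
      using C[OF that, of k] p by (simp add: field_simps)
    also have "\<dots> \<le> max 0 C / (1 + knorm k) ^ 6" using p by (intro divide_right_mono) auto
    finally show ?thesis by (simp add: lweight_def)
  qed
  then show thesis by (intro that[of "max 0 C"]) auto
qed

lemma rapid_add:
  assumes "rapid T c" "rapid T d"
  shows "rapid T (\<lambda>t k. c t k + d t k)"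
  unfolding rapid_def
proof (intro allI impI)
  fix m and t0 :: real assume t0: "0 < t0"
  obtain C D where C: "\<And>t k. t \<in> {t0..T} \<Longrightarrow> norm (c t k) * (1 + knorm k) ^ m \<le> C"
    and D: "\<And>t k. t \<in> {t0..T} \<Longrightarrow> norm (d t k) * (1 + knorm k) ^ m \<le> D"
    using assms t0 unfolding rapid_def by meson
  have "norm (c t k + d t k) * (1 + knorm k) ^ m \<le> C + D" if t: "t \<in> {t0..T}" for t k
  proof -
    have "norm (c t k + d t k) * (1 + knorm k) ^ m \<le> (norm (c t k) + norm (d t k)) * (1 + knorm k) ^ m"
      by (intro mult_right_mono norm_triangle_ineq) auto
    also have "\<dots> \<le> C + D" using C[OF t, of k] D[OF t, of k] by (simp add: distrib_right)
    finally show ?thesis .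
  qed
  then show "\<exists>C. \<forall>t\<in>{t0..T}. \<forall>k. norm (c t k + d t k) * (1 + knorm k) ^ m \<le> C" by blast
qed

lemma rapid_mult:
  assumes c: "rapid T c" and g: "\<And>k. norm (g k) \<le> B * (1 + knorm k) ^ p"
  shows "rapid T (\<lambda>t k. g k * c t k)"
  unfolding rapid_def
proof (intro allI impI)
  fix m and t0 :: real assume t0: "0 < t0"
  obtain C where C: "\<And>t k. t \<in> {t0..T} \<Longrightarrow> norm (c t k) * (1 + knorm k) ^ (m + p) \<le> C"
    using c t0 unfolding rapid_def by meson
  have "0 \<le> B" using order_trans[OF norm_ge_zero g[of 0]] by simp
  have "norm (g k * c t k) * (1 + knorm k) ^ m \<le> B * C" if t: "t \<in> {t0..T}" for t k
  proof -
    have "norm (g k * c t k) * (1 + knorm k) ^ m = norm (g k) * (norm (c t k) * (1 + knorm k) ^ m)"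
      by (simp add: norm_mult)
    also have "\<dots> \<le> (B * (1 + knorm k) ^ p) * (norm (c t k) * (1 + knorm k) ^ m)"
      by (intro mult_right_mono g) auto
    also have "\<dots> = B * (norm (c t k) * (1 + knorm k) ^ (m + p))" by (simp add: power_add)
    also have "\<dots> \<le> B * C" using C[OF t, of k] \<open>0 \<le> B\<close> by (intro mult_left_mono) auto
    finally show ?thesis .
  qed
  then show "\<exists>C. \<forall>t\<in>{t0..T}. \<forall>k. norm (g k * c t k) * (1 + knorm k) ^ m \<le> C" by blast
qed

lemma fexp_has_derivative:
  "(fexp k has_derivative (\<lambda>v. (2 * pi * \<i> * of_real (lattice_vec k \<bullet> v)) * fexp k x)) (at x within S)"
  unfolding fexp_def
  by (auto intro!: derivative_eq_intros simp: fun_eq_iff scaleR_conv_of_real)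

lemma norm_lattice_inner_le: "norm (2 * pi * \<i> * of_real (lattice_vec k \<bullet> v)) \<le> (2 * pi * norm v) * (1 + knorm k)"
proof -
  have "\<bar>lattice_vec k \<bullet> v\<bar> \<le> (1 + knorm k) * norm v"
    using Cauchy_Schwarz_ineq2[of "lattice_vec k" v] by (simp add: distrib_right add_increasing)
  then have "2 * pi * \<bar>lattice_vec k \<bullet> v\<bar> \<le> 2 * pi * ((1 + knorm k) * norm v)"
    by (intro mult_left_mono) auto
  then show ?thesis by (simp add: norm_mult abs_mult mult_ac)
qed

lemma rapid_lattice_inner: "rapid T c \<Longrightarrow> rapid T (\<lambda>t k. (2 * pi * \<i> * of_real (lattice_vec k \<bullet> v)) * c t k)"
  by (rule rapid_mult[where p=1 and B="2 * pi * norm v"])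
     (use norm_lattice_inner_le in \<open>simp_all only: power_one_right\<close>)

text \<open>These are the coefficients of the derivative of the series in the direction
  \<open>(\<tau>, v)\<close>. They are of the same kind again, which closes the induction in
  \<open>fourier_series_smooth\<close>.\<close>

lemma smooth_coef_derivative:
  assumes D0: "D 0 = c" and rapid: "\<And>n. rapid T (D n)"
    and deriv: "\<And>n k t. t \<in> {0<..T} \<Longrightarrow> ((\<lambda>t. D n t k) has_vector_derivative D (Suc n) t k) (at t within {0<..T})"
  shows "smooth_coef T (\<lambda>t k. of_real \<tau> * D 1 t k + (2 * pi * \<i> * of_real (lattice_vec k \<bullet> v)) * c t k)"
  unfolding smooth_coef_def
proof (intro exI[of _ "\<lambda>n t k. of_real \<tau> * D (Suc n) t k + (2 * pi * \<i> * of_real (lattice_vec k \<bullet> v)) * D n t k"] conjI allI ballI)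
  show "rapid T (\<lambda>t k. of_real \<tau> * D (Suc n) t k + (2 * pi * \<i> * of_real (lattice_vec k \<bullet> v)) * D n t k)" for n
    by (intro rapid_add rapid_lattice_inner rapid rapid_mult[where p=0 and B="\<bar>\<tau>\<bar>"]) auto
  show "((\<lambda>t. of_real \<tau> * D (Suc n) t k + (2 * pi * \<i> * of_real (lattice_vec k \<bullet> v)) * D n t k) has_vector_derivative
      of_real \<tau> * D (Suc (Suc n)) t k + (2 * pi * \<i> * of_real (lattice_vec k \<bullet> v)) * D (Suc n) t k) (at t within {0<..T})"
    if "t \<in> {0<..T}" for n k t
    using that by (intro has_vector_derivative_add has_vector_derivative_mult_right deriv)
qed (simp add: D0)

lemma summable_rapid:
  assumes "rapid T c" "t \<in> {0<..T}"
  shows "(\<lambda>k. norm (c t k)) summable_on UNIV"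
proof -
  obtain C where "\<And>s k. s \<in> {t..T} \<Longrightarrow> norm (c s k) \<le> C * lweight k"
    using rapid_bound[OF assms(1), of t] assms(2) by (metis greaterThanAtMost_iff)
  then have "\<And>k. norm (c t k) \<le> C * lweight k" using assms(2) by auto
  then show ?thesis
    by (intro summable_on_comparison_test[OF summable_on_cmult_right[OF summable_lweight, of C]]) auto
qed

text \<open>Termwise differentiation on \<open>[t0, T]\<close> times space, with \<open>t0\<close>
  half the time of \<open>p\<close>: there one summable \<open>b\<close> dominates the differentials
  of all terms. Near \<open>p\<close> this set agrees with the full domain, so the derivative within
  either is the same.\<close>

lemma fourier_series_has_derivative:
  assumes D0: "D 0 = c" and rapid: "\<And>n. rapid T (D n)"
    and deriv: "\<And>n k t. t \<in> {0<..T} \<Longrightarrow> ((\<lambda>t. D n t k) has_vector_derivative D (Suc n) t k) (at t within {0<..T})"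
    and p: "p \<in> {0<..T} \<times> UNIV"
  shows "((\<lambda>(t, x). \<Sum>\<^sub>\<infinity>k. c t k * fexp k x) has_derivative
    (\<lambda>(\<tau>, v). \<Sum>\<^sub>\<infinity>k. (of_real \<tau> * D 1 (fst p) k + (2 * pi * \<i> * of_real (lattice_vec k \<bullet> v)) * c (fst p) k) * fexp k (snd p)))
    (at p within {0<..T} \<times> UNIV)"
proof -
  define t0 where "t0 = fst p / 2"
  have t0: "0 < t0" "t0 < fst p" "fst p \<le> T" using p by (auto simp: t0_def)
  let ?S = "{t0..T} \<times> (UNIV :: (real^3) set)"
  define f where "f k q = c (fst q) k * fexp k (snd q)" for k and q :: "real \<times> (real^3)"
  define f' where "f' k q h = (of_real (fst h) * D 1 (fst q) k + (2 * pi * \<i> * of_real (lattice_vec k \<bullet> snd h)) * c (fst q) k) * fexp k (snd q)"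
    for k and q h :: "real \<times> (real^3)"
  have sub: "{t0..T} \<subseteq> {0<..T}" using t0 by auto
  obtain C1 where C1: "\<And>t k. t \<in> {t0..T} \<Longrightarrow> norm (D 1 t k) \<le> C1 * lweight k"
    using rapid_bound[OF rapid t0(1)] by blast
  have "rapid T (\<lambda>t k. of_real (1 + knorm k) * c t k)"
    using rapid[of 0] by (intro rapid_mult[where p=1 and B=1]) (auto simp: D0 simp del: of_real_add)
  then obtain C2 where C2: "\<And>t k. t \<in> {t0..T} \<Longrightarrow> norm (of_real (1 + knorm k) * c t k) \<le> C2 * lweight k"
    using rapid_bound[OF _ t0(1)] by blast
  define b where "b k = (C1 + 2 * pi * C2) * lweight k" for k
  have b: "b summable_on UNIV" unfolding b_def by (intro summable_on_cmult_right summable_lweight)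
  have f'_bd: "norm (f' k q h) \<le> norm h * b k" if q: "q \<in> ?S" for k q h
  proof -
    have q1: "fst q \<in> {t0..T}" using q by auto
    have h: "\<bar>fst h\<bar> \<le> norm h" "norm (snd h) \<le> norm h"
      using norm_fst_le[of "fst h" "snd h"] norm_snd_le[of "snd h" "fst h"] by simp_all
    have "norm (of_real (fst h) * D 1 (fst q) k) \<le> norm h * (C1 * lweight k)"
      unfolding norm_mult using h C1[OF q1] by (intro mult_mono) auto
    moreover have "norm ((2 * pi * \<i> * of_real (lattice_vec k \<bullet> snd h)) * c (fst q) k) \<le> norm h * (2 * pi * C2 * lweight k)"
    proof -
      have "norm ((2 * pi * \<i> * of_real (lattice_vec k \<bullet> snd h)) * c (fst q) k) \<le> ((2 * pi * norm (snd h)) * (1 + knorm k)) * norm (c (fst q) k)"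
        unfolding norm_mult[of _ "c (fst q) k"] by (intro mult_right_mono norm_lattice_inner_le) auto
      also have "\<dots> = (2 * pi * norm (snd h)) * norm (of_real (1 + knorm k) * c (fst q) k)"
        by (simp only: norm_mult norm_of_real) (simp add: mult_ac)
      also have "\<dots> \<le> (2 * pi * norm h) * (C2 * lweight k)"
        using h C2[OF q1, of k] by (intro mult_mono) auto
      finally show ?thesis by (simp add: mult_ac)
    qed
    ultimately have "norm (of_real (fst h) * D 1 (fst q) k + (2 * pi * \<i> * of_real (lattice_vec k \<bullet> snd h)) * c (fst q) k)
       \<le> norm h * (C1 * lweight k) + norm h * (2 * pi * C2 * lweight k)"
      by (intro norm_triangle_le add_mono)
    also have "\<dots> = norm h * b k" by (simp add: b_def algebra_simps)
    finally show ?thesis by (simp add: f'_def norm_mult)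
  qed
  have sb: "summable (natseq b)" by (rule natseq_summable[OF b])
  have f_deriv: "(f k has_derivative f' k q) (at q within ?S)" if q: "q \<in> ?S" for k q
  proof -
    have "((\<lambda>t. c t k) has_derivative (\<lambda>h. h *\<^sub>R D 1 (fst q) k)) (at (fst q) within {0<..T})"
      using deriv[of "fst q" 0 k] q sub by (auto simp: D0 has_vector_derivative_def)
    then have "((\<lambda>t. c t k) has_derivative (\<lambda>h. h *\<^sub>R D 1 (fst q) k)) (at (fst q) within fst ` ?S)"
      by (rule has_derivative_subset) (use sub in auto)
    from has_derivative_in_compose[OF has_derivative_fst[OF has_derivative_ident] this]
    have 1: "((\<lambda>q. c (fst q) k) has_derivative (\<lambda>h. fst h *\<^sub>R D 1 (fst q) k)) (at q within ?S)" .
    from has_derivative_compose[OF has_derivative_snd[OF has_derivative_ident] fexp_has_derivative]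
    have 2: "((\<lambda>q. fexp k (snd q)) has_derivative (\<lambda>h. (2 * pi * \<i> * of_real (lattice_vec k \<bullet> snd h)) * fexp k (snd q))) (at q within ?S)" .
    from has_derivative_mult[OF 1 2] show ?thesis
      unfolding f_def f'_def by (simp add: scaleR_conv_of_real algebra_simps)
  qed
  have nat: "natseq (\<lambda>k. g k) n = (if n \<in> range (to_nat :: int^3 \<Rightarrow> nat) then g (from_nat n) else 0)" for g :: "int^3 \<Rightarrow> complex" and n
    by (simp add: natseq_def)
  have nf'_bd: "norm (natseq (\<lambda>k. f' k q h) n) \<le> norm h * natseq b n" if "q \<in> ?S" for q h n
    using f'_bd[OF that] by (simp add: natseq_def)
  have s_f': "summable (\<lambda>n. norm (natseq (\<lambda>k. f' k q h) n))" if "q \<in> ?S" for q h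
    by (rule summable_comparison_test'[OF summable_mult[OF sb, of "norm h"], of 0]) (use nf'_bd[OF that] in auto)
  have sum_nat: "natseq g sums (\<Sum>\<^sub>\<infinity>k. g k)" if "(\<lambda>k. norm (g k)) summable_on UNIV" for g :: "int^3 \<Rightarrow> complex"
    by (rule natseq_sums[OF has_sum_infsum[OF abs_summable_summable[OF that]]])
  have s_f'0: "(\<lambda>k. norm (f' k q h)) summable_on UNIV" if "q \<in> ?S" for q h
    by (rule summable_on_comparison_test[OF summable_on_cmult_right[OF b, of "norm h"]]) (use f'_bd[OF that] in auto)
  have s_f0: "(\<lambda>k. norm (f k q)) summable_on UNIV" if "q \<in> ?S" for q
    using summable_rapid[OF rapid[of 0], of "fst q"] that sub by (auto simp: f_def norm_mult D0)
  have pS: "p \<in> ?S" using p t0 by auto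
  have "\<exists>g. \<forall>q\<in>?S. (\<lambda>n. natseq (\<lambda>k. f k q) n) sums g q \<and>
      (g has_derivative (\<lambda>h. \<Sum>\<^sub>\<infinity>k. f' k q h)) (at q within ?S)"
  proof (rule has_derivative_series[where f'="\<lambda>n q h. natseq (\<lambda>k. f' k q h) n"])
    show "convex ?S" by (intro convex_Times) auto
    show "p \<in> ?S" by (rule pS)
    show "(\<lambda>n. natseq (\<lambda>k. f k p) n) sums (\<Sum>\<^sub>\<infinity>k. f k p)" by (intro sum_nat s_f0 pS)
    show "((\<lambda>q. natseq (\<lambda>k. f k q) n) has_derivative (\<lambda>h. natseq (\<lambda>k. f' k q h) n)) (at q within ?S)" if "q \<in> ?S" for n q
      unfolding nat using f_deriv[OF that] by (cases "n \<in> range (to_nat :: int^3 \<Rightarrow> nat)") simp_all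
    fix e :: real assume e: "e > 0"
    have "(\<lambda>n. \<Sum>i. natseq b (i + n)) \<longlonglongrightarrow> 0" by (rule suminf_exist_split2[OF sb])
    then have "\<forall>\<^sub>F n in sequentially. (\<Sum>i. natseq b (i + n)) < e"
      using e by (auto intro: order_tendstoD)
    then show "\<forall>\<^sub>F n in sequentially. \<forall>q\<in>?S. \<forall>h. norm ((\<Sum>i<n. natseq (\<lambda>k. f' k q h) i) - (\<Sum>\<^sub>\<infinity>k. f' k q h)) \<le> e * norm h"
    proof eventually_elim
      case (elim n)
      show ?case
      proof (intro ballI allI)
        fix q h assume q: "q \<in> ?S"
        have eq: "(\<Sum>\<^sub>\<infinity>k. f' k q h) = (\<Sum>i. natseq (\<lambda>k. f' k q h) i)"
          using sum_nat[OF s_f'0[OF q]] by (rule sums_unique)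
        have "(\<Sum>i<n. natseq (\<lambda>k. f' k q h) i) - (\<Sum>\<^sub>\<infinity>k. f' k q h) = - (\<Sum>i. natseq (\<lambda>k. f' k q h) (i + n))"
          using suminf_minus_initial_segment[OF summable_norm_cancel[OF s_f'[OF q, where h=h]], where k=n] eq by simp
        also have "norm \<dots> \<le> (\<Sum>i. norm (natseq (\<lambda>k. f' k q h) (i + n)))"
          unfolding norm_minus_cancel by (intro summable_norm summable_ignore_initial_segment s_f' q)
        also have "\<dots> \<le> (\<Sum>i. norm h * natseq b (i + n))"
          by (intro suminf_le nf'_bd q summable_ignore_initial_segment s_f' summable_mult sb)
        also have "\<dots> = norm h * (\<Sum>i. natseq b (i + n))"
          by (intro suminf_mult summable_ignore_initial_segment sb)
        also have "\<dots> \<le> norm h * e" using elim by (intro mult_left_mono) auto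
        finally show "norm ((\<Sum>i<n. natseq (\<lambda>k. f' k q h) i) - (\<Sum>\<^sub>\<infinity>k. f' k q h)) \<le> e * norm h"
          by (simp add: mult.commute)
      qed
    qed
  qed
  then obtain g where g: "\<And>q. q \<in> ?S \<Longrightarrow> natseq (\<lambda>k. f k q) sums g q"
    "\<And>q. q \<in> ?S \<Longrightarrow> (g has_derivative (\<lambda>h. \<Sum>\<^sub>\<infinity>k. f' k q h)) (at q within ?S)" by blast
  have g_eq: "(\<Sum>\<^sub>\<infinity>k. f k q) = g q" if "q \<in> ?S" for q
    using sums_unique2[OF g(1)[OF that] sum_nat[OF s_f0[OF that]]] by simp
  have "((\<lambda>q. \<Sum>\<^sub>\<infinity>k. f k q) has_derivative (\<lambda>h. \<Sum>\<^sub>\<infinity>k. f' k p h)) (at p within ?S)"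
    by (rule has_derivative_transform[OF pS g_eq g(2)[OF pS]])
  moreover have "at p within ?S = at p within {0<..T} \<times> UNIV"
  proof (rule at_within_nhd)
    show "p \<in> {t0<..} \<times> UNIV" "open ({t0<..} \<times> (UNIV :: (real^3) set))"
      using t0 by (auto simp: mem_Times_iff intro!: open_Times)
  qed (use t0 in auto)
  ultimately show ?thesis unfolding f_def f'_def by (simp add: case_prod_beta')
qed

lemma fourier_series_smooth:
  assumes "smooth_coef T c"
  shows "smooth_on ({0<..T} \<times> UNIV) (\<lambda>(t, x). \<Sum>\<^sub>\<infinity>k. c t k * fexp k x)"
  unfolding smooth_on_def
proof
  fix n
  show "Ck_on n ({0<..T} \<times> UNIV) (\<lambda>(t, x). \<Sum>\<^sub>\<infinity>k. c t k * fexp k x)"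
    using assms
  proof (induction n arbitrary: c)
    case 0
    then obtain D where D: "D 0 = c" "\<And>n. rapid T (D n)"
      "\<And>n k t. t \<in> {0<..T} \<Longrightarrow> ((\<lambda>t. D n t k) has_vector_derivative D (Suc n) t k) (at t within {0<..T})"
      unfolding smooth_coef_def by blast
    from has_derivative_continuous_on[OF fourier_series_has_derivative[OF D]]
    show ?case unfolding Ck_on.simps by blast
  next
    case (Suc n)
    then obtain D where D: "D 0 = c" "\<And>n. rapid T (D n)"
      "\<And>n k t. t \<in> {0<..T} \<Longrightarrow> ((\<lambda>t. D n t k) has_vector_derivative D (Suc n) t k) (at t within {0<..T})"
      unfolding smooth_coef_def by blast
    show ?case unfolding Ck_on.simps
    proof (intro exI conjI ballI allI)
      show "((\<lambda>(t, x). \<Sum>\<^sub>\<infinity>k. c t k * fexp k x) has_derivative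
        (\<lambda>p (\<tau>, v). \<Sum>\<^sub>\<infinity>k. (of_real \<tau> * D 1 (fst p) k + (2 * pi * \<i> * of_real (lattice_vec k \<bullet> v)) * c (fst p) k) * fexp k (snd p)) p)
        (at p within {0<..T} \<times> UNIV)" if "p \<in> {0<..T} \<times> UNIV" for p
        by (rule fourier_series_has_derivative[OF D that])
      fix h :: "real \<times> (real^3)"
      obtain \<tau> v where h: "h = (\<tau>, v)" by force
      show "Ck_on n ({0<..T} \<times> UNIV) (\<lambda>p. (\<lambda>p (\<tau>, v). \<Sum>\<^sub>\<infinity>k. (of_real \<tau> * D 1 (fst p) k + (2 * pi * \<i> * of_real (lattice_vec k \<bullet> v)) * c (fst p) k) * fexp k (snd p)) p h)"
        using Suc.IH[OF smooth_coef_derivative[OF D, of \<tau> v]] by (simp add: h case_prod_beta')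
    qed
  qed
qed

subsection \<open>The Fourier form of the truncated nonlinearity\<close>

definition kdot :: "int^3 \<Rightarrow> complex^3 \<Rightarrow> complex" where
  "kdot k w = (\<Sum>i\<in>UNIV. of_int (k $ i) * w $ i)"

definition hdot :: "complex^3 \<Rightarrow> complex^3 \<Rightarrow> complex" where
  "hdot x y = (\<Sum>i\<in>UNIV. x $ i * cnj (y $ i))"

definition cvec :: "int^3 \<Rightarrow> complex^3" where
  "cvec k = (\<chi> i. of_int (k $ i))"

definition cnjv :: "complex^3 \<Rightarrow> complex^3" where
  "cnjv w = (\<chi> i. cnj (w $ i))"

text \<open>Orthogonal projection onto the amplitudes with \<open>kdot k w = 0\<close>. At
  \<open>k = 0\<close> the division by 0 yields 0 and the projection is the identity, as it should
  be.\<close>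

definition leray :: "int^3 \<Rightarrow> complex^3 \<Rightarrow> complex^3" where
  "leray k w = w - (kdot k w / of_real ((knorm k)\<^sup>2)) *s cvec k"

lemma norm_smult: "norm (c *s (x :: complex^3)) = cmod c * norm x"
  by (simp add: norm_vec_def L2_set_def norm_mult power_mult_distrib sum_distrib_left[symmetric] real_sqrt_mult)

lemma norm_cvec: "norm (cvec k) = knorm k"
  by (simp add: norm_vec_def L2_set_def cvec_def)

lemma norm_kdot_le: "cmod (kdot k w) \<le> knorm k * norm w"
proof -
  have "cmod (kdot k w) \<le> (\<Sum>i\<in>UNIV. \<bar>lattice_vec k $ i\<bar> * \<bar>cmod (w $ i)\<bar>)"
    unfolding kdot_def by (rule order_trans[OF norm_sum]) (simp add: norm_mult)
  also have "\<dots> \<le> L2_set (\<lambda>i. lattice_vec k $ i) UNIV * L2_set (\<lambda>i. cmod (w $ i)) UNIV"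
    by (rule L2_set_mult_ineq)
  also have "\<dots> = knorm k * norm w" by (simp add: norm_vec_def L2_set_def)
  finally show ?thesis .
qed

lemma scaleR_nth: "(r *\<^sub>R (x :: complex^3)) $ i = of_real r * x $ i"
  unfolding vector_scaleR_component by (rule scaleR_conv_of_real)

lemma kdot_scaleR: "kdot k (r *\<^sub>R x) = of_real r * kdot k x"
  by (simp add: kdot_def scaleR_nth sum_distrib_left algebra_simps del: vector_scaleR_component)

lemma kdot_add: "kdot k (x + y) = kdot k x + kdot k y"
  and kdot_diff: "kdot k (x - y) = kdot k x - kdot k y"
  and kdot_smult: "kdot k (c *s x) = c * kdot k x"
  and kdot_minus_left: "kdot (- k) x = - kdot k x"
  and kdot_diff_left: "kdot (k - l) x = kdot k x - kdot l x"
  and kdot_0: "kdot 0 x = 0" and kdot_zero: "kdot k 0 = 0"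
  and kdot_cnjv: "kdot k (cnjv x) = cnj (kdot k x)"
  by (simp_all add: kdot_def cnjv_def sum.distrib sum_subtractf sum_distrib_left sum_negf algebra_simps)

lemma bounded_linear_kdot: "bounded_linear (kdot k)"
proof (rule bounded_linear_intro)
  show "norm (kdot k x) \<le> norm x * knorm k" for x using norm_kdot_le[of k x] by (simp only: mult.commute)
  show "kdot k (r *\<^sub>R x) = r *\<^sub>R kdot k x" for r x
    unfolding kdot_scaleR by (rule scaleR_conv_of_real[symmetric])
qed (rule kdot_add)

lemma bounded_linear_cnjv: "bounded_linear cnjv"
  by (rule bounded_linear_intro[of _ 1]) (auto simp: cnjv_def vec_eq_iff norm_vec_def)

lemma norm_cnjv [simp]: "norm (cnjv x) = norm x"
  by (simp add: cnjv_def norm_vec_def)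

lemma cnjv_cnjv [simp]: "cnjv (cnjv x) = x" by (simp add: cnjv_def vec_eq_iff)

lemma smult_inner: "(c *s x) \<bullet> y = Re (c * hdot x y)"
  by (simp add: inner_vec_def hdot_def sum_distrib_left inner_complex_def Re_sum algebra_simps)

lemma kdot_cvec: "kdot k (cvec k) = of_real ((knorm k)\<^sup>2)"
  by (simp add: kdot_def cvec_def norm_vec_sq power2_eq_square[symmetric])

lemma kdot_leray [simp]: "kdot k (leray k w) = 0"
  by (cases "k = 0") (simp_all add: leray_def kdot_0 kdot_diff kdot_smult kdot_cvec)

text \<open>The sharp constant for an orthogonal projection is 1; the triangle inequality gives 2,
  which is reflected in the constant \<open>Cn\<close>.\<close>

lemma norm_leray_le: "norm (leray k w) \<le> 2 * norm w"
proof (cases "k = 0")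
  case True
  then show ?thesis by (simp add: leray_def kdot_0)
next
  case False
  then have k: "knorm k > 0" by simp
  have "norm (leray k w) \<le> norm w + norm ((kdot k w / of_real ((knorm k)\<^sup>2)) *s cvec k)"
    unfolding leray_def by (rule norm_triangle_ineq4)
  also have "norm ((kdot k w / of_real ((knorm k)\<^sup>2)) *s cvec k) = cmod (kdot k w) / knorm k"
    using k by (simp add: norm_smult norm_cvec norm_divide norm_power) (simp add: power2_eq_square)
  also have "\<dots> \<le> norm w" using norm_kdot_le[of k w] k by (simp add: divide_le_eq mult.commute)
  finally show ?thesis by simp
qed

lemma leray_inner:
  assumes "kdot k y = 0"
  shows "leray k x \<bullet> y = x \<bullet> y"
proof -
  have "hdot (cvec k) y = cnj (kdot k y)" by (simp add: hdot_def cvec_def kdot_def)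
  then have "((kdot k x / of_real ((knorm k)\<^sup>2)) *s cvec k) \<bullet> y = 0" using assms by (simp add: smult_inner)
  then show ?thesis by (simp add: leray_def inner_diff_left)
qed

lemma leray_linear:
  "leray k (x + y) = leray k x + leray k y" "leray k (x - y) = leray k x - leray k y"
  "leray k (c *s x) = c *s leray k x" "leray k (r *\<^sub>R x) = r *\<^sub>R leray k x" "leray k 0 = 0"
  by (simp_all add: leray_def kdot_add kdot_diff kdot_smult kdot_scaleR kdot_zero vec_eq_iff scaleR_nth
        add_divide_distrib diff_divide_distrib algebra_simps del: vector_scaleR_component)

lemma bounded_linear_leray: "bounded_linear (leray k)"
proof (rule bounded_linear_intro)
  show "norm (leray k x) \<le> norm x * 2" for x using norm_leray_le[of k x] by simp
qed (simp_all add: leray_linear)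

lemma leray_cnjv: "leray (- k) (cnjv w) = cnjv (leray k w)"
  unfolding leray_def kdot_minus_left kdot_cnjv by (simp add: vec_eq_iff cnjv_def cvec_def)

text \<open>Up to the factor \<open>2 * pi * \<i>\<close>, the Fourier coefficient of the transport
  term in divergence form, hence \<open>kdot k\<close> and not \<open>kdot l\<close>. For
  divergence-free \<open>a\<close> the two agree, because
  \<open>kdot (k - l) (a (k - l)) = 0\<close>.\<close>

definition conv :: "(int^3) set \<Rightarrow> (int^3 \<Rightarrow> complex^3) \<Rightarrow> (int^3 \<Rightarrow> complex^3) \<Rightarrow> int^3 \<Rightarrow> complex^3" where
  "conv A a b k = (\<Sum>l\<in>A. kdot k (a (k - l)) *s b l)"

lemma conv_bound:
  assumes a: "\<And>j. norm (a j) \<le> x" and b: "\<And>j. norm (b j) \<le> y"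
  shows "norm (conv A a b k) \<le> card A * (knorm k * x * y)"
proof -
  have "0 \<le> x" "0 \<le> y" using order_trans[OF norm_ge_zero] a b by blast+
  have "norm (kdot k (a (k - l)) *s b l) \<le> knorm k * x * y" for l
    unfolding norm_smult using a[of "k - l"] b[of l] \<open>0 \<le> x\<close>
    by (intro mult_mono order_trans[OF norm_kdot_le] mult_left_mono) auto
  then show ?thesis unfolding conv_def
    using sum_norm_le[of A "\<lambda>l. kdot k (a (k - l)) *s b l" "\<lambda>_. knorm k * x * y"] by simp
qed

lemma conv_diff:
  "conv A a a k - conv A b b k = conv A (\<lambda>j. a j - b j) a k + conv A b (\<lambda>j. a j - b j) k"
  by (simp add: conv_def sum.distrib[symmetric] sum_subtractf[symmetric] kdot_diff vec_eq_iff algebra_simps)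

lemma conv_mono_neutral:
  assumes "finite A'" "A \<subseteq> A'" "\<And>l. l \<in> A' - A \<Longrightarrow> b l = 0"
  shows "conv A a b k = conv A' a b k"
  unfolding conv_def using assms by (intro sum.mono_neutral_left) auto

lemma conv_scale: "conv A (\<lambda>j. r *\<^sub>R a j) (\<lambda>j. r *\<^sub>R b j) k = r\<^sup>2 *\<^sub>R conv A a b k"
  by (simp add: conv_def kdot_scaleR vec_eq_iff scaleR_nth sum_distrib_left power2_eq_square mult_ac
        del: vector_scaleR_component)

definition fmax :: "(int^3) set \<Rightarrow> (int^3 \<Rightarrow> complex^3) \<Rightarrow> real" where
  "fmax A w = Max ((\<lambda>j. norm (w j)) ` A)"

text \<open>Scaling all modes by a common factor makes the nonlinearity bounded and globally Lipschitz without
  destroying the cancellation behind the energy balance.\<close>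

definition retract :: "real \<Rightarrow> (int^3) set \<Rightarrow> (int^3 \<Rightarrow> complex^3) \<Rightarrow> int^3 \<Rightarrow> complex^3" where
  "retract R A w j = (R / max R (fmax A w)) *\<^sub>R w j"

lemma fmax_ge: "finite A \<Longrightarrow> j \<in> A \<Longrightarrow> norm (w j) \<le> fmax A w"
  unfolding fmax_def by (intro Max_ge) auto

lemma fmax_lipschitz:
  assumes "finite A" "A \<noteq> {}" "\<And>j. norm (w j - w' j) \<le> D"
  shows "\<bar>fmax A w - fmax A w'\<bar> \<le> D"
proof -
  have "fmax A v \<le> fmax A v' + D" if "\<And>j. norm (v j - v' j) \<le> D" for v v'
  proof -
    have "norm (v j) \<le> fmax A v' + D" if j: "j \<in> A" for j
      using norm_triangle_ineq2[of "v j" "v' j"] \<open>norm (v j - v' j) \<le> D\<close> fmax_ge[OF assms(1) j, of v'] by linarith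
    then show ?thesis unfolding fmax_def[of A v] using assms by (subst Max_le_iff) auto
  qed
  from this[of w w'] this[of w' w] show ?thesis using assms(3) by (auto simp: norm_minus_commute abs_le_iff)
qed

lemma fmax_mono_neutral:
  assumes "finite A'" "A \<subseteq> A'" "A \<noteq> {}" "\<And>l. l \<in> A' - A \<Longrightarrow> w l = 0"
  shows "fmax A w = fmax A' w"
proof (rule antisym)
  have fin: "finite A" using assms finite_subset by blast
  show "fmax A w \<le> fmax A' w" unfolding fmax_def using assms by (intro Max_mono) auto
  have "norm (w j) \<le> fmax A w" if "j \<in> A'" for j
  proof (cases "j \<in> A")
    case False
    obtain i where "i \<in> A" using assms(3) by blast
    then show ?thesis using False that assms(4) order_trans[OF norm_ge_zero fmax_ge[OF fin]] by simp
  qed (rule fmax_ge[OF fin])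
  then show "fmax A' w \<le> fmax A w" unfolding fmax_def[of A'] using assms by (subst Max_le_iff) auto
qed

lemma continuous_on_fmax:
  assumes "finite A" "A \<noteq> {}" "\<And>j. j \<in> A \<Longrightarrow> continuous_on S (\<lambda>s. w s j)"
  shows "continuous_on S (\<lambda>s. fmax A (w s))"
  using assms unfolding fmax_def
proof (induction A rule: finite_ne_induct)
  case (singleton x)
  then show ?case by (auto intro: continuous_intros)
next
  case (insert x A)
  have "(\<lambda>s. Max ((\<lambda>j. norm (w s j)) ` insert x A)) = (\<lambda>s. max (norm (w s x)) (Max ((\<lambda>j. norm (w s j)) ` A)))"
    using insert by simp
  then show ?case using insert by (auto intro!: continuous_intros)
qed

lemma norm_retract_le:
  assumes "R > 0" "finite A" "\<And>j. j \<notin> A \<Longrightarrow> w j = 0"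
  shows "norm (retract R A w j) \<le> R"
proof (cases "j \<in> A")
  case True
  then have "norm (w j) \<le> max R (fmax A w)" using fmax_ge[OF assms(2) True, of w] by simp
  then have "R * norm (w j) \<le> R * max R (fmax A w)" using assms by (intro mult_left_mono) auto
  then show ?thesis using assms by (simp add: retract_def divide_le_eq)
qed (use assms in \<open>simp add: retract_def\<close>)

text \<open>One unit of the constant comes from moving the amplitudes, the other from moving the
  common factor; the latter is under control because \<open>norm (w' j) \<le> p'\<close>.\<close>

lemma retract_lipschitz:
  assumes R: "R > 0" and A: "finite A" "A \<noteq> {}" and w: "\<And>j. j \<notin> A \<Longrightarrow> w j = 0" "\<And>j. j \<notin> A \<Longrightarrow> w' j = 0"
    and D: "\<And>j. norm (w j - w' j) \<le> D"
  shows "norm (retract R A w j - retract R A w' j) \<le> 2 * D"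
proof -
  define p p' where "p = max R (fmax A w)" and "p' = max R (fmax A w')"
  have p: "p \<ge> R" "p' \<ge> R" "p > 0" "p' > 0" using R by (auto simp: p_def p'_def)
  have pp: "\<bar>p' - p\<bar> \<le> D" using fmax_lipschitz[OF A, of w w' D] D by (auto simp: p_def p'_def)
  have "0 \<le> D" using order_trans[OF norm_ge_zero D] .
  have w'p: "norm (w' j) \<le> p'"
    using fmax_ge[OF A(1), of j w'] w(2)[of j] p by (cases "j \<in> A") (auto simp: p'_def)
  have eq: "retract R A w j - retract R A w' j = (R / p) *\<^sub>R (w j - w' j) + ((R / p) * (p' - p) / p') *\<^sub>R w' j"
  proof -
    have "R / p - R / p' = (R / p) * (p' - p) / p'" using p by (simp add: field_simps)
    then have "(R / p) *\<^sub>R (w j - w' j) + ((R / p) * (p' - p) / p') *\<^sub>R w' j = (R / p) *\<^sub>R (w j - w' j) + (R / p - R / p') *\<^sub>R w' j"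
      by simp
    then show ?thesis by (simp add: retract_def p_def[symmetric] p'_def[symmetric] algebra_simps)
  qed
  have Rp: "0 \<le> R / p" "R / p \<le> 1" using R p by auto
  have "norm ((R / p) *\<^sub>R (w j - w' j)) \<le> 1 * D"
    unfolding norm_scaleR using Rp D[of j] by (intro mult_mono) auto
  moreover have "norm (((R / p) * (p' - p) / p') *\<^sub>R w' j) \<le> D"
  proof -
    have "norm (((R / p) * (p' - p) / p') *\<^sub>R w' j) = (R / p) * \<bar>p' - p\<bar> * (norm (w' j) / p')"
      using p R by (simp add: abs_mult)
    also have "\<dots> \<le> 1 * D * 1"
      using Rp pp w'p p \<open>0 \<le> D\<close> by (intro mult_mono) auto
    finally show ?thesis by simp
  qed
  ultimately show ?thesis unfolding eq by (intro norm_triangle_le) simp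
qed

lemma retract_id:
  assumes "R > 0" "finite A" "A \<noteq> {}" "\<And>j. norm (w j) \<le> R"
  shows "retract R A w j = w j"
proof -
  have "fmax A w \<le> R" unfolding fmax_def using assms by (subst Max_le_iff) auto
  then show ?thesis using assms(1) by (simp add: retract_def max_def)
qed

locale lns =
  fixes \<phi> :: "real^3 \<Rightarrow> real" and \<Lambda> :: "real \<Rightarrow> real" and \<nu> T :: real
  assumes \<nu>: "\<nu> > 0" and T_pos: "T > 0" and cutoff: "cutoff \<phi>" and freq: "frequency_function T \<Lambda>"
begin

definition m :: "real \<Rightarrow> int^3 \<Rightarrow> real" where
  "m s k = \<phi> (lattice_vec k /\<^sub>R \<Lambda> s)"

definition low :: "real \<Rightarrow> (int^3) set" where
  "low s = {k. knorm k < 2 * \<Lambda> s}"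

definition sig :: "int^3 \<Rightarrow> real" where
  "sig k = \<nu> * (2 * pi * knorm k)\<^sup>2"

lemma sig_nonneg: "sig k \<ge> 0" using \<nu> by (simp add: sig_def)

lemma \<Lambda>_pos: "s \<in> {0<..T} \<Longrightarrow> \<Lambda> s > 0"
  using freq by (auto simp: frequency_function_def)

lemma \<Lambda>_antimono: "0 < s \<Longrightarrow> s \<le> t \<Longrightarrow> t \<le> T \<Longrightarrow> \<Lambda> t \<le> \<Lambda> s"
proof -
  assume "0 < s" "s \<le> t" "t \<le> T"
  moreover have "strict_antimono_on {0<..T} \<Lambda>" using freq by (simp add: frequency_function_def)
  ultimately show ?thesis
    using monotone_onD[of "{0<..T}" "(<)" "\<lambda>x y. y < x" \<Lambda> s t] by (cases "s = t") auto
qed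

lemma \<Lambda>_le: "s \<in> {0<..T} \<Longrightarrow> \<Lambda> s \<le> s powr (- 1 / 8)"
  using freq by (auto simp: frequency_function_def)

lemma m_bounds: "0 \<le> m s k" "m s k \<le> 1"
  using cutoff by (auto simp: m_def cutoff_def)

lemma m_uminus [simp]: "m s (- k) = m s k"
proof -
  have "norm (lattice_vec (- k) /\<^sub>R \<Lambda> s) = norm (lattice_vec k /\<^sub>R \<Lambda> s)" by simp
  then show ?thesis using cutoff unfolding cutoff_def m_def by blast
qed

lemma m_eq_0: "s \<in> {0<..T} \<Longrightarrow> k \<notin> low s \<Longrightarrow> m s k = 0"
proof -
  assume s: "s \<in> {0<..T}" "k \<notin> low s"
  then have "norm (lattice_vec k /\<^sub>R \<Lambda> s) \<ge> 2" using \<Lambda>_pos[OF s(1)] by (simp add: low_def field_simps)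
  then show ?thesis using cutoff by (simp add: m_def cutoff_def)
qed

lemma m_eq_1: "s \<in> {0<..T} \<Longrightarrow> knorm k < \<Lambda> s \<Longrightarrow> m s k = 1"
proof -
  assume s: "s \<in> {0<..T}" "knorm k < \<Lambda> s"
  then have "norm (lattice_vec k /\<^sub>R \<Lambda> s) < 1" using \<Lambda>_pos[OF s(1)] by (simp add: field_simps)
  then show ?thesis using cutoff by (simp add: m_def cutoff_def)
qed

lemma low_finite: "finite (low s)"
  unfolding low_def by (rule finite_knorm_ball)

lemma low_0: "s \<in> {0<..T} \<Longrightarrow> 0 \<in> low s"
  using \<Lambda>_pos by (simp add: low_def)

lemma low_uminus [simp]: "- k \<in> low s \<longleftrightarrow> k \<in> low s"
  by (simp add: low_def)

lemma low_antimono: "0 < s \<Longrightarrow> s \<le> t \<Longrightarrow> t \<le> T \<Longrightarrow> low t \<subseteq> low s"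
  using \<Lambda>_antimono by (force simp: low_def)

lemma \<Lambda>_smooth: "Ck_on n {0<..T} \<Lambda>"
  using freq by (simp add: frequency_function_def smooth_on_def)

lemma m_smooth: "Ck_on n {0<..T} (\<lambda>s. m s k)"
proof -
  have nz: "\<Lambda> s \<noteq> 0" if "s \<in> {0<..T}" for s using \<Lambda>_pos[OF that] by simp
  have "Ck_on n {0<..T} (\<lambda>s. inverse (\<Lambda> s) *\<^sub>R lattice_vec k)"
    by (intro Ck_on_scaleR Ck_on_inverse Ck_on_const \<Lambda>_smooth nz)
  moreover have "Ck_on n UNIV \<phi>" using cutoff by (simp add: cutoff_def smooth_on_def)
  ultimately show ?thesis unfolding m_def
    by (rule Ck_on_compose[where g=\<phi> and f="\<lambda>s. inverse (\<Lambda> s) *\<^sub>R lattice_vec k"])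
qed

lemma m_continuous: "continuous_on {0<..T} (\<lambda>s. m s k)"
  using m_smooth[of 0] by simp

text \<open>\<open>4 * pi\<close> is \<open>2 * pi\<close> from the derivative times 2 from
  \<open>norm_leray_le\<close>. Since \<open>s \<le> T\<close>, the 1 in the lattice count
  \<open>(4 * \<Lambda> s + 1) ^ 3\<close> is at most
  \<open>T powr (1/8) * s powr (-1/8)\<close>.\<close>

definition Cn :: real where "Cn = 4 * pi * (4 + T powr (1/8)) ^ 3"

lemma Cn_pos: "Cn > 0"
proof -
  have "(4 + T powr (1/8)) ^ 3 > 0" by (intro zero_less_power) (simp add: add_pos_nonneg)
  then show ?thesis by (simp add: Cn_def)
qed

lemma card_low_le:
  assumes s: "s \<in> {0<..T}"
  shows "4 * pi * card (low s) \<le> Cn * s powr (- 3 / 8)"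
proof -
  have "real (card (low s)) \<le> (2 * (2 * \<Lambda> s) + 1) ^ 3"
    unfolding low_def using \<Lambda>_pos[OF s] by (intro card_knorm_ball) auto
  also have "\<dots> \<le> ((4 + T powr (1/8)) * s powr (- 1 / 8)) ^ 3"
  proof (intro power_mono)
    have "T powr (1/8) * s powr (- 1 / 8) \<ge> s powr (1/8) * s powr (- 1 / 8)"
      using s by (intro mult_right_mono powr_mono2) auto
    then have "1 \<le> T powr (1/8) * s powr (- 1 / 8)" using s by (simp add: powr_add[symmetric])
    then show "2 * (2 * \<Lambda> s) + 1 \<le> (4 + T powr (1/8)) * s powr (- 1 / 8)"
      using \<Lambda>_le[OF s] by (simp add: distrib_right)
  qed (use \<Lambda>_pos[OF s] in auto)
  also have "\<dots> = (4 + T powr (1/8)) ^ 3 * s powr (- 3 / 8)"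
    using s by (simp add: power_mult_distrib powr_power)
  finally show ?thesis unfolding Cn_def using pi_gt_zero by (simp add: mult.assoc)
qed

text \<open>The outer filter is the factor \<open>m s k\<close>; the inner filters are left to the
  arguments, which makes room for the retraction between filtering and multiplying.\<close>

definition NL :: "real \<Rightarrow> (int^3 \<Rightarrow> complex^3) \<Rightarrow> (int^3 \<Rightarrow> complex^3) \<Rightarrow> int^3 \<Rightarrow> complex^3" where
  "NL s a b k = (- (2 * pi * \<i>) * of_real (m s k)) *s leray k (conv (low s) a b k)"

lemma NL_eq_0: "s \<in> {0<..T} \<Longrightarrow> k \<notin> low s \<Longrightarrow> NL s a b k = 0"
  by (simp add: NL_def m_eq_0 vec_eq_iff)

lemma NL_0: "NL s a b 0 = 0"
  by (simp add: NL_def conv_def kdot_0 leray_linear vec_eq_iff)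

lemma NL_bound:
  assumes s: "s \<in> {0<..T}" and a: "\<And>j. norm (a j) \<le> x" and b: "\<And>j. norm (b j) \<le> y"
  shows "norm (NL s a b k) \<le> Cn * x * y * (knorm k * s powr (- 3 / 8))"
proof -
  have xy: "0 \<le> x" "0 \<le> y" using order_trans[OF norm_ge_zero] a b by blast+
  have "norm (NL s a b k) = (2 * pi * m s k) * norm (leray k (conv (low s) a b k))"
    using m_bounds[of s k] by (simp add: NL_def norm_smult norm_mult)
  also have "\<dots> \<le> (2 * pi * 1) * (2 * (card (low s) * (knorm k * x * y)))"
    using m_bounds[of s k] conv_bound[where a=a and b=b and x=x and y=y and A="low s" and k=k, OF a b] norm_leray_le[of k "conv (low s) a b k"]
    by (intro mult_mono) auto
  also have "\<dots> = (4 * pi * card (low s)) * (knorm k * x * y)" by simp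
  also have "\<dots> \<le> (Cn * s powr (- 3 / 8)) * (knorm k * x * y)"
    using xy by (intro mult_right_mono card_low_le s) auto
  finally show ?thesis by (simp add: mult_ac)
qed

lemma knorm_low_le: "s \<in> {0<..T} \<Longrightarrow> k \<in> low s \<Longrightarrow> knorm k \<le> 2 * s powr (- 1 / 8)"
  using \<Lambda>_le[of s] by (simp add: low_def)

text \<open>The \<open>s powr (-3/8)\<close> from counting modes and the
  \<open>s powr (-1/8)\<close> from one derivative on an active mode combine to the integrable
  singularity \<open>1 / sqrt s\<close>.\<close>

lemma NL_bound_sqrt:
  assumes s: "s \<in> {0<..T}" and a: "\<And>j. norm (a j) \<le> x" and b: "\<And>j. norm (b j) \<le> y"
  shows "norm (NL s a b k) \<le> 2 * Cn * x * y / sqrt s"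
proof (cases "k \<in> low s")
  case True
  have xy: "0 \<le> x" "0 \<le> y" using order_trans[OF norm_ge_zero] a b by blast+
  have "norm (NL s a b k) \<le> Cn * x * y * (knorm k * s powr (- 3 / 8))" by (rule NL_bound[OF assms])
  also have "\<dots> \<le> Cn * x * y * ((2 * s powr (- 1 / 8)) * s powr (- 3 / 8))"
    using Cn_pos xy knorm_low_le[OF s True] by (intro mult_left_mono mult_right_mono) auto
  also have "(2 * s powr (- 1 / 8)) * s powr (- 3 / 8) = 2 * s powr (- (1/2))"
    by (simp add: powr_add[symmetric] mult.assoc)
  also have "s powr (- (1/2)) = 1 / sqrt s"
    using s by (simp add: powr_minus_divide powr_half_sqrt)
  finally show ?thesis by (simp add: mult_ac)
next
  case False
  have xy: "0 \<le> x" "0 \<le> y" using order_trans[OF norm_ge_zero] a b by blast+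
  then show ?thesis using Cn_pos s by (simp add: NL_eq_0[OF s False])
qed

lemma NL_diff: "NL s a a k - NL s b b k = NL s (\<lambda>j. a j - b j) a k + NL s b (\<lambda>j. a j - b j) k"
  unfolding NL_def vector_sub_rdistrib[symmetric] vec.scale_right_diff_distrib[symmetric]
    vec.scale_right_distrib[symmetric] leray_linear[symmetric] conv_diff ..

lemma NL_diff_bound:
  assumes s: "s \<in> {0<..T}" and ab: "\<And>j. norm (a j) \<le> R" "\<And>j. norm (b j) \<le> R" "\<And>j. norm (a j - b j) \<le> D"
  shows "norm (NL s a a k - NL s b b k) \<le> 4 * Cn * R * D / sqrt s"
proof -
  have "norm (NL s a a k - NL s b b k) \<le> 2 * Cn * D * R / sqrt s + 2 * Cn * R * D / sqrt s"
    unfolding NL_diff using ab by (intro norm_triangle_le add_mono NL_bound_sqrt[OF s])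
  then show ?thesis by (simp add: mult_ac)
qed

definition lowpass :: "real \<Rightarrow> (int^3 \<Rightarrow> complex^3) \<Rightarrow> int^3 \<Rightarrow> complex^3" where
  "lowpass s u j = m s j *\<^sub>R u j"

lemma lowpass_eq_0: "s \<in> {0<..T} \<Longrightarrow> j \<notin> low s \<Longrightarrow> lowpass s u j = 0"
  by (simp add: lowpass_def m_eq_0)

lemma norm_lowpass_le: "norm (lowpass s u j) \<le> norm (u j)"
  using m_bounds[of s j] by (simp add: lowpass_def mult_left_le_one_le)

lemma lowpass_diff: "lowpass s u j - lowpass s v j = lowpass s (\<lambda>j. u j - v j) j"
  by (simp add: lowpass_def scaleR_diff_right)

definition F :: "real \<Rightarrow> real \<Rightarrow> (int^3 \<Rightarrow> complex^3) \<Rightarrow> int^3 \<Rightarrow> complex^3" where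
  "F R s u = NL s (retract R (low s) (lowpass s u)) (retract R (low s) (lowpass s u))"

lemma F_eq_NL:
  assumes "s \<in> {0<..T}" "R > 0" "\<And>j. norm (u j) \<le> R"
  shows "F R s u k = NL s (lowpass s u) (lowpass s u) k"
proof -
  have "retract R (low s) (lowpass s u) = lowpass s u"
    using assms low_finite low_0
    by (intro ext retract_id order_trans[OF norm_lowpass_le]) blast+
  then show ?thesis by (simp add: F_def)
qed

text \<open>The summation set \<open>low s\<close> varies with time. On \<open>{c<..T}\<close> it
  can be replaced by the fixed finite set \<open>low c\<close>, because the additional terms vanish,
  and continuity on \<open>{0<..T}\<close> is a local matter.\<close>

lemma continuous_on_NL:
  assumes a: "\<And>j. continuous_on {0<..T} (\<lambda>s. a s j)" and a0: "\<And>s j. s \<in> {0<..T} \<Longrightarrow> j \<notin> low s \<Longrightarrow> a s j = 0"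
  shows "continuous_on {0<..T} (\<lambda>s. NL s (a s) (a s) k)"
proof -
  have "Ck_on 0 {0<..T} (\<lambda>s. NL s (a s) (a s) k)"
  proof (rule Ck_on_Ioc_local)
    fix c assume c: "0 < c" "c < T"
    have sub: "{c<..T} \<subseteq> {0<..T}" using c by auto
    have "continuous_on {c<..T} (\<lambda>s. (- (2 * pi * \<i>) * of_real (m s k)) *s leray k (conv (low c) (a s) (a s) k))"
      unfolding vector_scalar_mult_def conv_def
      by (intro continuous_intros continuous_on_vec_lambda bounded_linear.continuous_on[OF bounded_linear_leray]
          bounded_linear.continuous_on[OF bounded_linear_kdot] continuous_on_subset[OF m_continuous sub]
          continuous_on_subset[OF a sub])
    moreover have "conv (low c) (a s) (a s) k = conv (low s) (a s) (a s) k" if "s \<in> {c<..T}" for s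
      using that c low_antimono[of c s] a0[of s] by (intro conv_mono_neutral[symmetric] low_finite) auto
    ultimately show "Ck_on 0 {c<..T} (\<lambda>s. NL s (a s) (a s) k)"
      by (auto simp: NL_def intro: continuous_on_eq)
  qed
  then show ?thesis by simp
qed

lemma continuous_on_retract:
  assumes u: "\<And>j. continuous_on {0..T} (\<lambda>s. u s j)" and R: "R > 0"
  shows "continuous_on {0<..T} (\<lambda>s. retract R (low s) (lowpass s (u s)) j)"
proof -
  have "Ck_on 0 {0<..T} (\<lambda>s. retract R (low s) (lowpass s (u s)) j)"
  proof (rule Ck_on_Ioc_local)
    fix c assume c: "0 < c" "c < T"
    have sub: "{c<..T} \<subseteq> {0<..T}" "{c<..T} \<subseteq> {0..T}" using c by auto
    have lp: "continuous_on {c<..T} (\<lambda>s. lowpass s (u s) i)" for i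
      unfolding lowpass_def
      by (intro continuous_intros continuous_on_subset[OF m_continuous sub(1)] continuous_on_subset[OF u sub(2)])
    have "continuous_on {c<..T} (\<lambda>s. retract R (low c) (lowpass s (u s)) j)"
      unfolding retract_def using R low_0[of c] c
      by (intro continuous_intros continuous_on_fmax lp low_finite) auto
    moreover have "fmax (low c) (lowpass s (u s)) = fmax (low s) (lowpass s (u s))" if "s \<in> {c<..T}" for s
      using that c low_antimono[of c s] lowpass_eq_0[of s] low_0[of s]
      by (intro fmax_mono_neutral[symmetric] low_finite) auto
    ultimately show "Ck_on 0 {c<..T} (\<lambda>s. retract R (low s) (lowpass s (u s)) j)"
      by (auto simp: retract_def intro: continuous_on_eq)
  qed
  then show ?thesis by simp
qed

lemma retract_low:
  assumes "s \<in> {0<..T}" "R > 0"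
  shows "norm (retract R (low s) (lowpass s u) j) \<le> R"
    "j \<notin> low s \<Longrightarrow> retract R (low s) (lowpass s u) j = 0"
  using assms lowpass_eq_0[OF assms(1)] norm_retract_le[OF assms(2) low_finite]
  by (auto simp: retract_def)

lemma F_bound: "s \<in> {0<..T} \<Longrightarrow> R > 0 \<Longrightarrow> norm (F R s u k) \<le> Cn * R * R * (knorm k * s powr (- 3 / 8))"
  unfolding F_def by (intro NL_bound retract_low) auto

lemma F_eq_0: "s \<in> {0<..T} \<Longrightarrow> k \<notin> low s \<Longrightarrow> F R s u k = 0"
  unfolding F_def by (rule NL_eq_0)

text \<open>In the Lipschitz constant, 4 comes from the two terms of \<open>NL_diff_bound\<close>
  and 2 from \<open>retract_lipschitz\<close>; after retraction all amplitudes are at most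
  \<open>R\<close>.\<close>

lemma evolution:
  assumes R: "R > 0"
  shows "singular_evolution T (8 * Cn * R) (2 * Cn * R * R) sig (F R)"
proof
  show "T > 0" by (rule T_pos)
  show "8 * Cn * R \<ge> 0" using Cn_pos R by simp
  show "sig k \<ge> 0" for k by (rule sig_nonneg)
  show "norm (F R s u k) \<le> 2 * Cn * R * R / sqrt s" if "0 < s" "s \<le> T" for s u k
    unfolding F_def using that R by (intro NL_bound_sqrt retract_low) auto
  show "norm (F R s u k - F R s v k) \<le> 8 * Cn * R / sqrt s * D"
    if s: "0 < s" "s \<le> T" and D: "\<And>j. norm (u j - v j) \<le> D" for s u v D k
  proof -
    have s': "s \<in> {0<..T}" using s by simp
    have "norm (retract R (low s) (lowpass s u) j - retract R (low s) (lowpass s v) j) \<le> 2 * D" for j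
      using low_0[OF s'] lowpass_eq_0[OF s'] D
      by (intro retract_lipschitz R low_finite) (auto simp: lowpass_diff intro: order_trans[OF norm_lowpass_le])
    then have "norm (F R s u k - F R s v k) \<le> 4 * Cn * R * (2 * D) / sqrt s"
      unfolding F_def using s' R by (intro NL_diff_bound retract_low)
    then show ?thesis by simp
  qed
  show "continuous_on {0<..T} (\<lambda>s. F R s (u s) k)" if "\<And>j. continuous_on {0..T} (\<lambda>s. u s j)" for u k
    unfolding F_def using retract_low R
    by (intro continuous_on_NL continuous_on_retract that) auto
qed

end

subsection \<open>Properties of the truncated evolution\<close>

text \<open>The filter is arbitrary, so this dominated convergence serves continuity in space,
  continuity in time and the limit at time 0 alike.\<close>

lemma tannery_infsum:
  fixes f :: "'t \<Rightarrow> 'k::countable \<Rightarrow> 'b::{real_normed_algebra, banach}"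
  assumes lim: "\<And>k. ((\<lambda>t. f t k) \<longlongrightarrow> g k) Fl" and bd: "\<forall>\<^sub>F t in Fl. \<forall>k. norm (f t k) \<le> b k"
    and b: "b summable_on UNIV" and Fl: "Fl \<noteq> bot"
  shows "((\<lambda>t. \<Sum>\<^sub>\<infinity>k. f t k) \<longlongrightarrow> (\<Sum>\<^sub>\<infinity>k. g k)) Fl"
proof -
  have nat: "(\<Sum>\<^sub>\<infinity>k. c k) = (\<Sum>n. natseq c n)" if "\<And>k. norm (c k) \<le> b k" for c :: "'k \<Rightarrow> 'b"
  proof -
    have "(\<lambda>k. norm (c k)) summable_on UNIV" by (rule summable_on_comparison_test[OF b]) (use that in auto)
    from natseq_sums[OF has_sum_infsum[OF abs_summable_summable[OF this]]] show ?thesis by (rule sums_unique)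
  qed
  have g: "norm (g k) \<le> b k" for k
  proof (rule tendsto_le[OF Fl tendsto_const tendsto_norm[OF lim[of k]]])
    show "\<forall>\<^sub>F t in Fl. norm (f t k) \<le> b k" using bd by eventually_elim auto
  qed
  have "((\<lambda>t. \<Sum>n. natseq (f t) n) \<longlongrightarrow> (\<Sum>n. natseq g n)) Fl"
  proof (rule tannerys_theorem[THEN conjunct2, THEN conjunct2])
    show "((\<lambda>t. natseq (f t) n) \<longlongrightarrow> natseq g n) Fl" for n using lim by (simp add: natseq_def)
    have "\<forall>\<^sub>F t in Fl. \<forall>n. norm (natseq (f t) n) \<le> natseq b n"
      using bd by eventually_elim (simp add: natseq_def)
    then show "\<forall>\<^sub>F (n, t) in at_top \<times>\<^sub>F Fl. norm (natseq (f t) n) \<le> natseq b n"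
      by (subst eventually_prod_filter) (intro exI[of _ "\<lambda>_. True"] exI[of _ "\<lambda>t. \<forall>n. norm (natseq (f t) n) \<le> natseq b n"], auto)
    show "summable (natseq b)" by (rule natseq_summable[OF b])
  qed fact
  moreover have "\<forall>\<^sub>F t in Fl. (\<Sum>n. natseq (f t) n) = (\<Sum>\<^sub>\<infinity>k. f t k)"
    using bd by eventually_elim (use nat in auto)
  ultimately show ?thesis unfolding nat[of g, OF g] by (rule Lim_transform_eventually)
qed

lemma duhamel_linear:
  fixes h :: "'b::euclidean_space \<Rightarrow> 'c::euclidean_space"
  assumes h: "bounded_linear h"
    and f: "continuous_on {0<..t} f" "\<And>s. s \<in> {0<..t} \<Longrightarrow> norm (f s) \<le> K / sqrt s" "\<sigma> \<ge> 0"
  shows "h (duhamel \<sigma> a f t) = duhamel \<sigma> (h a) (\<lambda>s. h (f s)) t"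
proof -
  interpret bounded_linear h by fact
  show ?thesis
    using integral_linear[OF duhamel_integrable[OF f] h]
    by (simp add: duhamel_def scaleR add o_def)
qed

lemma duhamel_zero: "(\<And>s. s \<in> {0..t} \<Longrightarrow> f s = 0) \<Longrightarrow> duhamel \<sigma> a f t = exp (- (\<sigma> * t)) *\<^sub>R a"
  using integral_cong[of "{0..t}" "\<lambda>s. exp (\<sigma> * s) *\<^sub>R f s" "\<lambda>_. 0"] by (simp add: duhamel_def)

lemma knorm_ge_1: "k \<noteq> 0 \<Longrightarrow> knorm k \<ge> 1"
proof -
  assume "k \<noteq> 0"
  then obtain i where "k $ i \<noteq> 0" by (auto simp: vec_eq_iff)
  then have "1 \<le> \<bar>real_of_int (k $ i)\<bar>" by linarith
  also have "\<dots> \<le> knorm k" by (rule abs_coord_le_knorm)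
  finally show ?thesis .
qed

locale lns_trunc = lns +
  fixes R :: real
  assumes R: "R > 0"
begin

sublocale ev: singular_evolution T "8 * Cn * R" "2 * Cn * R * R" sig "F R"
  by (rule evolution[OF R])

lemma mild_bounded:
  assumes "ev.mild a u"
  obtains B where "B \<ge> 0" "\<And>t k. t \<in> {0..T} \<Longrightarrow> norm (u t k) \<le> B"
proof -
  obtain B where B: "\<forall>t\<in>{0..T}. \<forall>k. norm (u t k) \<le> B"
    using assms unfolding ev.mild_def by blast
  moreover have "0 \<le> B" using B T_pos order_trans[OF norm_ge_zero, of "u 0 0"] by auto
  ultimately show thesis using that by blast
qed

lemma mild_continuous: "ev.mild a u \<Longrightarrow> continuous_on {0..T} (\<lambda>t. u t k)"
  by (simp add: ev.mild_def)

lemma mild_duhamel: "ev.mild a u \<Longrightarrow> t \<in> {0..T} \<Longrightarrow> u t k = duhamel (sig k) (a k) (\<lambda>s. F R s (u s) k) t"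
  by (simp add: ev.mild_def)

text \<open>The active set shrinks in time, so a mode outside \<open>low t0\<close> is never forced
  after \<open>t0\<close> and only decays.\<close>

lemma mild_heat:
  assumes u: "ev.mild a u" and t0: "0 < t0" "t0 \<le> t" "t \<le> T" and k: "k \<notin> low t0"
  shows "u t k = exp (- (sig k * (t - t0))) *\<^sub>R u t0 k"
proof -
  let ?f = "\<lambda>s. exp (sig k * s) *\<^sub>R F R s (u s) k"
  have sub: "{0<..t} \<subseteq> {0<..T}" using t0 by auto
  have i: "?f integrable_on {0..t}"
    by (rule duhamel_integrable[OF continuous_on_subset[OF ev.mild_forcing(1)[OF u] sub] ev.mild_forcing(2)[OF u] sig_nonneg])
       (use sub in auto)
  have "F R s (u s) k = 0" if "s \<in> {t0..t}" for s
  proof -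
    have s: "0 < t0" "t0 \<le> s" "s \<le> T" using that t0 by auto
    then show ?thesis using k low_antimono[OF s] by (intro F_eq_0) auto
  qed
  then have "integral {t0..t} ?f = integral {t0..t} (\<lambda>_. 0)" by (intro integral_cong) simp
  then have "integral {0..t} ?f = integral {0..t0} ?f"
    using Henstock_Kurzweil_Integration.integral_combine[OF _ t0(2) i] t0 by simp
  then have "u t k = exp (- (sig k * t)) *\<^sub>R (a k + integral {0..t0} ?f)"
    "u t0 k = exp (- (sig k * t0)) *\<^sub>R (a k + integral {0..t0} ?f)"
    using mild_duhamel[OF u, of t k] mild_duhamel[OF u, of t0 k] t0 by (simp_all add: duhamel_def)
  then show ?thesis by (simp add: mult_exp_exp algebra_simps flip: scaleR_add_right)
qed

lemma mild_linear:
  fixes h :: "complex^3 \<Rightarrow> 'c::euclidean_space"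
  assumes u: "ev.mild a u" and h: "bounded_linear h" and t: "t \<in> {0..T}"
  shows "h (u t k) = duhamel (sig k) (h (a k)) (\<lambda>s. h (F R s (u s) k)) t"
proof -
  have sub: "{0<..t} \<subseteq> {0<..T}" using t by auto
  show ?thesis unfolding mild_duhamel[OF u t]
    by (rule duhamel_linear[OF h continuous_on_subset[OF ev.mild_forcing(1)[OF u] sub] ev.mild_forcing(2)[OF u] sig_nonneg])
       (use sub in auto)
qed

lemma kdot_F: "kdot k (F R s u k) = 0"
  unfolding F_def NL_def kdot_smult kdot_leray by simp

lemma mild_divfree:
  assumes "ev.mild a u" "kdot k (a k) = 0" "t \<in> {0..T}"
  shows "kdot k (u t k) = 0"
  using mild_linear[OF assms(1) bounded_linear_kdot assms(3)] assms(2) by (simp add: kdot_F duhamel_zero)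

lemma mild_mean:
  assumes "ev.mild a u" "a 0 = 0" "t \<in> {0..T}"
  shows "u t 0 = 0"
  using mild_duhamel[OF assms(1,3), of 0] assms(2) by (simp add: F_def NL_0 duhamel_zero)

text \<open>Reflection permutes \<open>low s\<close>. The sign produced by \<open>kdot\<close> at
  \<open>- k\<close> cancels the one produced by conjugating \<open>\<i>\<close>, so the
  nonlinearity commutes with reflected conjugation.\<close>

lemma F_reflect:
  assumes s: "s \<in> {0<..T}"
  shows "F R s (\<lambda>j. cnjv (u (- j))) k = cnjv (F R s u (- k))"
proof -
  have im: "uminus ` low s = low s"
    by (auto simp: image_iff intro!: bexI[of _ "- _"])
  define w where "w = retract R (low s) (lowpass s u)"
  have "fmax (low s) (lowpass s (\<lambda>j. cnjv (u (- j)))) = fmax (low s) (lowpass s u)"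
  proof -
    have eq: "(\<lambda>j. norm (lowpass s (\<lambda>j. cnjv (u (- j))) j)) = (\<lambda>j. norm (lowpass s u j)) \<circ> uminus"
      by (auto simp: lowpass_def fun_eq_iff)
    show ?thesis unfolding fmax_def eq image_comp[symmetric] im ..
  qed
  then have w: "retract R (low s) (lowpass s (\<lambda>j. cnjv (u (- j)))) = (\<lambda>j. cnjv (w (- j)))"
    by (simp add: fun_eq_iff w_def retract_def lowpass_def linear_cmul[OF bounded_linear.linear[OF bounded_linear_cnjv]])
  have "conv (low s) (\<lambda>j. cnjv (w (- j))) (\<lambda>j. cnjv (w (- j))) k = (\<Sum>l\<in>low s. kdot k (cnjv (w (- k + l))) *s cnjv (w (- l)))"
    by (simp add: conv_def)
  also have "\<dots> = (\<Sum>l\<in>uminus ` low s. kdot k (cnjv (w (- k - l))) *s cnjv (w l))"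
    by (subst sum.reindex) (auto simp: inj_on_def)
  also have "\<dots> = - cnjv (conv (low s) w w (- k))"
    unfolding im conv_def kdot_cnjv kdot_minus_left by (simp add: cnjv_def vec_eq_iff sum_negf)
  finally have c: "conv (low s) (\<lambda>j. cnjv (w (- j))) (\<lambda>j. cnjv (w (- j))) k = - cnjv (conv (low s) w w (- k))" .
  have "leray k (- cnjv x) = - cnjv (leray (- k) x)" for x
    using leray_cnjv[of "- k" x] leray_linear(4)[of k "-1" "cnjv x"] by simp
  then show ?thesis
    unfolding F_def w w_def[symmetric] NL_def c by (simp add: cnjv_def vec_eq_iff)
qed

text \<open>The reflected conjugate of a solution solves the same mild equation with the same datum;
  uniqueness identifies the two.\<close>

lemma mild_real:
  assumes u: "ev.mild a u" and a: "\<And>k. a (- k) = cnjv (a k)" and t: "t \<in> {0..T}"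
  shows "u t (- k) = cnjv (u t k)"
proof -
  define v where "v t k = cnjv (u t (- k))" for t k
  obtain B where B: "B \<ge> 0" "\<And>t k. t \<in> {0..T} \<Longrightarrow> norm (u t k) \<le> B" using mild_bounded[OF u] by blast
  have "ev.mild a v"
    unfolding ev.mild_def
  proof (intro conjI allI ballI)
    show "continuous_on {0..T} (\<lambda>t. v t k)" for k
      unfolding v_def by (intro bounded_linear.continuous_on[OF bounded_linear_cnjv] mild_continuous[OF u])
    show "\<exists>B. \<forall>t\<in>{0..T}. \<forall>k. norm (v t k) \<le> B" using B by (intro exI[of _ B]) (simp add: v_def)
    fix t k assume t: "t \<in> {0..T}"
    have ak: "cnjv (a (- k)) = a k" using a[of k] by simp
    have "v t k = duhamel (sig k) (a k) (\<lambda>s. cnjv (F R s (u s) (- k))) t"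
      using mild_linear[OF u bounded_linear_cnjv t, of "- k"] by (simp add: v_def ak sig_def)
    also have "\<dots> = duhamel (sig k) (a k) (\<lambda>s. F R s (v s) k) t"
    proof -
      have "integral {0..t} (\<lambda>s. exp (sig k * s) *\<^sub>R cnjv (F R s (u s) (- k))) = integral {0..t} (\<lambda>s. exp (sig k * s) *\<^sub>R F R s (v s) k)"
        \<comment> \<open>\<open>F_reflect\<close> covers positive times only, so the integrands are
          compared away from 0.\<close>
        by (rule integral_spike[OF negligible_sing[of 0]])
           (use t F_reflect[of _ "u _" k] in \<open>auto simp: v_def[abs_def]\<close>)
      then show ?thesis by (simp add: duhamel_def)
    qed
    finally show "v t k = duhamel (sig k) (a k) (\<lambda>s. F R s (v s) k) t" .
  qed
  from ev.mild_unique[OF u this t, of k] have "u t k = cnjv (u t (- k))" by (simp add: v_def)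
  then show ?thesis by simp
qed

text \<open>The product of \<open>128 * Cn * R * R\<close> and 8. In 128, a 16 comes from
  \<open>knorm k ^ 4 \<le> 16 * s powr (-1/2)\<close> and an 8 from integrating
  \<open>s powr (-7/8)\<close>; the last 8 comes from replacing \<open>knorm k ^ 3\<close> by
  \<open>(1 + knorm k) ^ 3\<close>.\<close>

definition C1 :: real where "C1 = 1024 * Cn * R * R"

lemma C1_nonneg: "C1 \<ge> 0" using Cn_pos R by (simp add: C1_def)

text \<open>On an active mode four powers of \<open>knorm k\<close> can be exchanged for
  \<open>s powr (-1/2)\<close>: the bound \<open>knorm k * s powr (-3/8)\<close> becomes
  \<open>s powr (-7/8) / knorm k ^ 3\<close>, up to constants. This is still integrable in time, and
  the resulting decay in \<open>k\<close> is square summable.\<close>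

lemma mild_increment:
  assumes u: "ev.mild a u" and t: "t \<in> {0..T}"
  shows "norm (u t k - exp (- (sig k * t)) *\<^sub>R a k) \<le> C1 * t powr (1/8) * sqrt (lweight k)"
proof (cases "k = 0")
  case True
  then show ?thesis using mild_duhamel[OF u t, of 0] C1_nonneg
    by (simp add: F_def NL_0 duhamel_zero lweight_def)
next
  case False
  let ?r = "knorm k"
  have r: "?r \<ge> 1" by (rule knorm_ge_1[OF False])
  have sub: "{0<..t} \<subseteq> {0<..T}" using t by auto
  have F0: "norm (F R s (u s) k) \<le> 16 * Cn * R * R / ?r ^ 3 * s powr (- 7 / 8)" if s: "s \<in> {0<..t}" for s
  proof (cases "k \<in> low s")
    case True
    have s': "s \<in> {0<..T}" using s sub by auto
    have "?r ^ 4 \<le> (2 * s powr (- 1 / 8)) ^ 4"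
      by (intro power_mono knorm_low_le[OF s' True]) auto
    also have "\<dots> = 16 * s powr (- 1 / 2)" using s by (simp add: power_mult_distrib powr_power)
    finally have r4: "?r ^ 4 \<le> 16 * s powr (- 1 / 2)" .
    have "?r * s powr (- 3 / 8) = ?r ^ 4 / ?r ^ 3 * s powr (- 3 / 8)"
      using r by (simp add: field_simps power_eq_if)
    also have "\<dots> \<le> (16 * s powr (- 1 / 2)) / ?r ^ 3 * s powr (- 3 / 8)"
      using r r4 by (intro mult_right_mono divide_right_mono) auto
    also have "\<dots> = 16 / ?r ^ 3 * s powr (- 7 / 8)"
      by (simp add: powr_add[symmetric])
    finally have "Cn * R * R * (?r * s powr (- 3 / 8)) \<le> Cn * R * R * (16 / ?r ^ 3 * s powr (- 7 / 8))"
      using Cn_pos R by (intro mult_left_mono) auto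
    then show ?thesis using F_bound[OF s' R, of "u s" k] by (simp add: mult_ac)
  next
    case False
    then show ?thesis using F_eq_0[of s k] s sub Cn_pos R r by auto
  qed
  have hi: "((\<lambda>s. 16 * Cn * R * R / ?r ^ 3 * s powr (- 7 / 8)) has_integral
      (16 * Cn * R * R / ?r ^ 3 * (t powr (- 7 / 8 + 1) / (- 7 / 8 + 1)))) {0..t}"
    using t by (intro has_integral_mult_right has_integral_powr_from_0) auto
  have "norm (duhamel (sig k) (a k) (\<lambda>s. F R s (u s) k) t - duhamel (sig k) (a k) (\<lambda>s. 0) t)
     \<le> norm (a k - a k) + 16 * Cn * R * R / ?r ^ 3 * (t powr (- 7 / 8 + 1) / (- 7 / 8 + 1))"
    by (rule duhamel_diff_bound[OF continuous_on_subset[OF ev.mild_forcing(1)[OF u] sub] ev.mild_forcing(2)[OF u]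
          _ _ sig_nonneg _ hi]) (use sub t F0 Cn_pos R in auto)
  then have "norm (u t k - exp (- (sig k * t)) *\<^sub>R a k) \<le> 128 * Cn * R * R * t powr (1/8) / ?r ^ 3"
    by (simp add: mild_duhamel[OF u t, symmetric] duhamel_zero mult_ac)
  also have "\<dots> \<le> 128 * Cn * R * R * t powr (1/8) * (8 * sqrt (lweight k))"
  proof -
    have "sqrt (lweight k) = 1 / (1 + ?r) ^ 3"
    proof -
      have "(1 + ?r) ^ 6 = ((1 + ?r) ^ 3)\<^sup>2" by (simp add: power_mult[symmetric])
      then have "sqrt ((1 + ?r) ^ 6) = (1 + ?r) ^ 3" by (intro real_sqrt_unique) auto
      then show ?thesis by (simp add: lweight_def real_sqrt_divide)
    qed
    moreover have "1 / ?r ^ 3 \<le> 8 / (1 + ?r) ^ 3"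
    proof -
      have "(1 + ?r) ^ 3 \<le> (2 * ?r) ^ 3" using r by (intro power_mono) auto
      moreover have "0 < ?r ^ 3" "0 < (1 + ?r) ^ 3" using r by (auto intro!: zero_less_power)
      ultimately show ?thesis by (simp add: frac_le_eq divide_le_eq le_divide_eq power_mult_distrib mult.commute)
    qed
    ultimately have "1 / ?r ^ 3 \<le> 8 * sqrt (lweight k)" by simp
    then have "128 * Cn * R * R * t powr (1/8) * (1 / ?r ^ 3) \<le> 128 * Cn * R * R * t powr (1/8) * (8 * sqrt (lweight k))"
      using Cn_pos R by (intro mult_left_mono) auto
    then show ?thesis by simp
  qed
  finally show ?thesis by (simp add: C1_def mult_ac)
qed

text \<open>A mode outside \<open>low (e / 2)\<close> has undergone free heat decay for a time of at
  least \<open>e / 2\<close>, which beats every power; the other modes have frequency below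
  \<open>2 * \<Lambda> (e / 2)\<close>.\<close>

lemma mild_rapid:
  assumes u: "ev.mild a u" and e: "0 < e"
  shows "\<exists>C. \<forall>t\<in>{e..T}. \<forall>k. norm (u t k) * (1 + knorm k) ^ n \<le> C"
proof (cases "e \<le> T")
  case True
  obtain B where B: "B \<ge> 0" "\<And>t k. t \<in> {0..T} \<Longrightarrow> norm (u t k) \<le> B" using mild_bounded[OF u] by blast
  define c where "c = \<nu> * (2 * pi)\<^sup>2 * (e / 2)"
  have "c > 0" using \<nu> e by (simp add: c_def)
  then obtain C where C: "\<And>r. r \<ge> 0 \<Longrightarrow> (1 + r) ^ n * exp (- (c * r\<^sup>2)) \<le> C"
    using power_exp_square_bounded by blast
  have "norm (u t k) * (1 + knorm k) ^ n \<le> B * C + B * (1 + 2 * \<Lambda> (e / 2)) ^ n" if t: "t \<in> {e..T}" for t k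
  proof (cases "k \<in> low (e / 2)")
    case True
    have "norm (u t k) * (1 + knorm k) ^ n \<le> B * (1 + 2 * \<Lambda> (e / 2)) ^ n"
      using B t e True by (intro mult_mono power_mono) (auto simp: low_def)
    moreover have "0 \<le> B * C" using B C[of 0] by (intro mult_nonneg_nonneg) (auto intro: order_trans[of 0 1])
    ultimately show ?thesis by simp
  next
    case False
    have "norm (u t k) = exp (- (sig k * (t - e / 2))) * norm (u (e / 2) k)"
      using mild_heat[OF u _ _ _ False, of t] t e by simp
    also have "\<dots> \<le> exp (- (c * (knorm k)\<^sup>2)) * B"
    proof (intro mult_mono B)
      have "\<nu> * (2 * pi * knorm k)\<^sup>2 * (e / 2) \<le> \<nu> * (2 * pi * knorm k)\<^sup>2 * (t - e / 2)"
        using \<nu> t by (intro mult_left_mono) auto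
      then show "exp (- (sig k * (t - e / 2))) \<le> exp (- (c * (knorm k)\<^sup>2))"
        by (simp add: sig_def c_def power_mult_distrib mult_ac)
    qed (use e t in auto)
    finally have "norm (u t k) * (1 + knorm k) ^ n \<le> exp (- (c * (knorm k)\<^sup>2)) * B * (1 + knorm k) ^ n"
      by (intro mult_right_mono) auto
    also have "\<dots> \<le> B * C" using C[of "knorm k"] B(1) by (simp add: mult_left_mono mult_ac)
    moreover have "0 \<le> B * (1 + 2 * \<Lambda> (e / 2)) ^ n"
      using B(1) \<Lambda>_pos[of "e / 2"] e True by (intro mult_nonneg_nonneg zero_le_power) auto
    ultimately show ?thesis by linarith
  qed
  then show ?thesis by blast
qed auto

text \<open>Conjugation exchanges \<open>k\<close> and \<open>l\<close> in the double sum
  \<open>?Z\<close>: reality turns \<open>w (k - l)\<close> into \<open>w (l - k)\<close>, and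
  vanishing divergence replaces \<open>kdot k\<close> by \<open>kdot l\<close>. Hence
  \<open>?Z\<close> is real, and its product with \<open>- (2 * pi * \<i>)\<close> has no real
  part.\<close>

lemma hdot_low_cancel:
  assumes s: "s \<in> {0<..T}" and div: "\<And>k. kdot k (w k) = 0" and real: "\<And>k. w (- k) = cnjv (w k)"
  shows "(\<Sum>k\<in>low s. ((- (2 * pi * \<i>)) *s conv (low s) w w k) \<bullet> w k) = 0"
proof -
  let ?L = "low s"
  let ?Z = "\<Sum>k\<in>?L. \<Sum>l\<in>?L. kdot k (w (k - l)) * hdot (w l) (w k)"
  have hd: "hdot (conv ?L w w k) (w k) = (\<Sum>l\<in>?L. kdot k (w (k - l)) * hdot (w l) (w k))" for k
    by (simp add: conv_def hdot_def sum_distrib_left sum_distrib_right sum_distrib_right[symmetric] sum.swap[of _ UNIV] mult.assoc)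
  have "cnj ?Z = (\<Sum>k\<in>?L. \<Sum>l\<in>?L. kdot l (w (l - k)) * hdot (w k) (w l))"
  proof -
    have "cnj (kdot k (w (k - l)) * hdot (w l) (w k)) = kdot l (w (l - k)) * hdot (w k) (w l)" for k l
    proof -
      have "cnj (kdot k (w (k - l))) = kdot k (w (l - k))" using real[of "k - l"] by (simp add: kdot_cnjv)
      also have "\<dots> = kdot l (w (l - k))" using div[of "l - k"] by (simp add: kdot_diff_left)
      finally show ?thesis by (simp add: hdot_def mult.commute)
    qed
    then show ?thesis by simp
  qed
  also have "\<dots> = ?Z" by (rule sum.swap)
  finally have cz: "cnj ?Z = ?Z" .
  have "cnj z = z \<Longrightarrow> Im z = 0" for z by (simp add: complex_eq_iff)
  from this[OF cz] have im: "Im ?Z = 0" .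
  have "(\<Sum>k\<in>?L. ((- (2 * pi * \<i>)) *s conv ?L w w k) \<bullet> w k) = Re ((- (2 * pi * \<i>)) * ?Z)"
    unfolding smult_inner hd by (simp only: sum_distrib_left Re_sum)
  also have "\<dots> = 0" using im by simp
  finally show ?thesis .
qed

text \<open>Because the retraction scales all modes by one factor \<open>p\<close>, it contributes
  just \<open>p^2\<close>. The outer multiplier \<open>m s k\<close> moves onto \<open>u\<close>,
  and \<open>leray\<close> disappears against a divergence-free field, so
  \<open>hdot_low_cancel\<close> applies to the filtered field.\<close>

lemma F_energy_cancel:
  assumes s: "s \<in> {0<..T}" and div: "\<And>k. kdot k (u k) = 0" and real: "\<And>k. u (- k) = cnjv (u k)"
  shows "(\<Sum>k\<in>low s. F R s u k \<bullet> u k) = 0"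
proof -
  define p where "p = R / max R (fmax (low s) (lowpass s u))"
  have rt: "retract R (low s) (lowpass s u) = (\<lambda>j. p *\<^sub>R lowpass s u j)"
    by (auto simp: retract_def p_def)
  have "F R s u k \<bullet> u k = p\<^sup>2 * (((- (2 * pi * \<i>)) *s conv (low s) (lowpass s u) (lowpass s u) k) \<bullet> lowpass s u k)" for k
  proof -
    have "F R s u k = leray k (p\<^sup>2 *\<^sub>R (m s k *\<^sub>R ((- (2 * pi * \<i>)) *s conv (low s) (lowpass s u) (lowpass s u) k)))"
    proof -
      have "(- (2 * pi * \<i>) * of_real (m s k)) *s x = m s k *\<^sub>R ((- (2 * pi * \<i>)) *s x)" for x :: "complex^3"
        by (simp add: vec_eq_iff scaleR_nth del: vector_scaleR_component)
      moreover have "c *s (r *\<^sub>R x) = r *\<^sub>R (c *s x)" for c r and x :: "complex^3"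
        by (simp add: vec_eq_iff scaleR_nth del: vector_scaleR_component)
      ultimately show ?thesis
        unfolding F_def NL_def rt conv_scale leray_linear(3)[symmetric] by (simp only: scaleR_left_commute)
    qed
    then show ?thesis by (simp add: leray_inner[OF div] lowpass_def)
  qed
  then have "(\<Sum>k\<in>low s. F R s u k \<bullet> u k) =
     p\<^sup>2 * (\<Sum>k\<in>low s. ((- (2 * pi * \<i>)) *s conv (low s) (lowpass s u) (lowpass s u) k) \<bullet> lowpass s u k)"
    by (simp add: sum_distrib_left)
  also have "\<dots> = 0"
    using hdot_low_cancel[OF s, of "lowpass s u"] div real
    by (simp add: lowpass_def kdot_scaleR linear_cmul[OF bounded_linear.linear[OF bounded_linear_cnjv]])
  finally show ?thesis .
qed

end

subsection \<open>Energy balance and smoothness of the Fourier coefficients\<close>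

lemma bounded_bilinear_smult: "bounded_bilinear ((*s) :: complex \<Rightarrow> complex^3 \<Rightarrow> complex^3)"
proof (rule bounded_bilinear.intro)
  show "\<exists>K. \<forall>a b. norm (a *s b :: complex^3) \<le> norm a * norm b * K"
    by (rule exI[of _ 1]) (simp add: norm_smult)
qed (simp_all add: vec_eq_iff scaleR_nth scaleR_conv_of_real[where 'a=complex] algebra_simps del: vector_scaleR_component)

lemmas Ck_on_smult = Ck_on_bilinear[OF bounded_bilinear_smult]

lemma Ck_on_of_real: "Ck_on n S f \<Longrightarrow> Ck_on n S (\<lambda>x. of_real (f x) :: complex)"
  by (rule Ck_on_bounded_linear[OF bounded_linear_of_real])

locale lns_sol = lns_trunc +
  fixes a :: "int^3 \<Rightarrow> complex^3" and u :: "real \<Rightarrow> int^3 \<Rightarrow> complex^3"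
  assumes mild: "ev.mild a u" and a_sq: "(\<lambda>k. (norm (a k))\<^sup>2) summable_on UNIV"
    and a_le: "(\<Sum>\<^sub>\<infinity>k. (norm (a k))\<^sup>2) \<le> R\<^sup>2"
    and a_div: "\<And>k. kdot k (a k) = 0" and a_real: "\<And>k. a (- k) = cnjv (a k)" and a_mean: "a 0 = 0"
begin

lemmas u_cont = mild_continuous[OF mild] and u_div = mild_divfree[OF mild a_div]
  and u_mean = mild_mean[OF mild a_mean] and u_real = mild_real[OF mild a_real] and u_0 = ev.mild_0[OF mild]

text \<open>A majorant of the squared modes for all times at once; its summability drives the
  dominated limits in time, in particular at time 0.\<close>

definition sqb :: "int^3 \<Rightarrow> real" where
  "sqb k = 2 * (norm (a k))\<^sup>2 + 2 * (C1 * T powr (1/8))\<^sup>2 * lweight k"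

lemma sqb_summable: "sqb summable_on UNIV"
  unfolding sqb_def by (intro summable_on_add summable_on_cmult_right a_sq summable_lweight)

lemma u_sq_le:
  assumes t: "t \<in> {0..T}"
  shows "(norm (u t k))\<^sup>2 \<le> sqb k"
proof -
  have "norm (u t k) \<le> norm (exp (- (sig k * t)) *\<^sub>R a k) + norm (u t k - exp (- (sig k * t)) *\<^sub>R a k)"
    using norm_triangle_ineq[of "exp (- (sig k * t)) *\<^sub>R a k" "u t k - exp (- (sig k * t)) *\<^sub>R a k"] by simp
  also have "\<dots> \<le> norm (a k) + C1 * T powr (1/8) * sqrt (lweight k)"
  proof (rule add_mono)
    show "norm (exp (- (sig k * t)) *\<^sub>R a k) \<le> norm (a k)"
      using sig_nonneg[of k] t by (simp add: mult_left_le_one_le)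
    have "C1 * t powr (1/8) * sqrt (lweight k) \<le> C1 * T powr (1/8) * sqrt (lweight k)"
      using t C1_nonneg lweight_pos[of k] by (intro mult_right_mono mult_left_mono powr_mono2) auto
    then show "norm (u t k - exp (- (sig k * t)) *\<^sub>R a k) \<le> C1 * T powr (1/8) * sqrt (lweight k)"
      using mild_increment[OF mild t, of k] by simp
  qed
  finally have "(norm (u t k))\<^sup>2 \<le> (norm (a k) + C1 * T powr (1/8) * sqrt (lweight k))\<^sup>2"
    by (intro power_mono) auto
  also have "\<dots> \<le> 2 * (norm (a k))\<^sup>2 + 2 * (C1 * T powr (1/8) * sqrt (lweight k))\<^sup>2"
    using sum_squares_bound[of "norm (a k)" "C1 * T powr (1/8) * sqrt (lweight k)"] by (simp add: power2_sum)
  also have "\<dots> = sqb k" using lweight_pos[of k] by (simp add: sqb_def power_mult_distrib)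
  finally show ?thesis .
qed

lemma u_sq_summable: "t \<in> {0..T} \<Longrightarrow> (\<lambda>k. (norm (u t k))\<^sup>2) summable_on UNIV"
  by (rule summable_on_comparison_test[OF sqb_summable]) (use u_sq_le in auto)

definition E :: "real \<Rightarrow> real" where "E t = (\<Sum>\<^sub>\<infinity>k. (norm (u t k))\<^sup>2)"

text \<open>\<open>sig\<close> contains the viscosity, so by Parseval this is \<open>\<nu>\<close>
  times the squared norm of the gradient; \<open>E\<close> is the squared norm of the field, without
  the factor one half.\<close>

definition D :: "real \<Rightarrow> real" where "D t = (\<Sum>\<^sub>\<infinity>k. sig k * (norm (u t k))\<^sup>2)"

lemma u_tendsto: "t \<in> {0..T} \<Longrightarrow> ((\<lambda>s. u s k) \<longlongrightarrow> u t k) (at t within {0..T})"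
  using u_cont[of k] by (simp add: continuous_on_def)

lemma at_within_T_not_bot: "t \<in> {0..T} \<Longrightarrow> at t within {0..T} \<noteq> bot"
  using T_pos by (simp add: trivial_limit_within islimpt_Icc)

lemma u_L2_continuous:
  assumes t: "t \<in> {0..T}"
  shows "((\<lambda>s. \<Sum>\<^sub>\<infinity>k. (norm (u s k - u t k))\<^sup>2) \<longlongrightarrow> 0) (at t within {0..T})"
proof -
  have "((\<lambda>s. \<Sum>\<^sub>\<infinity>k. (norm (u s k - u t k))\<^sup>2) \<longlongrightarrow> (\<Sum>\<^sub>\<infinity>k::int^3. 0)) (at t within {0..T})"
  proof (rule tannery_infsum[OF _ _ summable_on_cmult_right[OF sqb_summable, of 4] at_within_T_not_bot[OF t]])
    show "((\<lambda>s. (norm (u s k - u t k))\<^sup>2) \<longlongrightarrow> 0) (at t within {0..T})" for k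
    proof -
      have "((\<lambda>s. (norm (u s k - u t k))\<^sup>2) \<longlongrightarrow> (norm (u t k - u t k))\<^sup>2) (at t within {0..T})"
        by (intro tendsto_intros u_tendsto t)
      then show ?thesis by simp
    qed
    have "norm ((norm (u s k - u t k))\<^sup>2) \<le> 4 * sqb k" if s: "s \<in> {0..T}" for s k
    proof -
      have "(norm (u s k - u t k))\<^sup>2 \<le> (norm (u s k) + norm (u t k))\<^sup>2"
        by (intro power_mono norm_triangle_ineq4) auto
      also have "\<dots> \<le> 2 * (norm (u s k))\<^sup>2 + 2 * (norm (u t k))\<^sup>2"
        using sum_squares_bound[of "norm (u s k)" "norm (u t k)"] by (simp add: power2_sum)
      also have "\<dots> \<le> 4 * sqb k" using u_sq_le[OF s, of k] u_sq_le[OF t, of k] by simp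
      finally show ?thesis by simp
    qed
    then show "\<forall>\<^sub>F s in at t within {0..T}. \<forall>k. norm ((norm (u s k - u t k))\<^sup>2) \<le> 4 * sqb k"
      by (auto simp: eventually_at_filter)
  qed
  then show ?thesis by simp
qed

lemma E_tendsto_0: "(E \<longlongrightarrow> E 0) (at 0 within {0..T})"
  unfolding E_def
proof (rule tannery_infsum[OF _ _ sqb_summable at_within_T_not_bot])
  show "((\<lambda>s. (norm (u s k))\<^sup>2) \<longlongrightarrow> (norm (u 0 k))\<^sup>2) (at 0 within {0..T})" for k
    using T_pos by (intro tendsto_intros u_tendsto) auto
  show "\<forall>\<^sub>F s in at 0 within {0..T}. \<forall>k. norm ((norm (u s k))\<^sup>2) \<le> sqb k"
    using u_sq_le by (auto simp: eventually_at_filter)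
qed (use T_pos in auto)

lemma D_term_bound:
  assumes e: "0 < e"
  obtains C where "\<And>t k. t \<in> {e..T} \<Longrightarrow> sig k * (norm (u t k))\<^sup>2 \<le> C * lweight k"
proof -
  \<comment> \<open>Squaring gives 16 powers of decay; two are spent on \<open>sig k\<close>, and
    six of the rest make up \<open>lweight\<close>.\<close>
  obtain C where C: "\<And>t k. t \<in> {e..T} \<Longrightarrow> norm (u t k) * (1 + knorm k) ^ 8 \<le> C"
    using mild_rapid[OF mild e, of 8] by blast
  have "sig k * (norm (u t k))\<^sup>2 \<le> \<nu> * (2 * pi)\<^sup>2 * C\<^sup>2 * lweight k" if t: "t \<in> {e..T}" for t k
  proof -
    let ?x = "1 + knorm k"
    have x: "?x \<ge> 1" by simp
    have "0 < ?x ^ 8" using x by (intro zero_less_power) linarith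
    then have "norm (u t k) \<le> C / ?x ^ 8" using C[OF t, of k] by (simp only: pos_le_divide_eq)
    then have "(norm (u t k))\<^sup>2 \<le> (C / ?x ^ 8)\<^sup>2" by (intro power_mono) auto
    moreover have "sig k \<le> \<nu> * (2 * pi)\<^sup>2 * ?x\<^sup>2"
      using \<nu> by (auto simp: sig_def power_mult_distrib intro!: mult_left_mono power_mono)
    ultimately have "sig k * (norm (u t k))\<^sup>2 \<le> (\<nu> * (2 * pi)\<^sup>2 * ?x\<^sup>2) * (C / ?x ^ 8)\<^sup>2"
      using \<nu> by (intro mult_mono) auto
    also have "\<dots> = \<nu> * (2 * pi)\<^sup>2 * C\<^sup>2 * (?x\<^sup>2 / ?x ^ 16)"
      by (simp add: power_divide power_mult[symmetric])
    also have "?x\<^sup>2 / ?x ^ 16 \<le> lweight k"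
    proof -
      have "?x\<^sup>2 * ?x ^ 6 \<le> ?x ^ 16" using x by (simp add: power_add[symmetric] power_increasing)
      moreover have "0 < ?x ^ 16" "0 < ?x ^ 6" using x by (intro zero_less_power; linarith)+
      ultimately show ?thesis unfolding lweight_def by (simp add: divide_le_eq le_divide_eq)
    qed
    then have "\<nu> * (2 * pi)\<^sup>2 * C\<^sup>2 * (?x\<^sup>2 / ?x ^ 16) \<le> \<nu> * (2 * pi)\<^sup>2 * C\<^sup>2 * lweight k"
      using \<nu> by (intro mult_left_mono) auto
    finally show ?thesis .
  qed
  then show thesis by (rule that)
qed

lemma D_summable: "t \<in> {0<..T} \<Longrightarrow> (\<lambda>k. sig k * (norm (u t k))\<^sup>2) summable_on UNIV"
proof -
  assume t: "t \<in> {0<..T}"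
  obtain C where "\<And>s k. s \<in> {t..T} \<Longrightarrow> sig k * (norm (u s k))\<^sup>2 \<le> C * lweight k"
    using D_term_bound[of t] t by auto
  then show ?thesis
    by (intro summable_on_comparison_test[OF summable_on_cmult_right[OF summable_lweight, of C]])
       (use t sig_nonneg in auto)
qed

lemma D_nonneg: "D t \<ge> 0"
  unfolding D_def using sig_nonneg by (intro infsum_nonneg) auto

lemma u_inner_derivative:
  assumes t: "t \<in> {0<..<T}"
  shows "((\<lambda>s. (norm (u s k))\<^sup>2) has_vector_derivative
     (2 * (F R t (u t) k \<bullet> u t k) - 2 * (sig k * (norm (u t k))\<^sup>2))) (at t)"
proof -
  have sub: "{0<..<T} \<subseteq> {0<..T}" by auto
  have d: "((\<lambda>s. u s k) has_vector_derivative (- sig k *\<^sub>R u t k + F R t (u t) k)) (at t)"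
    using ev.mild_has_derivative[OF mild, of t k] t at_within_open_subset[OF t _ sub] by auto
  have "((\<lambda>s. u s k \<bullet> u s k) has_vector_derivative
      (u t k \<bullet> (- sig k *\<^sub>R u t k + F R t (u t) k) + (- sig k *\<^sub>R u t k + F R t (u t) k) \<bullet> u t k)) (at t)"
    by (rule bounded_bilinear.has_vector_derivative[OF bounded_bilinear_inner d d])
  moreover have "u t k \<bullet> (- sig k *\<^sub>R u t k + F R t (u t) k) + (- sig k *\<^sub>R u t k + F R t (u t) k) \<bullet> u t k
     = 2 * (F R t (u t) k \<bullet> u t k) - 2 * (sig k * (norm (u t k))\<^sup>2)"
    by (simp add: inner_add_left inner_add_right inner_diff_left inner_diff_right inner_commute[of "u t k" "F R t (u t) k"] dot_square_norm)
  ultimately show ?thesis by (simp add: dot_square_norm)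
qed

text \<open>Summing the balances of single modes rests on two facts: the dissipation series may be
  integrated termwise on \<open>[e, t]\<close>, and the exchange terms live on \<open>low e\<close>,
  where \<open>F_energy_cancel\<close> makes their sum vanish at each time.\<close>

lemma energy_eps:
  assumes e: "0 < e" "e \<le> t" "t \<le> T"
  shows "set_integrable lborel {e..t} D" "E t + 2 * (LINT s:{e..t}|lborel. D s) = E e"
proof -
  let ?M = "restrict_space lborel {e..t}"
  let ?g = "\<lambda>k s. sig k * (norm (u s k))\<^sup>2"
  have sub: "{e..t} \<subseteq> {0..T}" "{e..t} \<subseteq> {0<..T}" using e by auto
  have gc: "continuous_on {e..t} (?g k)" for k
    by (intro continuous_intros continuous_on_subset[OF u_cont sub(1)])
  obtain C where C: "\<And>s k. s \<in> {e..T} \<Longrightarrow> ?g k s \<le> C * lweight k" using D_term_bound[OF e(1)] by blast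
  have fm: "finite_measure ?M"
    using e by (intro finite_measureI) (simp add: emeasure_restrict_space space_restrict_space)
  have meas: "?g k \<in> borel_measurable ?M" for k
    using borel_measurable_continuous_on_indicator[OF _ gc, of k] by (simp add: borel_measurable_restrict_space_iff)
  have bd: "norm (?g k s) \<le> C * lweight k" if "s \<in> space ?M" for k s
    using C[of s k] that sig_nonneg[of k] e by (simp add: space_restrict_space abs_mult)
  note summ = summable_on_cmult_right[OF summable_lweight, of C]
  have hs: "integrable ?M (\<lambda>s. \<Sum>\<^sub>\<infinity>k. ?g k s)"
    "((\<lambda>k. integral\<^sup>L ?M (?g k)) has_sum integral\<^sup>L ?M (\<lambda>s. \<Sum>\<^sub>\<infinity>k. ?g k s)) UNIV"
    by (rule integral_has_sum[OF fm meas _ summ]; rule bd; assumption)+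
  have int: "integral\<^sup>L ?M f = (LINT s:{e..t}|lborel. f s)" for f :: "real \<Rightarrow> real"
    by (subst integral_restrict_space) (auto simp: set_lebesgue_integral_def)
  show D: "set_integrable lborel {e..t} D"
    using hs(1) by (subst (asm) integrable_restrict_space) (auto simp: set_integrable_def D_def[abs_def])
  have sum1: "((\<lambda>k. integral {e..t} (?g k)) has_sum (LINT s:{e..t}|lborel. D s)) UNIV"
  proof -
    have eq: "(\<lambda>k. LINT s:{e..t}|lborel. ?g k s) = (\<lambda>k. integral {e..t} (?g k))"
      by (intro ext set_borel_integral_eq_integral borel_integrable_atLeastAtMost'[OF gc])
    show ?thesis using hs(2) unfolding int eq D_def .
  qed
  \<comment> \<open>\<open>J k\<close> is the amount that the nonlinearity feeds into mode
    \<open>k\<close>. It is summed twice, as a convergent series of its three parts and as a finite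
    sum over \<open>low e\<close>; the values must agree.\<close>
  define J where "J k = (norm (u t k))\<^sup>2 + (-1) * (norm (u e k))\<^sup>2 + 2 * integral {e..t} (?g k)" for k
  have "(J has_sum (E t + (-1) * E e + 2 * (LINT s:{e..t}|lborel. D s))) UNIV"
    unfolding J_def E_def using sum1 e
    by (intro has_sum_add has_sum_cmult_right has_sum_infsum u_sq_summable) auto
  moreover have J_eq: "(\<lambda>s. 2 * (F R s (u s) k \<bullet> u s k)) integrable_on {e..t}"
     "J k = integral {e..t} (\<lambda>s. 2 * (F R s (u s) k \<bullet> u s k))" for k
  proof -
    have "((\<lambda>s. 2 * (F R s (u s) k \<bullet> u s k) - 2 * ?g k s) has_integral ((norm (u t k))\<^sup>2 - (norm (u e k))\<^sup>2)) {e..t}"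
      by (rule fundamental_theorem_of_calculus_interior[OF e(2)])
         (use e in \<open>auto intro!: continuous_intros continuous_on_subset[OF u_cont sub(1)] u_inner_derivative\<close>)
    moreover have "((\<lambda>s. 2 * ?g k s) has_integral 2 * integral {e..t} (?g k)) {e..t}"
      by (intro has_integral_mult_right integrable_integral integrable_continuous_interval gc)
    ultimately have hi: "((\<lambda>s. (2 * (F R s (u s) k \<bullet> u s k) - 2 * ?g k s) + 2 * ?g k s) has_integral
        ((norm (u t k))\<^sup>2 - (norm (u e k))\<^sup>2 + 2 * integral {e..t} (?g k))) {e..t}"
      by (rule has_integral_add)
    then have "((\<lambda>s. 2 * (F R s (u s) k \<bullet> u s k)) has_integral J k) {e..t}" by (simp add: J_def)
    then show "(\<lambda>s. 2 * (F R s (u s) k \<bullet> u s k)) integrable_on {e..t}"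
      "J k = integral {e..t} (\<lambda>s. 2 * (F R s (u s) k \<bullet> u s k))"
      by (auto simp only: integral_unique intro: has_integral_integrable)
  qed
  have F0: "F R s (u s) k = 0" if "s \<in> {e..t}" "k \<notin> low e" for s k
    using that e low_antimono[of e s] by (intro F_eq_0) auto
  have "(J has_sum (\<Sum>k\<in>low e. J k)) UNIV"
  proof (rule has_sum_finite_neutralI[OF low_finite])
    show "J k = 0" if "k \<in> UNIV - low e" for k
      using F0[of _ k] that integral_cong[of "{e..t}" "\<lambda>s. 2 * (F R s (u s) k \<bullet> u s k)" "\<lambda>_. 0"] by (simp add: J_eq(2))
  qed auto
  moreover have "(\<Sum>k\<in>low e. J k) = 0"
  proof -
    have "(\<Sum>k\<in>low e. J k) = integral {e..t} (\<lambda>s. \<Sum>k\<in>low e. 2 * (F R s (u s) k \<bullet> u s k))"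
      unfolding J_eq(2) by (rule integral_sum[symmetric]) (use J_eq(1) low_finite in auto)
    also have "\<dots> = integral {e..t} (\<lambda>_. 0)"
    proof (rule integral_cong)
      fix s assume s: "s \<in> {e..t}"
      then have s': "s \<in> {0<..T}" "s \<in> {0..T}" using sub by auto
      have "(\<Sum>k\<in>low e. F R s (u s) k \<bullet> u s k) = (\<Sum>k\<in>low s. F R s (u s) k \<bullet> u s k)"
        using s e low_antimono[of e s] F_eq_0[OF s'(1)] by (intro sum.mono_neutral_right low_finite) auto
      also have "\<dots> = 0" by (intro F_energy_cancel s' u_div u_real)
      finally show "(\<Sum>k\<in>low e. 2 * (F R s (u s) k \<bullet> u s k)) = 0" by (simp add: sum_distrib_left[symmetric])
    qed
    finally show ?thesis by simp
  qed
  ultimately have "E t + (-1) * E e + 2 * (LINT s:{e..t}|lborel. D s) = 0" using has_sum_unique by fastforce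
  then show "E t + 2 * (LINT s:{e..t}|lborel. D s) = E e" by simp
qed

text \<open>Integrability of \<open>D\<close> up to time 0 is a conclusion here, so monotone
  convergence of nonnegative integrals is used as the lower limit tends to 0;
  \<open>E_tendsto_0\<close> supplies the limit of the other side.\<close>

lemma energy_nn:
  assumes t: "t \<in> {0..T}"
  shows "E t \<le> E 0" "(\<integral>\<^sup>+s\<in>{0..t}. ennreal (D s) \<partial>lborel) = ennreal ((E 0 - E t) / 2)"
proof -
  have "E t \<le> E 0 \<and> (\<integral>\<^sup>+s\<in>{0..t}. ennreal (D s) \<partial>lborel) = ennreal ((E 0 - E t) / 2)"
  proof (cases "t = 0")
    case True
    have "(\<integral>\<^sup>+s\<in>{0::real}. ennreal (D s) \<partial>lborel) = 0"
    proof -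
      have "(\<integral>\<^sup>+s\<in>{0::real}. ennreal (D s) \<partial>lborel) = (\<integral>\<^sup>+s. ennreal (D 0) * indicator {0::real} s \<partial>lborel)"
        by (intro nn_integral_cong) (auto simp: indicator_def)
      then show ?thesis by (simp add: nn_integral_cmult_indicator)
    qed
    then show ?thesis using True by simp
  next
    case False
    then have t0: "0 < t" "t \<le> T" using t by auto
    define e where "e n = t / real (n + 1)" for n
    have e: "0 < e n" "e n \<le> t" for n using t0 by (auto simp: e_def field_simps)
    have e_anti: "e (Suc n) \<le> e n" for n unfolding e_def using t0 by (intro divide_left_mono) auto
    have e_lim: "e \<longlonglongrightarrow> 0" unfolding e_def using LIMSEQ_ignore_initial_segment[OF lim_const_over_n[of t], of 1] by simp
    have "filterlim e (at 0 within {0..T}) sequentially"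
      by (auto simp: filterlim_at e_lim intro!: eventuallyI e order_trans[OF e(2) t0(2)] less_imp_le[OF e(1)] less_imp_neq[OF e(1), symmetric])
    then have E_lim: "(\<lambda>n. E (e n)) \<longlonglongrightarrow> E 0" by (rule filterlim_compose[OF E_tendsto_0])
    note en = energy_eps[OF e t0(2)]
    have "E t \<le> E (e n)" for n
    proof -
      have "0 \<le> (LINT s:{e n..t}|lborel. D s)"
        unfolding set_lebesgue_integral_def using D_nonneg by (intro Bochner_Integration.integral_nonneg) auto
      then show ?thesis using en(2)[of n] by simp
    qed
    then have le: "E t \<le> E 0" by (intro LIMSEQ_le_const[OF E_lim]) auto
    let ?f = "\<lambda>n s. ennreal (indicator {e n..t} s * D s)"
    have "(\<lambda>n. \<integral>\<^sup>+s. ?f n s \<partial>lborel) \<longlonglongrightarrow> (\<integral>\<^sup>+s. ennreal (indicator {0<..t} s * D s) \<partial>lborel)"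
    proof (rule nn_integral_LIMSEQ)
      show "incseq ?f"
        using e_anti D_nonneg by (intro incseq_SucI le_funI ennreal_leI) (auto simp: indicator_def intro: order_trans)
      show "?f n \<in> borel_measurable lborel" for n
        using en(1)[of n] by (auto simp: set_integrable_def dest: borel_measurable_integrable)
      show "(\<lambda>n. ?f n s) \<longlonglongrightarrow> ennreal (indicator {0<..t} s * D s)" for s
      proof (cases "0 < s")
        case True
        then have "\<forall>\<^sub>F n in sequentially. e n < s" using e_lim by (intro order_tendstoD)
        then have "\<forall>\<^sub>F n in sequentially. ?f n s = ennreal (indicator {0<..t} s * D s)"
          by eventually_elim (use True in \<open>auto simp: indicator_def\<close>)
        then show ?thesis by (rule tendsto_eventually)
      next
        case False
        then have "?f n s = ennreal (indicator {0<..t} s * D s)" for n using e(1)[of n] by (auto simp: indicator_def)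
        then show ?thesis by simp
      qed
    qed
    moreover have "(\<integral>\<^sup>+s. ?f n s \<partial>lborel) = ennreal ((E (e n) - E t) / 2)" for n
    proof -
      have "(\<integral>s. indicator {e n..t} s * D s \<partial>lborel) = (E (e n) - E t) / 2"
        using en(2)[of n] by (simp add: set_lebesgue_integral_def)
      then show ?thesis using en(1)[of n] D_nonneg
        by (subst nn_integral_eq_integral) (auto simp only: set_integrable_def real_scaleR_def intro!: AE_I2 mult_nonneg_nonneg indicator_pos_le)
    qed
    moreover have "(\<lambda>n. ennreal ((E (e n) - E t) / 2)) \<longlonglongrightarrow> ennreal ((E 0 - E t) / 2)"
      by (intro tendsto_intros E_lim) auto
    ultimately have "(\<integral>\<^sup>+s. ennreal (indicator {0<..t} s * D s) \<partial>lborel) = ennreal ((E 0 - E t) / 2)"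
      using LIMSEQ_unique by auto
    moreover have "(\<integral>\<^sup>+s\<in>{0..t}. ennreal (D s) \<partial>lborel) = (\<integral>\<^sup>+s. ennreal (indicator {0<..t} s * D s) \<partial>lborel)"
      by (rule nn_integral_cong_AE, rule AE_mp[OF AE_lborel_singleton[of 0]]) (auto simp: indicator_def)
    ultimately show ?thesis using le by simp
  qed
  then show "E t \<le> E 0" "(\<integral>\<^sup>+s\<in>{0..t}. ennreal (D s) \<partial>lborel) = ennreal ((E 0 - E t) / 2)" by auto
qed

lemma E_0: "E 0 = (\<Sum>\<^sub>\<infinity>k. (norm (a k))\<^sup>2)"
  by (simp add: E_def u_0)

text \<open>One mode carries at most the whole of \<open>E\<close>, which does not exceed its value
  for the datum.\<close>

lemma u_le_R:
  assumes t: "t \<in> {0..T}"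
  shows "norm (u t k) \<le> R"
proof -
  have "sum (\<lambda>k. (norm (u t k))\<^sup>2) {k} \<le> E t"
    unfolding E_def using u_sq_summable[OF t] by (intro finite_sum_le_infsum) auto
  then have "(norm (u t k))\<^sup>2 \<le> R\<^sup>2" using energy_nn(1)[OF t] a_le by (simp add: E_0)
  then show ?thesis using R by (simp add: power2_le_iff_abs_le)
qed

lemma F_u: "t \<in> {0<..T} \<Longrightarrow> F R t (u t) k = NL t (lowpass t (u t)) (lowpass t (u t)) k"
  by (rule F_eq_NL) (use R u_le_R in auto)

text \<open>Near any positive time the derivative of one mode involves finitely many others, so all
  modes gain one derivative simultaneously; hence the induction over arbitrary
  \<open>k\<close>.\<close>

lemma u_smooth: "Ck_on n {0<..T} (\<lambda>t. u t k)"
proof (induction n arbitrary: k)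
  case 0
  show ?case unfolding Ck_on.simps by (rule continuous_on_subset[OF u_cont]) auto
next
  case (Suc n)
  show ?case
  proof (rule Ck_on_Suc_realI)
    show "((\<lambda>t. u t k) has_vector_derivative (- sig k *\<^sub>R u t k + F R t (u t) k)) (at t within {0<..T})" if "t \<in> {0<..T}" for t
      by (rule ev.mild_has_derivative[OF mild that])
    have "Ck_on n {0<..T} (\<lambda>t. F R t (u t) k)"
    proof (rule Ck_on_Ioc_local)
      fix c assume c: "0 < c" "c < T"
      have sub: "{c<..T} \<subseteq> {0<..T}" using c by auto
      have lp: "Ck_on n {c<..T} (\<lambda>t. lowpass t (u t) j)" for j
        unfolding lowpass_def by (intro Ck_on_scaleR Ck_on_subset[OF m_smooth sub] Ck_on_subset[OF Suc.IH sub])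
      have "Ck_on n {c<..T} (\<lambda>t. (- (2 * pi * \<i>) * of_real (m t k)) *s leray k (conv (low c) (lowpass t (u t)) (lowpass t (u t)) k))"
        unfolding conv_def
        by (intro Ck_on_smult Ck_on_mult Ck_on_const Ck_on_of_real Ck_on_subset[OF m_smooth sub]
            Ck_on_bounded_linear[OF bounded_linear_leray] Ck_on_sum Ck_on_bounded_linear[OF bounded_linear_kdot] lp)
      moreover have "conv (low c) (lowpass t (u t)) (lowpass t (u t)) k = conv (low t) (lowpass t (u t)) (lowpass t (u t)) k"
        if "t \<in> {c<..T}" for t
        using that c low_antimono[of c t] lowpass_eq_0[of t] by (intro conv_mono_neutral[symmetric] low_finite) auto
      ultimately show "Ck_on n {c<..T} (\<lambda>t. F R t (u t) k)"
        using sub by (elim Ck_on_cong) (auto simp: F_u NL_def)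
    qed
    then show "Ck_on n {0<..T} (\<lambda>t. - sig k *\<^sub>R u t k + F R t (u t) k)"
      by (intro Ck_on_add Ck_on_bounded_linear[OF bounded_linear_scaleR_right] Suc.IH)
  qed
qed

text \<open>The iterated time derivatives are given abstractly; on a mode that only decays,
  uniqueness of derivatives forces them to be the explicit ones.\<close>

lemma heat_iterates:
  assumes D0: "D' 0 = (\<lambda>t. u t k $ i)"
    and D: "\<And>n t. t \<in> {0<..T} \<Longrightarrow> (D' n has_vector_derivative D' (Suc n) t) (at t within {0<..T})"
    and c: "0 < c" and k: "k \<notin> low c" and t: "t \<in> {c<..T}"
  shows "D' n t = of_real ((- sig k) ^ n * exp (- (sig k * (t - c)))) * u c k $ i"
  using t
proof (induction n arbitrary: t)
  case 0
  then show ?case using mild_heat[OF mild c _ _ k, of t] by (simp add: D0 scaleR_conv_of_real[where 'a=complex])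
next
  case (Suc n)
  let ?h = "\<lambda>n t. of_real ((- sig k) ^ n * exp (- (sig k * (t - c)))) * u c k $ i"
  have "(D' n has_vector_derivative D' (Suc n) t) (at t within {c<..T})"
    by (rule has_vector_derivative_within_subset[OF D]) (use Suc.prems c in auto)
  moreover have "(D' n has_vector_derivative ?h (Suc n) t) (at t within {c<..T})"
  proof (rule has_vector_derivative_transform[OF Suc.prems Suc.IH])
    have "((\<lambda>t. (- sig k) ^ n * exp (- (sig k * (t - c)))) has_real_derivative ((- sig k) ^ Suc n * exp (- (sig k * (t - c))))) (at t within {c<..T})"
      by (auto intro!: derivative_eq_intros)
    then show "(?h n has_vector_derivative ?h (Suc n) t) (at t within {c<..T})"
      by (intro has_vector_derivative_mult_left has_vector_derivative_of_real)
         (simp add: has_real_derivative_iff_has_vector_derivative)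
  qed
  ultimately show ?case
    by (rule vector_derivative_unique_within[OF at_within_Ioc_not_bot[OF Suc.prems]])
qed

text \<open>High modes are explicit exponentials whose decay beats the powers of
  \<open>sig k\<close> produced by differentiation; the remaining modes are finitely many and
  bounded by compactness of \<open>[t0, T]\<close>.\<close>

lemma u_smooth_coef: "smooth_coef T (\<lambda>t k. u t k $ i)"
proof -
  have "\<exists>D'. D' 0 = (\<lambda>t. u t k $ i) \<and> (\<forall>n. continuous_on {0<..T} (D' n)) \<and>
     (\<forall>n. \<forall>t\<in>{0<..T}. (D' n has_vector_derivative D' (Suc n) t) (at t within {0<..T}))" for k
  proof -
    have "smooth_on {0<..T} (\<lambda>t. u t k $ i)"
      unfolding smooth_on_def by (intro allI Ck_on_vec_nth u_smooth)
    then show ?thesis by (rule smooth_on_iterates) blast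
  qed
  then obtain D' where D0: "\<And>k. D' k 0 = (\<lambda>t. u t k $ i)" and Dc: "\<And>k n. continuous_on {0<..T} (D' k n)"
    and Dd: "\<And>k n t. t \<in> {0<..T} \<Longrightarrow> (D' k n has_vector_derivative D' k (Suc n) t) (at t within {0<..T})"
    by metis
  have "rapid T (\<lambda>t k. D' k n t)" for n
    unfolding rapid_def
  proof (intro allI impI)
    fix p and t0 :: real assume t0: "0 < t0"
    show "\<exists>C. \<forall>t\<in>{t0..T}. \<forall>k. cmod (D' k n t) * (1 + knorm k) ^ p \<le> C"
    proof (cases "t0 \<le> T")
      case True
      define c where "c = t0 / 2"
      have c: "0 < c" "c < t0" "c \<le> T" using t0 True by (auto simp: c_def)
      define q where "q = \<nu> * (2 * pi)\<^sup>2"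
      have q: "q > 0" using \<nu> by (simp add: q_def)
      \<comment> \<open>Each time derivative contributes one factor \<open>sig k\<close>, hence two
        powers of the frequency.\<close>
      then obtain C where C: "\<And>r. r \<ge> 0 \<Longrightarrow> (1 + r) ^ (2 * n + p) * exp (- (q * c * r\<^sup>2)) \<le> C"
        using power_exp_square_bounded[of "q * c"] c by (metis mult_pos_pos)
      have sig: "sig k = q * (knorm k)\<^sup>2" for k by (simp add: sig_def q_def power_mult_distrib)
      have high: "cmod (D' k n t) * (1 + knorm k) ^ p \<le> q ^ n * R * C" if t: "t \<in> {t0..T}" and k: "k \<notin> low c" for t k
      proof -
        have "cmod (D' k n t) = sig k ^ n * exp (- (sig k * (t - c))) * cmod (u c k $ i)"
          using heat_iterates[OF D0 Dd c(1) k, of t n] t c sig_nonneg[of k] by (simp add: norm_mult norm_power)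
        also have "\<dots> \<le> (q * (1 + knorm k)\<^sup>2) ^ n * exp (- (q * c * (knorm k)\<^sup>2)) * R"
        proof (intro mult_mono)
          show "sig k ^ n \<le> (q * (1 + knorm k)\<^sup>2) ^ n"
            unfolding sig using q by (intro power_mono mult_left_mono) auto
          have "q * (knorm k)\<^sup>2 * c \<le> q * (knorm k)\<^sup>2 * (t - c)"
            using q t by (intro mult_left_mono) (auto simp: c_def)
          then show "exp (- (sig k * (t - c))) \<le> exp (- (q * c * (knorm k)\<^sup>2))" unfolding sig by (simp add: mult_ac)
          show "cmod (u c k $ i) \<le> R"
            using u_le_R[of c k] Finite_Cartesian_Product.norm_nth_le[of "u c k" i] c by auto
        qed (use q in auto)
        finally have "cmod (D' k n t) * (1 + knorm k) ^ p \<le>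
            (q * (1 + knorm k)\<^sup>2) ^ n * exp (- (q * c * (knorm k)\<^sup>2)) * R * (1 + knorm k) ^ p"
          by (intro mult_right_mono) auto
        also have "\<dots> = q ^ n * R * ((1 + knorm k) ^ (2 * n + p) * exp (- (q * c * (knorm k)\<^sup>2)))"
        proof -
          have "((1 + knorm k)\<^sup>2) ^ n = (1 + knorm k) ^ (2 * n)" by (simp add: power_mult)
          then show ?thesis by (simp add: power_mult_distrib power_add mult_ac)
        qed
        also have "\<dots> \<le> q ^ n * R * C" using q R C[of "knorm k"] by (intro mult_left_mono) auto
        finally show ?thesis .
      qed
      have "\<exists>B. \<forall>t\<in>{t0..T}. cmod (D' k n t) * (1 + knorm k) ^ p \<le> B" for k
      proof -
        have "continuous_on {t0..T} (\<lambda>t. cmod (D' k n t) * (1 + knorm k) ^ p)"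
          by (intro continuous_intros continuous_on_subset[OF Dc]) (use t0 in auto)
        then have "bdd_above ((\<lambda>t. cmod (D' k n t) * (1 + knorm k) ^ p) ` {t0..T})"
          by (intro bounded_imp_bdd_above compact_imp_bounded compact_continuous_image) auto
        then show ?thesis by (auto simp: bdd_above_def)
      qed
      then obtain B where B: "\<And>k t. t \<in> {t0..T} \<Longrightarrow> cmod (D' k n t) * (1 + knorm k) ^ p \<le> B k" by metis
      have B0: "0 \<le> B k" for k using order_trans[OF _ B[of T k]] True by auto
      have C0: "0 \<le> q ^ n * R * C" using order_trans[OF _ C[of 0]] q R by (intro mult_nonneg_nonneg) auto
      have "cmod (D' k n t) * (1 + knorm k) ^ p \<le> q ^ n * R * C + (\<Sum>k\<in>low c. B k)" if t: "t \<in> {t0..T}" for t k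
      proof (cases "k \<in> low c")
        case True
        then show ?thesis using B[OF t, of k] member_le_sum[of k "low c" B] B0 low_finite C0 by force
      next
        case False
        then show ?thesis using high[OF t] sum_nonneg[of "low c" B] B0 by force
      qed
      then show ?thesis by blast
    qed auto
  qed
  then show ?thesis unfolding smooth_coef_def
    by (intro exI[of _ "\<lambda>n t k. D' k n t"] conjI allI ballI Dd) (auto simp: D0 fun_eq_iff)
qed

end

subsection \<open>Smooth periodic test functions\<close>

lemma Ck_on_UNIV_differentiable: "Ck_on (Suc n) UNIV f \<Longrightarrow> f differentiable (at x)"
  by (auto simp: differentiable_def)

lemma Ck_on_pd:
  fixes f :: "real^3 \<Rightarrow> 'b::real_normed_vector"
  assumes "Ck_on (Suc n) UNIV f"
  shows "Ck_on n UNIV (pd j f)"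
proof -
  obtain f' where f': "\<And>x. (f has_derivative f' x) (at x)" "\<And>v. Ck_on n UNIV (\<lambda>x. f' x v)"
    using assms by auto
  have "pd j f = (\<lambda>x. f' x (axis j 1))"
    using frechet_derivative_at[OF f'(1)] by (simp add: pd_def fun_eq_iff)
  then show ?thesis using f'(2) by simp
qed

definition vtest :: "(real^3 \<Rightarrow> 'b::euclidean_space) \<Rightarrow> bool" where
  "vtest f \<longleftrightarrow> periodic f \<and> smooth_on UNIV f"

lemma vtest_Ck: "vtest f \<Longrightarrow> Ck_on n UNIV f"
  by (simp add: vtest_def smooth_on_def)

lemma vtest_differentiable: "vtest f \<Longrightarrow> f differentiable (at x)"
  by (rule Ck_on_UNIV_differentiable[OF vtest_Ck[where n="Suc 0"]])

lemma vtest_continuous: "vtest f \<Longrightarrow> continuous_on UNIV f"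
  using vtest_Ck[of f 0] by simp

lemma vtest_pd: "vtest f \<Longrightarrow> vtest (pd j f)"
  using Ck_on_pd vtest_Ck periodic_pd[of f j] vtest_differentiable
  unfolding vtest_def smooth_on_def by blast

lemma vtest_sum: "(\<And>i. i \<in> I \<Longrightarrow> vtest (f i)) \<Longrightarrow> vtest (\<lambda>x. \<Sum>i\<in>I. f i x)"
  by (auto simp: vtest_def smooth_on_def periodic_def intro!: Ck_on_sum)

lemma vtest_laplacian: "vtest f \<Longrightarrow> vtest (laplacian f)"
  unfolding laplacian_def[abs_def] by (intro vtest_sum vtest_pd)

lemma vtest_nth: "vtest f \<Longrightarrow> vtest (\<lambda>x. f x $ i)"
  by (auto simp: vtest_def smooth_on_def periodic_def intro: Ck_on_vec_nth)

lemma pd_nth: "vtest f \<Longrightarrow> pd j (\<lambda>x. f x $ i) x = pd j f x $ i"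
proof -
  assume f: "vtest f"
  have "((\<lambda>x. f x $ i) has_derivative (\<lambda>h. frechet_derivative f (at x) h $ i)) (at x)"
    by (rule bounded_linear.has_derivative[OF bounded_linear_vec_nth frechet_derivative_works[THEN iffD1]])
       (rule vtest_differentiable[OF f])
  from frechet_derivative_at[OF this] show ?thesis by (simp add: pd_def fun_eq_iff)
qed

lemma laplacian_nth: "vtest f \<Longrightarrow> laplacian f x $ i = laplacian (\<lambda>x. f x $ i) x"
proof -
  assume f: "vtest f"
  have "pd j (\<lambda>x. f x $ i) = (\<lambda>x. pd j f x $ i)" for j by (rule ext) (rule pd_nth[OF f])
  then show ?thesis by (simp add: laplacian_def pd_nth[OF vtest_pd[OF f]])
qed

lemma continuous_periodic_in_L2:
  fixes f :: "real^3 \<Rightarrow> 'b::euclidean_space"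
  assumes "continuous_on UNIV f" "periodic f"
  shows "in_L 2 f"
  using assms by (auto simp: in_L2_iff intro!: borel_measurable_continuous_onI integrable_torus_continuous continuous_intros)

lemma vtest_in_L2: "vtest f \<Longrightarrow> in_L 2 f"
  by (rule continuous_periodic_in_L2[OF vtest_continuous]) (auto simp: vtest_def)

lemma vtest_fcoeff_pd: "vtest f \<Longrightarrow> fcoeff (pd j f) k = 2 * pi * \<i> * of_int (k $ j) * fcoeff f k"
  by (rule fcoeff_pd) (auto simp: vtest_def[of f] intro: vtest_differentiable vtest_continuous[OF vtest_pd])

lemma vtest_vcoef_laplacian:
  assumes f: "vtest f"
  shows "vcoef (laplacian f) k = - ((2 * pi * knorm k)\<^sup>2) *\<^sub>R vcoef f k"
proof -
  have "fcoeff (laplacian g) k = of_real (- ((2 * pi * knorm k)\<^sup>2)) * fcoeff g k" if g: "vtest g" for g :: "real^3 \<Rightarrow> real"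
  proof -
    have i: "integrable torus (pd j (pd j g))" for j
      by (intro integrable_torus_continuous vtest_continuous vtest_pd g)
    have "fcoeff (laplacian g) k = (\<Sum>j\<in>UNIV. fcoeff (pd j (pd j g)) k)"
      unfolding laplacian_def fcoeff_fexp of_real_sum sum_distrib_right
      by (rule Bochner_Integration.integral_sum) (intro integrable_mult_fexp integrable_of_real i)
    also have "\<dots> = (\<Sum>j\<in>UNIV. - of_real ((2 * pi * of_int (k $ j))\<^sup>2) * fcoeff g k)"
      by (simp add: vtest_fcoeff_pd[OF vtest_pd[OF g]] vtest_fcoeff_pd[OF g] power2_eq_square mult_ac)
    also have "\<dots> = of_real (- ((2 * pi * knorm k)\<^sup>2)) * fcoeff g k"
      by (simp add: sum_distrib_right[symmetric] sum_negf power_mult_distrib norm_vec_sq sum_distrib_left[symmetric])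
    finally show ?thesis .
  qed
  from this[OF vtest_nth[OF f]] show ?thesis
    by (simp add: vcoef_def vec_eq_iff laplacian_nth[OF f] scaleR_conv_of_real[where 'a=complex])
qed

text \<open>Four Laplacians give decay of order 8: six powers go into the summable
  \<open>lweight\<close>, and two are kept in reserve for the growth of \<open>sig k\<close>. The
  factor 256 is \<open>2 ^ 8\<close>, from comparing \<open>1 + knorm k\<close> with
  \<open>knorm k\<close>.\<close>

lemma vtest_vcoef_decay:
  fixes f :: "real^3 \<Rightarrow> real^3"
  assumes f: "vtest f"
  obtains C where "\<And>k. norm (vcoef f k) \<le> C * (lweight k / (1 + knorm k)\<^sup>2)"
proof -
  let ?L = "laplacian (laplacian (laplacian (laplacian f)))"
  obtain C0 C4 where C: "\<And>k. norm (vcoef f k) \<le> C0" "\<And>k. norm (vcoef ?L k) \<le> C4"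
    using norm_vcoef_le[OF vtest_in_L2[OF f]]
      norm_vcoef_le[OF vtest_in_L2[OF vtest_laplacian[OF vtest_laplacian[OF vtest_laplacian[OF vtest_laplacian[OF f]]]]]]
    by blast
  have "norm (vcoef f k) \<le> 256 * (C0 + C4) * (lweight k / (1 + knorm k)\<^sup>2)" for k
  proof -
    let ?r = "knorm k"
    have L: "norm (vcoef ?L k) = (2 * pi * ?r) ^ 8 * norm (vcoef f k)"
    proof -
      define q where "q = (2 * pi * ?r)\<^sup>2"
      have "q \<ge> 0" "q ^ 4 = (2 * pi * ?r) ^ 8" by (simp_all add: q_def power_mult[symmetric])
      moreover have "vcoef ?L k = (- q) *\<^sub>R ((- q) *\<^sub>R ((- q) *\<^sub>R ((- q) *\<^sub>R vcoef f k)))"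
        unfolding q_def using f by (simp only: vtest_vcoef_laplacian vtest_laplacian)
      ultimately show ?thesis by (simp add: eval_nat_numeral mult_ac)
    qed
    have "?r ^ 8 \<le> (2 * pi * ?r) ^ 8"
      using pi_ge_two by (intro power_mono) (auto simp: mult_le_cancel_right1)
    moreover have "(1 + ?r) ^ 8 \<le> 256 * (1 + ?r ^ 8)"
    proof (cases "?r \<le> 1")
      case True
      then have "(1 + ?r) ^ 8 \<le> 2 ^ 8" by (intro power_mono) auto
      also have "(2::real) ^ 8 \<le> 256 * (1 + ?r ^ 8)" by simp
      finally show ?thesis .
    next
      case False
      then have "(1 + ?r) ^ 8 \<le> (2 * ?r) ^ 8" by (intro power_mono) auto
      then show ?thesis by (simp add: power_mult_distrib)
    qed
    ultimately have "(1 + ?r) ^ 8 \<le> 256 * (1 + (2 * pi * ?r) ^ 8)"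
      by (meson add_left_mono mult_left_mono order_trans zero_le_numeral)
    then have "(1 + ?r) ^ 8 * norm (vcoef f k) \<le> 256 * (1 + (2 * pi * ?r) ^ 8) * norm (vcoef f k)"
      by (rule mult_right_mono) simp
    also have "\<dots> = 256 * (norm (vcoef f k) + norm (vcoef ?L k))" unfolding L by (simp add: distrib_right)
    also have "\<dots> \<le> 256 * (C0 + C4)" using C[of k] by simp
    finally have "(1 + ?r) ^ 8 * norm (vcoef f k) \<le> 256 * (C0 + C4)" .
    moreover have "0 < (1 + ?r) ^ 8" by (intro zero_less_power) (auto intro: add_pos_nonneg)
    ultimately have "norm (vcoef f k) \<le> 256 * (C0 + C4) / (1 + ?r) ^ 8"
      by (simp only: pos_le_divide_eq mult.commute)
    also have "\<dots> = 256 * (C0 + C4) * (lweight k / (1 + ?r)\<^sup>2)"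
      by (simp add: lweight_def power_add[symmetric])
    finally show ?thesis .
  qed
  then show thesis by (rule that)
qed

lemma Ck_on_fexp: "Ck_on n S (fexp k)"
proof (induction n)
  case 0
  then show ?case by (auto intro!: continuous_intros)
next
  case (Suc n)
  then show ?case unfolding Ck_on.simps
    by (intro exI[of _ "\<lambda>x v. (2 * pi * \<i> * of_real (lattice_vec k \<bullet> v)) * fexp k x"] conjI ballI allI
        fexp_has_derivative Ck_on_mult Ck_on_const)
qed

text \<open>The test fields with two-point spectrum isolate single Fourier coefficients.\<close>

definition mode :: "int^3 \<Rightarrow> complex \<Rightarrow> real^3 \<Rightarrow> real" where
  "mode k z x = 2 * Re (z * fexp k x)"

definition vmode :: "int^3 \<Rightarrow> complex^3 \<Rightarrow> real^3 \<Rightarrow> real^3" where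
  "vmode k y x = (\<chi> i. mode k (y $ i) x)"

lemma vtest_mode: "vtest (mode k z)"
proof -
  have "bounded_linear (\<lambda>y. 2 * Re (z * y))"
    by (intro bounded_linear_const_mult bounded_linear_Re bounded_linear_compose[OF bounded_linear_Re] bounded_linear_mult_right)
  from Ck_on_bounded_linear[OF this Ck_on_fexp] show ?thesis
    by (simp add: vtest_def smooth_on_def mode_def[abs_def] periodic_def periodic_fexp)
qed

lemma vtest_vmode: "vtest (vmode k y)"
  using vtest_mode by (auto simp: vtest_def smooth_on_def vmode_def periodic_def intro!: Ck_on_vecI)

text \<open>Written as a sum of two cases because \<open>k\<close> and \<open>- k\<close> coincide
  for \<open>k = 0\<close>, where both contribute.\<close>

lemma fcoeff_mode: "fcoeff (mode k z) l = (if l = k then z else 0) + (if l = - k then cnj z else 0)"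
proof -
  have e: "of_real (mode k z x) * fexp (- l) x = z * fexp (k - l) x + cnj z * fexp (- k - l) x" for x
  proof -
    have "of_real (mode k z x) = z * fexp k x + cnj (z * fexp k x)"
      unfolding mode_def complex_add_cnj by simp
    then show ?thesis by (simp add: fexp_uminus fexp_diff algebra_simps)
  qed
  have "integrable torus (\<lambda>x. c * fexp k x)" for c k
    by (intro integrable_torus_continuous continuous_intros)
  then show ?thesis unfolding fcoeff_fexp e by (auto simp: integral_fexp)
qed

lemma vcoef_vmode: "vcoef (vmode k y) l = (if l = k then y else 0) + (if l = - k then cnjv y else 0)"
  by (rule vec_eq_iff[THEN iffD2]) (auto simp: vcoef_def vmode_def fcoeff_mode cnjv_def)

lemma has_sum_single: "((\<lambda>l. if l = k then f l else 0) has_sum f k) UNIV" for f :: "_ \<Rightarrow> real"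
  by (rule has_sum_finite_neutralI[of "{k}"]) auto

text \<open>By Hermitian symmetry the frequencies \<open>k\<close> and \<open>- k\<close> contribute
  equally, whence the factor 2.\<close>

lemma pairing_vmode:
  assumes x: "\<And>l. x (- l) = cnjv (x l)"
  shows "((\<lambda>l. x l \<bullet> vcoef (vmode k y) l) has_sum (2 * (x k \<bullet> y))) UNIV"
proof -
  have "((\<lambda>l. (if l = k then x l \<bullet> y else 0) + (if l = - k then x l \<bullet> cnjv y else 0)) has_sum (x k \<bullet> y + x (- k) \<bullet> cnjv y)) UNIV"
    by (intro has_sum_add has_sum_single)
  moreover have "x (- k) \<bullet> cnjv y = x k \<bullet> y"
    unfolding x by (simp add: cnjv_def inner_vec_def inner_complex_def)
  moreover have "(if l = k then x l \<bullet> y else 0) + (if l = - k then x l \<bullet> cnjv y else 0) = x l \<bullet> vcoef (vmode k y) l" for l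
    by (simp only: vcoef_vmode inner_add_right if_distrib[of "(\<bullet>) (x l)"] inner_zero_right)
  ultimately show ?thesis by simp
qed

lemma pairing_mode:
  assumes x: "\<And>l. x (- l) = cnj (x l)"
  shows "((\<lambda>l. x l \<bullet> fcoeff (mode k z) l) has_sum (2 * (x k \<bullet> z))) UNIV"
proof -
  have "((\<lambda>l. (if l = k then x l \<bullet> z else 0) + (if l = - k then x l \<bullet> cnj z else 0)) has_sum (x k \<bullet> z + x (- k) \<bullet> cnj z)) UNIV"
    by (intro has_sum_add has_sum_single)
  moreover have "x (- k) \<bullet> cnj z = x k \<bullet> z"
    unfolding x by (simp add: inner_complex_def)
  moreover have "(if l = k then x l \<bullet> z else 0) + (if l = - k then x l \<bullet> cnj z else 0) = x l \<bullet> fcoeff (mode k z) l" for l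
    by (simp only: fcoeff_mode inner_add_right if_distrib[of "(\<bullet>) (x l)"] inner_zero_right)
  ultimately show ?thesis by simp
qed

lemma vcoef_hermitian: "vcoef f (- k) = cnjv (vcoef f k)"
  by (simp add: vec_eq_iff vcoef_uminus cnjv_def)

lemma test_scalar_vtest: "test_scalar \<psi> \<longleftrightarrow> vtest \<psi>"
  by (simp add: test_scalar_def vtest_def)

text \<open>Multiplication by an imaginary number is skew for the real inner product: this is
  integration by parts on the Fourier side.\<close>

lemma inner_mult_i: "x \<bullet> (2 * pi * \<i> * of_int n * z) = (- (2 * pi * \<i> * of_int n * x)) \<bullet> z" for x z :: complex
  by (simp add: inner_complex_def algebra_simps)

lemma has_sum_integral_pd:
  assumes f: "in_L 2 f" and \<psi>: "vtest \<psi>"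
  shows "((\<lambda>k. (- (2 * pi * \<i> * of_int (k $ j) * vcoef f k $ i)) \<bullet> fcoeff \<psi> k) has_sum (\<integral>x. f x $ i * pd j \<psi> x \<partial>torus)) UNIV"
proof -
  have g: "pd j \<psi> \<in> borel_measurable borel" "integrable torus (\<lambda>x. (pd j \<psi> x)\<^sup>2)"
    using in_L2_component[OF vtest_in_L2[OF vtest_pd[OF \<psi>, where j=j]], where b=1] by simp_all
  from parseval_inner[OF in_L2_component_vec(1,2)[OF f] g, of i] show ?thesis
    unfolding vtest_fcoeff_pd[OF \<psi>] inner_mult_i by (simp add: vcoef_def)
qed

lemma has_sum_integral_div:
  assumes f: "in_L 2 f" and \<psi>: "vtest \<psi>"
  shows "((\<lambda>k. (- (2 * pi * \<i> * kdot k (vcoef f k))) \<bullet> fcoeff \<psi> k) has_sum (\<integral>x. (\<Sum>j\<in>UNIV. f x $ j * pd j \<psi> x) \<partial>torus)) UNIV"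
proof -
  have i: "integrable torus (\<lambda>x. f x $ j * pd j \<psi> x)" for j
    using in_L2_component[OF vtest_in_L2[OF vtest_pd[OF \<psi>, where j=j]], where b=1]
    by (intro integrable_square_sum in_L2_component_vec[OF f]) auto
  have "((\<lambda>k. \<Sum>j\<in>UNIV. (- (2 * pi * \<i> * of_int (k $ j) * vcoef f k $ j)) \<bullet> fcoeff \<psi> k) has_sum
     (\<Sum>j\<in>UNIV. \<integral>x. f x $ j * pd j \<psi> x \<partial>torus)) UNIV"
    by (intro has_sum_finite_sum has_sum_integral_pd f \<psi>) auto
  moreover have "(\<Sum>j\<in>UNIV. \<integral>x. f x $ j * pd j \<psi> x \<partial>torus) = (\<integral>x. (\<Sum>j\<in>UNIV. f x $ j * pd j \<psi> x) \<partial>torus)"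
    using i by simp
  moreover have "(\<Sum>j\<in>UNIV. (- (2 * pi * \<i> * of_int (k $ j) * vcoef f k $ j)) \<bullet> fcoeff \<psi> k)
      = (- (2 * pi * \<i> * kdot k (vcoef f k))) \<bullet> fcoeff \<psi> k" for k
    by (simp add: inner_sum_left[symmetric] kdot_def sum_distrib_left sum_negf mult_ac)
  ultimately show ?thesis by simp
qed

text \<open>A test function whose amplitude at \<open>k\<close> is the coefficient of the divergence
  itself turns the vanishing pairing into a vanishing square.\<close>

lemma div_free_iff:
  assumes f: "in_L 2 f"
  shows "div_free f \<longleftrightarrow> (\<forall>k. kdot k (vcoef f k) = 0)"
proof
  assume "div_free f"
  show "\<forall>k. kdot k (vcoef f k) = 0"
  proof
    fix k
    let ?x = "\<lambda>l. - (2 * pi * \<i> * kdot l (vcoef f l))"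
    have "?x (- l) = cnj (?x l)" for l
      by (simp add: vcoef_hermitian kdot_minus_left kdot_cnjv)
    from pairing_mode[of ?x k "?x k", OF this] has_sum_integral_div[OF f vtest_mode[of k "?x k"]]
    have "2 * (?x k \<bullet> ?x k) = (\<integral>x. (\<Sum>j\<in>UNIV. f x $ j * pd j (mode k (?x k)) x) \<partial>torus)"
      by (rule has_sum_unique)
    also have "\<dots> = 0" using \<open>div_free f\<close> vtest_mode by (simp add: div_free_def test_scalar_vtest)
    finally show "kdot k (vcoef f k) = 0" by simp
  qed
next
  assume k: "\<forall>k. kdot k (vcoef f k) = 0"
  have "(\<integral>x. (\<Sum>j\<in>UNIV. f x $ j * pd j \<psi> x) \<partial>torus) = 0" if "vtest \<psi>" for \<psi>
    using has_sum_unique[OF has_sum_integral_div[OF f that]] k by simp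
  then show "div_free f" by (simp add: div_free_def test_scalar_vtest)
qed

lemma mean_free_iff:
  assumes f: "in_L 2 f"
  shows "mean_free f \<longleftrightarrow> vcoef f 0 = 0"
proof -
  have i: "integrable torus f"
  proof -
    have "integrable torus (\<lambda>x. norm (f x))"
    proof (rule square_integrable_integrable)
      have [measurable]: "f \<in> borel_measurable borel" using f by (simp add: in_L2_iff)
      show "(\<lambda>x. norm (f x)) \<in> borel_measurable borel" by measurable
      show "integrable torus (\<lambda>x. (norm (f x))\<^sup>2)" using f by (simp add: in_L2_iff)
    qed
    moreover have "f \<in> borel_measurable torus" using f by (intro borel_measurable_torus) (simp add: in_L2_iff)
    ultimately show ?thesis by (rule integrable_norm_cancel)
  qed
  have "(\<integral>x. f x \<partial>torus) $ j = (\<integral>x. f x $ j \<partial>torus)" for j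
    by (rule integral_bounded_linear[OF bounded_linear_vec_nth i, symmetric])
  moreover have "vcoef f 0 $ j = of_real (\<integral>x. f x $ j \<partial>torus)" for j
    by (simp add: vcoef_def fcoeff_fexp)
  ultimately have "vcoef f 0 = (\<chi> j. of_real ((\<integral>x. f x \<partial>torus) $ j))" by (simp add: vec_eq_iff)
  then show ?thesis by (simp add: mean_free_def vec_eq_iff)
qed

lemma solenoidal_testD:
  assumes "solenoidal_test \<eta>"
  shows "vtest \<eta>" "kdot k (vcoef \<eta> k) = 0"
proof -
  show \<eta>: "vtest \<eta>" using assms by (simp add: solenoidal_test_def vtest_def)
  let ?d = "\<lambda>x. \<Sum>j\<in>UNIV. pd j \<eta> x $ j"
  have i: "integrable torus (\<lambda>x. pd j \<eta> x $ j)" for j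
    by (intro integrable_torus_continuous vtest_continuous vtest_nth vtest_pd \<eta>)
  have "fcoeff ?d k = (\<Sum>j\<in>UNIV. fcoeff (\<lambda>x. pd j \<eta> x $ j) k)"
    unfolding fcoeff_fexp of_real_sum sum_distrib_right
    by (rule Bochner_Integration.integral_sum) (intro integrable_mult_fexp integrable_of_real i)
  also have "\<dots> = (\<Sum>j\<in>UNIV. fcoeff (pd j (\<lambda>x. \<eta> x $ j)) k)"
    by (simp add: pd_nth[OF \<eta>, symmetric])
  also have "\<dots> = 2 * pi * \<i> * kdot k (vcoef \<eta> k)"
    by (simp add: vtest_fcoeff_pd[OF vtest_nth[OF \<eta>]] kdot_def vcoef_def sum_distrib_left mult_ac)
  finally have "fcoeff ?d k = 2 * pi * \<i> * kdot k (vcoef \<eta> k)" .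
  moreover have "?d = (\<lambda>_. 0)" using assms by (auto simp: solenoidal_test_def)
  moreover have "fcoeff (\<lambda>_. 0) k = 0" by (simp add: fcoeff_fexp)
  ultimately show "kdot k (vcoef \<eta> k) = 0" by (metis mult_eq_0_iff of_real_eq_0_iff pi_neq_zero zero_neq_numeral complex_i_not_zero)
qed

lemma pd_mode: "pd j (mode k z) x = 2 * Re (2 * pi * \<i> * of_int (k $ j) * z * fexp k x)"
proof -
  have "((\<lambda>x. 2 * Re (z * fexp k x)) has_derivative
      (\<lambda>v. 2 * Re (z * ((2 * pi * \<i> * of_real (lattice_vec k \<bullet> v)) * fexp k x)))) (at x)"
    by (intro has_derivative_mult_right has_derivative_Re fexp_has_derivative)
  from fun_cong[OF frechet_derivative_at[OF this], of "axis j 1"]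
  have "pd j (mode k z) x = 2 * Re (z * ((2 * pi * \<i> * of_real (lattice_vec k \<bullet> axis j 1)) * fexp k x))"
    unfolding pd_def mode_def[abs_def] by (rule sym)
  also have "z * ((2 * pi * \<i> * of_real (lattice_vec k \<bullet> axis j 1)) * fexp k x) = 2 * pi * \<i> * of_int (k $ j) * z * fexp k x"
    by (simp add: inner_axis mult_ac)
  finally show ?thesis .
qed

lemma solenoidal_vmode:
  assumes "kdot k y = 0"
  shows "solenoidal_test (vmode k y)"
proof -
  have "(\<Sum>j\<in>UNIV. pd j (vmode k y) x $ j) = 0" for x
  proof -
    have "(\<Sum>j\<in>UNIV. pd j (vmode k y) x $ j) = (\<Sum>j\<in>UNIV. pd j (mode k (y $ j)) x)"
      by (simp add: pd_nth[OF vtest_vmode, symmetric] vmode_def)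
    also have "\<dots> = 2 * Re (2 * pi * \<i> * kdot k y * fexp k x)"
      unfolding pd_mode kdot_def sum_distrib_left[symmetric] Re_sum[symmetric] sum_distrib_right
      by (simp add: sum_distrib_left mult_ac)
    finally show ?thesis using assms by simp
  qed
  then show ?thesis using vtest_vmode[of k y] by (simp add: solenoidal_test_def vtest_def)
qed

subsection \<open>Synthesis of fields from Fourier coefficients\<close>

text \<open>Meant for Hermitian coefficients, whose series is real (\<open>sser_complex\<close>);
  \<open>Re\<close> then only adjusts the type.\<close>

definition sser :: "(int^3 \<Rightarrow> complex) \<Rightarrow> real^3 \<Rightarrow> real" where
  "sser c x = Re (\<Sum>\<^sub>\<infinity>k. c k * fexp k x)"

definition synth :: "(int^3 \<Rightarrow> complex^3) \<Rightarrow> real^3 \<Rightarrow> real^3" where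
  "synth c x = (\<chi> i. sser (\<lambda>k. c k $ i) x)"

lemma periodic_sser: "periodic (sser c)"
  by (simp add: periodic_def sser_def periodic_fexp)

lemma continuous_sser:
  assumes c: "(\<lambda>k. norm (c k)) summable_on UNIV"
  shows "continuous_on UNIV (sser c)"
proof -
  have "((\<lambda>y. \<Sum>\<^sub>\<infinity>k. c k * fexp k y) \<longlongrightarrow> (\<Sum>\<^sub>\<infinity>k. c k * fexp k x)) (at x)" for x
  proof (rule tannery_infsum[OF _ _ c])
    have "isCont (fexp k) x" for k
      using continuous_on_fexp[OF continuous_on_id[of UNIV]] by (simp add: continuous_on_eq_continuous_at)
    then show "((\<lambda>y. c k * fexp k y) \<longlongrightarrow> c k * fexp k x) (at x)" for k
      by (intro tendsto_intros) (simp add: isCont_def)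
  qed (auto simp: norm_mult)
  then show ?thesis unfolding sser_def[abs_def]
    by (intro continuous_intros) (simp add: continuous_on_eq_continuous_at isCont_def)
qed

lemma sser_complex:
  assumes herm: "\<And>k. c (- k) = cnj (c k)"
  shows "of_real (sser c x) = (\<Sum>\<^sub>\<infinity>k. c k * fexp k x)"
proof -
  have "cnj (\<Sum>\<^sub>\<infinity>k. c k * fexp k x) = (\<Sum>\<^sub>\<infinity>k. c (- k) * fexp (- k) x)"
    by (simp add: infsum_cnj[symmetric] herm fexp_uminus)
  also have "\<dots> = (\<Sum>\<^sub>\<infinity>k. c k * fexp k x)"
    by (rule infsum_reindex_bij_betw) (rule bij_uminus)
  finally show ?thesis by (simp add: sser_def complex_eq_iff)
qed

lemma fcoeff_sser:
  assumes c: "(\<lambda>k. norm (c k)) summable_on UNIV" and herm: "\<And>k. c (- k) = cnj (c k)"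
  shows "fcoeff (sser c) k = c k"
proof -
  have e: "of_real (sser c x) * fexp (- k) x = (\<Sum>\<^sub>\<infinity>l. c l * fexp (l - k) x)" for x
    unfolding sser_complex[where c=c, OF herm]
    by (simp add: infsum_cmult_left'[symmetric] fexp_diff fexp_uminus mult.assoc)
  have "((\<lambda>l. \<integral>x. c l * fexp (l - k) x \<partial>torus) has_sum (\<integral>x. (\<Sum>\<^sub>\<infinity>l. c l * fexp (l - k) x) \<partial>torus)) UNIV"
    by (rule integral_has_sum[OF torus.finite_measure_axioms _ _ c]) (auto simp: norm_mult)
  moreover have "(\<integral>x. c l * fexp (l - k) x \<partial>torus) = (if l = k then c k else 0)" for l
    by (simp add: integral_fexp)
  moreover have "((\<lambda>l. if l = k then c k else 0) has_sum c k) UNIV"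
    by (rule has_sum_finite_neutralI[of "{k}"]) auto
  ultimately have "(\<integral>x. (\<Sum>\<^sub>\<infinity>l. c l * fexp (l - k) x) \<partial>torus) = c k"
    using has_sum_unique by fastforce
  then show ?thesis by (simp add: fcoeff_fexp e)
qed

lemma summable_nth: "(\<lambda>k. norm (c k)) summable_on UNIV \<Longrightarrow> (\<lambda>k. norm (c k $ i :: complex)) summable_on UNIV"
  by (rule summable_on_comparison_test) (auto simp: Finite_Cartesian_Product.norm_nth_le)

lemma synth_props:
  assumes c: "(\<lambda>k. norm (c k)) summable_on UNIV"
  shows "continuous_on UNIV (synth c)" "periodic (synth c)" "in_L 2 (synth c)"
proof -
  show 1: "continuous_on UNIV (synth c)" unfolding synth_def[abs_def]
    by (intro continuous_on_vec_lambda continuous_sser summable_nth c)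
  show 2: "periodic (synth c)" using periodic_sser by (simp add: synth_def periodic_def)
  show "in_L 2 (synth c)" by (rule continuous_periodic_in_L2[OF 1 2])
qed

lemma vcoef_synth:
  assumes "(\<lambda>k. norm (c k)) summable_on UNIV" and herm: "\<And>k. c (- k) = cnjv (c k)"
  shows "vcoef (synth c) k = c k"
  using fcoeff_sser[OF summable_nth[OF assms(1)]] herm by (simp add: vcoef_def synth_def vec_eq_iff cnjv_def)

lemma finite_support_summable:
  assumes "finite A" "\<And>k. k \<notin> A \<Longrightarrow> c k = 0"
  shows "(\<lambda>k. norm (c k)) summable_on UNIV"
  using summable_on_cong_neutral[of A UNIV "\<lambda>k. norm (c k)" "\<lambda>k. norm (c k)"] assms by auto

lemma sser_finite:
  assumes "finite A" "\<And>k. k \<notin> A \<Longrightarrow> c k = 0"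
  shows "sser c x = Re (\<Sum>k\<in>A. c k * fexp k x)"
proof -
  have "(\<Sum>\<^sub>\<infinity>k. c k * fexp k x) = (\<Sum>\<^sub>\<infinity>k\<in>A. c k * fexp k x)"
    using assms by (intro infsum_cong_neutral) auto
  then show ?thesis using assms by (simp add: sser_def)
qed

lemma vtest_sser_finite:
  assumes "finite A" "\<And>k. k \<notin> A \<Longrightarrow> c k = 0"
  shows "vtest (sser c)"
proof -
  have eq: "sser c = (\<lambda>x. Re (\<Sum>k\<in>A. c k * fexp k x))" using sser_finite[OF assms] by auto
  have "Ck_on n UNIV (sser c)" for n unfolding eq
    by (intro Ck_on_bounded_linear[OF bounded_linear_Re] Ck_on_sum Ck_on_mult Ck_on_const Ck_on_fexp)
  then show ?thesis using periodic_sser by (simp add: vtest_def smooth_on_def)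
qed

lemma pd_sser_finite:
  assumes A: "finite A" "\<And>k. k \<notin> A \<Longrightarrow> c k = 0"
  shows "pd j (sser c) x = sser (\<lambda>k. 2 * pi * \<i> * of_int (k $ j) * c k) x"
proof -
  have eq: "sser c = (\<lambda>x. Re (\<Sum>k\<in>A. c k * fexp k x))" using sser_finite[OF A] by auto
  have "(sser c has_derivative (\<lambda>v. Re (\<Sum>k\<in>A. c k * ((2 * pi * \<i> * of_real (lattice_vec k \<bullet> v)) * fexp k x)))) (at x)"
    unfolding eq by (intro has_derivative_Re has_derivative_sum has_derivative_mult_right fexp_has_derivative)
  from fun_cong[OF frechet_derivative_at[OF this], of "axis j 1"]
  have "pd j (sser c) x = Re (\<Sum>k\<in>A. c k * ((2 * pi * \<i> * of_real (lattice_vec k \<bullet> axis j 1)) * fexp k x))"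
    unfolding pd_def by (rule sym)
  also have "\<dots> = Re (\<Sum>k\<in>A. (2 * pi * \<i> * of_int (k $ j) * c k) * fexp k x)"
    by (intro arg_cong[of _ _ Re] sum.cong refl) (simp add: inner_axis mult_ac)
  also have "\<dots> = sser (\<lambda>k. 2 * pi * \<i> * of_int (k $ j) * c k) x"
    using A by (intro sser_finite[symmetric]) auto
  finally show ?thesis .
qed

lemma vtest_synth_finite:
  assumes "finite A" "\<And>k. k \<notin> A \<Longrightarrow> c k = 0"
  shows "vtest (synth c)"
proof -
  have "vtest (sser (\<lambda>k. c k $ i))" for i using assms by (intro vtest_sser_finite[of A]) auto
  then show ?thesis unfolding vtest_def smooth_on_def synth_def[abs_def]
    by (auto simp: periodic_def intro!: Ck_on_vecI)
qed

text \<open>A product becomes a convolution; with one factor of finite spectrum no question of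
  convergence arises.\<close>

lemma fcoeff_mult_sser_finite:
  assumes A: "finite A" "\<And>k. k \<notin> A \<Longrightarrow> c k = 0" and herm: "\<And>k. c (- k) = cnj (c k)" and g: "integrable torus g"
  shows "fcoeff (\<lambda>x. sser c x * g x) k = (\<Sum>l\<in>A. c l * fcoeff g (k - l))"
proof -
  have sc: "of_real (sser c x) = (\<Sum>l\<in>A. c l * fexp l x)" for x
  proof -
    have "(\<Sum>\<^sub>\<infinity>k. c k * fexp k x) = (\<Sum>\<^sub>\<infinity>k\<in>A. c k * fexp k x)"
      using A by (intro infsum_cong_neutral) auto
    then show ?thesis using A by (simp add: sser_complex[where c=c, OF herm])
  qed
  have "of_real (sser c x * g x) * fexp (- k) x = (\<Sum>l\<in>A. c l * (of_real (g x) * fexp (- (k - l)) x))" for x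
    unfolding of_real_mult sc sum_distrib_right
    by (intro sum.cong refl) (simp add: fexp_diff fexp_uminus mult_ac)
  then show ?thesis unfolding fcoeff_fexp
    by (simp add: Bochner_Integration.integral_sum integrable_mult_fexp integrable_of_real g del: minus_diff_eq)
qed

lemma fmult_vec: "fmult \<mu> f = synth (\<lambda>k. \<mu> (lattice_vec k) *\<^sub>R vcoef f k)"
proof
  fix x
  have "fmult \<mu> f x $ i = synth (\<lambda>k. \<mu> (lattice_vec k) *\<^sub>R vcoef f k) x $ i" for i
  proof -
    have ax: "axis i 1 \<in> (Basis :: (real^3) set)" by (auto simp: Basis_vec_def)
    have "fmult \<mu> f x $ i = fmult \<mu> f x \<bullet> axis i 1" by (simp add: inner_axis)
    also have "\<dots> = Re (\<Sum>\<^sub>\<infinity>k. of_real (\<mu> (lattice_vec k)) * fcoeff (\<lambda>y. f y \<bullet> axis i 1) k * fexp k x)"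
      unfolding fmult_def fexp_def by (rule inner_sum_left_Basis[OF ax])
    finally show ?thesis
      by (simp add: synth_def sser_def inner_axis vcoef_def scaleR_conv_of_real[where 'a=complex])
  qed
  then show "fmult \<mu> f x = synth (\<lambda>k. \<mu> (lattice_vec k) *\<^sub>R vcoef f k) x" by (simp add: vec_eq_iff)
qed

text \<open>Testing with modes shows that every weak gradient has the coefficients of the formal
  derivative, hence the same norm, and the series \<open>G0\<close> is one. So the infimum runs over
  a nonempty set with a single value.\<close>

lemma grad_sq_eq:
  assumes f: "in_L 2 f" and s: "(\<lambda>k. (1 + knorm k) * norm (vcoef f k)) summable_on UNIV"
    and s2: "(\<lambda>k. (2 * pi * knorm k)\<^sup>2 * (norm (vcoef f k))\<^sup>2) summable_on UNIV"
  shows "grad_sq f = ennreal (\<Sum>\<^sub>\<infinity>k. (2 * pi * knorm k)\<^sup>2 * (norm (vcoef f k))\<^sup>2)"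
proof -
  let ?c = "\<lambda>i j k. 2 * pi * \<i> * of_int (k $ j) * vcoef f k $ i"
  have norm_G: "Lnorm 2 G ^ 2 = ennreal (\<Sum>\<^sub>\<infinity>k. (2 * pi * knorm k)\<^sup>2 * (norm (vcoef f k))\<^sup>2)"
    if G: "in_L 2 G" and co: "\<And>i j k. fcoeff (\<lambda>x. G x $ i $ j) k = ?c i j k" for G :: "real^3 \<Rightarrow> real^3^3"
  proof -
    have comp: "(\<lambda>x. G x $ i $ j) \<in> borel_measurable borel" "integrable torus (\<lambda>x. (G x $ i $ j)\<^sup>2)" for i j
      using in_L2_component[OF G, of "axis i (axis j 1)"] by (simp_all add: inner_axis)
    have "((\<lambda>k. \<Sum>i\<in>UNIV. \<Sum>j\<in>UNIV. (cmod (?c i j k))\<^sup>2) has_sum (\<Sum>i\<in>UNIV. \<Sum>j\<in>UNIV. \<integral>x. (G x $ i $ j)\<^sup>2 \<partial>torus)) UNIV"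
      unfolding co[symmetric] by (intro has_sum_finite_sum parseval comp) auto
    moreover have "(\<Sum>i\<in>UNIV. \<Sum>j\<in>UNIV. \<integral>x. (G x $ i $ j)\<^sup>2 \<partial>torus) = (\<integral>x. (norm (G x))\<^sup>2 \<partial>torus)"
      using comp by (simp add: norm_vec_sq)
    moreover have "(\<Sum>i\<in>UNIV. \<Sum>j\<in>UNIV. (cmod (?c i j k))\<^sup>2) = (2 * pi * knorm k)\<^sup>2 * (norm (vcoef f k))\<^sup>2" for k
      by (simp add: norm_vec_sq norm_mult power_mult_distrib sum_product sum_distrib_left sum_distrib_right mult_ac)
        (rule sum.swap)
    ultimately have "((\<lambda>k. (2 * pi * knorm k)\<^sup>2 * (norm (vcoef f k))\<^sup>2) has_sum (\<integral>x. (norm (G x))\<^sup>2 \<partial>torus)) UNIV" by simp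
    then show ?thesis using G
      by (simp add: Lnorm2_eq in_L2_iff infsumI ennreal_power)
  qed
  define G0 :: "real^3 \<Rightarrow> real^3^3" where "G0 x = (\<chi> i j. sser (?c i j) x)" for x
  have sc: "(\<lambda>k. norm (?c i j k)) summable_on UNIV" for i j
  proof (rule summable_on_comparison_test[OF summable_on_cmult_right[OF s, of "2 * pi"]])
    fix k
    have "\<bar>real_of_int (k $ j)\<bar> * norm (vcoef f k $ i) \<le> (1 + knorm k) * norm (vcoef f k)"
      using abs_coord_le_knorm[of k j] by (intro mult_mono Finite_Cartesian_Product.norm_nth_le) auto
    then show "norm (?c i j k) \<le> 2 * pi * ((1 + knorm k) * norm (vcoef f k))"
      by (simp add: norm_mult mult.assoc)
  qed auto
  have hc: "?c i j (- k) = cnj (?c i j k)" for i j k by (simp add: vcoef_uminus)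
  have G0: "in_L 2 G0" "\<And>i j k. fcoeff (\<lambda>x. G0 x $ i $ j) k = ?c i j k"
  proof -
    have "continuous_on UNIV G0" unfolding G0_def[abs_def] by (intro continuous_on_vec_lambda continuous_sser sc)
    then show "in_L 2 G0"
      by (rule continuous_periodic_in_L2) (use periodic_sser in \<open>auto simp: G0_def periodic_def\<close>)
    show "fcoeff (\<lambda>x. G0 x $ i $ j) k = ?c i j k" for i j k
      using fcoeff_sser[OF sc hc] by (simp add: G0_def)
  qed
  have "weak_gradient f G0"
    unfolding weak_gradient_def
  proof (intro conjI allI impI G0(1))
    fix \<psi> i j assume "test_scalar \<psi>"
    then have \<psi>: "vtest \<psi>" by (simp add: test_scalar_vtest)
    have "((\<lambda>k. ?c i j k \<bullet> fcoeff \<psi> k) has_sum (\<integral>x. G0 x $ i $ j * \<psi> x \<partial>torus)) UNIV"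
      using in_L2_component[OF G0(1), of "axis i (axis j 1)"] in_L2_component[OF vtest_in_L2[OF \<psi>], of 1]
        parseval_inner[of "\<lambda>x. G0 x $ i $ j" \<psi>] by (simp add: inner_axis G0(2))
    from has_sum_uminusI[OF this] has_sum_integral_pd[OF f \<psi>, of j i]
    show "(\<integral>x. f x $ i * pd j \<psi> x \<partial>torus) = - (\<integral>x. G0 x $ i $ j * \<psi> x \<partial>torus)"
      using has_sum_unique by (auto simp: inner_minus_left)
  qed
  then have G0_mem: "G0 \<in> Collect (weak_gradient f)" by simp
  have co: "fcoeff (\<lambda>x. G x $ i $ j) k = ?c i j k" if G: "weak_gradient f G" for G i j k
  proof -
    have GL: "in_L 2 G" using G by (simp add: weak_gradient_def)
    let ?x = "fcoeff (\<lambda>x. G x $ i $ j)"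
    have eq: "(- ?c i j k) \<bullet> z = (- ?x k) \<bullet> z" for z
    proof -
      have "2 * ((- ?c i j k) \<bullet> z) = (\<integral>x. f x $ i * pd j (mode k z) x \<partial>torus)"
        using has_sum_unique[OF pairing_mode[of "\<lambda>l. - ?c i j l" k z] has_sum_integral_pd[OF f vtest_mode[of k z], of j i]]
        by (simp add: vcoef_uminus)
      also have "\<dots> = - (\<integral>x. G x $ i $ j * mode k z x \<partial>torus)"
        using G vtest_mode[of k z] by (simp add: weak_gradient_def test_scalar_vtest)
      also have "(\<integral>x. G x $ i $ j * mode k z x \<partial>torus) = 2 * (?x k \<bullet> z)"
      proof -
        have "((\<lambda>l. ?x l \<bullet> fcoeff (mode k z) l) has_sum (\<integral>x. G x $ i $ j * mode k z x \<partial>torus)) UNIV"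
          using in_L2_component[OF GL, of "axis i (axis j 1)"] in_L2_component[OF vtest_in_L2[OF vtest_mode[of k z]], of 1]
            parseval_inner[of "\<lambda>x. G x $ i $ j" "mode k z"] by (simp add: inner_axis)
        then show ?thesis using pairing_mode[of ?x k z] has_sum_unique by (simp add: fcoeff_uminus)
      qed
      finally show ?thesis by simp
    qed
    have "(?x k - ?c i j k) \<bullet> (?x k - ?c i j k) = 0"
      using eq[of "?x k - ?c i j k"] by (simp add: inner_diff_left)
    then show ?thesis by simp
  qed
  show ?thesis unfolding grad_sq_def
  proof (rule antisym)
    show "(INF G\<in>Collect (weak_gradient f). Lnorm 2 G ^ 2) \<le> ennreal (\<Sum>\<^sub>\<infinity>k. (2 * pi * knorm k)\<^sup>2 * (norm (vcoef f k))\<^sup>2)"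
      using INF_lower[OF G0_mem, of "\<lambda>G. Lnorm 2 G ^ 2"] norm_G[OF G0] by simp
    show "ennreal (\<Sum>\<^sub>\<infinity>k. (2 * pi * knorm k)\<^sup>2 * (norm (vcoef f k))\<^sup>2) \<le> (INF G\<in>Collect (weak_gradient f). Lnorm 2 G ^ 2)"
      using norm_G co by (intro INF_greatest) (simp add: weak_gradient_def)
  qed
qed

context lns
begin

lemma P_low_eq: "s > 0 \<Longrightarrow> P_low \<phi> \<Lambda> s f = synth (lowpass s (vcoef f))"
  unfolding P_low_def fmult_vec lowpass_def m_def by simp

lemma lowpass_herm: "(\<And>k. c (- k) = cnjv (c k)) \<Longrightarrow> lowpass s c (- k) = cnjv (lowpass s c k)"
  by (simp add: lowpass_def linear_cmul[OF bounded_linear.linear[OF bounded_linear_cnjv]])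

text \<open>Parseval for both terms. In the nonlinear one, integration by parts is skewness of
  multiplication by \<open>\<i>\<close>, the filter on the test field moves outside as
  \<open>m s k\<close>, and \<open>leray\<close> may be inserted because \<open>\<eta>\<close> is
  solenoidal; this produces \<open>NL\<close>.\<close>

lemma weak_integrand:
  assumes s: "s \<in> {0<..T}" and v: "in_L 2 v" and \<eta>: "vtest \<eta>" and div: "\<And>k. kdot k (vcoef \<eta> k) = 0"
  defines "w \<equiv> lowpass s (vcoef v)"
  shows "((\<lambda>k. (- sig k *\<^sub>R vcoef v k + NL s w w k) \<bullet> vcoef \<eta> k) has_sum
    (\<integral>x. \<nu> * (v x \<bullet> laplacian \<eta> x) +
           P_low \<phi> \<Lambda> s v x \<bullet> advect (P_low \<phi> \<Lambda> s v) (P_low \<phi> \<Lambda> s \<eta>) x \<partial>torus)) UNIV"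
proof -
  define z where "z = lowpass s (vcoef \<eta>)"
  let ?W = "synth w" and ?Z = "synth z"
  have P: "P_low \<phi> \<Lambda> s v = ?W" "P_low \<phi> \<Lambda> s \<eta> = ?Z" using s by (simp_all add: P_low_eq w_def z_def)
  have supp: "w k = 0" "z k = 0" if "k \<notin> low s" for k
    using lowpass_eq_0[OF s that] by (simp_all add: w_def z_def)
  have herm: "w (- k) = cnjv (w k)" "z (- k) = cnjv (z k)" for k
    unfolding w_def z_def by (intro lowpass_herm vcoef_hermitian)+
  have hw: "w (- k) $ i = cnj (w k $ i)" "z (- k) $ i = cnj (z k $ i)" for k i
    by (simp_all add: herm cnjv_def)
  let ?w = "\<lambda>i. sser (\<lambda>k. w k $ i)" and ?z = "\<lambda>i j. sser (\<lambda>k. 2 * pi * \<i> * of_int (k $ j) * z k $ i)"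
  have vw: "vtest (?w i)" and vz: "vtest (?z i j)" for i j
    using supp by (intro vtest_sser_finite[OF low_finite[of s]]; simp)+
  have ww: "vtest (\<lambda>x. ?w i x * ?w j x)" for i j
    using vw unfolding vtest_def smooth_on_def periodic_def by (auto intro: Ck_on_mult)
  have adv: "?W x \<bullet> advect ?W ?Z x = (\<Sum>i\<in>UNIV. \<Sum>j\<in>UNIV. (?w i x * ?w j x) * ?z i j x)" for x
  proof -
    have "pd j ?Z x $ i = ?z i j x" for i j
    proof -
      have "pd j ?Z x $ i = pd j (\<lambda>x. ?Z x $ i) x"
        by (rule pd_nth[symmetric]) (rule vtest_synth_finite[OF low_finite[of s]], rule supp)
      also have "\<dots> = ?z i j x"
        unfolding synth_def vec_lambda_beta
        using supp by (intro pd_sser_finite[OF low_finite[of s]]) simp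
      finally show ?thesis .
    qed
    then show ?thesis
      by (simp add: inner_vec_def advect_def synth_def sum_distrib_left mult.assoc)
  qed
  have sq: "(\<lambda>x. f x) \<in> borel_measurable borel" "integrable torus (\<lambda>x. (f x)\<^sup>2)" if "vtest f" for f :: "real^3 \<Rightarrow> real"
    using in_L2_component[OF vtest_in_L2[OF that], of 1] by simp_all
  have fz: "fcoeff (?z i j) k = 2 * pi * \<i> * of_int (k $ j) * z k $ i" for i j k
    using supp hw by (intro fcoeff_sser finite_support_summable[OF low_finite[of s]]) auto
  have fww: "fcoeff (\<lambda>x. ?w i x * ?w j x) k = (\<Sum>l\<in>low s. w l $ i * w (k - l) $ j)" for i j k
  proof -
    have "fcoeff (?w j) k = w k $ j" for k
      using supp hw by (intro fcoeff_sser finite_support_summable[OF low_finite[of s]]) auto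
    then show ?thesis
      using fcoeff_mult_sser_finite[OF low_finite[of s], of "\<lambda>k. w k $ i" "?w j" k] supp hw
        integrable_torus_continuous[OF vtest_continuous[OF vw]] by simp
  qed
  have "((\<lambda>k. \<Sum>i\<in>UNIV. \<Sum>j\<in>UNIV. fcoeff (\<lambda>x. ?w i x * ?w j x) k \<bullet> fcoeff (?z i j) k) has_sum
      (\<Sum>i\<in>UNIV. \<Sum>j\<in>UNIV. \<integral>x. (?w i x * ?w j x) * ?z i j x \<partial>torus)) UNIV"
    by (intro has_sum_finite_sum parseval_inner sq ww vz) auto
  moreover have int2: "integrable torus (\<lambda>x. (?w i x * ?w j x) * ?z i j x)" for i j
    by (intro integrable_square_sum sq ww vz)
  moreover have "(\<Sum>i\<in>UNIV. \<Sum>j\<in>UNIV. fcoeff (\<lambda>x. ?w i x * ?w j x) k \<bullet> fcoeff (?z i j) k) = NL s w w k \<bullet> vcoef \<eta> k" for k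
  proof -
    have "(\<Sum>j\<in>UNIV. (\<Sum>l\<in>low s. w l $ i * w (k - l) $ j) \<bullet> (2 * pi * \<i> * of_int (k $ j) * z k $ i))
       = ((- (2 * pi * \<i>)) * conv (low s) w w k $ i) \<bullet> z k $ i" for i
    proof -
      have "(\<Sum>j\<in>UNIV. (\<Sum>l\<in>low s. w l $ i * w (k - l) $ j) \<bullet> (2 * pi * \<i> * of_int (k $ j) * z k $ i))
        = (\<Sum>j\<in>UNIV. - (2 * pi * \<i> * of_int (k $ j) * (\<Sum>l\<in>low s. w l $ i * w (k - l) $ j))) \<bullet> z k $ i"
        unfolding inner_mult_i inner_sum_left ..
      also have "(\<Sum>j\<in>UNIV. - (2 * pi * \<i> * of_int (k $ j) * (\<Sum>l\<in>low s. w l $ i * w (k - l) $ j)))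
         = (- (2 * pi * \<i>)) * conv (low s) w w k $ i"
        unfolding conv_def kdot_def sum_component vector_smult_component sum_distrib_left sum_distrib_right
        by (subst sum.swap) (simp add: sum_negf mult_ac)
      finally show ?thesis .
    qed
    then have "(\<Sum>i\<in>UNIV. \<Sum>j\<in>UNIV. fcoeff (\<lambda>x. ?w i x * ?w j x) k \<bullet> fcoeff (?z i j) k)
      = ((- (2 * pi * \<i>)) *s conv (low s) w w k) \<bullet> z k"
      unfolding fz fww by (simp add: inner_vec_def)
    also have "\<dots> = leray k (m s k *\<^sub>R ((- (2 * pi * \<i>)) *s conv (low s) w w k)) \<bullet> vcoef \<eta> k"
      by (simp add: leray_inner[OF div] z_def lowpass_def)
    also have "m s k *\<^sub>R ((- (2 * pi * \<i>)) *s conv (low s) w w k) = (- (2 * pi * \<i>) * of_real (m s k)) *s conv (low s) w w k"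
      by (simp add: vec_eq_iff scaleR_nth del: vector_scaleR_component)
    finally show ?thesis by (simp only: NL_def leray_linear)
  qed
  ultimately have nl: "((\<lambda>k. NL s w w k \<bullet> vcoef \<eta> k) has_sum (\<integral>x. ?W x \<bullet> advect ?W ?Z x \<partial>torus)) UNIV"
    unfolding adv by simp
  have "((\<lambda>k. \<nu> * (vcoef v k \<bullet> vcoef (laplacian \<eta>) k)) has_sum (\<nu> * (\<integral>x. v x \<bullet> laplacian \<eta> x \<partial>torus))) UNIV"
    by (intro has_sum_cmult_right parseval_vec_inner v vtest_in_L2 vtest_laplacian \<eta>)
  moreover have "\<nu> * (vcoef v k \<bullet> vcoef (laplacian \<eta>) k) = (- sig k *\<^sub>R vcoef v k) \<bullet> vcoef \<eta> k" for k
    by (simp add: vtest_vcoef_laplacian[OF \<eta>] sig_def)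
  ultimately have lin: "((\<lambda>k. (- sig k *\<^sub>R vcoef v k) \<bullet> vcoef \<eta> k) has_sum (\<nu> * (\<integral>x. v x \<bullet> laplacian \<eta> x \<partial>torus))) UNIV"
    by simp
  have i1: "integrable torus (\<lambda>x. v x \<bullet> laplacian \<eta> x)"
    unfolding inner_vec_def
    by (intro Bochner_Integration.integrable_sum integrable_square_sum[unfolded inner_real_def[symmetric]]
        in_L2_component_vec v vtest_in_L2 vtest_laplacian \<eta>)
  have i2: "integrable torus (\<lambda>x. ?W x \<bullet> advect ?W ?Z x)"
    unfolding adv by (intro Bochner_Integration.integrable_sum int2)
  have "(\<integral>x. \<nu> * (v x \<bullet> laplacian \<eta> x) + ?W x \<bullet> advect ?W ?Z x \<partial>torus) =
      \<nu> * (\<integral>x. v x \<bullet> laplacian \<eta> x \<partial>torus) + (\<integral>x. ?W x \<bullet> advect ?W ?Z x \<partial>torus)"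
    using i1 i2 by simp
  then show ?thesis unfolding P inner_add_left using has_sum_add[OF lin nl] by simp
qed

end

subsection \<open>The solution operator\<close>

text \<open>A pointwise series of functions continuous in time is Borel. This lets the constant
  \<open>1 / \<nu>\<close> be pulled out of the nonnegative integral in
  \<open>V_energy\<close>.\<close>

lemma (in lns_sol) D_measurable:
  assumes "t \<le> T"
  shows "(\<lambda>s. indicator {0<..t} s * D s) \<in> borel_measurable lborel"
proof -
  let ?g = "\<lambda>k s. indicator {0<..t} s *\<^sub>R (sig k * (norm (u s k))\<^sup>2)"
  have "indicator {0<..t} s * D s = (\<Sum>n. natseq (\<lambda>k. ?g k s) n)" for s
  proof (cases "s \<in> {0<..t}")
    case True
    then have "natseq (\<lambda>k. sig k * (norm (u s k))\<^sup>2) sums D s"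
      unfolding D_def using assms by (intro natseq_sums has_sum_infsum D_summable) auto
    then show ?thesis using True by (simp add: sums_iff)
  qed (simp add: natseq_def)
  moreover have "(\<lambda>s. natseq (\<lambda>k. ?g k s) n) \<in> borel_measurable lborel" for n
  proof -
    have "?g k \<in> borel_measurable borel" for k
      by (rule borel_measurable_continuous_on_indicator)
         (use assms in \<open>auto intro!: continuous_intros continuous_on_subset[OF u_cont]\<close>)
    then show ?thesis
      by (cases "n \<in> range (to_nat :: int^3 \<Rightarrow> nat)") (simp_all add: natseq_def)
  qed
  ultimately show ?thesis by (simp add: borel_measurable_suminf)
qed

lemma L2_open_measurable: "L2_open W \<Longrightarrow> W \<in> sets L2_borel"
  by (simp add: L2_borel_def)

lemma vcoef_sq_summable: "in_L 2 g \<Longrightarrow> (\<lambda>k. (norm (vcoef g k))\<^sup>2) summable_on UNIV"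
  using parseval_vec by (auto simp: summable_on_def)

context lns_trunc
begin

text \<open>On \<open>[0, T]\<close> the choice is determined by \<open>mild_unique\<close>; outside
  it is arbitrary.\<close>

definition Sol :: "(int^3 \<Rightarrow> complex^3) \<Rightarrow> real \<Rightarrow> int^3 \<Rightarrow> complex^3" where
  "Sol a = (SOME u. ev.mild a u)"

text \<open>At time 0 the datum itself is kept: its coefficients need not be absolutely summable, so
  \<open>synth\<close> need not reproduce it.\<close>

definition U :: "(real^3 \<Rightarrow> real^3) \<Rightarrow> real \<Rightarrow> real^3 \<Rightarrow> real^3" where
  "U f t = (if t = 0 then f else synth (Sol (vcoef f) t))"

lemma mild_Sol: "in_L 2 f \<Longrightarrow> ev.mild (vcoef f) (Sol (vcoef f))"
  unfolding Sol_def using norm_vcoef_le by (intro someI_ex[OF ev.mild_exists])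

lemma mild_summable:
  assumes u: "ev.mild a u" and t: "t \<in> {0<..T}"
  shows "(\<lambda>k. (1 + knorm k) ^ n * norm (u t k)) summable_on UNIV"
proof -
  have "\<exists>C. \<forall>s\<in>{t..T}. \<forall>k. norm (u s k) * (1 + knorm k) ^ (n + 6) \<le> C"
    using t by (intro mild_rapid[OF u]) auto
  then obtain C where "\<forall>s\<in>{t..T}. \<forall>k. norm (u s k) * (1 + knorm k) ^ (n + 6) \<le> C" by blast
  then have C: "\<And>k. norm (u t k) * (1 + knorm k) ^ (n + 6) \<le> C" using t by auto
  have "(1 + knorm k) ^ n * norm (u t k) \<le> C * lweight k" for k
  proof -
    have "0 < (1 + knorm k) ^ 6" by (intro zero_less_power) (auto intro: add_pos_nonneg)
    then have "(1 + knorm k) ^ n * norm (u t k) \<le> C / (1 + knorm k) ^ 6"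
      using C[of k] by (simp only: pos_le_divide_eq) (simp only: power_add mult_ac)
    then show ?thesis by (simp add: lweight_def)
  qed
  then show ?thesis
    by (intro summable_on_comparison_test[OF summable_on_cmult_right[OF summable_lweight, of C]]) auto
qed

lemma U_in_L2: "in_L 2 f \<Longrightarrow> t \<in> {0..T} \<Longrightarrow> in_L 2 (U f t)"
  using synth_props(3) mild_summable[OF mild_Sol, of f t 0] by (auto simp: U_def)

lemma vcoef_U: "in_L 2 f \<Longrightarrow> t \<in> {0..T} \<Longrightarrow> vcoef (U f t) k = Sol (vcoef f) t k"
proof (cases "t = 0")
  case False
  assume f: "in_L 2 f" and t: "t \<in> {0..T}"
  show ?thesis unfolding U_def using False
    by (simp, intro vcoef_synth mild_real[OF mild_Sol[OF f] vcoef_hermitian t])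
       (use mild_summable[OF mild_Sol[OF f], of t 0] t in auto)
qed (simp add: U_def ev.mild_0[OF mild_Sol])

text \<open>Stability in the supremum norm at time \<open>t / 2\<close> becomes \<open>L2\<close>
  stability at time \<open>t\<close>: all but finitely many modes are damped over the second half of
  the interval by a factor whose squares are summable.\<close>

lemma U_lipschitz:
  assumes t: "t \<in> {0<..T}"
  obtains C where "C > 0" "\<And>f g :: real^3 \<Rightarrow> real^3. in_L 2 f \<Longrightarrow> in_L 2 g \<Longrightarrow>
    Lnorm 2 (\<lambda>x. U f t x - U g t x) \<le> ennreal C * Lnorm 2 (\<lambda>x. f x - g x)"
proof -
  define c where "c = t / 2"
  have c: "0 < c" "c \<le> t" "t \<le> T" "c \<in> {0..T}" "t - c = c" using t by (auto simp: c_def)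
  define S where "S = 2 * exp (ev.lam * sqrt T)"
  define w where "w k = (if k \<in> low c then 1 else exp (- (sig k * c)))" for k
  have w01: "0 \<le> w k" "w k \<le> 1" for k using sig_nonneg[of k] c by (auto simp: w_def)
  have w: "(\<lambda>k. (w k)\<^sup>2) summable_on UNIV"
  proof -
    have "\<nu> * (2 * pi)\<^sup>2 * c > 0" using \<nu> c by simp
    from power_exp_square_bounded[OF this, of 6] obtain B where
      B: "\<And>r. r \<ge> 0 \<Longrightarrow> (1 + r) ^ 6 * exp (- (\<nu> * (2 * pi)\<^sup>2 * c * r\<^sup>2)) \<le> B" by blast
    have "(w k)\<^sup>2 \<le> B * lweight k" if "k \<notin> low c" for k
    proof -
      have "(w k)\<^sup>2 \<le> w k" using w01[of k] by (simp add: power2_eq_square mult_left_le)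
      also have "w k = exp (- (\<nu> * (2 * pi)\<^sup>2 * c * (knorm k)\<^sup>2))"
        using that by (simp add: w_def sig_def power_mult_distrib mult_ac)
      also have "\<dots> \<le> B / (1 + knorm k) ^ 6"
      proof -
        have "0 < (1 + knorm k) ^ 6" by (intro zero_less_power) (auto intro: add_pos_nonneg)
        then show ?thesis using B[of "knorm k"] by (simp only: pos_le_divide_eq norm_ge_zero mult.commute)
      qed
      finally show ?thesis by (simp add: lweight_def)
    qed
    then have "(\<lambda>k. (w k)\<^sup>2) summable_on (UNIV - low c)"
      by (intro summable_on_comparison_test[OF summable_on_subset_banach[OF summable_on_cmult_right[OF summable_lweight, of B], of "UNIV - low c"]]) auto
    then have "(\<lambda>k. (w k)\<^sup>2) summable_on (UNIV - low c \<union> low c)"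
      by (rule summable_on_Un_disjoint[OF _ summable_on_finite[OF low_finite]]) auto
    then show ?thesis by simp
  qed
  \<comment> \<open>The summand 1 makes \<open>C\<close> positive, so that
    \<open>U_measurable\<close> can divide radii by it.\<close>
  define C where "C = 1 + S * sqrt (\<Sum>\<^sub>\<infinity>k. (w k)\<^sup>2)"
  have S: "S \<ge> 0" by (simp add: S_def)
  have C: "C > 0" using S by (simp add: C_def add_pos_nonneg infsum_nonneg)
  show thesis
  proof (rule that[OF C])
    fix f g :: "real^3 \<Rightarrow> real^3" assume f: "in_L 2 f" and g: "in_L 2 g"
    let ?u = "Sol (vcoef f)" and ?v = "Sol (vcoef g)"
    define d where "d = sqrt (\<Sum>\<^sub>\<infinity>k. (norm (vcoef f k - vcoef g k))\<^sup>2)"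
    have ab: "norm (vcoef f k - vcoef g k) \<le> d" for k
      using norm_vcoef_le[OF in_L2_diff[OF f g]] unfolding vcoef_diff[OF f g] d_def .
    have st: "norm (?u s k - ?v s k) \<le> S * d" if "s \<in> {0..T}" for s k
      unfolding S_def by (rule ev.mild_stable[OF mild_Sol[OF f] mild_Sol[OF g] ab that])
    have le: "norm (?u t k - ?v t k) \<le> w k * (S * d)" for k
    proof (cases "k \<in> low c")
      case True
      then show ?thesis using st[of t k] t by (simp add: w_def)
    next
      case False
      have "?u t k - ?v t k = w k *\<^sub>R (?u c k - ?v c k)"
        using mild_heat[OF mild_Sol[OF f] c(1-3) False] mild_heat[OF mild_Sol[OF g] c(1-3) False] False c(5)
        by (simp add: w_def scaleR_diff_right)
      then show ?thesis using st[OF c(4), of k] w01[of k] by (simp add: mult_left_mono)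
    qed
    have tt: "t \<in> {0..T}" using t by auto
    have "(\<Sum>\<^sub>\<infinity>k. (norm (vcoef (U f t) k - vcoef (U g t) k))\<^sup>2) \<le> (\<Sum>\<^sub>\<infinity>k. (S * d)\<^sup>2 * (w k)\<^sup>2)"
    proof (rule infsum_mono)
      show "(norm (vcoef (U f t) k - vcoef (U g t) k))\<^sup>2 \<le> (S * d)\<^sup>2 * (w k)\<^sup>2" for k
        using power_mono[OF le[of k] norm_ge_zero, of 2] by (simp add: vcoef_U[OF f tt] vcoef_U[OF g tt] power_mult_distrib mult_ac)
      show "(\<lambda>k. (norm (vcoef (U f t) k - vcoef (U g t) k))\<^sup>2) summable_on UNIV"
        using parseval_vec[OF in_L2_diff[OF U_in_L2[OF f tt] U_in_L2[OF g tt]]]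
        unfolding vcoef_diff[OF U_in_L2[OF f tt] U_in_L2[OF g tt]] by (auto simp: summable_on_def)
      show "(\<lambda>k. (S * d)\<^sup>2 * (w k)\<^sup>2) summable_on UNIV" by (intro summable_on_cmult_right w)
    qed
    also have "\<dots> = (S * d)\<^sup>2 * (\<Sum>\<^sub>\<infinity>k. (w k)\<^sup>2)" by (rule infsum_cmult_right) (rule w)
    finally have "sqrt (\<Sum>\<^sub>\<infinity>k. (norm (vcoef (U f t) k - vcoef (U g t) k))\<^sup>2) \<le> S * d * sqrt (\<Sum>\<^sub>\<infinity>k. (w k)\<^sup>2)"
      using real_sqrt_le_mono S by (fastforce simp: real_sqrt_mult d_def infsum_nonneg)
    also have "\<dots> \<le> C * d" by (simp add: C_def d_def infsum_nonneg distrib_right mult_ac)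
    finally show "Lnorm 2 (\<lambda>x. U f t x - U g t x) \<le> ennreal C * Lnorm 2 (\<lambda>x. f x - g x)"
      unfolding Lnorm2_dist[OF U_in_L2[OF f tt] U_in_L2[OF g tt]] Lnorm2_dist[OF f g] d_def
      using C by (simp add: ennreal_mult[symmetric] infsum_nonneg ennreal_leI)
  qed
qed

text \<open>Lipschitz continuity makes preimages of open sets open. Functions outside
  \<open>L2\<close> are left fixed; no set of the generator contains any of them, so they do not
  enter the preimages.\<close>

lemma U_measurable:
  assumes t: "t \<in> {0..T}"
  shows "(\<lambda>f. if in_L 2 f then U f t else f) \<in> measurable L2_borel L2_borel"
proof (cases "t = 0")
  case True
  then have "(\<lambda>f. if in_L 2 f then U f t else f) = (\<lambda>f. f)" by (auto simp: U_def)
  then show ?thesis by simp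
next
  case False
  then have t': "t \<in> {0<..T}" using t by auto
  obtain C where C: "C > 0" "\<And>f g. in_L 2 f \<Longrightarrow> in_L 2 g \<Longrightarrow>
    Lnorm 2 (\<lambda>x. U f t x - U g t x) \<le> ennreal C * Lnorm 2 (\<lambda>x. f x - g x)"
    by (rule U_lipschitz[OF t']) blast
  show ?thesis
  proof (subst (2) L2_borel_def, rule measurable_measure_of)
    fix W assume "W \<in> Collect L2_open"
    then have W: "L2_open W" by simp
    have "L2_open {f. in_L 2 f \<and> U f t \<in> W}"
      unfolding L2_open_def
    proof (intro conjI ballI)
      fix f assume "f \<in> {f. in_L 2 f \<and> U f t \<in> W}"
      then have f: "in_L 2 f" "U f t \<in> W" by auto
      then obtain r where r: "r > 0" "\<And>g. in_L 2 g \<Longrightarrow> Lnorm 2 (\<lambda>x. g x - U f t x) < ennreal r \<Longrightarrow> g \<in> W"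
        using W unfolding L2_open_def by blast
      show "\<exists>r>0. \<forall>g. in_L 2 g \<and> Lnorm 2 (\<lambda>x. g x - f x) < ennreal r \<longrightarrow> g \<in> {f. in_L 2 f \<and> U f t \<in> W}"
      proof (intro exI[of _ "r / C"] conjI allI impI)
        fix g assume g: "in_L 2 g \<and> Lnorm 2 (\<lambda>x. g x - f x) < ennreal (r / C)"
        have "Lnorm 2 (\<lambda>x. U g t x - U f t x) \<le> ennreal C * Lnorm 2 (\<lambda>x. g x - f x)"
          using C(2) g f by blast
        also have "\<dots> < ennreal C * ennreal (r / C)"
          using g C(1) by (intro ennreal_mult_strict_left_mono) auto
        also have "\<dots> = ennreal r" using C(1) r(1) by (simp add: ennreal_mult[symmetric])
        finally show "g \<in> {f. in_L 2 f \<and> U f t \<in> W}" using r(2)[OF U_in_L2[OF _ t]] g by auto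
      qed (use r C in auto)
    qed auto
    moreover have "(\<lambda>f. if in_L 2 f then U f t else f) -` W \<inter> space L2_borel = {f. in_L 2 f \<and> U f t \<in> W}"
      using W by (auto simp: L2_open_def L2_borel_def split: if_splits)
    ultimately show "(\<lambda>f. if in_L 2 f then U f t else f) -` W \<inter> space L2_borel \<in> sets L2_borel"
      by (simp add: L2_open_measurable)
  qed auto
qed

end

locale lns_field = lns_trunc +
  fixes f :: "real^3 \<Rightarrow> real^3"
  assumes f: "in_L 2 f" and f_div: "div_free f" and f_mean: "mean_free f" and f_le: "Lnorm 2 f \<le> ennreal R"
begin

abbreviation "u \<equiv> Sol (vcoef f)"

lemma f_sq_le: "(\<Sum>\<^sub>\<infinity>k. (norm (vcoef f k))\<^sup>2) \<le> R\<^sup>2"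
proof -
  have "sqrt (\<Sum>\<^sub>\<infinity>k. (norm (vcoef f k))\<^sup>2) \<le> R"
    using f_le R unfolding Lnorm2_vcoef[OF f] by (simp add: ennreal_le_iff)
  then show ?thesis using R by (simp add: real_sqrt_le_iff sqrt_le_D)
qed

sublocale sol: lns_sol \<phi> \<Lambda> \<nu> T R "vcoef f" u
proof unfold_locales
  show "ev.mild (vcoef f) u" by (rule mild_Sol[OF f])
qed (use vcoef_sq_summable[OF f] f_sq_le f_div f_mean vcoef_hermitian in
  \<open>auto simp: div_free_iff[OF f] mean_free_iff[OF f]\<close>)

lemmas V_in_L2 = U_in_L2[OF f] and vcoef_V = vcoef_U[OF f]

lemma V_C_path: "C_path 2 T (U f)"
  unfolding C_path_def
proof (intro ballI conjI V_in_L2)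
  fix t assume t: "t \<in> {0..T}"
  have "((\<lambda>s. ennreal (sqrt (\<Sum>\<^sub>\<infinity>k. (norm (u s k - u t k))\<^sup>2))) \<longlongrightarrow> ennreal (sqrt 0)) (at t within {0..T})"
    by (intro tendsto_intros sol.u_L2_continuous[OF t])
  moreover have "\<forall>\<^sub>F s in at t within {0..T}. ennreal (sqrt (\<Sum>\<^sub>\<infinity>k. (norm (u s k - u t k))\<^sup>2)) = Lnorm 2 (\<lambda>x. U f s x - U f t x)"
    using t by (auto simp: eventually_at_filter Lnorm2_dist V_in_L2 vcoef_V)
  ultimately show "((\<lambda>s. Lnorm 2 (\<lambda>x. U f s x - U f t x)) \<longlongrightarrow> 0) (at t within {0..T})"
    using Lim_transform_eventually by fastforce
qed

lemma V_div: "t \<in> {0..T} \<Longrightarrow> div_free (U f t)"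
  using sol.u_div by (simp add: div_free_iff V_in_L2 vcoef_V)

lemma V_mean: "t \<in> {0..T} \<Longrightarrow> mean_free (U f t)"
  using sol.u_mean by (simp add: mean_free_iff V_in_L2 vcoef_V)

lemma V_smooth: "smooth_on ({0<..T} \<times> UNIV) (\<lambda>(t, x). U f t x)"
  unfolding smooth_on_def
proof
  fix n
  have "Ck_on n ({0<..T} \<times> UNIV) (\<lambda>p. \<chi> i. sser (\<lambda>k. u (fst p) k $ i) (snd p))"
  proof (rule Ck_on_vecI)
    fix i
    have "Ck_on n ({0<..T} \<times> UNIV) (\<lambda>(t, x). \<Sum>\<^sub>\<infinity>k. u t k $ i * fexp k x)"
      using fourier_series_smooth[OF sol.u_smooth_coef] by (simp add: smooth_on_def)
    from Ck_on_bounded_linear[OF bounded_linear_Re this]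
    show "Ck_on n ({0<..T} \<times> UNIV) (\<lambda>p. (\<chi> i. sser (\<lambda>k. u (fst p) k $ i) (snd p)) $ i)"
      by (simp add: sser_def case_prod_beta')
  qed
  then show "Ck_on n ({0<..T} \<times> UNIV) (\<lambda>(t, x). U f t x)"
    by (rule Ck_on_cong) (auto simp: U_def synth_def)
qed

lemma V_energy:
  assumes t: "t \<in> {0..T}"
  shows "energy \<nu> (U f) t = Lnorm 2 f ^ 2 / 2"
proof -
  have gs: "ennreal \<nu> * grad_sq (U f s) = ennreal (sol.D s)" if s: "s \<in> {0<..T}" for s
  proof -
    have s': "s \<in> {0..T}" using s by auto
    have "(\<lambda>k. \<nu> * ((2 * pi * knorm k)\<^sup>2 * (norm (u s k))\<^sup>2)) summable_on UNIV"
      using sol.D_summable[OF s] by (simp add: sig_def mult.assoc)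
    then have s2: "(\<lambda>k. (2 * pi * knorm k)\<^sup>2 * (norm (u s k))\<^sup>2) summable_on UNIV"
      using \<nu> summable_on_cmult_right[of "\<lambda>k. \<nu> * ((2 * pi * knorm k)\<^sup>2 * (norm (u s k))\<^sup>2)" UNIV "1 / \<nu>"] by simp
    have "grad_sq (U f s) = ennreal (\<Sum>\<^sub>\<infinity>k. (2 * pi * knorm k)\<^sup>2 * (norm (u s k))\<^sup>2)"
      using grad_sq_eq[OF V_in_L2[OF s']] mild_summable[OF mild_Sol[OF f] s, of 1] s2 by (simp add: vcoef_V[OF s'])
    then have "ennreal \<nu> * grad_sq (U f s) = ennreal (\<nu> * (\<Sum>\<^sub>\<infinity>k. (2 * pi * knorm k)\<^sup>2 * (norm (u s k))\<^sup>2))"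
      using \<nu> by (simp add: ennreal_mult' infsum_nonneg)
    also have "\<nu> * (\<Sum>\<^sub>\<infinity>k. (2 * pi * knorm k)\<^sup>2 * (norm (u s k))\<^sup>2) = sol.D s"
      unfolding sol.D_def sig_def by (subst infsum_cmult_right[symmetric]) (use s2 in \<open>auto simp: mult.assoc\<close>)
    finally show ?thesis .
  qed
  have "ennreal \<nu> * (\<integral>\<^sup>+ s\<in>{0..t}. grad_sq (U f s) \<partial>lborel) = (\<integral>\<^sup>+ s\<in>{0..t}. ennreal (sol.D s) \<partial>lborel)"
  proof -
    have c: "ennreal \<nu> * (ennreal (1 / \<nu>) * x) = x" for x
      using \<nu> by (simp add: mult.assoc[symmetric] ennreal_mult[symmetric])
    have "(\<integral>\<^sup>+ s\<in>{0..t}. grad_sq (U f s) \<partial>lborel) = (\<integral>\<^sup>+ s. ennreal (1 / \<nu>) * (ennreal (sol.D s) * indicator {0<..t} s) \<partial>lborel)"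
    \<comment> \<open>The series for \<open>grad_sq\<close> is available at positive times only; at
      time 0 the datum is merely square integrable, and one instant has measure zero.\<close>
    proof (rule nn_integral_cong_AE, rule AE_mp[OF AE_lborel_singleton[of 0]], intro AE_I2 impI)
      fix s :: real assume "s \<noteq> 0"
      then show "grad_sq (U f s) * indicator {0..t} s = ennreal (1 / \<nu>) * (ennreal (sol.D s) * indicator {0<..t} s)"
        using gs[of s] t \<nu> by (auto simp: indicator_def mult.assoc[symmetric] ennreal_mult[symmetric] simp flip: gs)
    qed
    also have "\<dots> = ennreal (1 / \<nu>) * (\<integral>\<^sup>+ s. ennreal (sol.D s) * indicator {0<..t} s \<partial>lborel)"
    proof (rule nn_integral_cmult)
      have [measurable]: "(\<lambda>s. indicator {0<..t} s * sol.D s) \<in> borel_measurable lborel"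
        using t by (intro sol.D_measurable) auto
      have "(\<lambda>s. ennreal (sol.D s) * indicator {0<..t} s) = (\<lambda>s. ennreal (indicator {0<..t} s * sol.D s))"
        by (auto simp: indicator_def)
      then show "(\<lambda>s. ennreal (sol.D s) * indicator {0<..t} s) \<in> borel_measurable lborel" by simp
    qed
    also have "(\<integral>\<^sup>+ s. ennreal (sol.D s) * indicator {0<..t} s \<partial>lborel) = (\<integral>\<^sup>+ s\<in>{0..t}. ennreal (sol.D s) \<partial>lborel)"
      by (rule nn_integral_cong_AE, rule AE_mp[OF AE_lborel_singleton[of 0]]) (auto simp: indicator_def)
    finally show ?thesis by (simp add: c)
  qed
  also have "\<dots> = ennreal ((sol.E 0 - sol.E t) / 2)" by (rule sol.energy_nn(2)[OF t])
  finally have "energy \<nu> (U f) t = ennreal (sol.E t) / 2 + ennreal ((sol.E 0 - sol.E t) / 2)"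
    unfolding energy_def using Lnorm2_sq_vcoef[OF V_in_L2[OF t]] by (simp add: vcoef_V[OF t] sol.E_def)
  also have "\<dots> = ennreal (sol.E t / 2 + (sol.E 0 - sol.E t) / 2)"
    using sol.energy_nn(1)[OF t] by (subst ennreal_plus) (auto simp: sol.E_def infsum_nonneg ennreal_divide_numeral)
  also have "\<dots> = Lnorm 2 f ^ 2 / 2"
    unfolding Lnorm2_sq_vcoef[OF f] sol.E_0[symmetric] by (subst ennreal_divide_numeral) (auto simp: sol.E_def infsum_nonneg field_simps)
  finally show ?thesis .
qed

text \<open>The two powers held in reserve by \<open>vtest_vcoef_decay\<close> absorb the growth of
  \<open>sig k\<close>.\<close>

lemma summable_viscous_pairing:
  assumes \<eta>: "vtest \<eta>"
  shows "(\<lambda>k. (sig k * A + B) * norm (vcoef \<eta> k)) summable_on UNIV"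
proof -
  obtain C where C: "\<And>k. norm (vcoef \<eta> k) \<le> C * (lweight k / (1 + knorm k)\<^sup>2)"
    using vtest_vcoef_decay[OF \<eta>] by blast
  have "norm ((sig k * A + B) * norm (vcoef \<eta> k)) \<le> (\<nu> * (2 * pi)\<^sup>2 * \<bar>A\<bar> + \<bar>B\<bar>) * C * lweight k" for k
  proof -
    let ?x = "(1 + knorm k)\<^sup>2"
    have x: "?x \<ge> 1" by (intro one_le_power) simp
    have "(knorm k)\<^sup>2 \<le> ?x" by (intro power_mono) auto
    then have "sig k \<le> \<nu> * (2 * pi)\<^sup>2 * ?x" using \<nu> by (simp add: sig_def power_mult_distrib mult_left_mono)
    then have "\<bar>sig k * A + B\<bar> \<le> \<nu> * (2 * pi)\<^sup>2 * ?x * \<bar>A\<bar> + \<bar>B\<bar> * ?x"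
      using x sig_nonneg[of k]
      by (intro order_trans[OF abs_triangle_ineq] add_mono) (auto simp: abs_mult intro!: mult_right_mono mult_le_cancel_left1[THEN iffD2])
    then have "\<bar>sig k * A + B\<bar> * norm (vcoef \<eta> k) \<le> (\<nu> * (2 * pi)\<^sup>2 * ?x * \<bar>A\<bar> + \<bar>B\<bar> * ?x) * (C * (lweight k / ?x))"
      using \<nu> by (intro mult_mono C) auto
    also have "\<dots> = (\<nu> * (2 * pi)\<^sup>2 * \<bar>A\<bar> + \<bar>B\<bar>) * C * lweight k"
    proof -
      have "(a * y * b + d * y) * (C * (l / y)) = (a * b + d) * C * l" if "y \<noteq> 0" for a b d l y :: real
        using that by (simp add: field_simps)
      moreover have "?x \<noteq> 0" using x by linarith
      ultimately show ?thesis .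
    qed
    finally show ?thesis by (simp add: abs_mult)
  qed
  then have "(\<lambda>k. norm ((sig k * A + B) * norm (vcoef \<eta> k))) summable_on UNIV"
    by (rule summable_on_comparison_test[OF summable_on_cmult_right[OF summable_lweight]]) (rule norm_ge_zero)
  then show ?thesis by (rule abs_summable_summable)
qed

abbreviation "weak_rhs v \<eta> s \<equiv> (\<integral>x. \<nu> * (v s x \<bullet> laplacian \<eta> x) +
           P_low \<phi> \<Lambda> s (v s) x \<bullet> advect (P_low \<phi> \<Lambda> s (v s)) (P_low \<phi> \<Lambda> s \<eta>) x \<partial>torus)"

text \<open>Every mode obeys its integrated equation, and the pairing with \<open>\<eta>\<close>
  sums these. Decay of the coefficients of \<open>\<eta>\<close> pays for \<open>sig k\<close>, and
  the weight \<open>1 + 1 / sqrt s\<close> pays for the nonlinearity near time 0.\<close>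

lemma V_weak:
  assumes \<eta>: "solenoidal_test \<eta>" and t: "t \<in> {0..T}"
  shows "(\<integral>x. U f t x \<bullet> \<eta> x \<partial>torus) = (\<integral>x. f x \<bullet> \<eta> x \<partial>torus) + (LINT s:{0..t}|lborel. weak_rhs (U f) \<eta> s)"
proof -
  note \<eta>' = solenoidal_testD[OF \<eta>]
  let ?J = "weak_rhs (U f) \<eta>" and ?M = "restrict_space lborel {0<..t}"
  define G where "G k s = (- sig k *\<^sub>R u s k + F R s (u s) k) \<bullet> vcoef \<eta> k" for k s
  have sub: "{0<..t} \<subseteq> {0<..T}" "{0..t} \<subseteq> {0..T}" using t by auto
  have J: "((\<lambda>k. G k s) has_sum ?J s) UNIV" if s: "s \<in> {0<..t}" for s
  proof -
    have s': "s \<in> {0<..T}" "s \<in> {0..T}" using s t by auto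
    have "vcoef (U f s) = u s" using vcoef_V[OF s'(2)] by auto
    then show ?thesis
      using weak_integrand[OF s'(1) V_in_L2[OF s'(2)] \<eta>'] by (simp add: G_def sol.F_u[OF s'(1)])
  qed
  define b where "b k = (sig k * R + 2 * Cn * R * R) * norm (vcoef \<eta> k)" for k
  have G_bd: "norm (G k s) \<le> b k * (1 + 1 / sqrt s)" if s: "s \<in> {0<..t}" for k s
  proof -
    have s': "s \<in> {0<..T}" "s \<in> {0..T}" using s t by auto
    have "norm (- sig k *\<^sub>R u s k + F R s (u s) k) \<le> sig k * R + 2 * Cn * R * R / sqrt s"
      using sol.u_le_R[OF s'(2), of k] sig_nonneg[of k] ev.mild_forcing(2)[OF sol.mild s'(1), of k]
      by (intro norm_triangle_le add_mono) (auto intro: mult_left_mono)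
    also have "\<dots> \<le> (sig k * R + 2 * Cn * R * R) * (1 + 1 / sqrt s)"
    proof -
      have "0 \<le> sig k * R / sqrt s" "0 \<le> 2 * Cn * R * R" using s Cn_pos R sig_nonneg[of k] by simp_all
      then show ?thesis by (simp add: distrib_left distrib_right add_divide_distrib)
    qed
    finally have "norm (- sig k *\<^sub>R u s k + F R s (u s) k) * norm (vcoef \<eta> k) \<le> ((sig k * R + 2 * Cn * R * R) * (1 + 1 / sqrt s)) * norm (vcoef \<eta> k)"
      by (rule mult_right_mono) simp
    then show ?thesis
      using Cauchy_Schwarz_ineq2[of "- sig k *\<^sub>R u s k + F R s (u s) k" "vcoef \<eta> k"] by (simp add: G_def b_def mult_ac)
  qed
  have G_cont: "continuous_on {0<..t} (G k)" for k
    unfolding G_def by (intro continuous_intros continuous_on_subset[OF sol.u_cont] continuous_on_subset[OF ev.mild_forcing(1)[OF sol.mild]]) (use t in auto)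
  have w: "integrable ?M (\<lambda>s. 1 + 1 / sqrt s)"
  proof -
    have "emeasure lborel {0<..t} < \<infinity>" using t by simp
    then have "integrable lborel (indicator {0<..t} :: real \<Rightarrow> real)" by (intro integrable_real_indicator) auto
    then have "set_integrable lborel {0<..t} (\<lambda>s. 1 + 1 / sqrt s)"
      by (intro set_integral_add set_integrable_subset[OF set_integrable_inverse_sqrt[of t 1]]) (auto simp: set_integrable_def)
    then show ?thesis by (simp add: integrable_restrict_space set_integrable_def)
  qed
  have meas: "G k \<in> borel_measurable ?M" for k
    using borel_measurable_continuous_on_indicator[OF _ G_cont, of k] by (simp add: borel_measurable_restrict_space_iff)
  have bd: "norm (G k s) \<le> b k * (1 + 1 / sqrt s)" if "s \<in> space ?M" for k s
    using G_bd that by (simp add: space_restrict_space)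
  have bs: "b summable_on UNIV" unfolding b_def by (rule summable_viscous_pairing[OF \<eta>'(1)])
  have hs: "integrable ?M (\<lambda>s. \<Sum>\<^sub>\<infinity>k. G k s)"
    "((\<lambda>k. integral\<^sup>L ?M (G k)) has_sum integral\<^sup>L ?M (\<lambda>s. \<Sum>\<^sub>\<infinity>k. G k s)) UNIV"
    by (rule integral_has_sum_weighted[OF w meas _ bs]; rule bd; assumption)+
  have int: "integral\<^sup>L ?M h = (LINT s:{0<..t}|lborel. h s)" for h :: "real \<Rightarrow> real"
    by (subst integral_restrict_space) (auto simp: set_lebesgue_integral_def)
  have mode: "integral\<^sup>L ?M (G k) = u t k \<bullet> vcoef \<eta> k + (-1) * (vcoef f k \<bullet> vcoef \<eta> k)" for k
  proof -
    have si: "set_integrable lborel {0<..t} (G k)"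
    proof -
      have "set_integrable lborel {0<..t} (\<lambda>s. b k * (1 + 1 / sqrt s))"
        using w by (simp add: integrable_restrict_space set_integrable_def mult.left_commute)
      then show ?thesis unfolding set_integrable_def
        by (rule Bochner_Integration.integrable_bound)
           (use G_bd borel_measurable_continuous_on_indicator[OF _ G_cont, of k] in \<open>auto simp: indicator_def intro!: order_trans[OF _ abs_ge_self]\<close>)
    qed
    have "(G k has_integral (u t k \<bullet> vcoef \<eta> k - u 0 k \<bullet> vcoef \<eta> k)) {0..t}"
    proof (rule fundamental_theorem_of_calculus_interior)
      show "continuous_on {0..t} (\<lambda>s. u s k \<bullet> vcoef \<eta> k)"
        by (intro continuous_intros continuous_on_subset[OF sol.u_cont sub(2)])
      fix s assume s: "s \<in> {0<..<t}"
      have sub': "{0<..<T} \<subseteq> {0<..T}" and s': "s \<in> {0<..<T}" using s t by auto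
      have "((\<lambda>s. u s k) has_vector_derivative (- sig k *\<^sub>R u s k + F R s (u s) k)) (at s)"
        using ev.mild_has_derivative[OF sol.mild, of s k] at_within_open_subset[OF s' _ sub'] s' by auto
      then show "((\<lambda>s. u s k \<bullet> vcoef \<eta> k) has_vector_derivative G k s) (at s)"
        unfolding G_def by (rule bounded_linear.has_vector_derivative[OF bounded_linear_inner_left])
    qed (use t in auto)
    then have "integral {0..t} (G k) = u t k \<bullet> vcoef \<eta> k + (-1) * (vcoef f k \<bullet> vcoef \<eta> k)"
      by (simp add: integral_unique sol.u_0)
    then show ?thesis
      using set_borel_integral_eq_integral(2)[OF set_integrable_insert_0[OF si]] set_integral_insert_0[OF si] t
      by (simp add: int)
  qed
  have "((\<lambda>k. u t k \<bullet> vcoef \<eta> k + (-1) * (vcoef f k \<bullet> vcoef \<eta> k)) has_sum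
      ((\<integral>x. U f t x \<bullet> \<eta> x \<partial>torus) + (-1) * (\<integral>x. f x \<bullet> \<eta> x \<partial>torus))) UNIV"
    using parseval_vec_inner[OF V_in_L2[OF t] vtest_in_L2[OF \<eta>'(1)]]
    by (intro has_sum_add has_sum_cmult_right parseval_vec_inner f vtest_in_L2 \<eta>') (simp add: vcoef_V[OF t])
  from has_sum_unique[OF this hs(2)[unfolded mode]] have eq: "(\<integral>x. U f t x \<bullet> \<eta> x \<partial>torus) + (-1) * (\<integral>x. f x \<bullet> \<eta> x \<partial>torus) = (LINT s:{0<..t}|lborel. \<Sum>\<^sub>\<infinity>k. G k s)"
    unfolding int .
  have Jeq: "indicator {0<..t} s *\<^sub>R (\<Sum>\<^sub>\<infinity>k. G k s) = indicator {0<..t} s *\<^sub>R ?J s" for s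
    using infsumI[OF J, of s] by (simp add: indicator_def)
  have Ji: "set_integrable lborel {0<..t} ?J"
    using hs(1) unfolding set_integrable_def by (subst (asm) integrable_restrict_space) (simp_all only: Jeq, auto)
  have "(LINT s:{0<..t}|lborel. \<Sum>\<^sub>\<infinity>k. G k s) = (LINT s:{0..t}|lborel. ?J s)"
    using set_integral_insert_0[OF Ji] t unfolding set_lebesgue_integral_def Jeq by simp
  then show ?thesis using eq by simp
qed

text \<open>Solenoidal modes as test fields yield the equation for each Fourier coefficient, and the
  assumed bound \<open>R\<close> keeps every coefficient where the retraction is the identity. The
  coefficients thus form a mild solution, and \<open>mild_unique\<close> applies.\<close>

lemma V_unique:
  assumes path: "C_path 2 T v" and div: "\<And>t. t \<in> {0..T} \<Longrightarrow> div_free (v t)"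
    and le: "\<And>t. t \<in> {0..T} \<Longrightarrow> Lnorm 2 (v t) \<le> ennreal R"
    and weak: "\<And>\<eta> t. solenoidal_test \<eta> \<Longrightarrow> t \<in> {0..T} \<Longrightarrow>
      (\<integral>x. v t x \<bullet> \<eta> x \<partial>torus) = (\<integral>x. f x \<bullet> \<eta> x \<partial>torus) + (LINT s:{0..t}|lborel. weak_rhs v \<eta> s)"
    and t: "t \<in> {0..T}"
  shows "AE x in torus. v t x = U f t x"
proof -
  have vL: "in_L 2 (v t)" if "t \<in> {0..T}" for t using path that by (simp add: C_path_def)
  define c where "c t = vcoef (v t)" for t
  have c_div: "kdot k (c t k) = 0" if "t \<in> {0..T}" for t k
    using div[OF that] div_free_iff[OF vL[OF that]] by (simp add: c_def)
  have c_herm: "c t (- k) = cnjv (c t k)" for t k by (simp add: c_def vcoef_hermitian)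
  have c_le: "norm (c t k) \<le> R" if "t \<in> {0..T}" for t k
  proof -
    have "sqrt (\<Sum>\<^sub>\<infinity>k. (norm (c t k))\<^sup>2) \<le> R"
      using le[OF that] R unfolding Lnorm2_vcoef[OF vL[OF that]] c_def by (simp add: ennreal_le_iff)
    then show ?thesis using norm_vcoef_le[OF vL[OF that], of k] by (simp add: c_def)
  qed
  have c_cont: "continuous_on {0..T} (\<lambda>t. c t k)" for k
    unfolding continuous_on_def
  proof
    fix t assume t: "t \<in> {0..T}"
    have "((\<lambda>s. Lnorm 2 (\<lambda>x. v s x - v t x)) \<longlongrightarrow> ennreal 0) (at t within {0..T})"
      using path t by (simp add: C_path_def)
    then have "((\<lambda>s. enn2real (Lnorm 2 (\<lambda>x. v s x - v t x))) \<longlongrightarrow> 0) (at t within {0..T})"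
      by (rule tendsto_enn2real) simp
    note lim = this
    have "\<forall>\<^sub>F s in at t within {0..T}. norm (c s k - c t k) \<le> enn2real (Lnorm 2 (\<lambda>x. v s x - v t x))"
    proof -
      have "norm (c s k - c t k) \<le> enn2real (Lnorm 2 (\<lambda>x. v s x - v t x))" if s: "s \<in> {0..T}" for s
        using norm_vcoef_le[OF in_L2_diff[OF vL[OF s] vL[OF t]], of k]
        unfolding vcoef_diff[OF vL[OF s] vL[OF t]] Lnorm2_dist[OF vL[OF s] vL[OF t]] c_def by (simp add: infsum_nonneg)
      then show ?thesis by (auto simp: eventually_at_filter)
    qed
    from Lim_null_comparison[OF this lim] have "((\<lambda>s. c s k - c t k) \<longlongrightarrow> 0) (at t within {0..T})" .
    then show "((\<lambda>s. c s k) \<longlongrightarrow> c t k) (at t within {0..T})" by (simp add: LIM_zero_iff)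
  qed
  define g where "g k s = - sig k *\<^sub>R c s k + F R s (c s) k" for k s
  \<comment> \<open>Since \<open>s \<le> T\<close>, the factor \<open>sqrt T / sqrt s\<close> is at
    least 1; it puts the bounded viscous term under the same singular bound.\<close>
  define K where "K k = sig k * R * sqrt T + 2 * Cn * R * R" for k
  have g_cont: "continuous_on {0<..T} (g k)" for k
    unfolding g_def using exI[of "\<lambda>B. \<forall>t\<in>{0..T}. \<forall>j. norm (c t j) \<le> B" R] c_le
    by (intro continuous_intros continuous_on_subset[OF c_cont] ev.cont c_cont) auto
  have g_bd: "norm (g k s) \<le> K k / sqrt s" if s: "s \<in> {0<..T}" for k s
  proof -
    have "norm (g k s) \<le> sig k * R + 2 * Cn * R * R / sqrt s"
      unfolding g_def using c_le[of s] sig_nonneg[of k] ev.bound[of s "c s" k] s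
      by (intro norm_triangle_le add_mono) (auto intro!: mult_left_mono)
    also have "sig k * R \<le> sig k * R * sqrt T / sqrt s"
    proof -
      have "1 \<le> sqrt T / sqrt s" using s by simp
      then have "sig k * R * 1 \<le> sig k * R * (sqrt T / sqrt s)" using sig_nonneg[of k] R by (intro mult_left_mono) auto
      then show ?thesis by simp
    qed
    finally show ?thesis by (simp add: K_def add_divide_distrib)
  qed
  have g_herm: "g l s = cnjv (g (- l) s)" if "s \<in> {0<..T}" for l s
  proof -
    have "(\<lambda>j. cnjv (c s (- j))) = c s" by (simp add: c_herm)
    then have "F R s (c s) l = cnjv (F R s (c s) (- l))" using F_reflect[OF that, of "c s" l] by simp
    then show ?thesis
      by (simp add: g_def c_herm sig_def linear_diff[OF bounded_linear.linear[OF bounded_linear_cnjv]]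
          linear_cmul[OF bounded_linear.linear[OF bounded_linear_cnjv]])
  qed
  have J: "weak_rhs v (vmode k y) s = 2 * (g k s \<bullet> y)" if s: "s \<in> {0<..T}" and y: "kdot k y = 0" for k y s
  proof -
    have s': "s \<in> {0..T}" using s by auto
    have div': "kdot l (vcoef (vmode k y) l) = 0" for l by (rule solenoidal_testD[OF solenoidal_vmode[OF y]])
    have "F R s (c s) l = NL s (lowpass s (c s)) (lowpass s (c s)) l" for l
      by (rule F_eq_NL[OF s R]) (rule c_le[OF s'])
    then have "((\<lambda>l. g l s \<bullet> vcoef (vmode k y) l) has_sum weak_rhs v (vmode k y) s) UNIV"
      using weak_integrand[OF s vL[OF s'] vtest_vmode div'] by (simp add: g_def c_def)
    moreover have "g (- l) s = cnjv (g l s)" for l using g_herm[OF s, of "- l"] by simp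
    ultimately show ?thesis using pairing_vmode[of "\<lambda>l. g l s" k y] has_sum_unique by blast
  qed
  \<comment> \<open>The weak equation gives a plain time integral, so the viscous term is first
    counted as forcing in \<open>g\<close> and the damping is 0; \<open>mildI\<close> later restores
    the heat factor.\<close>
  have eq: "c t k = duhamel 0 (vcoef f k) (g k) t" if t: "t \<in> {0..T}" for t k
  proof -
    have sub: "{0<..t} \<subseteq> {0<..T}" using t by auto
    have gi: "g k integrable_on {0..t}"
      by (rule singular_integrable_on[OF continuous_on_subset[OF g_cont sub] g_bd]) (use sub in auto)
    \<comment> \<open>Only amplitudes with \<open>kdot k y = 0\<close> may be tested. The defect
      \<open>?x\<close> turns out to be of this kind, so it can be tested against itself.\<close>
    let ?x = "c t k - vcoef f k - integral {0..t} (g k)"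
    have test: "?x \<bullet> y = 0" if y: "kdot k y = 0" for y
    proof -
      have pair: "(\<integral>x. h x \<bullet> vmode k y x \<partial>torus) = 2 * (vcoef h k \<bullet> y)" if "in_L 2 h" for h
        by (rule has_sum_unique[OF parseval_vec_inner[OF that vtest_in_L2[OF vtest_vmode]]])
          (rule pairing_vmode, rule vcoef_hermitian)
      have si: "set_integrable lborel {0..t} (\<lambda>s. 2 * (g k s \<bullet> y))"
      proof (rule set_integrable_singular)
        show "continuous_on {0<..t} (\<lambda>s. 2 * (g k s \<bullet> y))"
          by (intro continuous_intros continuous_on_subset[OF g_cont sub])
        show "norm (2 * (g k s \<bullet> y)) \<le> (2 * K k * norm y) / sqrt s" if "s \<in> {0<..t}" for s
        proof -
          have "\<bar>g k s \<bullet> y\<bar> \<le> K k / sqrt s * norm y"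
            using order_trans[OF Cauchy_Schwarz_ineq2 mult_right_mono[OF g_bd norm_ge_zero]] that sub by blast
          then show ?thesis by (simp add: abs_mult)
        qed
      qed
      have si': "set_integrable lborel {0<..t} (\<lambda>s. 2 * (g k s \<bullet> y))" by (rule set_integrable_subset[OF si]) auto
      have ind: "indicator {0<..t} s *\<^sub>R weak_rhs v (vmode k y) s = indicator {0<..t} s *\<^sub>R (2 * (g k s \<bullet> y))" for s
        using J[OF _ y, of s] sub by (cases "s \<in> {0<..t}") auto
      have "set_integrable lborel {0<..t} (weak_rhs v (vmode k y))"
        using si' unfolding set_integrable_def ind .
      from set_integral_insert_0[OF this] set_integral_insert_0[OF si'] t
      have "(LINT s:{0..t}|lborel. weak_rhs v (vmode k y) s) = (LINT s:{0..t}|lborel. 2 * (g k s \<bullet> y))"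
        unfolding set_lebesgue_integral_def ind by simp
      also have "\<dots> = integral {0..t} (\<lambda>s. 2 * (g k s \<bullet> y))" by (rule set_borel_integral_eq_integral(2)[OF si])
      also have "\<dots> = 2 * (integral {0..t} (g k) \<bullet> y)"
        using integral_linear[OF gi bounded_linear_inner_left[of y]] by (simp add: o_def)
      finally have "2 * (c t k \<bullet> y) = 2 * (vcoef f k \<bullet> y) + 2 * (integral {0..t} (g k) \<bullet> y)"
        using weak[OF solenoidal_vmode[OF y] t] pair[OF vL[OF t]] pair[OF f] by (simp add: c_def)
      then show ?thesis by (simp add: inner_diff_left)
    qed
    have "kdot k (integral {0..t} (g k)) = 0"
    proof -
      have "kdot k (integral {0..t} (g k)) = integral {0..t} (\<lambda>s. kdot k (g k s))"
        using integral_linear[OF gi bounded_linear_kdot[of k]] by (simp add: o_def)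
      also have "\<dots> = integral {0..t} (\<lambda>_. 0)"
        using t c_div kdot_F[of k] by (intro integral_cong) (auto simp: g_def kdot_diff kdot_scaleR)
      finally show ?thesis by simp
    qed
    then have "kdot k ?x = 0" using c_div[OF t] sol.a_div by (simp add: kdot_diff)
    from test[OF this] have "?x = 0" by simp
    then show ?thesis by (simp add: duhamel_def algebra_simps)
  qed
  have "ev.mild (vcoef f) c"
  proof (rule ev.mildI[OF c_cont c_le])
    fix t k assume t: "t \<in> {0<..<T}"
    then have t': "t \<in> {0<..T}" and sub': "{0<..<T} \<subseteq> {0<..T}" by auto
    have "(duhamel 0 (vcoef f k) (g k) has_vector_derivative (- 0 *\<^sub>R duhamel 0 (vcoef f k) (g k) t + g k t)) (at t within {0<..T})"
      by (rule duhamel_has_derivative[OF g_cont g_bd order_refl t'])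
    then have "(duhamel 0 (vcoef f k) (g k) has_vector_derivative g k t) (at t within {0<..T})" by simp
    then have "((\<lambda>t. c t k) has_vector_derivative g k t) (at t within {0<..T})"
      by (rule has_vector_derivative_transform[OF t', rotated]) (use eq in auto)
    then show "((\<lambda>t. c t k) has_vector_derivative (- sig k *\<^sub>R c t k + F R t (c t) k)) (at t)"
      using at_within_open_subset[OF t _ sub'] by (simp add: g_def)
  next
    show "c 0 k = vcoef f k" for k using eq[of 0 k] T_pos by simp
  qed
  then have "c t k = u t k" for k by (rule ev.mild_unique[OF _ sol.mild t])
  then show ?thesis
    by (intro vcoef_inj vL V_in_L2 t) (simp add: vcoef_V[OF t] c_def)
qed

end

subsection \<open>Smooth multipliers on integrable functions\<close>

lemma Ck_on_id: "Ck_on n S (\<lambda>x. x)"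
  by (cases n) (auto intro!: exI[of _ "\<lambda>_ v. v"] Ck_on_const continuous_on_id)

lemma Ck_on_open_local:
  fixes f :: "'a::euclidean_space \<Rightarrow> 'b::real_normed_vector"
  assumes "\<And>x. \<exists>N. open N \<and> x \<in> N \<and> Ck_on n N f"
  shows "Ck_on n UNIV f"
  using assms
proof (induction n arbitrary: f)
  case 0
  have "isCont f x" for x
    using 0[of x] by (auto simp: continuous_on_eq_continuous_at)
  then show ?case by (simp add: continuous_on_eq_continuous_at)
next
  case (Suc n)
  have D: "f differentiable (at x)" for x
  proof -
    obtain N where "open N" "x \<in> N" "Ck_on (Suc n) N f" using Suc.prems[of x] by blast
    then obtain f' where "(f has_derivative f' x) (at x within N)" by auto
    then show ?thesis using at_within_open[OF \<open>x \<in> N\<close> \<open>open N\<close>] by (auto simp: differentiable_def)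
  qed
  show ?case unfolding Ck_on.simps
  proof (intro exI conjI ballI allI)
    show "(f has_derivative frechet_derivative f (at x)) (at x within UNIV)" for x
      using D by (simp add: frechet_derivative_works)
    fix v
    show "Ck_on n UNIV (\<lambda>x. frechet_derivative f (at x) v)"
    proof (rule Suc.IH)
      fix x
      obtain N where N: "open N" "x \<in> N" "Ck_on (Suc n) N f" using Suc.prems[of x] by blast
      then obtain f' where f': "\<And>y. y \<in> N \<Longrightarrow> (f has_derivative f' y) (at y within N)" "\<And>v. Ck_on n N (\<lambda>y. f' y v)"
        by auto
      have "f' y = frechet_derivative f (at y)" if "y \<in> N" for y
        using f'(1)[OF that] at_within_open[OF that N(1)] frechet_derivative_at by fastforce
      then have "Ck_on n N (\<lambda>y. frechet_derivative f (at y) v)"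
        by (intro Ck_on_cong[OF f'(2)[of v]]) auto
      with N show "\<exists>N. open N \<and> x \<in> N \<and> Ck_on n N (\<lambda>y. frechet_derivative f (at y) v)" by blast
    qed
  qed
qed

text \<open>The difference is continuous with vanishing coefficients, so Parseval gives a zero
  integral of its square, and continuity upgrades this from almost everywhere to everywhere.\<close>

lemma fourier_inversion:
  assumes cont: "continuous_on UNIV g" and per: "periodic g"
    and c: "(\<lambda>k. norm (fcoeff g k)) summable_on UNIV"
  shows "sser (fcoeff g) x = g x"
proof -
  define d where "d x = g x - sser (fcoeff g) x" for x
  have cs: "continuous_on UNIV (sser (fcoeff g))" by (rule continuous_sser[OF c])
  have dc: "continuous_on S d" for S
    unfolding d_def by (intro continuous_intros continuous_on_subset[OF cont] continuous_on_subset[OF cs]) auto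
  have dp: "periodic d" using per periodic_sser[of "fcoeff g"] by (simp add: periodic_def d_def)
  have "fcoeff d k = 0" for k
    using fcoeff_diff[OF integrable_torus_continuous[OF cont] integrable_torus_continuous[OF cs], of k]
      fcoeff_sser[OF c, of k] by (simp add: fcoeff_uminus d_def[abs_def])
  moreover have "continuous_on UNIV (\<lambda>x. (d x)\<^sup>2)" by (intro continuous_intros dc)
  then have "integrable torus (\<lambda>x. (d x)\<^sup>2)" by (rule integrable_torus_continuous)
  ultimately have "((\<lambda>k::int^3. 0::real) has_sum (\<integral>x. (d x)\<^sup>2 \<partial>torus)) UNIV"
    using parseval[of d] borel_measurable_continuous_onI[OF dc] by simp
  then have "(\<integral>x. (d x)\<^sup>2 \<partial>torus) = 0" by (rule has_sum_unique) (simp add: has_sum_0)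
  moreover have "(\<integral>x. (d x)\<^sup>2 \<partial>torus) = integral (cbox 0 1) (\<lambda>x. (d x)\<^sup>2)"
  proof -
    have "set_integrable lborel (cbox 0 1) (\<lambda>x. (d x)\<^sup>2)"
      unfolding set_integrable_def by (rule borel_integrable_compact) (auto intro!: continuous_intros dc)
    from set_borel_integral_eq_integral(2)[OF this] show ?thesis
      by (simp add: integral_torus set_lebesgue_integral_def)
  qed
  moreover have "box (0::real^3) 1 \<noteq> {}" by (simp add: interval_ne_empty_cart(2))
  ultimately have z: "d y = 0" if "y \<in> cbox 0 1" for y
    using integral_cbox_eq_0_iff[of 0 "1::real^3" "\<lambda>x. (d x)\<^sup>2"] that by (auto intro!: continuous_intros dc)
  obtain k where "x - lattice_vec k \<in> cbox 0 1" using unit_cube_representative by blast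
  from z[OF this] have "d x = 0" using periodic_lattice[OF dp, of x "- k"] by simp
  then show ?thesis by (simp add: d_def)
qed

text \<open>Spectrum in an open ball. Continuity and periodicity are included so that the function
  equals its finite Fourier sum at every point (\<open>band_sser\<close>).\<close>

definition band :: "real \<Rightarrow> (real^3 \<Rightarrow> real) \<Rightarrow> bool" where
  "band r g \<longleftrightarrow> continuous_on UNIV g \<and> periodic g \<and> (\<forall>k. r \<le> knorm k \<longrightarrow> fcoeff g k = 0)"

lemma band_sser:
  assumes "band r g"
  shows "sser (fcoeff g) x = g x"
  using assms finite_support_summable[of "{k. knorm k < r}" "fcoeff g"] finite_knorm_ball[of r]
  by (intro fourier_inversion) (auto simp: band_def not_less)

lemma band_mult:
  assumes f: "band r f" and g: "band s g"
  shows "band (r + s) (\<lambda>x. f x * g x)"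
  unfolding band_def
proof (intro conjI allI impI)
  show "continuous_on UNIV (\<lambda>x. f x * g x)" using f g by (auto simp: band_def intro!: continuous_intros)
  show "periodic (\<lambda>x. f x * g x)" using f g by (simp add: band_def periodic_def)
  fix k assume k: "r + s \<le> knorm k"
  have gi: "integrable torus g" using g by (simp add: band_def integrable_torus_continuous)
  have "fcoeff (\<lambda>x. f x * g x) k = fcoeff (\<lambda>x. sser (fcoeff f) x * g x) k" by (simp add: band_sser[OF f])
  also have "\<dots> = (\<Sum>l\<in>{l. knorm l < r}. fcoeff f l * fcoeff g (k - l))"
    using f by (intro fcoeff_mult_sser_finite finite_knorm_ball fcoeff_uminus gi) (auto simp: band_def not_less)
  also have "\<dots> = 0"
  proof (intro sum.neutral ballI)
    fix l assume "l \<in> {l. knorm l < r}"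
    then have "s \<le> knorm (k - l)" using k norm_triangle_ineq2[of "lattice_vec k" "lattice_vec l"] by simp
    then show "fcoeff f l * fcoeff g (k - l) = 0" using g by (simp add: band_def)
  qed
  finally show "fcoeff (\<lambda>x. f x * g x) k = 0" .
qed

lemma band_diff: "band r f \<Longrightarrow> band r g \<Longrightarrow> band r (\<lambda>x. f x - g x)"
  by (auto simp: band_def periodic_def fcoeff_diff integrable_torus_continuous intro!: continuous_intros)

lemma band_add: "band r f \<Longrightarrow> band r g \<Longrightarrow> band r (\<lambda>x. f x + g x)"
  by (auto simp: band_def periodic_def fcoeff_add integrable_torus_continuous intro!: continuous_intros)

lemma band_cmult: "band r f \<Longrightarrow> band r (\<lambda>x. c * f x)"
  by (auto simp: band_def periodic_def fcoeff_cmult intro!: continuous_intros)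

lemma band_mono: "band r f \<Longrightarrow> r \<le> s \<Longrightarrow> band s f"
  by (auto simp: band_def)

text \<open>For a cutoff the rescaled bump vanishes once \<open>norm y \<ge> 1/5\<close>, so its
  lattice translates are disjoint and subtracting the nearest lattice point periodizes it without a
  series. The factor 10 maps frequencies with \<open>knorm k < 5 * L\<close> to points
  \<open>k / (10 * L)\<close> within distance 1/2 of the origin.\<close>

definition periodization :: "(real^3 \<Rightarrow> real) \<Rightarrow> real^3 \<Rightarrow> real" where
  "periodization \<phi> y = \<phi> (10 *\<^sub>R (y - lattice_vec (\<chi> i. round (y $ i))))"

lemma periodization_eq:
  assumes "norm y < 1/2"
  shows "periodization \<phi> y = \<phi> (10 *\<^sub>R y)"
proof -
  have "round (y $ i) = 0" for i
    using component_le_norm_cart[of y i] assms by (intro round_unique') simp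
  then have "(\<chi> i. round (y $ i)) = 0" by (simp add: vec_eq_iff)
  then show ?thesis by (simp add: periodization_def)
qed

lemma round_add_of_int: "round (x + of_int n) = round x + n" for x :: real
proof -
  have "x + of_int n + 1 / 2 = x + 1 / 2 + of_int n" by simp
  then show ?thesis unfolding round_def by (simp only: floor_add_int[symmetric])
qed

lemma periodization_lattice: "periodization \<phi> (y + lattice_vec k) = periodization \<phi> y"
proof -
  have "lattice_vec (\<chi> i. round ((y + lattice_vec k) $ i)) = lattice_vec (\<chi> i. round (y $ i)) + lattice_vec k"
    by (simp add: vec_eq_iff round_add_of_int)
  then show ?thesis by (simp add: periodization_def)
qed

lemma periodization_vtest:
  assumes \<phi>: "cutoff \<phi>"
  shows "vtest (periodization \<phi>)"
proof -
  have ax: "axis i 1 = lattice_vec (axis i 1)" for i :: 3 by (simp add: vec_eq_iff axis_def)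
  have "periodic (periodization \<phi>)" by (simp add: periodic_def ax periodization_lattice)
  moreover have "Ck_on n UNIV (periodization \<phi>)" for n
  proof (rule Ck_on_open_local)
    fix x :: "real^3"
    let ?k = "(\<chi> i. round (x $ i)) :: int^3"
    let ?z = "x - lattice_vec ?k"
    show "\<exists>N. open N \<and> x \<in> N \<and> Ck_on n N (periodization \<phi>)"
    proof (cases "norm ?z < 1/2")
      case True
      let ?N = "ball (lattice_vec ?k) (1/2)"
      have "Ck_on n ?N (\<lambda>y. \<phi> (10 *\<^sub>R (y - lattice_vec ?k)))"
      proof (rule Ck_on_compose[where g=\<phi> and f="\<lambda>y. 10 *\<^sub>R (y - lattice_vec ?k)"])
        show "Ck_on n UNIV \<phi>" using \<phi> by (simp add: cutoff_def smooth_on_def)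
        show "Ck_on n ?N (\<lambda>y. 10 *\<^sub>R (y - lattice_vec ?k))"
          using Ck_on_add[OF Ck_on_bounded_linear[OF bounded_linear_scaleR_right Ck_on_id] Ck_on_const, of n ?N 10 "- (10 *\<^sub>R lattice_vec ?k)"]
          by (simp add: scaleR_diff_right)
      qed
      moreover have "\<phi> (10 *\<^sub>R (y - lattice_vec ?k)) = periodization \<phi> y" if "y \<in> ?N" for y
        using periodization_eq[of "y - lattice_vec ?k" \<phi>] periodization_lattice[of \<phi> y "- ?k"] that
        by (simp add: dist_norm norm_minus_commute)
      ultimately have "Ck_on n ?N (periodization \<phi>)" by (rule Ck_on_cong)
      then show ?thesis using True by (intro exI[of _ ?N]) (simp add: dist_norm norm_minus_commute)
    next
      case False
      \<comment> \<open>Radius 1/10: if \<open>y\<close> were within 1/5 of its rounded lattice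
        point, \<open>x\<close> would be within 3/10 of it, hence rounded to the same point, against
        the case assumption.\<close>
      let ?N = "ball x (1/10)"
      have "periodization \<phi> y = 0" if y: "y \<in> ?N" for y
      proof -
        let ?w = "y - lattice_vec (\<chi> i. round (y $ i))"
        have "2/10 \<le> norm ?w"
        proof (rule ccontr)
          let ?l = "(\<chi> i. round (y $ i)) - ?k"
          assume "\<not> 2/10 \<le> norm ?w"
          moreover have "norm (x - y) < 1/10" using y by (simp add: dist_norm)
          ultimately have *: "norm (x - lattice_vec (\<chi> i. round (y $ i))) < 3/10"
            using norm_triangle_ineq[of "x - y" ?w] by simp
          have "round (x $ i) = round (y $ i)" for i
          proof (rule round_unique')
            show "\<bar>x $ i - of_int (round (y $ i))\<bar> < 1 / 2"
              using component_le_norm_cart[of "x - lattice_vec (\<chi> i. round (y $ i))" i] * by simp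
          qed
          with * False show False by simp
        qed
        then show ?thesis using \<phi> by (simp add: periodization_def cutoff_def)
      qed
      then have "Ck_on n ?N (periodization \<phi>)" by (intro Ck_on_cong[OF Ck_on_const[of n ?N 0]]) auto
      then show ?thesis by (intro exI[of _ ?N]) simp
    qed
  qed
  ultimately show ?thesis by (simp add: vtest_def smooth_on_def)
qed

lemma vtest_fcoeff_summable:
  assumes g: "vtest g"
  shows "(\<lambda>k. norm (fcoeff g k)) summable_on UNIV"
proof -
  have v: "vtest (\<lambda>x. \<chi> i. g x)" using g
    by (auto simp: vtest_def periodic_def smooth_on_def intro!: Ck_on_vecI)
  obtain C where C: "\<And>k. norm (vcoef (\<lambda>x. \<chi> i. g x) k) \<le> C * (lweight k / (1 + knorm k)\<^sup>2)"
    using vtest_vcoef_decay[OF v] by blast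
  have "norm (fcoeff g k) \<le> \<bar>C\<bar> * lweight k" for k
  proof -
    have "norm (fcoeff g k) \<le> norm (vcoef (\<lambda>x. \<chi> i. g x) k)"
      using Finite_Cartesian_Product.norm_nth_le[of "vcoef (\<lambda>x. \<chi> i. g x) k" 1] by (simp add: vcoef_def)
    also have "\<dots> \<le> C * (lweight k / (1 + knorm k)\<^sup>2)" by (rule C)
    also have "\<dots> \<le> \<bar>C\<bar> * lweight k"
    proof (intro mult_mono)
      have "1 \<le> (1 + knorm k)\<^sup>2" by (intro one_le_power) simp
      then show "lweight k / (1 + knorm k)\<^sup>2 \<le> lweight k" using lweight_pos[of k]
        by (simp add: divide_le_eq mult_le_cancel_left1 less_imp_le)
    qed (use lweight_pos[of k] in \<open>auto intro!: divide_nonneg_nonneg\<close>)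
    finally show ?thesis .
  qed
  then show ?thesis
    by (intro summable_on_comparison_test[OF summable_on_cmult_right[OF summable_lweight, of "\<bar>C\<bar>"]]) auto
qed

text \<open>On a frequency ball of radius \<open>5 L\<close> the symbol agrees with an absolutely convergent Fourier
  series, so the multiplier is an absolutely convergent combination of translations.\<close>

lemma multiplier_translations:
  fixes g :: "real^3 \<Rightarrow> 'b::euclidean_space"
  assumes \<phi>: "cutoff \<phi>" and L: "L > 0" and g: "\<And>b. b \<in> Basis \<Longrightarrow> band (5 * L) (\<lambda>x. g x \<bullet> b)"
  shows "((\<lambda>n. Re (fcoeff (periodization \<phi>) n) *\<^sub>R g (x + (1 / (10 * L)) *\<^sub>R lattice_vec n)) has_sum
     fmult (\<lambda>\<xi>. \<phi> (\<xi> /\<^sub>R L)) g x) UNIV"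
proof -
  let ?p = "fcoeff (periodization \<phi>)" and ?h = "1 / (10 * L)" and ?A = "{k. knorm k < 5 * L}"
  have A: "finite ?A" by (rule finite_knorm_ball)
  note pv = periodization_vtest[OF \<phi>]
  note ps = vtest_fcoeff_summable[OF pv]
  have sym: "((\<lambda>n. ?p n * fexp k (?h *\<^sub>R lattice_vec n)) has_sum of_real (\<phi> (lattice_vec k /\<^sub>R L))) UNIV"
    if k: "k \<in> ?A" for k
  proof -
    let ?y = "?h *\<^sub>R lattice_vec k"
    have "norm ?y < 1/2" using k L by (simp add: field_simps)
    then have "\<phi> (lattice_vec k /\<^sub>R L) = periodization \<phi> ?y"
    proof -
      have "lattice_vec k /\<^sub>R L = 10 *\<^sub>R ?y" using L by (simp add: inverse_eq_divide)
      then show ?thesis using periodization_eq[OF \<open>norm ?y < 1/2\<close>] by (simp only:)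
    qed
    also have "\<dots> = sser ?p ?y"
      using fourier_inversion[OF vtest_continuous[OF pv] _ ps] pv by (simp add: vtest_def)
    finally have eq: "of_real (\<phi> (lattice_vec k /\<^sub>R L)) = (\<Sum>\<^sub>\<infinity>n. ?p n * fexp n ?y)"
      by (simp add: sser_complex fcoeff_uminus)
    \<comment> \<open>The pairing of frequency \<open>k\<close> and index \<open>n\<close> is
      symmetric. This turns the Fourier series of the symbol, evaluated at a frequency, into
      translations of the argument.\<close>
    have fx: "fexp n ?y = fexp k (?h *\<^sub>R lattice_vec n)" for n
      by (simp add: fexp_def inner_commute)
    have "(\<lambda>n. ?p n * fexp n ?y) summable_on UNIV"
      by (rule abs_summable_summable) (simp add: norm_mult ps)
    from has_sum_infsum[OF this] show ?thesis unfolding eq fx .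
  qed
  have comp: "((\<lambda>n. Re (?p n) * (g (x + ?h *\<^sub>R lattice_vec n) \<bullet> b)) has_sum
      Re (\<Sum>\<^sub>\<infinity>k. of_real (\<phi> (lattice_vec k /\<^sub>R L)) * fcoeff (\<lambda>y. g y \<bullet> b) k * fexp k x)) UNIV"
    if b: "b \<in> Basis" for b
  proof -
    let ?c = "fcoeff (\<lambda>y. g y \<bullet> b)"
    have c0: "?c k = 0" if "k \<notin> ?A" for k using g[OF b] that by (simp add: band_def not_less)
    have gb: "of_real (g y \<bullet> b) = (\<Sum>k\<in>?A. ?c k * fexp k y)" for y
    proof -
      have "of_real (g y \<bullet> b) = (\<Sum>\<^sub>\<infinity>k. ?c k * fexp k y)"
        using band_sser[OF g[OF b], of y] sser_complex[of ?c y] fcoeff_uminus by simp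
      also have "\<dots> = (\<Sum>\<^sub>\<infinity>k\<in>?A. ?c k * fexp k y)" using c0 by (intro infsum_cong_neutral) auto
      finally show ?thesis using A by simp
    qed
    have "((\<lambda>n. \<Sum>k\<in>?A. ?p n * fexp k (?h *\<^sub>R lattice_vec n) * (?c k * fexp k x)) has_sum
        (\<Sum>k\<in>?A. of_real (\<phi> (lattice_vec k /\<^sub>R L)) * (?c k * fexp k x))) UNIV"
      by (intro has_sum_finite_sum A has_sum_cmult_left sym)
    moreover have "(\<Sum>k\<in>?A. ?p n * fexp k (?h *\<^sub>R lattice_vec n) * (?c k * fexp k x)) =
        ?p n * of_real (g (x + ?h *\<^sub>R lattice_vec n) \<bullet> b)" for n
      unfolding gb sum_distrib_left by (simp add: fexp_add_arg mult_ac)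
    moreover have "(\<Sum>k\<in>?A. of_real (\<phi> (lattice_vec k /\<^sub>R L)) * (?c k * fexp k x)) =
        (\<Sum>\<^sub>\<infinity>k. of_real (\<phi> (lattice_vec k /\<^sub>R L)) * ?c k * fexp k x)"
    proof -
      have "(\<Sum>\<^sub>\<infinity>k. of_real (\<phi> (lattice_vec k /\<^sub>R L)) * ?c k * fexp k x) =
          (\<Sum>\<^sub>\<infinity>k\<in>?A. of_real (\<phi> (lattice_vec k /\<^sub>R L)) * ?c k * fexp k x)"
        using c0 by (intro infsum_cong_neutral) auto
      then show ?thesis using A by (simp add: mult.assoc)
    qed
    ultimately have "((\<lambda>n. ?p n * of_real (g (x + ?h *\<^sub>R lattice_vec n) \<bullet> b)) has_sum
        (\<Sum>\<^sub>\<infinity>k. of_real (\<phi> (lattice_vec k /\<^sub>R L)) * ?c k * fexp k x)) UNIV" by simp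
    from has_sum_Re[OF this] show ?thesis by simp
  qed
  have "((\<lambda>n. \<Sum>b\<in>Basis. (Re (?p n) * (g (x + ?h *\<^sub>R lattice_vec n) \<bullet> b)) *\<^sub>R b) has_sum
      (\<Sum>b\<in>Basis. Re (\<Sum>\<^sub>\<infinity>k. of_real (\<phi> (lattice_vec k /\<^sub>R L)) * fcoeff (\<lambda>y. g y \<bullet> b) k * fexp k x) *\<^sub>R b)) UNIV"
    by (intro has_sum_finite_sum finite_Basis has_sum_bounded_linear[OF bounded_linear_scaleR_left] comp)
  moreover have "(\<Sum>b\<in>Basis. (Re (?p n) * (g y \<bullet> b)) *\<^sub>R b) = Re (?p n) *\<^sub>R g y" for n y
    by (simp add: scaleR_scaleR[symmetric] scaleR_sum_right[symmetric] euclidean_representation del: scaleR_scaleR)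
  ultimately show ?thesis by (simp add: fmult_def fexp_def)
qed

lemma continuous_band:
  fixes g :: "real^3 \<Rightarrow> 'b::euclidean_space"
  assumes g: "\<And>b. b \<in> Basis \<Longrightarrow> band r (\<lambda>x. g x \<bullet> b)"
  shows "continuous_on UNIV g" "periodic g"
  using g by (auto simp: band_def periodic_def continuous_on_componentwise[of _ g] euclidean_eq_iff[where 'a='b])

lemma fmult_inner:
  fixes g :: "real^3 \<Rightarrow> 'b::euclidean_space"
  assumes "b \<in> Basis"
  shows "fmult \<mu> g x \<bullet> b = sser (\<lambda>k. of_real (\<mu> (lattice_vec k)) * fcoeff (\<lambda>y. g y \<bullet> b) k) x"
  unfolding fmult_def fexp_def sser_def by (rule inner_sum_left_Basis[OF assms])

lemma fmult_band:
  fixes g :: "real^3 \<Rightarrow> 'b::euclidean_space"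
  assumes g: "\<And>b. b \<in> Basis \<Longrightarrow> band r (\<lambda>x. g x \<bullet> b)"
  shows "continuous_on UNIV (fmult \<mu> g)" "periodic (fmult \<mu> g)"
proof -
  have "continuous_on UNIV (\<lambda>x. fmult \<mu> g x \<bullet> b)" if b: "b \<in> Basis" for b
    unfolding fmult_inner[OF b]
    by (intro continuous_sser finite_support_summable[OF finite_knorm_ball[of r]])
       (use g[OF b] in \<open>auto simp: band_def not_less\<close>)
  then show "continuous_on UNIV (fmult \<mu> g)" by (subst continuous_on_componentwise) blast
  show "periodic (fmult \<mu> g)"
    using periodic_sser by (auto simp: periodic_def euclidean_eq_iff[where 'a='b] fmult_inner)
qed

text \<open>Each translation preserves the integral of the norm, so the constant is the absolute sum
  of the coefficients of \<open>periodization \<phi>\<close>. The scale \<open>L\<close> affects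
  only the step of the translations, whence uniformity in \<open>L\<close>.\<close>

lemma multiplier_L1:
  assumes \<phi>: "cutoff \<phi>"
  obtains C where "C \<ge> 0" "\<And>L (g :: real^3 \<Rightarrow> 'b::euclidean_space). L > 0 \<Longrightarrow> (\<And>b. b \<in> Basis \<Longrightarrow> band (5 * L) (\<lambda>x. g x \<bullet> b)) \<Longrightarrow>
    (\<integral>x. norm (fmult (\<lambda>\<xi>. \<phi> (\<xi> /\<^sub>R L)) g x) \<partial>torus) \<le> C * (\<integral>x. norm (g x) \<partial>torus)"
proof
  let ?p = "fcoeff (periodization \<phi>)"
  note ps = vtest_fcoeff_summable[OF periodization_vtest[OF \<phi>]]
  show "0 \<le> (\<Sum>\<^sub>\<infinity>n. norm (?p n))" by (simp add: infsum_nonneg)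
  fix L and g :: "real^3 \<Rightarrow> 'b"
  assume L: "L > 0" and g: "\<And>b. b \<in> Basis \<Longrightarrow> band (5 * L) (\<lambda>x. g x \<bullet> b)"
  note gc = continuous_band[OF g] and fc = fmult_band(1)[OF g]
  obtain B where B: "\<And>x. norm (g x) \<le> B" using periodic_continuous_bounded[OF gc] by blast
  define h where "h n = (1 / (10 * L)) *\<^sub>R lattice_vec n" for n
  have ngc: "continuous_on UNIV (\<lambda>x. norm (g x))" and ngp: "periodic (\<lambda>x. norm (g x))"
    using gc by (auto intro!: continuous_intros simp: periodic_def)
  have tc: "continuous_on UNIV (\<lambda>x. norm (g (x + h n)))" for n
    by (intro continuous_intros continuous_on_compose2[OF gc(1)]) auto
  define S where "S x = (\<Sum>\<^sub>\<infinity>n. norm (?p n) * norm (g (x + h n)))" for x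
  have sb: "norm (norm (?p n) * norm (g (x + h n))) \<le> norm (?p n) * B" for n x
    using B by (simp add: abs_mult mult_left_mono)
  have S: "integrable torus S" "((\<lambda>n. \<integral>x. norm (?p n) * norm (g (x + h n)) \<partial>torus) has_sum (\<integral>x. S x \<partial>torus)) UNIV"
    unfolding S_def
    by (rule integral_has_sum[OF torus.finite_measure_axioms _ sb summable_on_cmult_left[OF ps]],
        intro borel_measurable_integrable integrable_torus_continuous continuous_intros tc)+
  have "(\<integral>x. norm (g (x + h n)) \<partial>torus) = (\<integral>x. norm (g x) \<partial>torus)" for n
    by (rule integral_torus_translate[OF ngc ngp])
  then have "(\<integral>x. norm (?p n) * norm (g (x + h n)) \<partial>torus) = norm (?p n) * (\<integral>x. norm (g x) \<partial>torus)" for n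
    by simp
  then have Seq: "(\<integral>x. S x \<partial>torus) = (\<Sum>\<^sub>\<infinity>n. norm (?p n)) * (\<integral>x. norm (g x) \<partial>torus)"
    using has_sum_unique[OF S(2)] has_sum_cmult_left[OF has_sum_infsum[OF ps]] by presburger
  have "norm (fmult (\<lambda>\<xi>. \<phi> (\<xi> /\<^sub>R L)) g x) \<le> S x" for x
  proof -
    have sm: "(\<lambda>n. norm (?p n) * norm (g (x + h n))) summable_on UNIV"
      by (rule summable_on_comparison_test[OF summable_on_cmult_left[OF ps, of B]]) (use sb in auto)
    note hs = multiplier_translations[OF \<phi> L g, of x, folded h_def]
    have le: "norm (Re (?p n) *\<^sub>R g (x + h n)) \<le> norm (?p n) * norm (g (x + h n))" for n
      by (simp add: mult_right_mono abs_Re_le_cmod)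
    have "norm (\<Sum>\<^sub>\<infinity>n. Re (?p n) *\<^sub>R g (x + h n)) \<le> (\<Sum>\<^sub>\<infinity>n. norm (?p n) * norm (g (x + h n)))"
      by (rule norm_infsum_le[OF has_sum_infsum has_sum_infsum[OF sm]]) (use hs le in \<open>auto simp: summable_on_def\<close>)
    then show ?thesis using infsumI[OF hs] by (simp add: S_def)
  qed
  then have "(\<integral>x. norm (fmult (\<lambda>\<xi>. \<phi> (\<xi> /\<^sub>R L)) g x) \<partial>torus) \<le> (\<integral>x. S x \<partial>torus)"
    by (intro integral_mono S integrable_torus_continuous continuous_intros fc)
  then show "(\<integral>x. norm (fmult (\<lambda>\<xi>. \<phi> (\<xi> /\<^sub>R L)) g x) \<partial>torus) \<le> (\<Sum>\<^sub>\<infinity>n. norm (?p n)) * (\<integral>x. norm (g x) \<partial>torus)"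
    by (simp add: Seq)
qed

subsection \<open>The initial layer\<close>

lemma Lnorm1_eq:
  fixes g :: "real^3 \<Rightarrow> 'b::euclidean_space"
  assumes g: "continuous_on UNIV g"
  shows "Lnorm 1 g = ennreal (\<integral>x. norm (g x) \<partial>torus)"
proof -
  have "integrable torus (\<lambda>x. norm (g x))" by (intro integrable_torus_continuous continuous_intros g)
  then show ?thesis
    by (simp add: Lnorm_def ennpow_def nn_integral_eq_integral powr_one Bochner_Integration.integral_nonneg)
qed

lemma continuous_periodic_in_L1:
  fixes g :: "real^3 \<Rightarrow> 'b::euclidean_space"
  assumes "continuous_on UNIV g" "periodic g"
  shows "in_L 1 g"
  using assms by (simp add: in_L_def Lnorm1_eq borel_measurable_continuous_onI)

text \<open>A coefficient is 1-Lipschitz for the \<open>L2\<close> distance, so its superlevel sets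
  are open; the value 0 given to functions outside \<open>L2\<close> matters for negative levels
  only.\<close>

lemma coefficient_measurable: "(\<lambda>f. if in_L 2 f then norm (vcoef f k) else 0) \<in> borel_measurable L2_borel"
  unfolding borel_measurable_iff_greater
proof
  fix a :: real
  show "{f \<in> space L2_borel. a < (if in_L 2 f then norm (vcoef f k) else 0)} \<in> sets L2_borel"
  proof (cases "a < 0")
    case True
    then have "{f \<in> space L2_borel. a < (if in_L 2 f then norm (vcoef f k) else 0)} = space L2_borel"
      by (auto intro: less_le_trans)
    then show ?thesis by simp
  next
    case False
    have "L2_open {f. in_L 2 f \<and> a < norm (vcoef f k)}"
      unfolding L2_open_def
    proof (intro conjI ballI)
      fix f assume "f \<in> {f. in_L 2 f \<and> a < norm (vcoef f k)}"
      then have f: "in_L 2 f" "a < norm (vcoef f k)" by auto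
      show "\<exists>r>0. \<forall>g. in_L 2 g \<and> Lnorm 2 (\<lambda>x. g x - f x) < ennreal r \<longrightarrow> g \<in> {f. in_L 2 f \<and> a < norm (vcoef f k)}"
      proof (intro exI[of _ "norm (vcoef f k) - a"] conjI allI impI)
        fix g assume g: "in_L 2 g \<and> Lnorm 2 (\<lambda>x. g x - f x) < ennreal (norm (vcoef f k) - a)"
        have "ennreal (norm (vcoef g k - vcoef f k)) \<le> Lnorm 2 (\<lambda>x. g x - f x)"
          using norm_vcoef_le[OF in_L2_diff, of g f k] g f
          by (simp add: Lnorm2_dist vcoef_diff ennreal_leI)
        also have "\<dots> < ennreal (norm (vcoef f k) - a)" using g by blast
        finally have "norm (vcoef g k - vcoef f k) < norm (vcoef f k) - a" by (simp add: ennreal_less_iff)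
        then show "g \<in> {f. in_L 2 f \<and> a < norm (vcoef f k)}"
          using norm_triangle_ineq3[of "vcoef g k" "vcoef f k"] g by auto
      qed (use f in auto)
    qed auto
    moreover have "{f \<in> space L2_borel. a < (if in_L 2 f then norm (vcoef f k) else 0)} = {f. in_L 2 f \<and> a < norm (vcoef f k)}"
      using False by (auto simp: L2_borel_def)
    ultimately show ?thesis by (simp add: L2_open_measurable)
  qed
qed

lemma at_right_0_Ioc: "T > (0::real) \<Longrightarrow> \<forall>\<^sub>F t in at_right 0. t \<in> {0<..T}"
  using eventually_at_right_real[of 0 T] by (auto elim: eventually_mono)

context lns_trunc
begin

text \<open>The first summand measures how far the heat flow has moved a mode by time
  \<open>t\<close>, the second charges the modes of the datum beyond the cut at
  \<open>\<Lambda> t / 2\<close>. The constants 4 and 2 arise from applying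
  \<open>(a + b)^2 \<le> 2 a^2 + 2 b^2\<close> twice and once, respectively.\<close>

definition layer_wt :: "real \<Rightarrow> int^3 \<Rightarrow> real" where
  "layer_wt t k = 4 * (1 - exp (- (sig k * t)))\<^sup>2 + (if \<Lambda> t / 2 \<le> knorm k then 2 else 0)"

text \<open>Bounds the distance of the solution, and of its low-pass part, to low modes of the datum;
  the summand \<open>1\<close> makes it positive.\<close>

definition layer :: "real \<Rightarrow> (real^3 \<Rightarrow> real^3) \<Rightarrow> real" where
  "layer t f = (\<Sum>\<^sub>\<infinity>k. layer_wt t k * (norm (vcoef f k))\<^sup>2) + (4 * C1\<^sup>2 * (\<Sum>\<^sub>\<infinity>k. lweight k) + 1) * t powr (1/4)"

lemma layer_wt_bounds: "t \<ge> 0 \<Longrightarrow> 0 \<le> layer_wt t k" "t \<ge> 0 \<Longrightarrow> layer_wt t k \<le> 6"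
proof -
  assume t: "t \<ge> 0"
  then have "(1 - exp (- (sig k * t)))\<^sup>2 \<le> 1" using sig_nonneg[of k]
    by (intro power_le_one) auto
  then show "layer_wt t k \<le> 6" by (simp add: layer_wt_def)
qed (simp add: layer_wt_def)

lemma layer_summable:
  assumes "in_L 2 f" "t \<ge> 0"
  shows "(\<lambda>k. layer_wt t k * (norm (vcoef f k))\<^sup>2) summable_on UNIV"
  using layer_wt_bounds[OF assms(2)]
  by (intro summable_on_comparison_test[OF summable_on_cmult_right[OF vcoef_sq_summable[OF assms(1)], of 6]])
     (auto intro: mult_right_mono)

lemma lweight_sum_nonneg: "0 \<le> (\<Sum>\<^sub>\<infinity>k. lweight k)"
  by (intro infsum_nonneg) (simp add: less_imp_le lweight_pos)

lemma layer_pos: "t > 0 \<Longrightarrow> 0 < layer t f"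
  unfolding layer_def using lweight_sum_nonneg layer_wt_bounds
  by (intro add_nonneg_pos mult_pos_pos) (auto intro!: infsum_nonneg add_nonneg_pos)

text \<open>The bound does not depend on the datum beyond \<open>R\<close>, as dominated convergence
  over the probability space demands.\<close>

lemma layer_bound:
  assumes f: "in_L 2 f" and le: "(\<Sum>\<^sub>\<infinity>k. (norm (vcoef f k))\<^sup>2) \<le> R\<^sup>2" and t: "t \<in> {0<..T}"
  shows "layer t f \<le> 6 * R\<^sup>2 + (4 * C1\<^sup>2 * (\<Sum>\<^sub>\<infinity>k. lweight k) + 1) * T powr (1/4)"
  unfolding layer_def
proof (rule add_mono)
  have t0: "t \<ge> 0" using t by simp
  have "(\<Sum>\<^sub>\<infinity>k. layer_wt t k * (norm (vcoef f k))\<^sup>2) \<le> (\<Sum>\<^sub>\<infinity>k. 6 * (norm (vcoef f k))\<^sup>2)"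
    by (intro infsum_mono layer_summable f summable_on_cmult_right vcoef_sq_summable mult_right_mono layer_wt_bounds t0) auto
  also have "\<dots> = 6 * (\<Sum>\<^sub>\<infinity>k. (norm (vcoef f k))\<^sup>2)" by (intro infsum_cmult_right vcoef_sq_summable f)
  finally show "(\<Sum>\<^sub>\<infinity>k. layer_wt t k * (norm (vcoef f k))\<^sup>2) \<le> 6 * R\<^sup>2" using le by simp
  show "(4 * C1\<^sup>2 * (\<Sum>\<^sub>\<infinity>k. lweight k) + 1) * t powr (1/4) \<le> (4 * C1\<^sup>2 * (\<Sum>\<^sub>\<infinity>k. lweight k) + 1) * T powr (1/4)"
    using t lweight_sum_nonneg by (intro mult_left_mono powr_mono2) auto
qed

lemma layer_measurable: "t \<ge> 0 \<Longrightarrow> (\<lambda>f. if in_L 2 f then layer t f else 0) \<in> borel_measurable L2_borel"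
proof -
  assume t: "t \<ge> 0"
  define h where "h k f = (if in_L 2 f then norm (vcoef f k) else 0)" for k f
  let ?g = "\<lambda>f k. layer_wt t k * (h k f)\<^sup>2"
  let ?B = "(4 * C1\<^sup>2 * (\<Sum>\<^sub>\<infinity>k. lweight k) + 1) * t powr (1/4)"
  have hm [measurable]: "h k \<in> borel_measurable L2_borel" for k
    unfolding h_def by (rule coefficient_measurable)
  have nm: "(\<lambda>f. natseq (?g f) n) \<in> borel_measurable L2_borel" for n
    by (cases "n \<in> range (to_nat :: int^3 \<Rightarrow> nat)") (simp_all add: natseq_def)
  have [measurable]: "(\<lambda>f. \<Sum>n. natseq (?g f) n) \<in> borel_measurable L2_borel"
    by (intro borel_measurable_suminf nm)
  have set [measurable]: "{f \<in> space L2_borel. in_L 2 f} \<in> sets L2_borel"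
  proof -
    have "L2_open (Collect (in_L 2))" unfolding L2_open_def by (auto intro: exI[of _ 1])
    then show ?thesis using L2_open_measurable by (simp add: L2_borel_def)
  qed
  have "(\<lambda>f. if in_L 2 f then (\<Sum>n. natseq (?g f) n) + ?B else 0) \<in> borel_measurable L2_borel"
    by (intro measurable_If set) measurable
  moreover have "(\<Sum>n. natseq (?g f) n) + ?B = layer t f" if f: "in_L 2 f" for f
  proof -
    have "natseq (?g f) sums (\<Sum>\<^sub>\<infinity>k. layer_wt t k * (norm (vcoef f k))\<^sup>2)"
      using natseq_sums[OF has_sum_infsum[OF layer_summable[OF f t]]] f by (simp add: h_def)
    then show ?thesis by (simp add: layer_def sums_iff)
  qed
  ultimately show ?thesis by (simp cong: if_cong)
qed

text \<open>For a fixed mode the heat part vanishes in the limit and the cut becomes inactive once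
  \<open>\<Lambda> t > 2 * knorm k\<close>; dominated convergence sums over the modes.\<close>

lemma layer_tendsto:
  assumes f: "in_L 2 f"
  shows "((\<lambda>t. layer t f) \<longlongrightarrow> 0) (at_right 0)"
proof -
  have ev: "\<forall>\<^sub>F t in at_right 0. t \<in> {0<..T}" by (rule at_right_0_Ioc[OF T_pos])
  have "((\<lambda>t. \<Sum>\<^sub>\<infinity>k. layer_wt t k * (norm (vcoef f k))\<^sup>2) \<longlongrightarrow> (\<Sum>\<^sub>\<infinity>k::int^3. 0)) (at_right 0)"
  proof (rule tannery_infsum[OF _ _ summable_on_cmult_right[OF vcoef_sq_summable[OF f], of 6]])
    show "((\<lambda>t. layer_wt t k * (norm (vcoef f k))\<^sup>2) \<longlongrightarrow> 0) (at_right 0)" for k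
    proof -
      have "\<forall>\<^sub>F t in at_right 0. 2 * knorm k < \<Lambda> t"
        using freq by (auto simp: frequency_function_def filterlim_at_top_dense)
      then have eq: "\<forall>\<^sub>F t in at_right 0. 4 * (1 - exp (- (sig k * t)))\<^sup>2 = layer_wt t k"
        by eventually_elim (simp add: layer_wt_def)
      have "((\<lambda>t. 4 * (1 - exp (- (sig k * t)))\<^sup>2) \<longlongrightarrow> 4 * (1 - exp (- (sig k * 0)))\<^sup>2) (at_right 0)"
        by (intro tendsto_intros)
      from Lim_transform_eventually[OF this eq] have "((\<lambda>t. layer_wt t k) \<longlongrightarrow> 0) (at_right 0)" by simp
      then show ?thesis by (rule tendsto_mult_left_zero)
    qed
    show "\<forall>\<^sub>F t in at_right 0. \<forall>k. norm (layer_wt t k * (norm (vcoef f k))\<^sup>2) \<le> 6 * (norm (vcoef f k))\<^sup>2"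
      using ev
    proof eventually_elim
      case (elim t)
      then show ?case using layer_wt_bounds[of t] by (auto intro!: mult_right_mono)
    qed
  qed simp
  moreover have "((\<lambda>t::real. t powr (1/4)) \<longlongrightarrow> 0 powr (1/4)) (at_right 0)"
    by (intro tendsto_powr' tendsto_intros) (auto simp: eventually_at_filter)
  then have "((\<lambda>t. (4 * C1\<^sup>2 * (\<Sum>\<^sub>\<infinity>k. lweight k) + 1) * t powr (1/4)) \<longlongrightarrow> 0) (at_right 0)"
    by (intro tendsto_mult_right_zero) simp
  ultimately show ?thesis unfolding layer_def[abs_def] using tendsto_add by fastforce
qed

end

context lns_field
begin

text \<open>The right-hand side depends on the later time \<open>t'\<close> only, so it controls the
  supremum over \<open>[0, t']\<close> that \<open>LC_norm\<close> asks for.\<close>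

lemma increment:
  assumes t: "t \<in> {0..t'}" and t': "t' \<in> {0<..T}"
  shows "(norm (u t k - vcoef f k))\<^sup>2 \<le> 2 * (C1\<^sup>2 * t' powr (1/4) * lweight k) + 2 * ((1 - exp (- (sig k * t')))\<^sup>2 * (norm (vcoef f k))\<^sup>2)"
proof -
  have tT: "t \<in> {0..T}" using t t' by auto
  let ?x = "norm (u t k - exp (- (sig k * t)) *\<^sub>R vcoef f k)" and ?y = "(1 - exp (- (sig k * t))) * norm (vcoef f k)"
  have e: "0 \<le> 1 - exp (- (sig k * t))" "1 - exp (- (sig k * t)) \<le> 1 - exp (- (sig k * t'))"
    using t sig_nonneg[of k] by (auto simp: mult_left_mono)
  have "vcoef f k - exp (- (sig k * t)) *\<^sub>R vcoef f k = (1 - exp (- (sig k * t))) *\<^sub>R vcoef f k"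
    by (simp add: scaleR_left_diff_distrib)
  then have "?y = norm (vcoef f k - exp (- (sig k * t)) *\<^sub>R vcoef f k)" using e by simp
  then have "norm (u t k - vcoef f k) \<le> ?x + ?y"
    using norm_triangle_ineq4[of "u t k - exp (- (sig k * t)) *\<^sub>R vcoef f k" "vcoef f k - exp (- (sig k * t)) *\<^sub>R vcoef f k"] by simp
  then have "(norm (u t k - vcoef f k))\<^sup>2 \<le> (?x + ?y)\<^sup>2" by (intro power_mono) auto
  also have "\<dots> \<le> 2 * ?x\<^sup>2 + 2 * ?y\<^sup>2"
    using sum_squares_bound[of ?x ?y] by (simp add: power2_sum)
  also have "\<dots> \<le> 2 * (C1\<^sup>2 * t' powr (1/4) * lweight k) + 2 * ((1 - exp (- (sig k * t')))\<^sup>2 * (norm (vcoef f k))\<^sup>2)"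
  proof (intro add_mono mult_left_mono)
    have "?x \<le> C1 * t powr (1/8) * sqrt (lweight k)" by (rule mild_increment[OF sol.mild tT])
    also have "\<dots> \<le> C1 * t' powr (1/8) * sqrt (lweight k)"
      using t C1_nonneg by (intro mult_right_mono mult_left_mono powr_mono2) (auto simp: less_imp_le lweight_pos)
    finally have "?x\<^sup>2 \<le> (C1 * t' powr (1/8) * sqrt (lweight k))\<^sup>2" by (rule power_mono) simp
    also have "\<dots> = C1\<^sup>2 * t' powr (1/4) * lweight k"
      using t' lweight_pos[of k] by (simp add: power_mult_distrib power2_eq_square[of "t' powr (1/8)"] flip: powr_add)
    finally show "?x\<^sup>2 \<le> C1\<^sup>2 * t' powr (1/4) * lweight k" .
    have "(1 - exp (- (sig k * t)))\<^sup>2 \<le> (1 - exp (- (sig k * t')))\<^sup>2" by (intro power_mono e)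
    then show "?y\<^sup>2 \<le> (1 - exp (- (sig k * t')))\<^sup>2 * (norm (vcoef f k))\<^sup>2"
      unfolding power_mult_distrib by (intro mult_right_mono) auto
  qed auto
  finally show ?thesis .
qed

text \<open>Stated for an arbitrary defect \<open>d\<close>: once it is the distance of the solution
  to the datum, once that of the low-pass part to the low modes of the datum.\<close>

lemma layer_dominates:
  assumes t': "t' \<in> {0<..T}"
    and d: "\<And>k. (norm (d k))\<^sup>2 \<le> 4 * C1\<^sup>2 * t' powr (1/4) * lweight k + layer_wt t' k * (norm (vcoef f k))\<^sup>2"
  shows "(\<lambda>k. (norm (d k))\<^sup>2) summable_on UNIV" "(\<Sum>\<^sub>\<infinity>k. (norm (d k))\<^sup>2) \<le> layer t' f"
proof -
  let ?b = "\<lambda>k. 4 * C1\<^sup>2 * t' powr (1/4) * lweight k + layer_wt t' k * (norm (vcoef f k))\<^sup>2"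
  have t0: "t' \<ge> 0" using t' by simp
  have hs: "(?b has_sum (4 * C1\<^sup>2 * t' powr (1/4) * (\<Sum>\<^sub>\<infinity>k. lweight k) + (\<Sum>\<^sub>\<infinity>k. layer_wt t' k * (norm (vcoef f k))\<^sup>2))) UNIV"
    by (intro has_sum_add has_sum_cmult_right has_sum_infsum summable_lweight layer_summable f t0)
  then have bs: "?b summable_on UNIV" by (auto simp: summable_on_def)
  show ds: "(\<lambda>k. (norm (d k))\<^sup>2) summable_on UNIV"
    by (rule summable_on_comparison_test[OF bs]) (use d in auto)
  have "(\<Sum>\<^sub>\<infinity>k. (norm (d k))\<^sup>2) \<le> (\<Sum>\<^sub>\<infinity>k. ?b k)" by (rule infsum_mono[OF ds bs d])
  also have "\<dots> \<le> layer t' f" unfolding infsumI[OF hs] layer_def by (simp add: algebra_simps)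
  finally show "(\<Sum>\<^sub>\<infinity>k. (norm (d k))\<^sup>2) \<le> layer t' f" .
qed

lemma V_layer:
  assumes t: "t \<in> {0..t'}" and t': "t' \<in> {0<..T}"
  shows "Lnorm 2 (\<lambda>x. U f t x - f x) \<le> ennreal (sqrt (layer t' f))"
proof -
  have tT: "t \<in> {0..T}" using t t' by auto
  have "(norm (u t k - vcoef f k))\<^sup>2 \<le> 4 * C1\<^sup>2 * t' powr (1/4) * lweight k + layer_wt t' k * (norm (vcoef f k))\<^sup>2" for k
  proof -
    have "0 \<le> C1\<^sup>2 * t' powr (1/4) * lweight k" "0 \<le> (1 - exp (- (sig k * t')))\<^sup>2 * (norm (vcoef f k))\<^sup>2"
      using lweight_pos[of k] by simp_all
    moreover have "4 * ((1 - exp (- (sig k * t')))\<^sup>2 * (norm (vcoef f k))\<^sup>2) \<le> layer_wt t' k * (norm (vcoef f k))\<^sup>2"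
      unfolding mult.assoc[symmetric] by (intro mult_right_mono) (auto simp: layer_wt_def)
    ultimately show ?thesis using increment[OF t t', of k] by linarith
  qed
  from layer_dominates(2)[OF t' this]
  show ?thesis unfolding Lnorm2_dist[OF V_in_L2[OF tT] f] vcoef_V[OF tT]
    by (intro ennreal_leI real_sqrt_le_mono)
qed

end

text \<open>Measurability of the supremum over all times is not at hand, but the nonnegative
  integral is monotone for arbitrary functions. It is bounded by the integral of the measurable
  \<open>g t\<close>, raised to the power \<open>\<rho>\<close>, to which dominated convergence
  applies.\<close>

lemma LC_norm_tendsto_0:
  assumes P: "prob_space P" and \<rho>: "\<rho> \<ge> 1" and T: "T > 0"
    and meas: "\<And>t. t \<in> {0<..T} \<Longrightarrow> g t \<in> borel_measurable P"
    and bd: "\<And>t \<omega>. t \<in> {0<..T} \<Longrightarrow> 0 \<le> g t \<omega> \<and> g t \<omega> \<le> B"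
    and dom: "AE \<omega> in P. \<forall>t'\<in>{0<..T}. \<forall>t\<in>{0..t'}. Lnorm p (X t \<omega>) \<le> ennreal (g t' \<omega>)"
    and lim: "AE \<omega> in P. ((\<lambda>t. g t \<omega>) \<longlongrightarrow> 0) (at_right 0)"
  shows "((\<lambda>t. LC_norm P \<rho> p t X) \<longlongrightarrow> 0) (at_right 0)"
proof (rule tendsto_at_right_sequentially[OF T])
  interpret prob_space P by fact
  fix S assume S: "\<And>n. 0 < S n" "\<And>n. S n < T" "S \<longlonglongrightarrow> 0"
  have S': "S n \<in> {0<..T}" for n using S(1,2)[of n] by auto
  let ?I = "\<lambda>n. \<integral>\<omega>. g (S n) \<omega> powr \<rho> \<partial>P"
  have gm [measurable]: "g (S n) \<in> borel_measurable P" for n by (rule meas[OF S'])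
  have pw: "norm (g (S n) \<omega> powr \<rho>) \<le> B powr \<rho>" for n \<omega>
    using bd[OF S', of n \<omega>] \<rho> by (simp add: powr_mono2)
  have int: "integrable P (\<lambda>\<omega>. g (S n) \<omega> powr \<rho>)" for n
    by (rule integrable_const_bound[of _ "B powr \<rho>"]) (use pw in auto)
  have le: "LC_norm P \<rho> p (S n) X \<le> ennreal (?I n powr (1 / \<rho>))" for n
  proof -
    have mono: "ennpow x q \<le> ennpow y q" if "x \<le> y" "q > 0" for x y :: ennreal and q
      using that by (cases x; cases y) (auto simp: ennpow_def top_unique ennreal_leI powr_mono2)
    have "(\<integral>\<^sup>+ \<omega>. (SUP t\<in>{0..S n}. ennpow (Lnorm p (X t \<omega>)) \<rho>) \<partial>P) \<le> (\<integral>\<^sup>+ \<omega>. ennreal (g (S n) \<omega> powr \<rho>) \<partial>P)"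
    proof (rule nn_integral_mono_AE, use dom in eventually_elim)
      case (elim \<omega>)
      show ?case
      proof (rule SUP_least)
        fix t assume "t \<in> {0..S n}"
        then have "Lnorm p (X t \<omega>) \<le> ennreal (g (S n) \<omega>)" using elim S' by blast
        then have "ennpow (Lnorm p (X t \<omega>)) \<rho> \<le> ennpow (ennreal (g (S n) \<omega>)) \<rho>" using \<rho> by (intro mono) auto
        also have "\<dots> = ennreal (g (S n) \<omega> powr \<rho>)" using bd[OF S', of n \<omega>] by (simp add: ennpow_def)
        finally show "ennpow (Lnorm p (X t \<omega>)) \<rho> \<le> ennreal (g (S n) \<omega> powr \<rho>)" .
      qed
    qed
    also have "\<dots> = ennreal (?I n)" by (rule nn_integral_eq_integral[OF int]) simp
    finally have "LC_norm P \<rho> p (S n) X \<le> ennpow (ennreal (?I n)) (1 / \<rho>)"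
      unfolding LC_norm_def using \<rho> by (intro mono) auto
    also have "\<dots> = ennreal (?I n powr (1 / \<rho>))" by (simp add: ennpow_def Bochner_Integration.integral_nonneg)
    finally show ?thesis .
  qed
  have "?I \<longlonglongrightarrow> (\<integral>\<omega>. 0 \<partial>P)"
  proof (rule integral_dominated_convergence[where w="\<lambda>_. B powr \<rho>"])
    show "AE \<omega> in P. (\<lambda>n. g (S n) \<omega> powr \<rho>) \<longlonglongrightarrow> 0"
      using lim
    proof eventually_elim
      case (elim \<omega>)
      have "filterlim S (at_right 0) sequentially"
        using S(1,3) by (auto simp: filterlim_at less_imp_neq[symmetric] intro!: always_eventually)
      from filterlim_compose[OF elim this] have "(\<lambda>n. g (S n) \<omega>) \<longlonglongrightarrow> 0" .
      then have "(\<lambda>n. g (S n) \<omega> powr \<rho>) \<longlonglongrightarrow> 0 powr \<rho>"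
        using bd[OF S'] \<rho> by (intro tendsto_powr' tendsto_const) (auto intro: always_eventually)
      then show ?case using \<rho> by simp
    qed
  qed (use pw in auto)
  then have "(\<lambda>n. ennreal (?I n powr (1 / \<rho>))) \<longlonglongrightarrow> ennreal (0 powr (1 / \<rho>))"
    using \<rho> by (intro tendsto_ennrealI tendsto_powr' tendsto_const)
      (auto intro!: always_eventually Bochner_Integration.integral_nonneg)
  then have lim0: "(\<lambda>n. ennreal (?I n powr (1 / \<rho>))) \<longlonglongrightarrow> 0" using \<rho> by simp
  show "(\<lambda>n. LC_norm P \<rho> p (S n) X) \<longlonglongrightarrow> 0"
    by (rule tendsto_sandwich[OF _ _ tendsto_const lim0]) (use le in \<open>auto intro!: always_eventually\<close>)
qed

subsection \<open>The high frequencies of the quadratic term\<close>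

lemma bounded_bilinear_tf_tensor: "bounded_bilinear tf_tensor"
proof -
  have "linear (tf_tensor a)" for a
    by (rule linearI) (simp_all add: tf_tensor_def vec_eq_iff algebra_simps inner_add_right add_divide_distrib)
  moreover have "linear (\<lambda>a. tf_tensor a b)" for b
    by (rule linearI) (simp_all add: tf_tensor_def vec_eq_iff algebra_simps inner_add_left add_divide_distrib)
  ultimately show ?thesis by (simp add: bilinear_conv_bounded_bilinear[symmetric] bilinear_def)
qed

lemma band_tf_tensor:
  assumes a: "\<And>i. band r (\<lambda>x. a x $ i)" and b: "b \<in> Basis"
  shows "band (r + r) (\<lambda>x. tf_tensor (a x) (a x) \<bullet> b)"
proof -
  obtain i j where ij: "b = axis i (axis j 1)" using b by (auto simp: Basis_vec_def)
  define c :: real where "c = (if i = j then 1/3 else 0)"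
  have "tf_tensor (a x) (a x) \<bullet> b = a x $ i * a x $ j - c * (a x $ 1 * a x $ 1 + a x $ 2 * a x $ 2 + a x $ 3 * a x $ 3)" for x
  proof -
    have "a x \<bullet> a x = a x $ 1 * a x $ 1 + a x $ 2 * a x $ 2 + a x $ 3 * a x $ 3" by (simp add: inner_vec_def sum_3)
    moreover have "tf_tensor (a x) (a x) \<bullet> b = tf_tensor (a x) (a x) $ i $ j" by (simp add: ij inner_axis)
    ultimately show ?thesis by (simp add: tf_tensor_def mat_def c_def)
  qed
  then show ?thesis by (simp only:) (intro band_diff band_cmult band_add band_mult a)
qed

lemma band_synth:
  assumes c: "\<And>k. r \<le> knorm k \<Longrightarrow> c k = 0" and herm: "\<And>k. c (- k) = cnjv (c k)"
  shows "band r (\<lambda>x. synth c x $ i)"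
proof -
  have s: "(\<lambda>k. norm (c k $ i)) summable_on UNIV"
    using c by (intro finite_support_summable[OF finite_knorm_ball[of r]]) (auto simp: not_less)
  have "fcoeff (sser (\<lambda>k. c k $ i)) k = c k $ i" for k
    by (rule fcoeff_sser[OF s]) (simp add: herm cnjv_def)
  then show ?thesis
    using c continuous_sser[OF s] periodic_sser by (auto simp: band_def synth_def)
qed

lemma uniform_limit_Basis:
  fixes f :: "'t \<Rightarrow> 'a \<Rightarrow> 'b::euclidean_space"
  assumes "\<And>b. b \<in> Basis \<Longrightarrow> uniform_limit X (\<lambda>s x. f s x \<bullet> b) (\<lambda>x. g x \<bullet> b) Fl"
  shows "uniform_limit X f g Fl"
proof (rule uniform_limitI)
  fix e :: real assume e: "e > 0"
  let ?n = "real DIM('b)"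
  have n: "?n > 0" using DIM_positive by simp
  have "\<forall>\<^sub>F s in Fl. \<forall>b\<in>Basis. \<forall>x\<in>X. dist (f s x \<bullet> b) (g x \<bullet> b) < e / ?n"
    using uniform_limitD[OF assms divide_pos_pos[OF e n]] by (auto simp: eventually_ball_finite_distrib)
  then show "\<forall>\<^sub>F s in Fl. \<forall>x\<in>X. dist (f s x) (g x) < e"
  proof eventually_elim
    case (elim s)
    show ?case
    proof
      fix x assume x: "x \<in> X"
      have "dist (f s x) (g x) \<le> (\<Sum>b\<in>Basis. \<bar>(f s x - g x) \<bullet> b\<bar>)" unfolding dist_norm by (rule norm_le_l1)
      also have "\<dots> < (\<Sum>b\<in>(Basis::'b set). e / ?n)"
        using elim x by (intro sum_strict_mono) (auto simp: dist_real_def inner_diff_left)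
      also have "\<dots> = e" using n by simp
      finally show "dist (f s x) (g x) < e" .
    qed
  qed
qed

text \<open>Characters have modulus 1, so the error is at most the sum of the coefficient errors,
  whatever \<open>x\<close> is.\<close>

lemma uniform_limit_trig_sum:
  assumes A: "finite A" and lim: "\<And>k. k \<in> A \<Longrightarrow> ((\<lambda>s. c s k) \<longlongrightarrow> l k) Fl"
  shows "uniform_limit UNIV (\<lambda>s x. Re (\<Sum>k\<in>A. c s k * fexp k x)) (\<lambda>x. Re (\<Sum>k\<in>A. l k * fexp k x)) Fl"
proof (rule uniform_limitI)
  fix e :: real assume e: "e > 0"
  have "((\<lambda>s. \<Sum>k\<in>A. norm (c s k - l k)) \<longlongrightarrow> (\<Sum>k\<in>A. norm (l k - l k))) Fl"
    by (intro tendsto_intros lim)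
  then have "\<forall>\<^sub>F s in Fl. (\<Sum>k\<in>A. norm (c s k - l k)) < e" using e by (intro order_tendstoD(2)) auto
  then show "\<forall>\<^sub>F s in Fl. \<forall>x\<in>UNIV. dist (Re (\<Sum>k\<in>A. c s k * fexp k x)) (Re (\<Sum>k\<in>A. l k * fexp k x)) < e"
  proof eventually_elim
    case (elim s)
    have "dist (Re (\<Sum>k\<in>A. c s k * fexp k x)) (Re (\<Sum>k\<in>A. l k * fexp k x)) \<le> norm (\<Sum>k\<in>A. (c s k - l k) * fexp k x)" for x
      using abs_Re_le_cmod[of "\<Sum>k\<in>A. (c s k - l k) * fexp k x"]
      by (simp add: dist_real_def left_diff_distrib sum_subtractf)
    also have "norm (\<Sum>k\<in>A. (c s k - l k) * fexp k x) \<le> (\<Sum>k\<in>A. norm (c s k - l k))" for x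
      by (rule order_trans[OF norm_sum]) (simp add: norm_mult)
    finally show ?case using elim by (auto intro: le_less_trans)
  qed
qed

lemma fcoeff_tendsto:
  assumes ul: "uniform_limit UNIV g g0 Fl" and cont: "\<forall>\<^sub>F s in Fl. continuous_on UNIV (g s)" "continuous_on UNIV g0"
  shows "((\<lambda>s. fcoeff (g s) k) \<longlongrightarrow> fcoeff g0 k) Fl"
proof (rule tendstoI)
  fix e :: real assume e: "e > 0"
  have "\<forall>\<^sub>F s in Fl. \<forall>x\<in>UNIV. dist (g s x) (g0 x) < e / 2" by (rule uniform_limitD[OF ul half_gt_zero[OF e]])
  with cont(1) show "\<forall>\<^sub>F s in Fl. dist (fcoeff (g s) k) (fcoeff g0 k) < e"
  proof eventually_elim
    case (elim s)
    have i: "integrable torus (g s)" "integrable torus g0" using elim cont by (auto intro: integrable_torus_continuous)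
    have "dist (fcoeff (g s) k) (fcoeff g0 k) = norm (\<integral>x. of_real (g s x - g0 x) * fexp (- k) x \<partial>torus)"
      using fcoeff_diff[OF i, of k] by (simp add: dist_norm fcoeff_fexp)
    also have "\<dots> \<le> (\<integral>x. e / 2 \<partial>torus)"
    proof (rule order_trans[OF Bochner_Integration.integral_norm_bound integral_mono[OF Bochner_Integration.integrable_norm]])
      show "integrable torus (\<lambda>x. of_real (g s x - g0 x) * fexp (- k) x)"
        using i by (intro integrable_mult_fexp integrable_of_real Bochner_Integration.integrable_diff)
      show "norm (of_real (g s x - g0 x) * fexp (- k) x) \<le> e / 2" for x
        using elim less_imp_le[of "\<bar>g s x - g0 x\<bar>" "e / 2"] by (simp add: norm_mult dist_real_def del: of_real_diff)
    qed simp
    also have "\<dots> < e" using e torus.prob_space by simp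
    finally show ?case .
  qed
qed

lemma Lnorm1_tendsto:
  fixes g :: "'t \<Rightarrow> real^3 \<Rightarrow> 'b::euclidean_space"
  assumes ul: "uniform_limit UNIV g g0 Fl" and cont: "\<forall>\<^sub>F s in Fl. continuous_on UNIV (g s)" "continuous_on UNIV g0"
  shows "((\<lambda>s. Lnorm 1 (\<lambda>x. g s x - g0 x)) \<longlongrightarrow> 0) Fl"
proof (rule order_tendstoI)
  fix a :: ennreal assume "a > 0"
  have "\<exists>e>0. ennreal e < a"
  proof (cases a)
    case (real r)
    then show ?thesis using \<open>a > 0\<close> by (intro exI[of _ "r / 2"]) (auto simp: ennreal_less_iff)
  qed (auto intro: exI[of _ 1])
  then obtain e where e: "e > 0" "ennreal e < a" by blast
  have "\<forall>\<^sub>F s in Fl. \<forall>x\<in>UNIV. dist (g s x) (g0 x) < e" using uniform_limitD[OF ul] e by simp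
  with cont(1) show "\<forall>\<^sub>F s in Fl. Lnorm 1 (\<lambda>x. g s x - g0 x) < a"
  proof eventually_elim
    case (elim s)
    have c: "continuous_on UNIV (\<lambda>x. g s x - g0 x)" using elim cont by (intro continuous_intros) auto
    have "(\<integral>x. norm (g s x - g0 x) \<partial>torus) \<le> (\<integral>x. e \<partial>torus)"
      using elim by (intro integral_mono integrable_torus_continuous continuous_intros c) (auto simp: dist_norm less_imp_le)
    then have "Lnorm 1 (\<lambda>x. g s x - g0 x) \<le> ennreal e"
      unfolding Lnorm1_eq[OF c] using torus.prob_space by (intro ennreal_leI) simp
    then show ?case using e by simp
  qed
qed simp

context lns_field
begin

abbreviation "quad t \<equiv> (\<lambda>x. tf_tensor (P_low \<phi> \<Lambda> t (U f t) x) (P_low \<phi> \<Lambda> t (U f t) x))"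

lemma P_low_U: "t \<in> {0<..T} \<Longrightarrow> P_low \<phi> \<Lambda> t (U f t) = synth (lowpass t (u t))"
proof -
  assume t: "t \<in> {0<..T}"
  then have "vcoef (U f t) = u t" using vcoef_V[of t] by auto
  then show ?thesis using P_low_eq[of t] t by simp
qed

lemma lowpass_u_herm: "t \<in> {0<..T} \<Longrightarrow> lowpass t (u t) (- k) = cnjv (lowpass t (u t) k)"
  using sol.u_real by (intro lowpass_herm) auto

lemma lowpass_u_eq_0: "t \<in> {0<..T} \<Longrightarrow> 2 * \<Lambda> t \<le> knorm k \<Longrightarrow> lowpass t (u t) k = 0"
  using m_eq_0 by (simp add: lowpass_def low_def)

lemma band_P_low_U: "t \<in> {0<..T} \<Longrightarrow> band (2 * \<Lambda> t) (\<lambda>x. P_low \<phi> \<Lambda> t (U f t) x $ i)"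
  unfolding P_low_U by (intro band_synth lowpass_u_eq_0 lowpass_u_herm)

text \<open>Filtered fields have frequencies below \<open>2 * \<Lambda> t\<close>, their products
  below \<open>4 * \<Lambda> t\<close>; this stays inside the ball of radius
  \<open>5 * \<Lambda> t\<close> on which the multiplier is a combination of translations.\<close>

lemma band_quad: "t \<in> {0<..T} \<Longrightarrow> b \<in> Basis \<Longrightarrow> band (4 * \<Lambda> t) (\<lambda>x. quad t x \<bullet> b)"
  using band_tf_tensor[OF band_P_low_U] by fastforce

lemma P_high_quad: "t \<in> {0<..T} \<Longrightarrow> P_high \<phi> \<Lambda> t (quad t) = (\<lambda>x. quad t x - fmult (\<lambda>\<xi>. \<phi> (\<xi> /\<^sub>R \<Lambda> t)) (quad t) x)"
  by (auto simp: P_high_def P_low_def)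

lemma P_high_quad_continuous:
  assumes t: "t \<in> {0<..T}"
  shows "continuous_on UNIV (P_high \<phi> \<Lambda> t (quad t))" "periodic (P_high \<phi> \<Lambda> t (quad t))"
  unfolding P_high_quad[OF t]
  using continuous_band[OF band_quad[OF t]] fmult_band[OF band_quad[OF t], where \<mu>="\<lambda>\<xi>. \<phi> (\<xi> /\<^sub>R \<Lambda> t)"]
  by (auto intro!: continuous_intros simp: periodic_def)

lemma P_high_quad_0: "P_high \<phi> \<Lambda> 0 (quad 0) = (\<lambda>x. 0)"
  by (auto simp: P_high_def P_low_def)

text \<open>Near a positive time the filters confine all frequencies to one finite set
  \<open>low c\<close>, so convergence of single coefficients is uniform convergence in space, and
  it survives the bilinear product and the second filter.\<close>

lemma P_high_quad_tendsto:
  assumes t: "t \<in> {0<..T}"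
  shows "((\<lambda>s. Lnorm 1 (\<lambda>x. P_high \<phi> \<Lambda> s (quad s) x - P_high \<phi> \<Lambda> t (quad t) x)) \<longlongrightarrow> 0) (at t within {0..T})"
proof -
  define c where "c = t / 2"
  let ?Fl = "at t within {0..T}" and ?A = "low c" and ?w = "\<lambda>s. P_low \<phi> \<Lambda> s (U f s)"
  have c: "0 < c" "c < t" using t by (auto simp: c_def)
  have ev: "\<forall>\<^sub>F s in ?Fl. s \<in> {c..T}"
  proof -
    have "\<forall>\<^sub>F s in ?Fl. c < s" using c by (intro order_tendstoD(1)[OF tendsto_ident_at])
    then show ?thesis by (auto simp: eventually_at_filter elim: eventually_mono)
  qed
  have evT: "\<forall>\<^sub>F s in ?Fl. s \<in> {0<..T}" using ev c by (auto elim: eventually_mono)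
  have tt: "t \<in> {c..T}" "at t within {0..T} = at t within {0<..T}"
    using t c by (auto intro!: at_within_nhd[of _ "{0<..}"])
  have A: "2 * \<Lambda> s \<le> knorm k" if "k \<notin> ?A" "s \<in> {c..T}" for s k
    using \<Lambda>_antimono[of c s] c that by (auto simp: low_def)
  have mc: "((\<lambda>s. m s k) \<longlongrightarrow> m t k) ?Fl" for k
    using m_continuous[of k] t unfolding tt(2) by (simp add: continuous_on_def)
  have uc: "((\<lambda>s. u s k) \<longlongrightarrow> u t k) ?Fl" for k
    using sol.u_cont[of k] t by (simp add: continuous_on_def)
  have cont: "continuous_on UNIV (quad s)" if "s \<in> {0<..T}" for s by (rule continuous_band[OF band_quad[OF that]])
  have w: "uniform_limit UNIV ?w (?w t) ?Fl"
  proof (rule uniform_limit_Basis)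
    fix b :: "real^3" assume "b \<in> Basis"
    then obtain i where b: "b = axis i 1" by (auto simp: Basis_vec_def)
    have eq: "?w s x \<bullet> b = Re (\<Sum>k\<in>?A. (m s k *\<^sub>R u s k $ i) * fexp k x)" if s: "s \<in> {c..T}" for s x
    proof -
      have s': "s \<in> {0<..T}" using s c by auto
      have "?w s x \<bullet> b = sser (\<lambda>k. lowpass s (u s) k $ i) x" by (simp add: P_low_U[OF s'] synth_def b inner_axis)
      also have "\<dots> = Re (\<Sum>k\<in>?A. lowpass s (u s) k $ i * fexp k x)"
        by (rule sser_finite[OF low_finite]) (use A s lowpass_u_eq_0[OF s'] in auto)
      finally show ?thesis by (simp add: lowpass_def)
    qed
    have "uniform_limit UNIV (\<lambda>s x. Re (\<Sum>k\<in>?A. (m s k *\<^sub>R u s k $ i) * fexp k x))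
        (\<lambda>x. Re (\<Sum>k\<in>?A. (m t k *\<^sub>R u t k $ i) * fexp k x)) ?Fl"
      by (intro uniform_limit_trig_sum low_finite tendsto_intros mc uc)
    moreover have "\<forall>\<^sub>F s in ?Fl. \<forall>x\<in>UNIV. Re (\<Sum>k\<in>?A. (m s k *\<^sub>R u s k $ i) * fexp k x) = ?w s x \<bullet> b"
      using ev by eventually_elim (simp add: eq)
    ultimately show "uniform_limit UNIV (\<lambda>s x. ?w s x \<bullet> b) (\<lambda>x. ?w t x \<bullet> b) ?Fl"
      using eq[OF tt(1)] by (subst (asm) uniform_limit_cong) auto
  qed
  have bw: "bounded (range (?w t))"
  proof -
    have "\<And>b. b \<in> Basis \<Longrightarrow> band (2 * \<Lambda> t) (\<lambda>x. ?w t x \<bullet> b)"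
      using band_P_low_U[OF t] by (auto simp: Basis_vec_def inner_axis)
    from periodic_continuous_bounded[OF continuous_band[OF this]] show ?thesis
      by (metis bounded_iff rangeE)
  qed
  have q: "uniform_limit UNIV quad (quad t) ?Fl"
    by (rule bounded_bilinear.bounded_uniform_limit[OF bounded_bilinear_tf_tensor w w bw bw])
  have l: "uniform_limit UNIV (\<lambda>s. fmult (\<lambda>\<xi>. \<phi> (\<xi> /\<^sub>R \<Lambda> s)) (quad s)) (fmult (\<lambda>\<xi>. \<phi> (\<xi> /\<^sub>R \<Lambda> t)) (quad t)) ?Fl"
  proof (rule uniform_limit_Basis)
    fix b :: "real^3^3" assume b: "b \<in> Basis"
    let ?c = "\<lambda>s k. of_real (m s k) * fcoeff (\<lambda>y. quad s y \<bullet> b) k"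
    have eq: "fmult (\<lambda>\<xi>. \<phi> (\<xi> /\<^sub>R \<Lambda> s)) (quad s) x \<bullet> b = Re (\<Sum>k\<in>?A. ?c s k * fexp k x)" if s: "s \<in> {c..T}" for s x
    proof -
      have s': "s \<in> {0<..T}" using s c by auto
      have "m s k = 0" if "k \<notin> ?A" for k using m_eq_0[OF s'] A[OF that s] by (simp add: low_def)
      then show ?thesis unfolding fmult_inner[OF b] m_def[symmetric] by (intro sser_finite low_finite) auto
    qed
    have qb: "uniform_limit UNIV (\<lambda>s x. quad s x \<bullet> b) (\<lambda>x. quad t x \<bullet> b) ?Fl"
      by (rule bounded_linear.uniform_limit[OF bounded_linear_inner_left q])
    have "((\<lambda>s. fcoeff (\<lambda>y. quad s y \<bullet> b) k) \<longlongrightarrow> fcoeff (\<lambda>y. quad t y \<bullet> b) k) ?Fl" for k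
    proof (rule fcoeff_tendsto[OF qb])
      show "\<forall>\<^sub>F s in ?Fl. continuous_on UNIV (\<lambda>x. quad s x \<bullet> b)"
        using evT by eventually_elim (intro continuous_intros cont)
    qed (intro continuous_intros cont t)
    then have "uniform_limit UNIV (\<lambda>s x. Re (\<Sum>k\<in>?A. ?c s k * fexp k x)) (\<lambda>x. Re (\<Sum>k\<in>?A. ?c t k * fexp k x)) ?Fl"
      by (intro uniform_limit_trig_sum low_finite tendsto_intros mc)
    moreover have "\<forall>\<^sub>F s in ?Fl. \<forall>x\<in>UNIV. Re (\<Sum>k\<in>?A. ?c s k * fexp k x) = fmult (\<lambda>\<xi>. \<phi> (\<xi> /\<^sub>R \<Lambda> s)) (quad s) x \<bullet> b"
      using ev by eventually_elim (simp add: eq)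
    ultimately show "uniform_limit UNIV (\<lambda>s x. fmult (\<lambda>\<xi>. \<phi> (\<xi> /\<^sub>R \<Lambda> s)) (quad s) x \<bullet> b) (\<lambda>x. fmult (\<lambda>\<xi>. \<phi> (\<xi> /\<^sub>R \<Lambda> t)) (quad t) x \<bullet> b) ?Fl"
      using eq[OF tt(1)] by (subst (asm) uniform_limit_cong) auto
  qed
  have "uniform_limit UNIV (\<lambda>s. P_high \<phi> \<Lambda> s (quad s)) (P_high \<phi> \<Lambda> t (quad t)) ?Fl"
  proof -
    have "uniform_limit UNIV (\<lambda>s x. quad s x - fmult (\<lambda>\<xi>. \<phi> (\<xi> /\<^sub>R \<Lambda> s)) (quad s) x) (P_high \<phi> \<Lambda> t (quad t)) ?Fl"
      unfolding P_high_quad[OF t] by (rule uniform_limit_minus[OF q l])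
    moreover have "\<forall>\<^sub>F s in ?Fl. \<forall>x\<in>UNIV. quad s x - fmult (\<lambda>\<xi>. \<phi> (\<xi> /\<^sub>R \<Lambda> s)) (quad s) x = P_high \<phi> \<Lambda> s (quad s) x"
      using evT by eventually_elim (simp add: P_high_quad)
    ultimately show ?thesis by (subst (asm) uniform_limit_cong) auto
  qed
  moreover have "\<forall>\<^sub>F s in ?Fl. continuous_on UNIV (P_high \<phi> \<Lambda> s (quad s))"
    using evT by eventually_elim (rule P_high_quad_continuous)
  ultimately show ?thesis by (rule Lnorm1_tendsto) (rule P_high_quad_continuous[OF t])
qed

text \<open>The square of the low modes of \<open>f\<close> is invisible to the high-pass filter; the rest of the
  quadratic term is small in mean.\<close>

lemma P_high_quad_layer:
  assumes mult: "\<And>L (g :: real^3 \<Rightarrow> real^3^3). L > 0 \<Longrightarrow> (\<And>b. b \<in> Basis \<Longrightarrow> band (5 * L) (\<lambda>x. g x \<bullet> b)) \<Longrightarrow>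
      (\<integral>x. norm (fmult (\<lambda>\<xi>. \<phi> (\<xi> /\<^sub>R L)) g x) \<partial>torus) \<le> C * (\<integral>x. norm (g x) \<partial>torus)"
    and C: "C \<ge> 0" and K: "K \<ge> 0" "\<And>a b. norm (tf_tensor a b) \<le> norm a * norm b * K"
    and t: "t \<in> {0<..t'}" and t': "t' \<in> {0<..T}"
  shows "Lnorm 1 (P_high \<phi> \<Lambda> t (quad t)) \<le> ennreal ((1 + C) * (K / 2 * (1 + 4 * R\<^sup>2)) * sqrt (layer t' f))"
proof -
  have tT: "t \<in> {0<..T}" "t \<in> {0..T}" "t \<in> {0..t'}" using t t' by auto
  have LL: "\<Lambda> t' \<le> \<Lambda> t" "\<Lambda> t' > 0" "\<Lambda> t > 0" using \<Lambda>_antimono[of t t'] \<Lambda>_pos t t' tT by auto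
  let ?w = "P_low \<phi> \<Lambda> t (U f t)" and ?fm = "fmult (\<lambda>\<xi>. \<phi> (\<xi> /\<^sub>R \<Lambda> t)) :: (real^3 \<Rightarrow> real^3^3) \<Rightarrow> _"
  \<comment> \<open>Cutting below \<open>\<Lambda> t' / 2\<close> puts the frequencies of the square
    below \<open>\<Lambda> t'\<close>, where the multiplier at any earlier time is 1. The cut is
    taken at the later time \<open>t'\<close>, so that one field serves all \<open>t\<close> in
    \<open>{0<..t'}\<close>.\<close>
  define \<alpha> where "\<alpha> k = (if 2 * knorm k < \<Lambda> t' then vcoef f k else 0)" for k
  have \<alpha>_herm: "\<alpha> (- k) = cnjv (\<alpha> k)" for k by (auto simp: \<alpha>_def vcoef_hermitian cnjv_def vec_eq_iff)
  have \<alpha>_fin: "(\<lambda>k. norm (\<alpha> k)) summable_on UNIV"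
    by (rule finite_support_summable[OF finite_knorm_ball[of "\<Lambda> t' / 2"]]) (auto simp: \<alpha>_def)
  define a where "a = synth \<alpha>"
  have aL: "in_L 2 a" and va: "vcoef a k = \<alpha> k" for k
    using synth_props(3)[OF \<alpha>_fin] vcoef_synth[OF \<alpha>_fin \<alpha>_herm] by (auto simp: a_def)
  have ba: "band (\<Lambda> t' / 2) (\<lambda>x. a x $ i)" for i
    unfolding a_def by (rule band_synth, simp add: \<alpha>_def, rule \<alpha>_herm)
  have l_fin: "(\<lambda>k. norm (lowpass t (u t) k)) summable_on UNIV"
    by (rule finite_support_summable[OF finite_knorm_ball[of "2 * \<Lambda> t"]]) (use lowpass_u_eq_0[OF tT(1)] in auto)
  have wL: "in_L 2 ?w" and vw: "vcoef ?w k = lowpass t (u t) k" for k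
    using synth_props(3)[OF l_fin] vcoef_synth[OF l_fin lowpass_u_herm[OF tT(1)]] by (auto simp: P_low_U[OF tT(1)])
  let ?G = "quad t" and ?A = "\<lambda>x. tf_tensor (a x) (a x)"
  let ?H = "\<lambda>x. ?G x - ?A x"
  have bG: "band (5 * \<Lambda> t) (\<lambda>x. ?G x \<bullet> b)" if "b \<in> Basis" for b
    using band_mono[OF band_quad[OF tT(1) that]] LL by simp
  have bA': "band (\<Lambda> t') (\<lambda>x. ?A x \<bullet> b)" if "b \<in> Basis" for b
    using band_tf_tensor[of "\<Lambda> t' / 2" a, OF ba that] by simp
  have bA: "band (5 * \<Lambda> t) (\<lambda>x. ?A x \<bullet> b)" if "b \<in> Basis" for b
    using band_mono[OF bA'[OF that]] LL by simp
  have bH: "band (5 * \<Lambda> t) (\<lambda>x. ?H x \<bullet> b)" if "b \<in> Basis" for b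
    unfolding inner_diff_left by (intro band_diff bG bA that)
  have fmA: "?fm ?A x = ?A x" for x
  proof (rule euclidean_eqI)
    fix b :: "real^3^3" assume b: "b \<in> Basis"
    have "(\<lambda>k. of_real (m t k) * fcoeff (\<lambda>y. ?A y \<bullet> b) k) = fcoeff (\<lambda>y. ?A y \<bullet> b)"
    proof
      fix k show "of_real (m t k) * fcoeff (\<lambda>y. ?A y \<bullet> b) k = fcoeff (\<lambda>y. ?A y \<bullet> b) k"
        using m_eq_1[OF tT(1), of k] bA'[OF b] LL by (cases "knorm k < \<Lambda> t'") (auto simp: band_def)
    qed
    then show "?fm ?A x \<bullet> b = ?A x \<bullet> b"
      unfolding fmult_inner[OF b] m_def[symmetric] by (simp add: band_sser[OF bA[OF b]])
  qed
  \<comment> \<open>Linearity of the multiplier is read off from its representation by translations,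
    where both sides are sums of the same family.\<close>
  have fmH: "?fm ?H x = ?fm ?G x - ?fm ?A x" for x
  proof (rule has_sum_unique)
    show "((\<lambda>n. Re (fcoeff (periodization \<phi>) n) *\<^sub>R ?H (x + (1 / (10 * \<Lambda> t)) *\<^sub>R lattice_vec n)) has_sum ?fm ?H x) UNIV"
      by (rule multiplier_translations[OF cutoff LL(3) bH])
    show "((\<lambda>n. Re (fcoeff (periodization \<phi>) n) *\<^sub>R ?H (x + (1 / (10 * \<Lambda> t)) *\<^sub>R lattice_vec n)) has_sum (?fm ?G x - ?fm ?A x)) UNIV"
      unfolding diff_conv_add_uminus scaleR_add_right scaleR_minus_right
      by (intro has_sum_add has_sum_uminus[THEN iffD2]; (simp only: minus_minus)?; intro multiplier_translations[OF cutoff LL(3)] bG bA)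
  qed
  have high: "P_high \<phi> \<Lambda> t ?G x = ?H x - ?fm ?H x" for x
    by (simp add: P_high_quad[OF tT(1)] fmH fmA)
  have cH: "continuous_on UNIV ?H" and cF: "continuous_on UNIV (?fm ?H)"
    using continuous_band(1)[OF bH] fmult_band(1)[OF bH] by auto
  have iH: "integrable torus (\<lambda>x. norm (?H x))" and iF: "integrable torus (\<lambda>x. norm (?fm ?H x))"
    by (intro integrable_torus_continuous continuous_intros cH cF)+
  have "(\<integral>x. norm (P_high \<phi> \<Lambda> t ?G x) \<partial>torus) \<le> (\<integral>x. norm (?H x) + norm (?fm ?H x) \<partial>torus)"
    unfolding high by (intro integral_mono Bochner_Integration.integrable_add iH iF norm_triangle_ineq4
        integrable_torus_continuous continuous_intros cH cF)
  also have "\<dots> = (\<integral>x. norm (?H x) \<partial>torus) + (\<integral>x. norm (?fm ?H x) \<partial>torus)"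
    by (rule Bochner_Integration.integral_add[OF iH iF])
  also have "\<dots> \<le> (1 + C) * (\<integral>x. norm (?H x) \<partial>torus)"
    using mult[OF LL(3) bH] by (simp add: distrib_right)
  finally have 1: "(\<integral>x. norm (P_high \<phi> \<Lambda> t ?G x) \<partial>torus) \<le> (1 + C) * (\<integral>x. norm (?H x) \<partial>torus)" .
  define \<delta> where "\<delta> = sqrt (layer t' f)"
  have \<delta>: "\<delta> > 0" "\<delta>\<^sup>2 = layer t' f" using layer_pos[of t' f] t' by (auto simp: \<delta>_def)
  have dle: "(norm (lowpass t (u t) k - \<alpha> k))\<^sup>2 \<le> 4 * C1\<^sup>2 * t' powr (1/4) * lweight k + layer_wt t' k * (norm (vcoef f k))\<^sup>2" for k
  proof -
    let ?x = "norm (u t k - vcoef f k)" and ?c = "if \<Lambda> t' / 2 \<le> knorm k then 1 else 0 :: real"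
    have "lowpass t (u t) k - \<alpha> k = m t k *\<^sub>R (u t k - vcoef f k) + (m t k * ?c) *\<^sub>R vcoef f k"
      using m_eq_1[OF tT(1), of k] LL by (auto simp: lowpass_def \<alpha>_def algebra_simps)
    then have "norm (lowpass t (u t) k - \<alpha> k) \<le> m t k * ?x + m t k * ?c * norm (vcoef f k)"
      using norm_triangle_ineq[of "m t k *\<^sub>R (u t k - vcoef f k)" "(m t k * ?c) *\<^sub>R vcoef f k"] m_bounds[of t k] by simp
    also have "\<dots> \<le> 1 * ?x + 1 * ?c * norm (vcoef f k)"
      using m_bounds[of t k] by (intro add_mono mult_right_mono) auto
    finally have "(norm (lowpass t (u t) k - \<alpha> k))\<^sup>2 \<le> (?x + ?c * norm (vcoef f k))\<^sup>2" by (intro power_mono) auto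
    also have "\<dots> \<le> 2 * ?x\<^sup>2 + 2 * (?c * norm (vcoef f k))\<^sup>2"
      using sum_squares_bound[of ?x "?c * norm (vcoef f k)"] by (simp add: power2_sum)
    also have "(?c * norm (vcoef f k))\<^sup>2 = ?c * (norm (vcoef f k))\<^sup>2" by simp
    finally show ?thesis using increment[OF tT(3) t', of k] by (simp add: layer_wt_def distrib_right split: if_splits)
  qed
  have vd: "vcoef (\<lambda>x. ?w x - a x) k = lowpass t (u t) k - \<alpha> k" for k
    using vcoef_diff[OF wL aL] by (simp add: vw va)
  have I1: "(\<integral>x. (norm (?w x - a x))\<^sup>2 \<partial>torus) \<le> \<delta>\<^sup>2"
    using layer_dominates(2)[OF t' dle] parseval_vec[OF in_L2_diff[OF wL aL], THEN infsumI] \<delta> by (simp add: vd)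
  have I2: "(\<integral>x. (norm (?w x))\<^sup>2 \<partial>torus) \<le> R\<^sup>2"
  proof -
    have "(\<integral>x. (norm (?w x))\<^sup>2 \<partial>torus) = (\<Sum>\<^sub>\<infinity>k. (norm (lowpass t (u t) k))\<^sup>2)"
      using parseval_vec[OF wL, THEN infsumI] by (simp add: vw)
    also have "\<dots> \<le> sol.E t" unfolding sol.E_def
    proof (rule infsum_mono)
      show "(\<lambda>k. (norm (lowpass t (u t) k))\<^sup>2) summable_on UNIV" using vcoef_sq_summable[OF wL] by (simp add: vw)
      show "(norm (lowpass t (u t) k))\<^sup>2 \<le> (norm (u t k))\<^sup>2" for k
        using m_bounds[of t k] by (intro power_mono) (auto simp: lowpass_def mult_left_le_one_le)
    qed (rule sol.u_sq_summable[OF tT(2)])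
    also have "\<dots> \<le> R\<^sup>2" using sol.energy_nn(1)[OF tT(2)] f_sq_le by (simp add: sol.E_0)
    finally show ?thesis .
  qed
  have I3: "(\<integral>x. (norm (a x))\<^sup>2 \<partial>torus) \<le> R\<^sup>2"
  proof -
    have "(\<integral>x. (norm (a x))\<^sup>2 \<partial>torus) = (\<Sum>\<^sub>\<infinity>k. (norm (\<alpha> k))\<^sup>2)"
      using parseval_vec[OF aL, THEN infsumI] by (simp add: va)
    also have "\<dots> \<le> (\<Sum>\<^sub>\<infinity>k. (norm (vcoef f k))\<^sup>2)"
      using vcoef_sq_summable[OF aL] by (intro infsum_mono vcoef_sq_summable f) (auto simp: va \<alpha>_def)
    finally show ?thesis using f_sq_le by simp
  qed
  have i: "integrable torus (\<lambda>x. (norm (?w x - a x))\<^sup>2)" "integrable torus (\<lambda>x. (norm (?w x))\<^sup>2)" "integrable torus (\<lambda>x. (norm (a x))\<^sup>2)"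
    using in_L2_diff[OF wL aL] wL aL by (auto simp: in_L2_iff)
  \<comment> \<open>Young's inequality with weight \<open>\<delta>\<close> takes the place of
    Cauchy-Schwarz: after integration the first term is at most of order
    \<open>\<delta>^2 / \<delta>\<close> and the second of order \<open>\<delta> * R^2\<close>.
    Dividing by \<open>\<delta>\<close> is possible because \<open>layer\<close> is
    positive.\<close>
  let ?g = "\<lambda>x. K / 2 * ((norm (?w x - a x))\<^sup>2 / \<delta> + \<delta> * (2 * (norm (?w x))\<^sup>2 + 2 * (norm (a x))\<^sup>2))"
  have "norm (?H x) \<le> ?g x" for x
  proof -
    interpret tf: bounded_bilinear tf_tensor by (rule bounded_bilinear_tf_tensor)
    let ?d = "norm (?w x - a x)" and ?s = "norm (?w x) + norm (a x)"
    have "?H x = tf_tensor (?w x - a x) (?w x) + tf_tensor (a x) (?w x - a x)"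
      by (simp add: tf.diff_left tf.diff_right)
    then have "norm (?H x) \<le> ?d * norm (?w x) * K + norm (a x) * ?d * K"
      using norm_triangle_le[OF add_mono[OF K(2) K(2)]] by simp
    also have "\<dots> = K / 2 * (2 * ((?d / sqrt \<delta>) * (sqrt \<delta> * ?s)))" using \<delta>(1) by (simp add: algebra_simps)
    also have "\<dots> \<le> K / 2 * ((?d / sqrt \<delta>)\<^sup>2 + (sqrt \<delta> * ?s)\<^sup>2)"
      using K(1) sum_squares_bound[of "?d / sqrt \<delta>" "sqrt \<delta> * ?s"] by (intro mult_left_mono) auto
    also have "\<dots> = K / 2 * (?d\<^sup>2 / \<delta> + \<delta> * ?s\<^sup>2)"
      using \<delta>(1) by (simp add: power_divide power_mult_distrib)
    also have "\<dots> \<le> ?g x"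
      using K(1) \<delta>(1) sum_squares_bound[of "norm (?w x)" "norm (a x)"]
      by (intro mult_left_mono add_mono order_refl) (auto simp: power2_sum)
    finally show ?thesis .
  qed
  moreover have "integrable torus ?g"
    by (intro integrable_mult_right integrable_divide_zero integrable_divide Bochner_Integration.integrable_add i)
  ultimately have "(\<integral>x. norm (?H x) \<partial>torus) \<le> (\<integral>x. ?g x \<partial>torus)"
    by (intro integral_mono iH)
  also have "\<dots> = K / 2 * ((\<integral>x. (norm (?w x - a x))\<^sup>2 \<partial>torus) / \<delta> + \<delta> * (2 * (\<integral>x. (norm (?w x))\<^sup>2 \<partial>torus) + 2 * (\<integral>x. (norm (a x))\<^sup>2 \<partial>torus)))"
    using i by (simp add: Bochner_Integration.integral_add)
  also have "\<dots> \<le> K / 2 * (\<delta>\<^sup>2 / \<delta> + \<delta> * (2 * R\<^sup>2 + 2 * R\<^sup>2))"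
    using K(1) \<delta>(1) I1 I2 I3 by (intro mult_left_mono add_mono divide_right_mono) auto
  also have "\<dots> = K / 2 * (1 + 4 * R\<^sup>2) * \<delta>" using \<delta>(1) by (simp add: power2_eq_square algebra_simps)
  finally have "(\<integral>x. norm (P_high \<phi> \<Lambda> t ?G x) \<partial>torus) \<le> (1 + C) * (K / 2 * (1 + 4 * R\<^sup>2) * \<delta>)"
    using 1 C by (meson mult_left_mono order_trans add_nonneg_nonneg zero_le_one)
  then show ?thesis
    unfolding Lnorm1_eq[OF P_high_quad_continuous(1)[OF tT(1)]] \<delta>_def by (intro ennreal_leI) (simp add: mult.assoc)
qed

text \<open>At time 0 the high-pass filter is 0 by convention, so continuity there means smallness
  of the filtered term at small times, which is the layer estimate.\<close>

lemma P_high_quad_C_path: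
  assumes mult: "\<And>L (g :: real^3 \<Rightarrow> real^3^3). L > 0 \<Longrightarrow> (\<And>b. b \<in> Basis \<Longrightarrow> band (5 * L) (\<lambda>x. g x \<bullet> b)) \<Longrightarrow>
      (\<integral>x. norm (fmult (\<lambda>\<xi>. \<phi> (\<xi> /\<^sub>R L)) g x) \<partial>torus) \<le> C * (\<integral>x. norm (g x) \<partial>torus)"
    and C: "C \<ge> 0" and K: "K \<ge> 0" "\<And>a b. norm (tf_tensor a b) \<le> norm a * norm b * K"
  shows "C_path 1 T (\<lambda>t. P_high \<phi> \<Lambda> t (quad t))"
  unfolding C_path_def
proof (intro ballI conjI)
  fix t assume t: "t \<in> {0..T}"
  show "in_L 1 (P_high \<phi> \<Lambda> t (quad t))"
  proof (cases "t = 0")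
    case True
    then show ?thesis unfolding True P_high_quad_0
      by (intro continuous_periodic_in_L1) (auto simp: periodic_def)
  next
    case False
    then show ?thesis using t by (intro continuous_periodic_in_L1 P_high_quad_continuous) auto
  qed
  show "((\<lambda>s. Lnorm 1 (\<lambda>x. P_high \<phi> \<Lambda> s (quad s) x - P_high \<phi> \<Lambda> t (quad t) x)) \<longlongrightarrow> 0) (at t within {0..T})"
  proof (cases "t = 0")
    case True
    let ?B = "\<lambda>s. ennreal ((1 + C) * (K / 2 * (1 + 4 * R\<^sup>2)) * sqrt (layer s f))"
    have "(?B \<longlongrightarrow> ennreal ((1 + C) * (K / 2 * (1 + 4 * R\<^sup>2)) * sqrt 0)) (at_right 0)"
      by (intro tendsto_intros layer_tendsto f)
    then have B: "(?B \<longlongrightarrow> 0) (at_right 0)" by simp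
    have "\<forall>\<^sub>F s in at_right 0. Lnorm 1 (\<lambda>x. P_high \<phi> \<Lambda> s (quad s) x - P_high \<phi> \<Lambda> 0 (quad 0) x) \<le> ?B s"
      using at_right_0_Ioc[OF T_pos]
      by eventually_elim (use P_high_quad_layer[OF mult C K] in \<open>simp add: P_high_quad_0\<close>)
    then have "((\<lambda>s. Lnorm 1 (\<lambda>x. P_high \<phi> \<Lambda> s (quad s) x - P_high \<phi> \<Lambda> 0 (quad 0) x)) \<longlongrightarrow> 0) (at_right 0)"
      by (intro tendsto_sandwich[OF _ _ tendsto_const B]) auto
    then show ?thesis using T_pos by (simp add: True at_within_Icc_at_right)
  next
    case False
    then show ?thesis using t by (intro P_high_quad_tendsto) auto
  qed
qed

end

lemma ennreal_half_square_le:
  fixes x y :: ennreal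
  assumes "x < \<infinity>" "y < \<infinity>" "x\<^sup>2 / 2 \<le> y\<^sup>2 / 2"
  shows "x \<le> y"
proof -
  obtain a b where ab: "a \<ge> 0" "x = ennreal a" "b \<ge> 0" "y = ennreal b"
    using assms(1,2) by (cases x; cases y) auto
  have "ennreal (a\<^sup>2 / 2) \<le> ennreal (b\<^sup>2 / 2)"
    using assms(3) unfolding ab ennreal_power[OF ab(1)] ennreal_power[OF ab(3)]
      ennreal_divide_numeral[OF zero_le_power2] .
  then have "a\<^sup>2 \<le> b\<^sup>2" using ab by (simp add: ennreal_le_iff)
  from power2_le_imp_le[OF this ab(3)] show ?thesis unfolding ab by (rule ennreal_leI)
qed

theorem theorem2p1:
  fixes P :: "'w measure" and F :: "real \<Rightarrow> 'w measure"
    and \<phi> :: "real^3 \<Rightarrow> real" and \<Lambda> :: "real \<Rightarrow> real" and \<nu> T M :: real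
    and v0 :: "'w \<Rightarrow> real^3 \<Rightarrow> real^3"
  assumes "prob_space P" and "normal_filtration P F"
    and "\<nu> > 0" and "T > 0"
    and "cutoff \<phi>" and "frequency_function T \<Lambda>"
    and "M \<ge> 1"
    and "v0 \<in> measurable (F 0) L2_borel"
    and "AE \<omega> in P. in_L 2 (v0 \<omega>) \<and> div_free (v0 \<omega>) \<and> mean_free (v0 \<omega>) \<and>
           Lnorm 2 (v0 \<omega>) \<le> ennreal M"
  shows "\<exists>u :: real \<Rightarrow> 'w \<Rightarrow> real^3 \<Rightarrow> real^3.
    (weak_solution P F \<phi> \<Lambda> \<nu> T v0 u \<and>
     (AE \<omega> in P. smooth_on ({0<..T} \<times> UNIV) (\<lambda>(t, x). u t \<omega> x)) \<and>
     (AE \<omega> in P. ((\<lambda>t. Lnorm 2 (\<lambda>x. u t \<omega> x - v0 \<omega> x)) \<longlongrightarrow> 0) (at_right 0)) \<and>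
     (AE \<omega> in P. \<forall>t\<in>{0..T}. energy \<nu> (\<lambda>s. u s \<omega>) t = Lnorm 2 (v0 \<omega>) ^ 2 / 2) \<and>
     (\<forall>\<rho>\<ge>1. ((\<lambda>T'. LC_norm P \<rho> 2 T' (\<lambda>t \<omega> x. u t \<omega> x - v0 \<omega> x)) \<longlongrightarrow> 0) (at_right 0))) \<and>
    (leray_hopf P F \<phi> \<Lambda> \<nu> T v0 u \<and>
     (\<forall>v. leray_hopf P F \<phi> \<Lambda> \<nu> T v0 v \<longrightarrow>
        (AE \<omega> in P. \<forall>t\<in>{0..T}. AE x in torus. v t \<omega> x = u t \<omega> x))) \<and>
    ((AE \<omega> in P. C_path 1 T (\<lambda>t. P_high \<phi> \<Lambda> t (\<lambda>x.
        tf_tensor (P_low \<phi> \<Lambda> t (u t \<omega>) x) (P_low \<phi> \<Lambda> t (u t \<omega>) x)))) \<and>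
     (\<forall>\<rho>\<ge>1. ((\<lambda>T'. LC_norm P \<rho> 1 T' (\<lambda>t \<omega>. P_high \<phi> \<Lambda> t (\<lambda>x.
        tf_tensor (P_low \<phi> \<Lambda> t (u t \<omega>) x) (P_low \<phi> \<Lambda> t (u t \<omega>) x))))
        \<longlongrightarrow> 0) (at_right 0)))"
proof -
  interpret lns_trunc \<phi> \<Lambda> \<nu> T M by unfold_locales (use assms(3-7) in simp_all)
  \<comment> \<open>The extension by \<open>v0\<close> outside \<open>L2\<close> matches
    \<open>U_measurable\<close>, so measurability holds for the whole map and not just on a set of
    full probability.\<close>
  define u where "u t \<omega> = (if in_L 2 (v0 \<omega>) then U (v0 \<omega>) t else v0 \<omega>)" for t \<omega>
  have good: "AE \<omega> in P. lns_field \<phi> \<Lambda> \<nu> T M (v0 \<omega>)"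
    using assms(9) by eventually_elim (intro lns_field.intro lns_trunc_axioms lns_field_axioms.intro; simp)
  have u_eq: "u t \<omega> = U (v0 \<omega>) t" if "lns_field \<phi> \<Lambda> \<nu> T M (v0 \<omega>)" for t \<omega>
    using lns_field.f[OF that] by (simp add: u_def)
  have sub0: "subalgebra P (F t)" if "t \<ge> 0" for t
    using assms(2) that by (simp add: normal_filtration_def)
  have subt: "subalgebra (F t) (F 0)" if "t \<ge> 0" for t
  proof -
    have "sets (F 0) \<subseteq> sets (F t)" using assms(2) that unfolding normal_filtration_def by blast
    then show ?thesis using sub0[OF order_refl] sub0[OF that] by (simp add: subalgebra_def)
  qed
  have u_meas: "u t \<in> measurable (F t) L2_borel" if t: "t \<in> {0..T}" for t
  proof (rule measurable_from_subalg[OF subt])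
    show "u t \<in> measurable (F 0) L2_borel"
      using measurable_compose[OF assms(8) U_measurable[OF t]] by (simp add: u_def[abs_def])
  qed (use t in simp)

  have sol: "weak_solution P F \<phi> \<Lambda> \<nu> T v0 u"
    unfolding weak_solution_def
  proof (intro conjI ballI u_meas)
    show "AE \<omega> in P. C_path 2 T (\<lambda>t. u t \<omega>)"
      using good by eventually_elim (simp add: u_eq lns_field.V_C_path)
    show "AE \<omega> in P. \<forall>t\<in>{0..T}. div_free (u t \<omega>) \<and> mean_free (u t \<omega>)"
      using good by eventually_elim (simp add: u_eq lns_field.V_div lns_field.V_mean)
    show "AE \<omega> in P. \<forall>\<eta>. solenoidal_test \<eta> \<longrightarrow> (\<forall>t\<in>{0..T}.
        (\<integral>x. u t \<omega> x \<bullet> \<eta> x \<partial>torus) = (\<integral>x. v0 \<omega> x \<bullet> \<eta> x \<partial>torus) +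
        (LINT s:{0..t}|lborel. (\<integral>x. \<nu> * (u s \<omega> x \<bullet> laplacian \<eta> x) +
           P_low \<phi> \<Lambda> s (u s \<omega>) x \<bullet> advect (P_low \<phi> \<Lambda> s (u s \<omega>)) (P_low \<phi> \<Lambda> s \<eta>) x \<partial>torus)))"
      using good
    proof eventually_elim
      case (elim \<omega>)
      show ?case unfolding u_eq[OF elim] using lns_field.V_weak[OF elim] by blast
    qed
  qed
  have en: "AE \<omega> in P. \<forall>t\<in>{0..T}. energy \<nu> (\<lambda>s. u s \<omega>) t = Lnorm 2 (v0 \<omega>) ^ 2 / 2"
    using good by eventually_elim (simp add: u_eq lns_field.V_energy)
  have smooth: "AE \<omega> in P. smooth_on ({0<..T} \<times> UNIV) (\<lambda>(t, x). u t \<omega> x)"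
    using good by eventually_elim (simp add: u_eq lns_field.V_smooth)
  have init: "AE \<omega> in P. ((\<lambda>t. Lnorm 2 (\<lambda>x. u t \<omega> x - v0 \<omega> x)) \<longlongrightarrow> 0) (at_right 0)"
    using good
  proof eventually_elim
    case (elim \<omega>)
    have "((\<lambda>t. Lnorm 2 (\<lambda>x. U (v0 \<omega>) t x - U (v0 \<omega>) 0 x)) \<longlongrightarrow> 0) (at 0 within {0..T})"
      using lns_field.V_C_path[OF elim] T_pos by (simp add: C_path_def)
    then show ?case using T_pos by (simp add: u_eq[OF elim] at_within_Icc_at_right U_def)
  qed

  \<comment> \<open>Convergence of moments at time 0\<close>
  define B where "B = sqrt (6 * M\<^sup>2 + (4 * C1\<^sup>2 * (\<Sum>\<^sub>\<infinity>k. lweight k) + 1) * T powr (1/4))"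
  \<comment> \<open>The minimum enforces the bound \<open>B\<close> for every outcome; on admissible
    data it is inactive by \<open>layer_bound\<close>.\<close>
  define g where "g t \<omega> = min B (sqrt (if in_L 2 (v0 \<omega>) then layer t (v0 \<omega>) else 0))" for t \<omega>
  have B: "B \<ge> 0" using lweight_sum_nonneg by (simp add: B_def)
  have g_meas: "g t \<in> borel_measurable P" if t: "t \<in> {0<..T}" for t
  proof -
    have "(\<lambda>\<omega>. if in_L 2 (v0 \<omega>) then layer t (v0 \<omega>) else 0) \<in> borel_measurable (F 0)"
      using measurable_compose[OF assms(8) layer_measurable] t by simp
    then have [measurable]: "(\<lambda>\<omega>. if in_L 2 (v0 \<omega>) then layer t (v0 \<omega>) else 0) \<in> borel_measurable P"
      by (rule measurable_from_subalg[OF sub0[OF order_refl]])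
    show ?thesis unfolding g_def by measurable
  qed
  have g_bd: "0 \<le> g t \<omega> \<and> g t \<omega> \<le> B" if t: "t \<in> {0<..T}" for t \<omega>
    using B layer_pos[of t "v0 \<omega>"] t by (auto simp: g_def)
  have g_eq: "g t \<omega> = sqrt (layer t (v0 \<omega>))" if "lns_field \<phi> \<Lambda> \<nu> T M (v0 \<omega>)" "t \<in> {0<..T}" for t \<omega>
    using layer_bound[OF lns_field.f[OF that(1)] lns_field.f_sq_le[OF that(1)] that(2)] lns_field.f[OF that(1)]
    by (simp add: g_def B_def min_absorb2)
  have g_lim: "AE \<omega> in P. ((\<lambda>t. g t \<omega>) \<longlongrightarrow> 0) (at_right 0)"
    using good
  proof eventually_elim
    case (elim \<omega>)
    have "((\<lambda>t. sqrt (layer t (v0 \<omega>))) \<longlongrightarrow> sqrt 0) (at_right 0)"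
      by (intro tendsto_intros layer_tendsto lns_field.f[OF elim])
    moreover have "\<forall>\<^sub>F t in at_right 0. sqrt (layer t (v0 \<omega>)) = g t \<omega>"
      using at_right_0_Ioc[OF T_pos] by eventually_elim (simp add: g_eq[OF elim])
    ultimately show ?case using Lim_transform_eventually by fastforce
  qed
  have LC: "((\<lambda>T'. LC_norm P \<rho> 2 T' (\<lambda>t \<omega> x. u t \<omega> x - v0 \<omega> x)) \<longlongrightarrow> 0) (at_right 0)" if "\<rho> \<ge> 1" for \<rho>
  proof (rule LC_norm_tendsto_0[OF assms(1) that T_pos g_meas g_bd _ g_lim])
    show "AE \<omega> in P. \<forall>t'\<in>{0<..T}. \<forall>t\<in>{0..t'}. Lnorm 2 (\<lambda>x. u t \<omega> x - v0 \<omega> x) \<le> ennreal (g t' \<omega>)"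
      using good by eventually_elim (simp add: u_eq g_eq lns_field.V_layer)
  qed

  \<comment> \<open>Uniqueness in the Leray-Hopf class\<close>
  have lh: "leray_hopf P F \<phi> \<Lambda> \<nu> T v0 u"
    unfolding leray_hopf_def using sol en by (auto elim: eventually_mono)
  have uniq: "AE \<omega> in P. \<forall>t\<in>{0..T}. AE x in torus. v t \<omega> x = u t \<omega> x" if v: "leray_hopf P F \<phi> \<Lambda> \<nu> T v0 v" for v
  proof -
    have w: "AE \<omega> in P. C_path 2 T (\<lambda>t. v t \<omega>)"
      "AE \<omega> in P. \<forall>t\<in>{0..T}. div_free (v t \<omega>) \<and> mean_free (v t \<omega>)"
      "AE \<omega> in P. \<forall>\<eta>. solenoidal_test \<eta> \<longrightarrow> (\<forall>t\<in>{0..T}.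
        (\<integral>x. v t \<omega> x \<bullet> \<eta> x \<partial>torus) = (\<integral>x. v0 \<omega> x \<bullet> \<eta> x \<partial>torus) +
        (LINT s:{0..t}|lborel. (\<integral>x. \<nu> * (v s \<omega> x \<bullet> laplacian \<eta> x) +
           P_low \<phi> \<Lambda> s (v s \<omega>) x \<bullet> advect (P_low \<phi> \<Lambda> s (v s \<omega>)) (P_low \<phi> \<Lambda> s \<eta>) x \<partial>torus)))"
      "AE \<omega> in P. \<forall>t\<in>{0..T}. energy \<nu> (\<lambda>s. v s \<omega>) t \<le> Lnorm 2 (v0 \<omega>) ^ 2 / 2"
      using v by (simp_all add: leray_hopf_def weak_solution_def)
    from w good show ?thesis
    proof eventually_elim
      case (elim \<omega>)
      interpret lns_field \<phi> \<Lambda> \<nu> T M "v0 \<omega>" by fact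
      show ?case
      proof
        fix t assume t: "t \<in> {0..T}"
        show "AE x in torus. v t \<omega> x = u t \<omega> x"
          unfolding u_eq[OF elim(5)]
        proof (rule V_unique[OF elim(1) _ _ _ t])
          fix s assume s: "s \<in> {0..T}"
          show "div_free (v s \<omega>)" using elim(2) s by blast
          \<comment> \<open>Dropping the dissipation from the energy inequality bounds the norm by
            that of the datum, hence by \<open>M\<close>, as \<open>V_unique\<close>
            requires.\<close>
          have "Lnorm 2 (v s \<omega>) ^ 2 / 2 \<le> energy \<nu> (\<lambda>s. v s \<omega>) s" by (simp add: energy_def)
          also have "\<dots> \<le> Lnorm 2 (v0 \<omega>) ^ 2 / 2" using elim(4) s by blast
          finally have sq: "Lnorm 2 (v s \<omega>) ^ 2 / 2 \<le> Lnorm 2 (v0 \<omega>) ^ 2 / 2" .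
          have "in_L 2 (v s \<omega>)" using elim(1) s unfolding C_path_def by blast
          then have "Lnorm 2 (v s \<omega>) \<le> Lnorm 2 (v0 \<omega>)"
            using f by (intro ennreal_half_square_le[OF _ _ sq]) (simp_all only: in_L_def)
          also have "\<dots> \<le> ennreal M" by (rule f_le)
          finally show "Lnorm 2 (v s \<omega>) \<le> ennreal M" .
        qed (use elim(3) in blast)
      qed
    qed
  qed

  \<comment> \<open>The trace-free quadratic term in \<open>L1\<close>\<close>
  obtain C where C: "C \<ge> 0" "\<And>L (g :: real^3 \<Rightarrow> real^3^3). L > 0 \<Longrightarrow>
      (\<And>b. b \<in> Basis \<Longrightarrow> band (5 * L) (\<lambda>x. g x \<bullet> b)) \<Longrightarrow>
      (\<integral>x. norm (fmult (\<lambda>\<xi>. \<phi> (\<xi> /\<^sub>R L)) g x) \<partial>torus) \<le> C * (\<integral>x. norm (g x) \<partial>torus)"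
    using multiplier_L1[OF cutoff] by blast
  obtain K where K: "K \<ge> 0" "\<And>a b. norm (tf_tensor a b) \<le> norm a * norm b * K"
    using bounded_bilinear.nonneg_bounded[OF bounded_bilinear_tf_tensor] by blast
  let ?H = "\<lambda>t \<omega>. P_high \<phi> \<Lambda> t (\<lambda>x. tf_tensor (P_low \<phi> \<Lambda> t (u t \<omega>) x) (P_low \<phi> \<Lambda> t (u t \<omega>) x))"
  define Q where "Q = (1 + C) * (K / 2 * (1 + 4 * M\<^sup>2))"
  have Q: "Q \<ge> 0" using C(1) K(1) by (simp add: Q_def)
  have path: "AE \<omega> in P. C_path 1 T (\<lambda>t. ?H t \<omega>)"
    using good
  proof eventually_elim
    case (elim \<omega>)
    show ?case unfolding u_eq[OF elim] by (rule lns_field.P_high_quad_C_path[OF elim C(2) C(1) K])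
  qed
  have LC1: "((\<lambda>T'. LC_norm P \<rho> 1 T' ?H) \<longlongrightarrow> 0) (at_right 0)" if "\<rho> \<ge> 1" for \<rho>
  proof (rule LC_norm_tendsto_0[OF assms(1) that T_pos, of "\<lambda>t \<omega>. Q * g t \<omega>" "Q * B"])
    show "(\<lambda>\<omega>. Q * g t \<omega>) \<in> borel_measurable P" if "t \<in> {0<..T}" for t
      using g_meas[OF that] by measurable
    show "0 \<le> Q * g t \<omega> \<and> Q * g t \<omega> \<le> Q * B" if "t \<in> {0<..T}" for t \<omega>
      using g_bd[OF that, of \<omega>] Q by (simp add: mult_left_mono)
    show "AE \<omega> in P. ((\<lambda>t. Q * g t \<omega>) \<longlongrightarrow> 0) (at_right 0)"
      using g_lim by eventually_elim (rule tendsto_mult_right_zero)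
    show "AE \<omega> in P. \<forall>t'\<in>{0<..T}. \<forall>t\<in>{0..t'}. Lnorm 1 (?H t \<omega>) \<le> ennreal (Q * g t' \<omega>)"
      using good
    proof eventually_elim
      case (elim \<omega>)
      interpret lns_field \<phi> \<Lambda> \<nu> T M "v0 \<omega>" by fact
      show ?case
      proof (intro ballI)
        fix t' t assume t': "t' \<in> {0<..T}" and t: "t \<in> {0..t'}"
        show "Lnorm 1 (?H t \<omega>) \<le> ennreal (Q * g t' \<omega>)"
          unfolding u_eq[OF elim]
        proof (cases "t = 0")
          case True
          show "Lnorm 1 (P_high \<phi> \<Lambda> t (quad t)) \<le> ennreal (Q * g t' \<omega>)"
            unfolding True P_high_quad_0 by (simp add: Lnorm1_eq)
        next
          case False
          then have "t \<in> {0<..t'}" using t by auto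
          from P_high_quad_layer[OF C(2) C(1) K this t']
          show "Lnorm 1 (P_high \<phi> \<Lambda> t (quad t)) \<le> ennreal (Q * g t' \<omega>)"
            by (simp add: g_eq[OF elim t'] Q_def)
        qed
      qed
    qed
  qed
  show ?thesis
    using sol smooth init en LC lh uniq path LC1 by (intro exI[of _ u] conjI allI impI) assumption+
qed

end
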